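(* Let $\Omega\subseteq\mathbb{R}^n$ be a bounded open set with Lipschitz boundary and $0\in\Omega$, let $2\le p<n$ and $\mu\in(0,+\infty)$. Let $f,g\colon\mathbb{R}\to\mathbb{R}$ be continuous functions such that: (f1) $\lim_{|t|\to 0}\frac{f(t)}{|t|^{p-1}}=0$; (f2) $\lim_{|t|\to+\infty}\frac{f(t)}{|t|^{p-1}}=0$; (f3) $\sup_{t\in\mathbb{R}}F(t)>0$, where $F(t)=\int_0^t f(s)\,ds$; (g1) there exist $c_g\ge 0$ and $1<q<\frac{pn}{n-p}$ such that $|g(t)|\le c_g(1+|t|^{q-1})$ for all $t\in\mathbb{R}$. Then there exists $\beta>0$ such that for each compact interval $[a,b]\subset(\beta,+\infty)$ there exists $r>0$ with the following property: for every $\lambda\in[a,b]$ there exists $\delta>0$ such that for each $\gamma\in[0,\delta]$ there are at least three distinct functions $u\in W^{1,p}_0(\Omega)$ with $\|u\|_{W^{1,p}_0(\Omega)}<r$ satisfying $$\int_\Omega |\nabla u(x)|^{p-2}\nabla u(x)\cdot\nabla v(x)+\mu\frac{|u(x)|^{p-2}u(x)v(x)}{|x|^p}\,dx=\lambda\int_\Omega f(u(x))v(x)\,dx+\gamma\int_\Omega g(u(x))v(x)\,dx$$ for all $v\in W^{1,p}_0(\Omega)$.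
   Context: $W^{1,p}_0(\Omega)$ is the closure of $C_0^\infty(\Omega)$ in the Sobolev space $W^{1,p}(\Omega)$ (real-valued functions), equipped with the norm $\|u\|_{W^{1,p}_0(\Omega)}=\left(\int_\Omega|\nabla u(x)|^p\,dx\right)^{1/p}$. *)

theory Defs
  imports "HOL-Analysis.Analysis"
begin

text \<open>
  Functions on \<open>\<Omega>\<close> are represented by total functions on \<open>real ^ 'n\<close> whose values outside \<open>\<Omega>\<close>
  are irrelevant; elements of Lebesgue and Sobolev spaces are represented by functions rather
  than by equivalence classes, so equality in these spaces is equality almost everywhere on \<open>\<Omega>\<close>.
\<close>

definition lipschitz_boundary :: "(real ^ 'n) set \<Rightarrow> bool" where
  \<comment> \<open>Near every boundary point, \<open>\<Omega>\<close> is the strict epigraph of a Lipschitz function in some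
      orthonormal coordinate system: \<open>e\<close> is the last axis, the hyperplane orthogonal to \<open>e\<close>
      carries the remaining coordinates.\<close>
  "lipschitz_boundary \<Omega> \<longleftrightarrow>
    (\<forall>z \<in> frontier \<Omega>. \<exists>\<rho> > 0. \<exists>e \<psi> L.
        norm e = 1 \<and> L-lipschitz_on {y. y \<bullet> e = 0} \<psi> \<and>
        (\<forall>x \<in> ball z \<rho>. x \<in> \<Omega> \<longleftrightarrow> \<psi> (x - (x \<bullet> e) *\<^sub>R e) < x \<bullet> e))"

definition partial_deriv :: "'n \<Rightarrow> (real ^ 'n \<Rightarrow> real) \<Rightarrow> real ^ 'n \<Rightarrow> real" where
  "partial_deriv i f x = frechet_derivative f (at x) (axis i 1)"

primrec C_k :: "nat \<Rightarrow> (real ^ 'n \<Rightarrow> real) \<Rightarrow> bool" where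
  "C_k 0 f \<longleftrightarrow> continuous_on UNIV f"
| "C_k (Suc k) f \<longleftrightarrow> (\<forall>x. f differentiable (at x)) \<and> (\<forall>i. C_k k (partial_deriv i f))"

definition test_functions :: "(real ^ 'n) set \<Rightarrow> (real ^ 'n \<Rightarrow> real) set" where
  "test_functions \<Omega> =
    {\<phi>. (\<forall>k. C_k k \<phi>) \<and> compact (closure {x. \<phi> x \<noteq> 0}) \<and> closure {x. \<phi> x \<noteq> 0} \<subseteq> \<Omega>}"

definition L_p :: "real \<Rightarrow> (real ^ 'n) set \<Rightarrow> (real ^ 'n \<Rightarrow> 'b::euclidean_space) set" where
  "L_p p \<Omega> = {u \<in> borel_measurable (lebesgue_on \<Omega>).
      integrable (lebesgue_on \<Omega>) (\<lambda>x. norm (u x) powr p)}"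

definition locally_integrable :: "(real ^ 'n) set \<Rightarrow> (real ^ 'n \<Rightarrow> 'b::euclidean_space) \<Rightarrow> bool" where
  "locally_integrable \<Omega> u \<longleftrightarrow> u \<in> borel_measurable (lebesgue_on \<Omega>) \<and>
    (\<forall>K. compact K \<and> K \<subseteq> \<Omega> \<longrightarrow> set_integrable lebesgue K u)"

definition has_weak_gradient ::
    "(real ^ 'n) set \<Rightarrow> (real ^ 'n \<Rightarrow> real) \<Rightarrow> (real ^ 'n \<Rightarrow> real ^ 'n) \<Rightarrow> bool" where
  "has_weak_gradient \<Omega> u G \<longleftrightarrow> locally_integrable \<Omega> u \<and> locally_integrable \<Omega> G \<and>
    (\<forall>\<phi> \<in> test_functions \<Omega>. \<forall>i.
        (\<integral>x. u x * partial_deriv i \<phi> x \<partial>(lebesgue_on \<Omega>)) =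
        - (\<integral>x. G x $ i * \<phi> x \<partial>(lebesgue_on \<Omega>)))"

text \<open>A weak gradient on an open set is unique almost everywhere, so the choice below is immaterial.\<close>

definition weak_gradient ::
    "(real ^ 'n) set \<Rightarrow> (real ^ 'n \<Rightarrow> real) \<Rightarrow> real ^ 'n \<Rightarrow> real ^ 'n" where
  "weak_gradient \<Omega> u = (SOME G. has_weak_gradient \<Omega> u G)"

definition W1p :: "real \<Rightarrow> (real ^ 'n) set \<Rightarrow> (real ^ 'n \<Rightarrow> real) set" where
  "W1p p \<Omega> = {u \<in> L_p p \<Omega>. \<exists>G \<in> L_p p \<Omega>. has_weak_gradient \<Omega> u G}"

definition W1p_norm :: "real \<Rightarrow> (real ^ 'n) set \<Rightarrow> (real ^ 'n \<Rightarrow> real) \<Rightarrow> real" where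
  "W1p_norm p \<Omega> u =
    ((\<integral>x. \<bar>u x\<bar> powr p \<partial>(lebesgue_on \<Omega>)) +
     (\<integral>x. norm (weak_gradient \<Omega> u x) powr p \<partial>(lebesgue_on \<Omega>))) powr (1 / p)"

definition W1p_0 :: "real \<Rightarrow> (real ^ 'n) set \<Rightarrow> (real ^ 'n \<Rightarrow> real) set" where
  "W1p_0 p \<Omega> =
    {u \<in> W1p p \<Omega>. \<forall>\<epsilon> > 0. \<exists>\<phi> \<in> test_functions \<Omega>. W1p_norm p \<Omega> (\<lambda>x. u x - \<phi> x) < \<epsilon>}"

definition W1p_0_norm :: "real \<Rightarrow> (real ^ 'n) set \<Rightarrow> (real ^ 'n \<Rightarrow> real) \<Rightarrow> real" where
  "W1p_0_norm p \<Omega> u = (\<integral>x. norm (weak_gradient \<Omega> u x) powr p \<partial>(lebesgue_on \<Omega>)) powr (1 / p)"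

definition weak_solution ::
    "real \<Rightarrow> real \<Rightarrow> (real \<Rightarrow> real) \<Rightarrow> (real \<Rightarrow> real) \<Rightarrow> real \<Rightarrow> real \<Rightarrow> (real ^ 'n) set \<Rightarrow>
     (real ^ 'n \<Rightarrow> real) \<Rightarrow> bool" where
  \<comment> \<open>Integrability is required because a Bochner integral of a non-integrable function is 0.
      Note that \<open>0 powr 0 = 0\<close>; this is harmless here, since for \<open>p = 2\<close> the factor
      \<open>0 powr (p - 2)\<close> always multiplies a zero, and the point \<open>x = 0\<close> is a null set.\<close>
  "weak_solution p \<mu> f g lam \<gamma> \<Omega> u \<longleftrightarrow> u \<in> W1p_0 p \<Omega> \<and>
    (\<forall>v \<in> W1p_0 p \<Omega>.
      integrable (lebesgue_on \<Omega>) (\<lambda>x.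
        norm (weak_gradient \<Omega> u x) powr (p - 2) * (weak_gradient \<Omega> u x \<bullet> weak_gradient \<Omega> v x)
        + \<mu> * (\<bar>u x\<bar> powr (p - 2) * u x * v x / norm x powr p)) \<and>
      integrable (lebesgue_on \<Omega>) (\<lambda>x. f (u x) * v x) \<and>
      integrable (lebesgue_on \<Omega>) (\<lambda>x. g (u x) * v x) \<and>
      (\<integral>x. norm (weak_gradient \<Omega> u x) powr (p - 2) * (weak_gradient \<Omega> u x \<bullet> weak_gradient \<Omega> v x)
        + \<mu> * (\<bar>u x\<bar> powr (p - 2) * u x * v x / norm x powr p) \<partial>(lebesgue_on \<Omega>))
      = lam * (\<integral>x. f (u x) * v x \<partial>(lebesgue_on \<Omega>))
        + \<gamma> * (\<integral>x. g (u x) * v x \<partial>(lebesgue_on \<Omega>)))"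

definition ae_distinct ::
    "(real ^ 'n) set \<Rightarrow> (real ^ 'n \<Rightarrow> real) \<Rightarrow> (real ^ 'n \<Rightarrow> real) \<Rightarrow> bool" where
  "ae_distinct \<Omega> u v \<longleftrightarrow> \<not> (AE x in lebesgue_on \<Omega>. u x = v x)"

end

theory Submission
  imports Defs "HOL-Complex_Analysis.Great_Picard" "HOL-Library.Diagonal_Subsequence"
begin

text \<open>
  The solutions are limits of almost critical sequences, consisting of test functions only, of the
  energy \<open>E = \<Phi> - \<lambda> \<integral>F(u) - \<gamma> \<integral>G(u)\<close>, where
  \<open>\<Phi>(u) = (\<integral>|\<nabla>u|\<^sup>p + \<mu> \<integral>|u|\<^sup>p/|x|\<^sup>p)/p\<close>. By (f1) and (f2), \<open>E\<close> is coercive when \<open>\<gamma> = 0\<close>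
  and at least a positive constant on a thin shell around \<open>0\<close>; by (f3), for \<open>\<lambda> > \<beta>\<close> it is less than \<open>-1\<close> at some
  test function \<open>w\<close>. On a ball that is large compared to the sublevel set of \<open>E\<close>, the term with \<open>\<gamma>\<close> is
  uniformly small for small \<open>\<gamma>\<close>, so that \<open>g\<close> never has to be truncated. Hence there are three different
  levels: the infimum over the small ball, the infimum over the large ball, and the mountain
  pass level between \<open>0\<close> and \<open>w\<close>.

  Since \<open>p \<ge> 2\<close>, the \<open>p\<close>-Laplacian is strongly monotone; together with the compact embedding into a
  subcritical \<open>L\<^sup>s\<close> this makes almost critical sequences Cauchy, without any appeal to reflexivity.
  Hardy's inequality carries the singular term. The embedding and its compactness are obtained by
  comparing a test function with its averages over cubes of dyadic size.
\<close>

section \<open>Lebesgue spaces\<close>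

text \<open>Test functions carry classical gradients that depend linearly on the function, whereas
  \<open>weak_gradient\<close> is a choice and linear only almost everywhere; the passage to the
  limit is therefore made once per solution. The price is an incomplete space: minimisers need not
  exist, and all differentiability estimates must be uniform on balls of \<open>N\<close>. The
  property \<open>nemy\<close> supplies them, with exponent \<open>p\<close> for the two homogeneous
  terms and, for \<open>f\<close> and \<open>g\<close>, with one exponent \<open>s\<close> above
  their growth and below the critical one. The constants arise in the order of the quantifiers.
  \<open>\<beta>\<close> depends only on \<open>w\<close> and leaves a margin of 1 at
  \<open>w\<close>, half of which the term with \<open>\<gamma>\<close> may consume. The radius
  \<open>r\<close> comes from coercivity with \<open>b\<close> in the place of \<open>lam\<close>,
  so it serves the whole interval. \<open>\<delta>\<close> comes last, from a bound for the
  functional of \<open>g\<close> on a ball fixed by \<open>r\<close>. Different levels give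
  different solutions because the energy is Lipschitz at small distances on balls: limits that agree
  almost everywhere would force equal levels.\<close>

lemma young_powr:
  fixes a b s :: real
  assumes "1 < s" "0 \<le> a" "0 \<le> b"
  shows "a powr (s - 1) * b \<le> (s - 1) / s * a powr s + b powr s / s"
proof -
  have "1 / (s / (s - 1)) + 1 / s = 1"
    using assms by (simp add: field_simps)
  moreover have "s / (s - 1) > 1"
    using assms by (simp add: field_simps)
  ultimately have "a powr (s - 1) * b \<le> (a powr (s - 1)) powr (s / (s - 1)) / (s / (s - 1)) + b powr s / s"
    using assms by (intro Youngs_inequality) auto
  moreover have "(a powr (s - 1)) powr (s / (s - 1)) = a powr s"
    using assms by (simp add: powr_powr)
  ultimately show ?thesis
    using assms by (simp add: mult.commute)
qed

text \<open>If the power is not integrable, the Bochner integral and with it \<open>lpn\<close> are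
  0. A bound on \<open>lpn\<close> is thus informative only together with membership in
  \<open>Lps\<close>, which is why the two are proved side by side.\<close>

definition lpn :: "'a measure \<Rightarrow> real \<Rightarrow> ('a \<Rightarrow> 'b::euclidean_space) \<Rightarrow> real" where
  "lpn M s f = (\<integral>x. norm (f x) powr s \<partial>M) powr (1 / s)"

definition Lps :: "'a measure \<Rightarrow> real \<Rightarrow> ('a \<Rightarrow> 'b::euclidean_space) set" where
  "Lps M s = {f \<in> borel_measurable M. integrable M (\<lambda>x. norm (f x) powr s)}"

lemma lpn_nonneg [simp]: "0 \<le> lpn M s f"
  by (simp add: lpn_def)

lemma lpn_powr: "s > 0 \<Longrightarrow> lpn M s f powr s = (\<integral>x. norm (f x) powr s \<partial>M)"
  by (simp add: lpn_def powr_powr)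

lemma LpsI: "f \<in> borel_measurable M \<Longrightarrow> integrable M (\<lambda>x. norm (f x) powr s) \<Longrightarrow> f \<in> Lps M s"
  by (simp add: Lps_def)

lemma LpsD: assumes "f \<in> Lps M s"
  shows "f \<in> borel_measurable M" "integrable M (\<lambda>x. norm (f x) powr s)"
  using assms by (auto simp: Lps_def)

lemma lpn_eq_0_AE:
  assumes "f \<in> Lps M s" "s > 0" "lpn M s f = 0"
  shows "AE x in M. f x = 0"
proof -
  have "(\<integral>x. norm (f x) powr s \<partial>M) = 0"
    using assms(2,3) lpn_powr[of s M f] by simp
  then have "AE x in M. norm (f x) powr s = 0"
    using assms by (subst (asm) integral_nonneg_eq_0_iff_AE) (auto simp: Lps_def)
  then show ?thesis by eventually_elim (use assms in auto)
qed

lemma lpn_norm: "lpn M s (\<lambda>x. norm (f x)) = lpn M s f"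
  by (simp add: lpn_def)

lemma Lps_norm: "f \<in> Lps M s \<Longrightarrow> (\<lambda>x. norm (f x)) \<in> Lps M s"
  by (auto simp: Lps_def)

text \<open>Young's inequality for \<open>f\<close> and \<open>g\<close> divided by their norms,
  integrated. The conjugate exponent stays hidden: every dual function that occurs later is bounded
  by the (s-1)-th power of an L^s function, so one scale of spaces suffices.\<close>

lemma Holder_powr:
  fixes f :: "'a \<Rightarrow> 'b::euclidean_space" and g :: "'a \<Rightarrow> 'c::euclidean_space"
  assumes s: "1 < s" and f: "f \<in> Lps M s" and g: "g \<in> Lps M s"
  shows "integrable M (\<lambda>x. norm (f x) powr (s - 1) * norm (g x))" (is ?I)
    and "(\<integral>x. norm (f x) powr (s - 1) * norm (g x) \<partial>M) \<le> lpn M s f powr (s - 1) * lpn M s g" (is ?B)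
proof -
  note [measurable] = LpsD(1)[OF f] LpsD(1)[OF g]
  note i [intro] = LpsD(2)[OF f] LpsD(2)[OF g]
  show ?I
  proof (rule Bochner_Integration.integrable_bound)
    show "integrable M (\<lambda>x. (s - 1) / s * norm (f x) powr s + norm (g x) powr s / s)"
      by (intro Bochner_Integration.integrable_add integrable_mult_right integrable_divide i)
    show "AE x in M. norm (norm (f x) powr (s - 1) * norm (g x))
        \<le> norm ((s - 1) / s * norm (f x) powr s + norm (g x) powr s / s)"
      using young_powr[OF s norm_ge_zero norm_ge_zero] s
      by (intro AE_I2) (auto simp: abs_of_nonneg intro!: order_trans[OF _ abs_ge_self])
  qed measurable
  show ?B
  proof (cases "lpn M s f = 0 \<or> lpn M s g = 0")
    case True
    then have "AE x in M. f x = 0 \<or> g x = 0"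
    proof
      assume "lpn M s f = 0"
      with lpn_eq_0_AE[OF f] s have "AE x in M. f x = 0" by simp
      then show ?thesis by eventually_elim auto
    next
      assume "lpn M s g = 0"
      with lpn_eq_0_AE[OF g] s have "AE x in M. g x = 0" by simp
      then show ?thesis by eventually_elim auto
    qed
    then have "AE x in M. norm (f x) powr (s - 1) * norm (g x) = 0"
      by eventually_elim auto
    then have "(\<integral>x. norm (f x) powr (s - 1) * norm (g x) \<partial>M) = 0"
      by (rule integral_eq_zero_AE)
    then show ?thesis by simp
  next
    case False
    define A where "A = lpn M s f"
    define B where "B = lpn M s g"
    have A: "A > 0" and B: "B > 0"
      using False lpn_nonneg[of M s f] lpn_nonneg[of M s g] unfolding A_def B_def by linarith+
    have *: "norm (f x) powr (s - 1) * norm (g x)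
      \<le> A powr (s - 1) * B * ((s - 1) / s * (norm (f x) powr s / A powr s) + (norm (g x) powr s / B powr s) / s)" for x
    proof -
      have "(norm (f x) / A) powr (s - 1) * (norm (g x) / B)
        \<le> (s - 1) / s * (norm (f x) / A) powr s + (norm (g x) / B) powr s / s"
        using A B s by (intro young_powr) auto
      then have "A powr (s - 1) * B * ((norm (f x) / A) powr (s - 1) * (norm (g x) / B))
        \<le> A powr (s - 1) * B * ((s - 1) / s * (norm (f x) / A) powr s + (norm (g x) / B) powr s / s)"
        using A B by (intro mult_left_mono) auto
      moreover have "A powr (s - 1) * B * ((norm (f x) / A) powr (s - 1) * (norm (g x) / B))
          = norm (f x) powr (s - 1) * norm (g x)"
        using A B by (simp add: powr_divide)
      ultimately show ?thesis using A B by (simp add: powr_divide)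
    qed
    have "(\<integral>x. norm (f x) powr (s - 1) * norm (g x) \<partial>M)
      \<le> (\<integral>x. A powr (s - 1) * B * ((s - 1) / s * (norm (f x) powr s / A powr s) + (norm (g x) powr s / B powr s) / s) \<partial>M)"
      by (intro integral_mono * \<open>?I\<close> integrable_mult_right Bochner_Integration.integrable_add integrable_divide i)
    also have "\<dots> = A powr (s - 1) * B * ((s - 1) / s * ((\<integral>x. norm (f x) powr s \<partial>M) / A powr s)
        + ((\<integral>x. norm (g x) powr s \<partial>M) / B powr s) / s)"
      by (simp add: i integrable_mult_right integrable_divide)
    also have "\<dots> = A powr (s - 1) * B * ((s - 1) / s + 1 / s)"
    proof -
      have "(\<integral>x. norm (f x) powr s \<partial>M) = A powr s" "(\<integral>x. norm (g x) powr s \<partial>M) = B powr s"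
        using s by (simp_all add: A_def B_def lpn_powr)
      moreover have "A powr s \<noteq> 0" "B powr s \<noteq> 0" using A B by auto
      ultimately show ?thesis by simp
    qed
    also have "\<dots> = A powr (s - 1) * B"
      using s by (simp add: field_simps)
    finally show ?thesis by (simp add: A_def B_def)
  qed
qed

lemma powr_add_le:
  fixes a b s :: real
  assumes "0 \<le> a" "0 \<le> b" "0 < s"
  shows "(a + b) powr s \<le> 2 powr s * (a powr s + b powr s)"
proof -
  have "(a + b) powr s \<le> (2 * max a b) powr s"
    using assms by (intro powr_mono2) auto
  also have "\<dots> = 2 powr s * max a b powr s"
    using assms by (simp add: powr_mult)
  also have "max a b powr s \<le> a powr s + b powr s"
    by (auto simp: max_def)
  finally show ?thesis by (simp add: mult_left_mono)
qed

lemma Lps_bound: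
  assumes "f \<in> Lps M s" "g \<in> borel_measurable M" "AE x in M. norm (g x) \<le> norm (f x)" "0 \<le> s"
  shows "g \<in> Lps M s"
proof (rule LpsI)
  show "integrable M (\<lambda>x. norm (g x) powr s)"
  proof (rule Bochner_Integration.integrable_bound)
    show "integrable M (\<lambda>x. norm (f x) powr s)" by (rule LpsD[OF assms(1)])
    show "(\<lambda>x. norm (g x) powr s) \<in> borel_measurable M" using assms by measurable
    show "AE x in M. norm (norm (g x) powr s) \<le> norm (norm (f x) powr s)"
      using assms(3) by eventually_elim (use assms in \<open>auto intro: powr_mono2\<close>)
  qed
qed fact

lemma lpn_mono:
  assumes "f \<in> Lps M s" "g \<in> borel_measurable M" "AE x in M. norm (g x) \<le> norm (f x)" "0 < s"
  shows "lpn M s g \<le> lpn M s f"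
  unfolding lpn_def
proof (rule powr_mono2)
  show "(\<integral>x. norm (g x) powr s \<partial>M) \<le> (\<integral>x. norm (f x) powr s \<partial>M)"
  proof (rule integral_mono_AE)
    show "integrable M (\<lambda>x. norm (g x) powr s)"
      using Lps_bound[OF assms(1-3)] assms(4) by (auto dest: LpsD)
    show "integrable M (\<lambda>x. norm (f x) powr s)" by (rule LpsD[OF assms(1)])
    show "AE x in M. norm (g x) powr s \<le> norm (f x) powr s"
      using assms(3) by eventually_elim (use assms in \<open>auto intro: powr_mono2\<close>)
  qed
qed (use assms in auto)

lemma Lps_add_norm:
  assumes "f \<in> Lps M s" "g \<in> Lps M s" "0 < s"
  shows "(\<lambda>x. norm (f x) + norm (g x)) \<in> Lps M s"
proof (rule LpsI)
  note [measurable] = LpsD(1)[OF assms(1)] LpsD(1)[OF assms(2)]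
  show "(\<lambda>x. norm (f x) + norm (g x)) \<in> borel_measurable M" by measurable
  show "integrable M (\<lambda>x. norm (norm (f x) + norm (g x)) powr s)"
  proof (rule Bochner_Integration.integrable_bound)
    show "integrable M (\<lambda>x. 2 powr s * (norm (f x) powr s + norm (g x) powr s))"
      using LpsD[OF assms(1)] LpsD[OF assms(2)] by auto
    show "AE x in M. norm (norm (norm (f x) + norm (g x)) powr s)
          \<le> norm (2 powr s * (norm (f x) powr s + norm (g x) powr s))"
      using assms by (intro AE_I2) (auto simp: powr_add_le)
  qed measurable
qed

lemma Lps_add:
  assumes "f \<in> Lps M s" "g \<in> Lps M s" "0 < s"
  shows "(\<lambda>x. f x + g x) \<in> Lps M s"
  using assms LpsD(1)[OF assms(1)] LpsD(1)[OF assms(2)]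
  by (intro Lps_bound[OF Lps_add_norm[OF assms]]) (auto intro!: AE_I2 norm_triangle_ineq)

lemma Lps_scaleR: "f \<in> Lps M s \<Longrightarrow> (\<lambda>x. c *\<^sub>R f x) \<in> Lps M s"
  by (auto simp: Lps_def powr_mult)

lemma Lps_mult: "f \<in> Lps M s \<Longrightarrow> (\<lambda>x. c * f x :: real) \<in> Lps M s"
  using Lps_scaleR[of f M s c] by simp

lemma lpn_scaleR: "s > 0 \<Longrightarrow> lpn M s (\<lambda>x. c *\<^sub>R f x) = \<bar>c\<bar> * lpn M s f"
  by (simp add: lpn_def powr_mult powr_powr)

lemma lpn_mult: "s > 0 \<Longrightarrow> lpn M s (\<lambda>x. c * f x :: real) = \<bar>c\<bar> * lpn M s f"
  using lpn_scaleR[of s M c f] by simp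

lemma Lps_diff:
  assumes "f \<in> Lps M s" "g \<in> Lps M s" "0 < s"
  shows "(\<lambda>x. f x - g x) \<in> Lps M s"
  using Lps_add[OF assms(1) Lps_scaleR[OF assms(2), of "-1"] assms(3)] by simp

lemma lpn_add_norm:
  assumes f: "f \<in> Lps M s" and g: "g \<in> Lps M s" and s: "1 < s"
  shows "lpn M s (\<lambda>x. norm (f x) + norm (g x)) \<le> lpn M s f + lpn M s g"
proof (cases "lpn M s (\<lambda>x. norm (f x) + norm (g x)) = 0")
  case False
  define h where "h = (\<lambda>x. norm (f x) + norm (g x))"
  have h: "h \<in> Lps M s" using Lps_add_norm[OF f g] s by (simp add: h_def)
  have H: "lpn M s h > 0" using False lpn_nonneg[of M s h] unfolding h_def by linarith
  have "h x powr s = norm (h x) powr (s - 1) * norm (f x) + norm (h x) powr (s - 1) * norm (g x)" for x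
  proof -
    have "h x \<ge> 0" by (simp add: h_def)
    then have "h x powr s = h x powr (s - 1) * h x"
      by (cases "h x = 0") (auto simp: powr_diff)
    also have "\<dots> = h x powr (s - 1) * norm (f x) + h x powr (s - 1) * norm (g x)"
      by (simp add: h_def distrib_left)
    finally show ?thesis using \<open>h x \<ge> 0\<close> by simp
  qed
  moreover have "norm (h x) = h x" for x by (simp add: h_def)
  ultimately have "lpn M s h powr s = (\<integral>x. norm (h x) powr (s - 1) * norm (f x) \<partial>M) + (\<integral>x. norm (h x) powr (s - 1) * norm (g x) \<partial>M)"
    using s Holder_powr(1)[OF s h f] Holder_powr(1)[OF s h g] by (simp add: lpn_powr)
  also have "\<dots> \<le> lpn M s h powr (s - 1) * lpn M s f + lpn M s h powr (s - 1) * lpn M s g"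
    by (intro add_mono Holder_powr s h f g)
  finally have "lpn M s h powr (s - 1) * lpn M s h \<le> lpn M s h powr (s - 1) * (lpn M s f + lpn M s g)"
    using H by (simp add: powr_diff distrib_left)
  then show ?thesis using H by (simp add: h_def[symmetric])
qed (simp add: add_nonneg_nonneg)

lemma lpn_add:
  assumes f: "f \<in> Lps M s" and g: "g \<in> Lps M s" and s: "1 < s"
  shows "lpn M s (\<lambda>x. f x + g x) \<le> lpn M s f + lpn M s g"
proof -
  have "lpn M s (\<lambda>x. f x + g x) \<le> lpn M s (\<lambda>x. norm (f x) + norm (g x))"
    using assms LpsD(1)[OF f] LpsD(1)[OF g]
    by (intro lpn_mono Lps_add_norm) (auto intro!: AE_I2 norm_triangle_ineq)
  with lpn_add_norm[OF assms] show ?thesis by simp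
qed

lemma lpn_minus_commute: "lpn M s (\<lambda>x. f x - g x) = lpn M s (\<lambda>x. g x - f x)"
  by (simp add: lpn_def norm_minus_commute)

lemma lpn_diff:
  assumes f: "f \<in> Lps M s" and g: "g \<in> Lps M s" and s: "1 < s"
  shows "lpn M s (\<lambda>x. f x - g x) \<le> lpn M s f + lpn M s g"
  using lpn_add[OF f Lps_scaleR[OF g, of "-1"] s] lpn_scaleR[of s M "-1" g] s by simp

lemma lpn_triangle:
  assumes "f \<in> Lps M s" "g \<in> Lps M s" "h \<in> Lps M s" and s: "1 < s"
  shows "lpn M s (\<lambda>x. f x - h x) \<le> lpn M s (\<lambda>x. f x - g x) + lpn M s (\<lambda>x. g x - h x)"
  using lpn_add[OF Lps_diff[OF assms(1,2)] Lps_diff[OF assms(2,3)]] s by simp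

lemma lpn_abs_diff:
  assumes f: "f \<in> Lps M s" and g: "g \<in> Lps M s" and s: "1 < s"
  shows "\<bar>lpn M s f - lpn M s g\<bar> \<le> lpn M s (\<lambda>x. f x - g x)"
  using lpn_add[OF Lps_diff[OF f g] g] lpn_add[OF Lps_diff[OF g f] f] s lpn_minus_commute[of M s f g]
  by auto

lemma Lps_zero [simp]: "(\<lambda>x. 0) \<in> Lps M s"
  by (simp add: Lps_def)

lemma lpn_zero [simp]: "lpn M s (\<lambda>x. 0) = 0"
  by (simp add: lpn_def)

lemma Lps_const: "finite_measure M \<Longrightarrow> (\<lambda>x. c) \<in> Lps M s"
  by (auto simp: Lps_def finite_measure.integrable_const)

lemma Holder_finite:
  assumes "finite_measure M" "1 < s" "g \<in> Lps M s"
  shows "integrable M g" "(\<integral>x. norm (g x) \<partial>M) \<le> lpn M s (\<lambda>x. 1::real) powr (s - 1) * lpn M s g"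
proof -
  have "(\<lambda>x. 1::real) \<in> Lps M s" using assms by (intro Lps_const)
  from Holder_powr[OF assms(2) this assms(3)]
  show "integrable M g" "(\<integral>x. norm (g x) \<partial>M) \<le> lpn M s (\<lambda>x. 1::real) powr (s - 1) * lpn M s g"
    using LpsD(1)[OF assms(3)] by (auto simp: integrable_norm_iff)
qed

text \<open>Fatou's lemma for the powers of the norms. It yields membership and bound at once, and
  it is how uniform estimates pass to pointwise limits of regularisations, of averages and of Cauchy
  sequences.\<close>

lemma lpn_Fatou:
  assumes f: "\<And>k. f k \<in> Lps M s" and g: "g \<in> borel_measurable M"
    and lim: "AE x in M. (\<lambda>k. f k x) \<longlonglongrightarrow> g x" and B: "\<And>k. lpn M s (f k) \<le> B" and s: "s > 0"
  shows "g \<in> Lps M s" "lpn M s g \<le> B"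
proof -
  note [measurable] = LpsD(1)[OF f] g
  have B0: "0 \<le> B" using B[of 0] lpn_nonneg[of M s "f 0"] by linarith
  have fB: "(\<integral>\<^sup>+x. ennreal (norm (f k x) powr s) \<partial>M) \<le> ennreal (B powr s)" for k
  proof -
    have "(\<integral>\<^sup>+x. ennreal (norm (f k x) powr s) \<partial>M) = ennreal (\<integral>x. norm (f k x) powr s \<partial>M)"
      using LpsD(2)[OF f] by (intro nn_integral_eq_integral) auto
    also have "(\<integral>x. norm (f k x) powr s \<partial>M) = lpn M s (f k) powr s"
      using s by (simp add: lpn_powr)
    also have "ennreal \<dots> \<le> ennreal (B powr s)"
      using B s by (intro ennreal_leI powr_mono2) auto
    finally show ?thesis .
  qed
  have "(\<integral>\<^sup>+x. ennreal (norm (g x) powr s) \<partial>M) = (\<integral>\<^sup>+x. liminf (\<lambda>k. ennreal (norm (f k x) powr s)) \<partial>M)"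
  proof (rule nn_integral_cong_AE)
    show "AE x in M. ennreal (norm (g x) powr s) = liminf (\<lambda>k. ennreal (norm (f k x) powr s))"
      using lim
    proof eventually_elim
      case (elim x)
      have "(\<lambda>k. norm (f k x) powr s) \<longlonglongrightarrow> norm (g x) powr s"
        using elim s by (intro tendsto_intros tendsto_powr2) (auto intro!: tendsto_intros elim)
      then have "(\<lambda>k. ennreal (norm (f k x) powr s)) \<longlonglongrightarrow> ennreal (norm (g x) powr s)"
        by (rule tendsto_ennrealI)
      then show ?case using lim_imp_Liminf[OF sequentially_bot] by metis
    qed
  qed
  also have "\<dots> \<le> liminf (\<lambda>k. \<integral>\<^sup>+x. ennreal (norm (f k x) powr s) \<partial>M)"
    by (rule nn_integral_liminf) measurable
  also have "\<dots> \<le> liminf (\<lambda>k::nat. ennreal (B powr s))"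
    using fB by (intro Liminf_mono) auto
  also have "\<dots> = ennreal (B powr s)" by (simp add: Liminf_const)
  finally have le: "(\<integral>\<^sup>+x. ennreal (norm (g x) powr s) \<partial>M) \<le> ennreal (B powr s)" .
  have int: "integrable M (\<lambda>x. norm (g x) powr s)"
    by (rule integrableI_nonneg) (use le in \<open>auto intro: le_less_trans[OF le]\<close>)
  then show "g \<in> Lps M s" using g by (intro LpsI)
  have "ennreal (\<integral>x. norm (g x) powr s \<partial>M) \<le> ennreal (B powr s)"
    using le int by (subst (asm) nn_integral_eq_integral) auto
  then have "(\<integral>x. norm (g x) powr s \<partial>M) \<le> B powr s"
    by (simp add: ennreal_le_iff)
  then have "lpn M s g \<le> (B powr s) powr (1/s)"
    unfolding lpn_def using s by (intro powr_mono2) (auto intro: integral_nonneg_AE)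
  also have "\<dots> = B" using s B0 by (simp add: powr_powr)
  finally show "lpn M s g \<le> B" .
qed

text \<open>Hoelder's inequality against the constant 1 turns L^s convergence on a finite measure
  space into L^1 convergence, and from that a subsequence converges almost everywhere.\<close>

lemma Lps_tendsto_AE:
  fixes f :: "nat \<Rightarrow> 'a \<Rightarrow> 'b::euclidean_space"
  assumes M: "finite_measure M" and s: "1 < s" and f: "\<And>k. f k \<in> Lps M s" and g: "g \<in> Lps M s"
    and lim: "(\<lambda>k. lpn M s (\<lambda>x. f k x - g x)) \<longlonglongrightarrow> 0"
  obtains r :: "nat \<Rightarrow> nat" where "strict_mono r" "AE x in M. (\<lambda>k. f (r k) x) \<longlonglongrightarrow> g x"
proof -
  have d: "(\<lambda>x. f k x - g x) \<in> Lps M s" for k using s by (intro Lps_diff f g) auto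
  have "(\<lambda>k. \<integral>x. norm (f k x - g x) \<partial>M) \<longlonglongrightarrow> 0"
  proof (rule tendsto_sandwich[OF _ _ tendsto_const])
    show "\<forall>\<^sub>F k in sequentially. (\<integral>x. norm (f k x - g x) \<partial>M)
      \<le> lpn M s (\<lambda>x. 1::real) powr (s - 1) * lpn M s (\<lambda>x. f k x - g x)"
      by (intro always_eventually allI Holder_finite M s d)
    show "(\<lambda>k. lpn M s (\<lambda>x. 1::real) powr (s - 1) * lpn M s (\<lambda>x. f k x - g x)) \<longlonglongrightarrow> 0"
      by (intro tendsto_mult_right_zero lim)
  qed auto
  from tendsto_L1_AE_subseq[OF Holder_finite(1)[OF M s d] this]
  obtain r where "strict_mono r" "AE x in M. (\<lambda>n. f (r n) x - g x) \<longlonglongrightarrow> 0" by auto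
  then show ?thesis using that by (auto simp: LIM_zero_iff)
qed

text \<open>Riesz-Fischer: the sequence is Cauchy in L^1 as well, so a subsequence converges almost
  everywhere, and Fatou's lemma shows that the whole sequence approaches this pointwise limit in
  L^s.\<close>

lemma Lps_complete:
  fixes f :: "nat \<Rightarrow> 'a \<Rightarrow> 'b::euclidean_space"
  assumes M: "finite_measure M" and s: "1 < s" and f: "\<And>k. f k \<in> Lps M s"
    and C: "\<And>e. e > 0 \<Longrightarrow> \<exists>N. \<forall>i\<ge>N. \<forall>j\<ge>N. lpn M s (\<lambda>x. f i x - f j x) < e"
  obtains g where "g \<in> Lps M s" "(\<lambda>k. lpn M s (\<lambda>x. f k x - g x)) \<longlonglongrightarrow> 0"
proof -
  have d: "(\<lambda>x. f k x - f l x) \<in> Lps M s" for k l using s by (intro Lps_diff f) auto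
  have "\<exists>N. \<forall>i\<ge>N. \<forall>j\<ge>N. (\<integral>x. norm (f i x - f j x) \<partial>M) < e" if e: "e > 0" for e
  proof -
    define c where "c = lpn M s (\<lambda>x. 1::real) powr (s - 1)"
    have c: "0 \<le> c" by (simp add: c_def)
    obtain N where N: "\<forall>i\<ge>N. \<forall>j\<ge>N. lpn M s (\<lambda>x. f i x - f j x) < e / (c + 1)"
      using C[of "e / (c + 1)"] e c by auto
    have "(\<integral>x. norm (f i x - f j x) \<partial>M) < e" if "i \<ge> N" "j \<ge> N" for i j
    proof -
      have "(\<integral>x. norm (f i x - f j x) \<partial>M) \<le> c * lpn M s (\<lambda>x. f i x - f j x)"
        unfolding c_def by (intro Holder_finite M s d)
      also have "\<dots> \<le> c * (e / (c + 1))"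
        using N that c by (intro mult_left_mono) (auto intro: less_imp_le)
      also have "\<dots> < e" using c e by (simp add: field_simps)
      finally show ?thesis .
    qed
    then show ?thesis by blast
  qed
  then obtain r where r: "strict_mono r" "AE x in M. Cauchy (\<lambda>i. f (r i) x)"
    by (rule cauchy_L1_AE_cauchy_subseq[OF Holder_finite(1)[OF M s f]])
  define g where "g x = lim (\<lambda>i. f (r i) x)" for x
  have [measurable]: "f k \<in> borel_measurable M" for k by (rule LpsD[OF f])
  have g: "g \<in> borel_measurable M" unfolding g_def by measurable
  have lim: "AE x in M. (\<lambda>i. f (r i) x) \<longlonglongrightarrow> g x"
    using r(2) by eventually_elim (auto simp: g_def Cauchy_convergent_iff convergent_LIMSEQ_iff)
  \<comment> \<open>Fatou's lemma in the second index with \<open>k\<close> fixed, along a tail of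
    the subsequence; strict monotonicity of \<open>r\<close> keeps that tail beyond
    \<open>N\<close>.\<close>
  have *: "(\<lambda>x. f k x - g x) \<in> Lps M s \<and> lpn M s (\<lambda>x. f k x - g x) \<le> e"
    if N: "\<forall>i\<ge>N. \<forall>j\<ge>N. lpn M s (\<lambda>x. f i x - f j x) < e" and k: "k \<ge> N" for k N e
  proof -
    have "lpn M s (\<lambda>x. f k x - f (r (i + N)) x) \<le> e" for i
      using N k seq_suble[OF r(1), of "i + N"] by (auto intro: less_imp_le)
    moreover have "AE x in M. (\<lambda>i. f k x - f (r (i + N)) x) \<longlonglongrightarrow> f k x - g x"
      using lim by eventually_elim (intro tendsto_intros, subst LIMSEQ_ignore_initial_segment, auto)
    moreover have "(\<lambda>x. f k x - g x) \<in> borel_measurable M" using g by measurable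
    ultimately show ?thesis using lpn_Fatou[of "\<lambda>i x. f k x - f (r (i + N)) x" M s "\<lambda>x. f k x - g x" e] d s by auto
  qed
  obtain N where "\<forall>i\<ge>N. \<forall>j\<ge>N. lpn M s (\<lambda>x. f i x - f j x) < 1" using C[of 1] by auto
  from *[OF this order_refl] have "(\<lambda>x. f N x - g x) \<in> Lps M s" by simp
  from Lps_diff[OF f[of N] this] s have "g \<in> Lps M s" by simp
  moreover have "(\<lambda>k. lpn M s (\<lambda>x. f k x - g x)) \<longlonglongrightarrow> 0"
  proof (rule LIMSEQ_I)
    fix e :: real assume "e > 0"
    then obtain N where "\<forall>i\<ge>N. \<forall>j\<ge>N. lpn M s (\<lambda>x. f i x - f j x) < e / 2" using C[of "e/2"] by auto
    from *[OF this] \<open>e > 0\<close> show "\<exists>N. \<forall>k\<ge>N. norm (lpn M s (\<lambda>x. f k x - g x) - 0) < e"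
      by (intro exI[of _ N]) force
  qed
  ultimately show ?thesis by (rule that)
qed

lemma lpn_lim_unique:
  assumes s: "1 < s" and f: "\<And>k. f k \<in> Lps M s" and g: "g \<in> Lps M s" and h: "h \<in> Lps M s"
    and lim: "(\<lambda>k. lpn M s (\<lambda>x. f k x - g x)) \<longlonglongrightarrow> 0" "(\<lambda>k. lpn M s (\<lambda>x. f k x - h x)) \<longlonglongrightarrow> 0"
  shows "AE x in M. g x = h x"
proof -
  have "lpn M s (\<lambda>x. g x - h x) \<le> lpn M s (\<lambda>x. f k x - g x) + lpn M s (\<lambda>x. f k x - h x)" for k
    using lpn_triangle[OF g f h s, of k] lpn_minus_commute[of M s "f k" g] by simp
  then have "lpn M s (\<lambda>x. g x - h x) \<le> 0 + 0"
    by (intro LIMSEQ_le_const[OF tendsto_add[OF lim]]) auto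
  then have "lpn M s (\<lambda>x. g x - h x) = 0" using lpn_nonneg[of M s "\<lambda>x. g x - h x"] by linarith
  then have "AE x in M. g x - h x = 0" using s by (intro lpn_eq_0_AE[OF Lps_diff[OF g h]]) auto
  then show ?thesis by simp
qed

lemma lpn_cong_AE:
  assumes "AE x in M. norm (f x) = norm (g x)" "f \<in> borel_measurable M" "g \<in> borel_measurable M"
  shows "lpn M s f = lpn M s g"
proof -
  have "(\<integral>x. norm (f x) powr s \<partial>M) = (\<integral>x. norm (g x) powr s \<partial>M)"
    using assms(1) by (intro integral_cong_AE) (use assms in auto)
  then show ?thesis by (simp add: lpn_def)
qed

section \<open>Superposition operators\<close>

text \<open>The pointwise form of uniform continuity of the superposition operator from bounded sets
  of \<open>L\<^sup>s\<close> to the dual of \<open>L\<^sup>s\<close>; it holds for continuous functions of strictly smaller growth and for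
  the flux of the \<open>s\<close>-Laplacian.\<close>

definition nemy :: "real \<Rightarrow> ('b::euclidean_space \<Rightarrow> 'b) \<Rightarrow> bool" where
  "nemy s a \<longleftrightarrow> continuous_on UNIV a \<and>
    (\<forall>\<epsilon>>0. \<exists>C\<ge>0. \<forall>x y. norm (a x - a y)
        \<le> \<epsilon> * (1 + norm x + norm y) powr (s - 1) + C * norm (x - y) powr (s - 1))"

lemma nemy_measurable:
  assumes "nemy s a" "U \<in> borel_measurable M" shows "(\<lambda>x. a (U x)) \<in> borel_measurable M"
  using assms borel_measurable_continuous_onI[of a] unfolding nemy_def
  by (auto intro: measurable_compose)

lemma nemyE:
  assumes "nemy s a" "\<epsilon> > 0"
  obtains C where "C \<ge> 0" "\<And>x y. norm (a x - a y)
        \<le> \<epsilon> * (1 + norm x + norm y) powr (s - 1) + C * norm (x - y) powr (s - 1)"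
  using assms unfolding nemy_def by blast

lemma nemy_bound:
  fixes a :: "'b::euclidean_space \<Rightarrow> 'b"
  assumes "nemy s a" "1 < s"
  obtains C where "C \<ge> 0" "\<And>x. norm (a x) \<le> C * (1 + norm x) powr (s - 1)"
proof -
  obtain C where C: "C \<ge> 0" "\<And>x y. norm (a x - a y)
        \<le> 1 * (1 + norm x + norm y) powr (s - 1) + C * norm (x - y) powr (s - 1)"
    using nemyE[OF assms(1), of 1] by auto
  show ?thesis
  proof
    show "0 \<le> norm (a 0) + 1 + C" using C by (simp add: add_nonneg_nonneg)
    fix x :: 'b
    have "1 \<le> (1 + norm x) powr (s - 1)"
      using assms by (intro ge_one_powr_ge_zero) auto
    then have 1: "norm (a 0) * 1 \<le> norm (a 0) * (1 + norm x) powr (s - 1)"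
      by (intro mult_left_mono) auto
    have 2: "C * norm x powr (s - 1) \<le> C * (1 + norm x) powr (s - 1)"
      using assms C by (intro mult_left_mono powr_mono2) auto
    have "norm (a x) \<le> norm (a 0) + norm (a x - a 0)"
      by norm
    also have "norm (a x - a 0) \<le> (1 + norm x) powr (s - 1) + C * norm x powr (s - 1)"
      using C(2)[of x 0] by simp
    finally show "norm (a x) \<le> (norm (a 0) + 1 + C) * (1 + norm x) powr (s - 1)"
      using 1 2 by (simp add: algebra_simps)
  qed
qed

text \<open>The common core of integrability, uniform continuity and differentiability. In the
  continuity estimates \<open>w\<close> measures the size of the arguments, with a small factor, and
  \<open>z\<close> their distance, with a large one; for plain bounds \<open>z\<close> is 0.\<close>

lemma Holder_estimate:
  fixes V :: "'a \<Rightarrow> 'b::euclidean_space" and w z k :: "'a \<Rightarrow> real"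
  assumes s: "1 < s" and w: "w \<in> Lps M s" and z: "z \<in> Lps M s" and V: "V \<in> Lps M s"
    and k: "k \<in> borel_measurable M" and nn: "\<And>x. 0 \<le> w x" "\<And>x. 0 \<le> z x"
    and le: "\<And>x. \<bar>k x\<bar> \<le> (\<epsilon> * w x powr (s - 1) + C * z x powr (s - 1)) * norm (V x)"
    and c: "\<epsilon> \<ge> 0" "C \<ge> 0"
  shows "integrable M k" "\<bar>\<integral>x. k x \<partial>M\<bar> \<le> (\<epsilon> * lpn M s w powr (s - 1) + C * lpn M s z powr (s - 1)) * lpn M s V"
proof -
  have wi: "integrable M (\<lambda>x. w x powr (s - 1) * norm (V x))"
       "(\<integral>x. w x powr (s - 1) * norm (V x) \<partial>M) \<le> lpn M s w powr (s - 1) * lpn M s V"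
    using Holder_powr[OF s w V] nn by simp_all
  have zi: "integrable M (\<lambda>x. z x powr (s - 1) * norm (V x))"
       "(\<integral>x. z x powr (s - 1) * norm (V x) \<partial>M) \<le> lpn M s z powr (s - 1) * lpn M s V"
    using Holder_powr[OF s z V] nn by simp_all
  define b where "b = (\<lambda>x. \<epsilon> * (w x powr (s - 1) * norm (V x)) + C * (z x powr (s - 1) * norm (V x)))"
  have b: "integrable M b" unfolding b_def using wi zi by auto
  have kb: "\<bar>k x\<bar> \<le> b x" for x using le[of x] by (simp add: b_def algebra_simps)
  show ki: "integrable M k"
    by (rule Bochner_Integration.integrable_bound[OF b k]) (use kb in \<open>auto intro: order_trans[OF _ abs_ge_self]\<close>)
  have "\<bar>\<integral>x. k x \<partial>M\<bar> \<le> (\<integral>x. \<bar>k x\<bar> \<partial>M)" by (rule integral_abs_bound)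
  also have "\<dots> \<le> (\<integral>x. b x \<partial>M)" by (intro integral_mono kb b integrable_abs ki)
  also have "\<dots> = \<epsilon> * (\<integral>x. w x powr (s - 1) * norm (V x) \<partial>M) + C * (\<integral>x. z x powr (s - 1) * norm (V x) \<partial>M)"
    unfolding b_def using wi zi by simp
  also have "\<dots> \<le> \<epsilon> * (lpn M s w powr (s - 1) * lpn M s V) + C * (lpn M s z powr (s - 1) * lpn M s V)"
    by (intro add_mono mult_left_mono wi zi c)
  finally show "\<bar>\<integral>x. k x \<partial>M\<bar> \<le> (\<epsilon> * lpn M s w powr (s - 1) + C * lpn M s z powr (s - 1)) * lpn M s V"
    by (simp add: algebra_simps)
qed

lemma Lps_one_plus:
  assumes "finite_measure M" "U \<in> Lps M s" "s > 1"
  shows "(\<lambda>x. 1 + norm (U x)) \<in> Lps M s"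
    "lpn M s (\<lambda>x. 1 + norm (U x)) \<le> lpn M s (\<lambda>x. 1::real) + lpn M s U"
  using Lps_add_norm[OF Lps_const[OF assms(1), of "1::real" s] assms(2)]
    lpn_add_norm[OF Lps_const[OF assms(1), of "1::real" s] assms(2,3)] assms(3) by simp_all

lemma nemy_integrable:
  assumes M: "finite_measure M" and s: "1 < s" and a: "nemy s a" and U: "U \<in> Lps M s" and V: "V \<in> Lps M s"
  shows "integrable M (\<lambda>x. a (U x) \<bullet> V x)"
proof -
  obtain C where C: "C \<ge> 0" "\<And>x. norm (a x) \<le> C * (1 + norm x) powr (s - 1)"
    using nemy_bound[OF a s] by blast
  note [measurable] = nemy_measurable[OF a LpsD(1)[OF U]] LpsD(1)[OF V]
  have *: "\<bar>a (U x) \<bullet> V x\<bar> \<le> (C * (1 + norm (U x)) powr (s - 1) + 0 * 0 powr (s - 1)) * norm (V x)" for x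
    using order_trans[OF Cauchy_Schwarz_ineq2 mult_right_mono[OF C(2) norm_ge_zero]] by simp
  show ?thesis
    by (rule Holder_estimate(1)[OF s Lps_one_plus(1)[OF M U s] Lps_zero V _ _ _ *]) (use C in auto)
qed

lemma nemy_bound_integral:
  assumes M: "finite_measure M" and s: "1 < s" and a: "nemy s a"
  shows "\<exists>C\<ge>0. \<forall>U\<in>Lps M s. \<forall>V\<in>Lps M s. lpn M s U \<le> R \<longrightarrow>
    \<bar>\<integral>x. a (U x) \<bullet> V x \<partial>M\<bar> \<le> C * lpn M s V"
proof -
  obtain C where C: "C \<ge> 0" "\<And>x. norm (a x) \<le> C * (1 + norm x) powr (s - 1)"
    using nemy_bound[OF a s] by blast
  define K where "K = lpn M s (\<lambda>x. 1::real) + R"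
  have "\<bar>\<integral>x. a (U x) \<bullet> V x \<partial>M\<bar> \<le> C * K powr (s - 1) * lpn M s V"
    if U: "U \<in> Lps M s" and V: "V \<in> Lps M s" and R: "lpn M s U \<le> R" for U V
  proof -
    note [measurable] = nemy_measurable[OF a LpsD(1)[OF U]] LpsD(1)[OF V]
    have *: "\<bar>a (U x) \<bullet> V x\<bar> \<le> (C * (1 + norm (U x)) powr (s - 1) + 0 * 0 powr (s - 1)) * norm (V x)" for x
      using order_trans[OF Cauchy_Schwarz_ineq2 mult_right_mono[OF C(2) norm_ge_zero]] by simp
    have "\<bar>\<integral>x. a (U x) \<bullet> V x \<partial>M\<bar> \<le> (C * lpn M s (\<lambda>x. 1 + norm (U x)) powr (s - 1) + 0 * lpn M s (\<lambda>x. 0::real) powr (s - 1)) * lpn M s V"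
      by (rule Holder_estimate(2)[OF s Lps_one_plus(1)[OF M U s] Lps_zero V _ _ _ *]) (use C in auto)
    also have "\<dots> \<le> C * K powr (s - 1) * lpn M s V"
      using Lps_one_plus(2)[OF M U s] R s C unfolding K_def
      by (auto intro!: mult_right_mono mult_left_mono powr_mono2)
    finally show ?thesis .
  qed
  then show ?thesis using C by (intro exI[of _ "C * K powr (s - 1)"]) auto
qed

text \<open>The order of the quantifiers is the point: \<open>\<epsilon>\<close> must be fixed
  before \<open>C\<close> is known, since the constant \<open>C\<close> of \<open>nemy\<close>
  depends on \<open>\<epsilon>\<close>; only \<open>d\<close> may depend on
  \<open>C\<close>.\<close>

lemma small_combination:
  fixes s :: real
  assumes "s > 1" "e > 0" "K \<ge> 0"
  shows "\<exists>\<epsilon>>0. \<forall>C\<ge>0. \<exists>d>0. d \<le> 1 \<and> \<epsilon> * (K + 2) powr (s - 1) + C * d powr (s - 1) \<le> e"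
proof (intro exI conjI allI impI)
  define \<epsilon> where "\<epsilon> = e / 2 / (K + 2) powr (s - 1)"
  have K: "(K + 2) powr (s - 1) > 0" using assms by simp
  show "\<epsilon> > 0" using assms K by (simp add: \<epsilon>_def)
  fix C :: real assume C: "C \<ge> 0"
  define d where "d = min 1 ((e / 2 / (C + 1)) powr (1 / (s - 1)))"
  show "d > 0" using assms C by (simp add: d_def)
  show "d \<le> 1" by (simp add: d_def)
  have "d powr (s - 1) \<le> ((e / 2 / (C + 1)) powr (1 / (s - 1))) powr (s - 1)"
    using assms \<open>d > 0\<close> by (intro powr_mono2) (auto simp: d_def)
  also have "\<dots> = e / 2 / (C + 1)" using assms C by (simp add: powr_powr)
  finally have "C * d powr (s - 1) \<le> C * (e / 2 / (C + 1))" using C by (intro mult_left_mono)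
  also have "\<dots> \<le> e / 2" using C assms by (simp add: field_simps)
  finally show "\<epsilon> * (K + 2) powr (s - 1) + C * d powr (s - 1) \<le> e"
    using K by (simp add: \<epsilon>_def)
qed

text \<open>The bound is uniform over the direction \<open>V\<close>, so this is continuity into the
  dual space, uniform on balls. The small term is paid for by the sizes of \<open>U\<close> and
  \<open>W\<close>, the large one by their distance.\<close>

lemma nemy_uniform_continuity:
  assumes M: "finite_measure M" and s: "1 < s" and a: "nemy s a" and e: "e > 0"
  shows "\<exists>d>0. \<forall>U\<in>Lps M s. \<forall>W\<in>Lps M s. \<forall>V\<in>Lps M s. lpn M s U \<le> R \<longrightarrow> lpn M s (\<lambda>x. W x - U x) \<le> d \<longrightarrow>
    \<bar>(\<integral>x. a (W x) \<bullet> V x \<partial>M) - (\<integral>x. a (U x) \<bullet> V x \<partial>M)\<bar> \<le> e * lpn M s V"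
proof -
  define K where "K = lpn M s (\<lambda>x. 1::real) + 2 * \<bar>R\<bar>"
  have K: "K \<ge> 0" by (simp add: K_def)
  obtain \<epsilon> where \<epsilon>: "\<epsilon> > 0" and d: "\<And>C. C \<ge> 0 \<Longrightarrow> \<exists>d>0. d \<le> 1 \<and> \<epsilon> * (K + 2) powr (s - 1) + C * d powr (s - 1) \<le> e"
    using small_combination[OF s e K] by blast
  obtain C where C: "C \<ge> 0" "\<And>x y. norm (a x - a y)
        \<le> \<epsilon> * (1 + norm x + norm y) powr (s - 1) + C * norm (x - y) powr (s - 1)"
    using nemyE[OF a \<epsilon>] by blast
  obtain d where d: "d > 0" "d \<le> 1" "\<epsilon> * (K + 2) powr (s - 1) + C * d powr (s - 1) \<le> e"
    using d[OF C(1)] by blast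
  show ?thesis
  proof (intro exI[of _ d] conjI ballI impI d)
    fix U W V :: "'a \<Rightarrow> 'b" assume U: "U \<in> Lps M s" and W: "W \<in> Lps M s" and V: "V \<in> Lps M s"
      and R: "lpn M s U \<le> R" and WU: "lpn M s (\<lambda>x. W x - U x) \<le> d"
    note [measurable] = nemy_measurable[OF a LpsD(1)[OF U]] nemy_measurable[OF a LpsD(1)[OF W]] LpsD(1)[OF V]
    define w where "w = (\<lambda>x. norm (1 + norm (W x)) + norm (U x))"
    have w: "w \<in> Lps M s" unfolding w_def using s by (intro Lps_add_norm Lps_one_plus M W U) auto
    have "lpn M s W \<le> lpn M s (\<lambda>x. W x - U x) + lpn M s U"
      using lpn_add[OF Lps_diff[OF W U] U s] s by simp
    then have W1: "lpn M s W \<le> \<bar>R\<bar> + 1" using R WU d by linarith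
    have "lpn M s w \<le> lpn M s (\<lambda>x. 1 + norm (W x)) + lpn M s U"
      unfolding w_def by (intro lpn_add_norm Lps_one_plus M W U s)
    also have "\<dots> \<le> lpn M s (\<lambda>x. 1::real) + lpn M s W + lpn M s U"
      using Lps_one_plus(2)[OF M W s] by simp
    also have "\<dots> \<le> K + 2" using W1 R unfolding K_def by linarith
    finally have wK: "lpn M s w \<le> K + 2" .
    have *: "\<bar>a (W x) \<bullet> V x - a (U x) \<bullet> V x\<bar>
        \<le> (\<epsilon> * w x powr (s - 1) + C * norm (W x - U x) powr (s - 1)) * norm (V x)" for x
    proof -
      have "\<bar>a (W x) \<bullet> V x - a (U x) \<bullet> V x\<bar> = \<bar>(a (W x) - a (U x)) \<bullet> V x\<bar>"
        by (simp add: inner_diff_left)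
      also have "\<dots> \<le> norm (a (W x) - a (U x)) * norm (V x)" by (rule Cauchy_Schwarz_ineq2)
      also have "\<dots> \<le> (\<epsilon> * w x powr (s - 1) + C * norm (W x - U x) powr (s - 1)) * norm (V x)"
        using C(2)[of "W x" "U x"] unfolding w_def by (intro mult_right_mono) auto
      finally show ?thesis .
    qed
    have "(\<integral>x. a (W x) \<bullet> V x \<partial>M) - (\<integral>x. a (U x) \<bullet> V x \<partial>M) = (\<integral>x. a (W x) \<bullet> V x - a (U x) \<bullet> V x \<partial>M)"
      by (intro Bochner_Integration.integral_diff[symmetric] nemy_integrable[OF M s a W V] nemy_integrable[OF M s a U V])
    also have "\<bar>\<dots>\<bar> \<le> (\<epsilon> * lpn M s w powr (s - 1) + C * lpn M s (\<lambda>x. norm (W x - U x)) powr (s - 1)) * lpn M s V"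
      by (rule Holder_estimate(2)[OF s w Lps_norm[OF Lps_diff[OF W U]] V _ _ _ *])
         (use s \<epsilon> C in \<open>auto simp: w_def\<close>)
    also have "\<dots> \<le> (\<epsilon> * (K + 2) powr (s - 1) + C * d powr (s - 1)) * lpn M s V"
      using wK WU \<epsilon> C s by (auto intro!: mult_right_mono add_mono mult_left_mono powr_mono2 simp: lpn_norm)
    also have "\<dots> \<le> e * lpn M s V" using d by (intro mult_right_mono) auto
    finally show "\<bar>(\<integral>x. a (W x) \<bullet> V x \<partial>M) - (\<integral>x. a (U x) \<bullet> V x \<partial>M)\<bar> \<le> e * lpn M s V" .
  qed
qed

text \<open>The mean value theorem along a segment. The intermediate \<open>t\<close> depends on the
  points without any measurability, so it may appear only inside pointwise bounds.\<close>

lemma potential_mvt: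
  fixes P :: "'b::euclidean_space \<Rightarrow> real"
  assumes P: "\<And>x. (P has_derivative (\<lambda>h. a x \<bullet> h)) (at x)"
  obtains t where "0 < t" "t < 1" "P (x + y) - P x = a (x + t *\<^sub>R y) \<bullet> y"
proof -
  have "((\<lambda>t. P (x + t *\<^sub>R y)) has_real_derivative a (x + t *\<^sub>R y) \<bullet> y) (at t)" for t
  proof -
    have "((\<lambda>t. P (x + t *\<^sub>R y)) has_derivative (\<lambda>h. a (x + t *\<^sub>R y) \<bullet> (h *\<^sub>R y))) (at t)"
      by (rule has_derivative_compose[OF _ P]) (auto intro!: derivative_eq_intros)
    then show ?thesis by (simp add: has_field_derivative_def mult_commute_abs)
  qed
  then have "\<exists>z>0. z < 1 \<and> P (x + 1 *\<^sub>R y) - P (x + 0 *\<^sub>R y) = (1 - 0) * (a (x + z *\<^sub>R y) \<bullet> y)"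
    by (intro MVT2) auto
  then show ?thesis using that by auto
qed

lemma potential_measurable:
  assumes P: "\<And>x. (P has_derivative (\<lambda>h. a x \<bullet> h)) (at x)" and U: "U \<in> borel_measurable M"
  shows "(\<lambda>x. P (U x) :: real) \<in> borel_measurable M"
proof -
  have "continuous_on UNIV P"
    using P by (intro continuous_at_imp_continuous_on ballI has_derivative_continuous)
  then show ?thesis using borel_measurable_continuous_onI[of P] U by (auto intro: measurable_compose)
qed

lemma potential_integrable:
  assumes M: "finite_measure M" and s: "1 < s" and a: "nemy s a"
    and P: "\<And>x. (P has_derivative (\<lambda>h. a x \<bullet> h)) (at x)" and U: "U \<in> Lps M s"
  shows "integrable M (\<lambda>x. P (U x) :: real)"
proof -
  obtain C where C: "C \<ge> 0" "\<And>x. norm (a x) \<le> C * (1 + norm x) powr (s - 1)"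
    using nemy_bound[OF a s] by blast
  note [measurable] = potential_measurable[OF P LpsD(1)[OF U]]
  have *: "\<bar>P (U x) - P 0\<bar> \<le> (C * (1 + norm (U x)) powr (s - 1) + 0 * 0 powr (s - 1)) * norm (U x)" for x
  proof -
    obtain t where t: "0 < t" "t < 1" "P (0 + U x) - P 0 = a (0 + t *\<^sub>R U x) \<bullet> U x"
      using potential_mvt[OF P, of 0 "U x"] by blast
    then have "\<bar>P (U x) - P 0\<bar> \<le> norm (a (t *\<^sub>R U x)) * norm (U x)"
      by (simp add: Cauchy_Schwarz_ineq2)
    also have "norm (a (t *\<^sub>R U x)) \<le> C * (1 + norm (t *\<^sub>R U x)) powr (s - 1)" by (rule C)
    also have "\<dots> \<le> C * (1 + norm (U x)) powr (s - 1)"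
      using s C t by (intro mult_left_mono powr_mono2) (auto intro!: mult_left_le_one_le)
    finally show ?thesis by (simp add: mult_right_mono)
  qed
  have "integrable M (\<lambda>x. P (U x) - P 0)"
    by (rule Holder_estimate(1)[OF s Lps_one_plus(1)[OF M U s] Lps_zero U _ _ _ *]) (use C in auto)
  from Bochner_Integration.integrable_add[OF this finite_measure.integrable_const[OF M, of "P 0"]]
  show ?thesis by simp
qed

text \<open>By the mean value theorem the remainder is, at each point, the difference of
  \<open>a\<close> at \<open>U x + t *\<^sub>R V x\<close> and at \<open>U x\<close>, applied to
  \<open>V x\<close>; from there the argument is that of
  \<open>nemy_uniform_continuity\<close>.\<close>

lemma potential_frechet:
  assumes M: "finite_measure M" and s: "1 < s" and a: "nemy s a" and e: "e > 0"
    and P: "\<And>x. (P has_derivative (\<lambda>h. a x \<bullet> h)) (at x)"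
  shows "\<exists>d>0. \<forall>U\<in>Lps M s. \<forall>V\<in>Lps M s. lpn M s U \<le> R \<longrightarrow> lpn M s V \<le> d \<longrightarrow>
    \<bar>(\<integral>x. P (U x + V x) \<partial>M) - (\<integral>x. (P (U x) :: real) \<partial>M) - (\<integral>x. a (U x) \<bullet> V x \<partial>M)\<bar> \<le> e * lpn M s V"
proof -
  define K where "K = lpn M s (\<lambda>x. 1::real) + 2 * \<bar>R\<bar>"
  have K: "K \<ge> 0" by (simp add: K_def)
  obtain \<epsilon> where \<epsilon>: "\<epsilon> > 0" and d: "\<And>C. C \<ge> 0 \<Longrightarrow> \<exists>d>0. d \<le> 1 \<and> \<epsilon> * (K + 2) powr (s - 1) + C * d powr (s - 1) \<le> e"
    using small_combination[OF s e K] by blast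
  obtain C where C: "C \<ge> 0" "\<And>x y. norm (a x - a y)
        \<le> \<epsilon> * (1 + norm x + norm y) powr (s - 1) + C * norm (x - y) powr (s - 1)"
    using nemyE[OF a \<epsilon>] by blast
  obtain d where d: "d > 0" "d \<le> 1" "\<epsilon> * (K + 2) powr (s - 1) + C * d powr (s - 1) \<le> e"
    using d[OF C(1)] by blast
  show ?thesis
  proof (intro exI[of _ d] conjI ballI impI d)
    fix U V :: "'a \<Rightarrow> 'b" assume U: "U \<in> Lps M s" and V: "V \<in> Lps M s"
      and R: "lpn M s U \<le> R" and Vd: "lpn M s V \<le> d"
    have UV: "(\<lambda>x. U x + V x) \<in> Lps M s" using s by (intro Lps_add U V) auto
    note [measurable] = potential_measurable[OF P LpsD(1)[OF UV]] potential_measurable[OF P LpsD(1)[OF U]]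
        nemy_measurable[OF a LpsD(1)[OF U]] LpsD(1)[OF V]
    \<comment> \<open>Dominates all intermediate points of the segment from \<open>U x\<close> to
      \<open>U x + V x\<close> at once, which removes the non-measurable parameter
      \<open>t\<close>.\<close>
    define y where "y = (\<lambda>x. norm (U x) + norm (V x))"
    have y: "y \<in> Lps M s" unfolding y_def using s by (intro Lps_add_norm U V) auto
    have yR: "lpn M s y \<le> \<bar>R\<bar> + 1" using lpn_add_norm[OF U V s] R Vd d unfolding y_def by linarith
    define w where "w = (\<lambda>x. norm (1 + norm (y x)) + norm (U x))"
    have w: "w \<in> Lps M s" unfolding w_def using s by (intro Lps_add_norm Lps_one_plus M y U) auto
    have "lpn M s w \<le> lpn M s (\<lambda>x. 1 + norm (y x)) + lpn M s U"
      unfolding w_def by (intro lpn_add_norm Lps_one_plus M y U s)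
    also have "\<dots> \<le> lpn M s (\<lambda>x. 1::real) + lpn M s y + lpn M s U"
      using Lps_one_plus(2)[OF M y s] by simp
    also have "\<dots> \<le> K + 2" using yR R unfolding K_def by linarith
    finally have wK: "lpn M s w \<le> K + 2" .
    have *: "\<bar>P (U x + V x) - P (U x) - a (U x) \<bullet> V x\<bar>
        \<le> (\<epsilon> * w x powr (s - 1) + C * norm (V x) powr (s - 1)) * norm (V x)" for x
    proof -
      obtain t where t: "0 < t" "t < 1" "P (U x + V x) - P (U x) = a (U x + t *\<^sub>R V x) \<bullet> V x"
        using potential_mvt[OF P, of "U x" "V x"] by blast
      have tV: "norm (t *\<^sub>R V x) \<le> norm (V x)" using t by (auto intro!: mult_left_le_one_le)
      have "\<bar>P (U x + V x) - P (U x) - a (U x) \<bullet> V x\<bar> = \<bar>(a (U x + t *\<^sub>R V x) - a (U x)) \<bullet> V x\<bar>"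
        using t by (simp add: inner_diff_left)
      also have "\<dots> \<le> norm (a (U x + t *\<^sub>R V x) - a (U x)) * norm (V x)" by (rule Cauchy_Schwarz_ineq2)
      also have "norm (a (U x + t *\<^sub>R V x) - a (U x)) \<le>
        \<epsilon> * (1 + norm (U x + t *\<^sub>R V x) + norm (U x)) powr (s - 1) + C * norm (U x + t *\<^sub>R V x - U x) powr (s - 1)"
        by (rule C)
      also have "\<dots> \<le> \<epsilon> * w x powr (s - 1) + C * norm (V x) powr (s - 1)"
      proof (intro add_mono mult_left_mono powr_mono2)
        have "norm (U x + t *\<^sub>R V x) \<le> norm (U x) + norm (V x)"
          using tV norm_triangle_ineq[of "U x" "t *\<^sub>R V x"] by linarith
        then show "1 + norm (U x + t *\<^sub>R V x) + norm (U x) \<le> w x" by (simp add: w_def y_def)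
      qed (use s \<epsilon> C tV in auto)
      finally show ?thesis by (simp add: mult_right_mono)
    qed
    have "(\<integral>x. P (U x + V x) \<partial>M) - (\<integral>x. P (U x) \<partial>M) - (\<integral>x. a (U x) \<bullet> V x \<partial>M)
        = (\<integral>x. P (U x + V x) - P (U x) - a (U x) \<bullet> V x \<partial>M)"
      using potential_integrable[OF M s a P UV] potential_integrable[OF M s a P U] nemy_integrable[OF M s a U V]
      by simp
    also have "\<bar>\<dots>\<bar> \<le> (\<epsilon> * lpn M s w powr (s - 1) + C * lpn M s (\<lambda>x. norm (V x)) powr (s - 1)) * lpn M s V"
      by (rule Holder_estimate(2)[OF s w Lps_norm[OF V] V _ _ _ *])
         (use s \<epsilon> C in \<open>auto simp: w_def\<close>)
    also have "\<dots> \<le> (\<epsilon> * (K + 2) powr (s - 1) + C * d powr (s - 1)) * lpn M s V"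
      using wK Vd \<epsilon> C s by (auto intro!: mult_right_mono add_mono mult_left_mono powr_mono2 simp: lpn_norm)
    also have "\<dots> \<le> e * lpn M s V" using d by (intro mult_right_mono) auto
    finally show "\<bar>(\<integral>x. P (U x + V x) \<partial>M) - (\<integral>x. P (U x) \<partial>M) - (\<integral>x. a (U x) \<bullet> V x \<partial>M)\<bar> \<le> e * lpn M s V" .
  qed
qed

text \<open>The error splits into \<open>a (u x)\<close> applied to \<open>V k x - v x\<close>,
  small by the dual bound, and the difference of \<open>a (U k x)\<close> and \<open>a (u x)\<close>
  applied to \<open>V k x\<close>, small by uniform continuity because the \<open>V k\<close> stay
  bounded.\<close>

lemma nemy_limit:
  assumes M: "finite_measure M" and s: "1 < s" and a: "nemy s a"
    and U: "\<And>k. U k \<in> Lps M s" "u \<in> Lps M s" "(\<lambda>k. lpn M s (\<lambda>x. U k x - u x)) \<longlonglongrightarrow> 0"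
    and V: "\<And>k. V k \<in> Lps M s" "v \<in> Lps M s" "(\<lambda>k. lpn M s (\<lambda>x. V k x - v x)) \<longlonglongrightarrow> 0"
  shows "(\<lambda>k. \<integral>x. a (U k x) \<bullet> V k x \<partial>M) \<longlonglongrightarrow> (\<integral>x. a (u x) \<bullet> v x \<partial>M)"
proof -
  have d: "(\<lambda>x. V k x - v x) \<in> Lps M s" for k using s by (intro Lps_diff V) auto
  obtain C where C: "C \<ge> 0" "\<And>U V. U\<in>Lps M s \<Longrightarrow> V\<in>Lps M s \<Longrightarrow> lpn M s U \<le> lpn M s u \<Longrightarrow>
    \<bar>\<integral>x. a (U x) \<bullet> V x \<partial>M\<bar> \<le> C * lpn M s V"
    using nemy_bound_integral[OF M s a, of "lpn M s u"] by blast
  have 1: "(\<lambda>k. \<integral>x. a (u x) \<bullet> (V k x - v x) \<partial>M) \<longlonglongrightarrow> 0"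
  proof (rule Lim_null_comparison)
    show "\<forall>\<^sub>F k in sequentially. norm (\<integral>x. a (u x) \<bullet> (V k x - v x) \<partial>M) \<le> C * lpn M s (\<lambda>x. V k x - v x)"
      using C(2)[OF U(2) d] by auto
    show "(\<lambda>k. C * lpn M s (\<lambda>x. V k x - v x)) \<longlonglongrightarrow> 0" by (intro tendsto_mult_right_zero V)
  qed
  have 2: "(\<lambda>k. (\<integral>x. a (U k x) \<bullet> V k x \<partial>M) - (\<integral>x. a (u x) \<bullet> V k x \<partial>M)) \<longlonglongrightarrow> 0"
  proof (rule LIMSEQ_I)
    fix r :: real assume r: "r > 0"
    define B where "B = lpn M s v + 1"
    have B: "B > 0" using lpn_nonneg[of M s v] unfolding B_def by linarith
    obtain d where d: "d > 0" "\<And>W V. W\<in>Lps M s \<Longrightarrow> V\<in>Lps M s \<Longrightarrow> lpn M s (\<lambda>x. W x - u x) \<le> d \<Longrightarrow>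
      \<bar>(\<integral>x. a (W x) \<bullet> V x \<partial>M) - (\<integral>x. a (u x) \<bullet> V x \<partial>M)\<bar> \<le> (r / 2 / B) * lpn M s V"
      using nemy_uniform_continuity[OF M s a, of "r / 2 / B" "lpn M s u"] r B U(2) by fastforce
    have "\<forall>\<^sub>F k in sequentially. lpn M s (\<lambda>x. U k x - u x) < d" using d(1) U(3) by (auto dest: order_tendstoD)
    moreover have "\<forall>\<^sub>F k in sequentially. lpn M s (\<lambda>x. V k x - v x) < 1" by (rule order_tendstoD(2)[OF V(3)]) simp
    ultimately have "\<forall>\<^sub>F k in sequentially. norm ((\<integral>x. a (U k x) \<bullet> V k x \<partial>M) - (\<integral>x. a (u x) \<bullet> V k x \<partial>M) - 0) < r"
    proof eventually_elim
      case (elim k)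
      have "lpn M s (V k) \<le> lpn M s (\<lambda>x. V k x - v x) + lpn M s v"
        using lpn_add[OF Lps_diff[OF V(1)[of k] V(2)] V(2) s] s by simp
      with elim have "lpn M s (V k) \<le> B" unfolding B_def by linarith
      then have "(r / 2 / B) * lpn M s (V k) \<le> (r / 2 / B) * B" using r B by (intro mult_left_mono) auto
      also have "\<dots> < r" using r B by simp
      finally show ?case using d(2)[OF U(1) V(1), of k k] elim by simp
    qed
    then show "\<exists>N. \<forall>k\<ge>N. norm ((\<integral>x. a (U k x) \<bullet> V k x \<partial>M) - (\<integral>x. a (u x) \<bullet> V k x \<partial>M) - 0) < r"
      by (simp add: eventually_sequentially)
  qed
  have "(\<integral>x. a (U k x) \<bullet> V k x \<partial>M) = (\<integral>x. a (u x) \<bullet> v x \<partial>M) + (\<integral>x. a (u x) \<bullet> (V k x - v x) \<partial>M)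
      + ((\<integral>x. a (U k x) \<bullet> V k x \<partial>M) - (\<integral>x. a (u x) \<bullet> V k x \<partial>M))" for k
    using nemy_integrable[OF M s a U(2) V(1)[of k]] nemy_integrable[OF M s a U(2) V(2)]
    by (simp add: inner_diff_right)
  with tendsto_add[OF tendsto_add[OF tendsto_const[of "\<integral>x. a (u x) \<bullet> v x \<partial>M"] 1] 2] show ?thesis by simp
qed

text \<open>For large arguments the strictly smaller exponent \<open>q\<close> lets
  \<open>\<epsilon>\<close> absorb the growth. On the bounded region that remains, uniform
  continuity treats close pairs, and the constant \<open>C\<close> is made large enough for pairs at
  distance at least \<open>d\<close>.\<close>

lemma nemy_growth:
  fixes f :: "real \<Rightarrow> real"
  assumes f: "continuous_on UNIV f" and qs: "1 \<le> q" "q < s" and c: "\<And>t. \<bar>f t\<bar> \<le> c * (1 + \<bar>t\<bar>) powr (q - 1)"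
  shows "nemy s f"
  unfolding nemy_def
proof (intro conjI f allI impI)
  fix \<epsilon> :: real assume \<epsilon>: "\<epsilon> > 0"
  have c0: "c \<ge> 0" using c[of 0] by simp
  \<comment> \<open>Threshold from which on \<open>\<epsilon>\<close> times the power with exponent
    \<open>s - q\<close> beats the growth constant \<open>2 * c\<close>.\<close>
  define T where "T = (2 * c / \<epsilon> + 1) powr (1 / (s - q))"
  have T1: "2 * c / \<epsilon> + 1 > 0" using c0 \<epsilon> by (simp add: add_nonneg_pos)
  then have T0: "T > 0" by (simp add: T_def)
  have TT: "2 * c \<le> \<epsilon> * T powr (s - q)"
  proof -
    have "T powr (s - q) = 2 * c / \<epsilon> + 1"
      using qs T1 unfolding T_def by (subst powr_powr) auto
    then show ?thesis using \<epsilon> by (simp add: field_simps)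
  qed
  have "uniformly_continuous_on {-T..T} f"
    by (rule compact_uniformly_continuous[OF continuous_on_subset[OF f]]) auto
  then obtain d where d: "d > 0" "\<And>x y. x \<in> {-T..T} \<Longrightarrow> y \<in> {-T..T} \<Longrightarrow> \<bar>x - y\<bar> < d \<Longrightarrow> \<bar>f x - f y\<bar> < \<epsilon>"
    unfolding uniformly_continuous_on_def dist_real_def using \<epsilon> by (metis abs_minus_commute)
  define C where "C = 2 * c * (1 + T) powr (q - 1) / d powr (s - 1)"
  have C0: "C \<ge> 0" using c0 by (simp add: C_def)
  have "\<bar>f x - f y\<bar> \<le> \<epsilon> * (1 + \<bar>x\<bar> + \<bar>y\<bar>) powr (s - 1) + C * \<bar>x - y\<bar> powr (s - 1)" for x y
  proof -
    define m where "m = 1 + \<bar>x\<bar> + \<bar>y\<bar>"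
    have m: "m \<ge> 1" by (simp add: m_def)
    have fb: "\<bar>f x - f y\<bar> \<le> 2 * c * m powr (q - 1)"
    proof -
      have "(1 + \<bar>x\<bar>) powr (q - 1) \<le> m powr (q - 1)" "(1 + \<bar>y\<bar>) powr (q - 1) \<le> m powr (q - 1)"
        using qs by (auto simp: m_def intro!: powr_mono2)
      then have "\<bar>f x\<bar> \<le> c * m powr (q - 1)" "\<bar>f y\<bar> \<le> c * m powr (q - 1)"
        using c[of x] c[of y] c0 by (meson mult_left_mono order_trans)+
      then show ?thesis by simp
    qed
    have Cn: "0 \<le> C * \<bar>x - y\<bar> powr (s - 1)" using C0 by simp
    have en: "0 \<le> \<epsilon> * m powr (s - 1)" using \<epsilon> by simp
    consider "m \<ge> T" | "m < T" "\<bar>x - y\<bar> < d" | "m < T" "\<bar>x - y\<bar> \<ge> d" by linarith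
    then have "\<bar>f x - f y\<bar> \<le> \<epsilon> * m powr (s - 1) + C * \<bar>x - y\<bar> powr (s - 1)"
    proof cases
      case 1
      have "2 * c * m powr (q - 1) \<le> \<epsilon> * T powr (s - q) * m powr (q - 1)"
        using TT by (intro mult_right_mono) auto
      also have "\<dots> \<le> \<epsilon> * m powr (s - q) * m powr (q - 1)"
        using 1 T0 qs \<epsilon> by (intro mult_right_mono mult_left_mono powr_mono2) auto
      also have "\<dots> = \<epsilon> * m powr (s - 1)" by (simp add: powr_add[symmetric])
      finally show ?thesis using fb Cn by linarith
    next
      case 2
      then have "\<bar>f x - f y\<bar> < \<epsilon>" unfolding m_def by (intro d(2)) auto
      moreover have "1 \<le> m powr (s - 1)" using m qs by (intro ge_one_powr_ge_zero) auto
      then have "\<epsilon> * 1 \<le> \<epsilon> * m powr (s - 1)" using \<epsilon> by (intro mult_left_mono) auto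
      ultimately show ?thesis using Cn by linarith
    next
      case 3
      have "2 * c * m powr (q - 1) \<le> 2 * c * (1 + T) powr (q - 1)"
        using 3 m c0 qs by (intro mult_left_mono powr_mono2) auto
      also have "\<dots> = C * d powr (s - 1)" using d(1) by (simp add: C_def)
      also have "\<dots> \<le> C * \<bar>x - y\<bar> powr (s - 1)"
        using 3 d(1) C0 qs by (intro mult_left_mono powr_mono2) auto
      finally show ?thesis using fb en by linarith
    qed
    then show ?thesis by (simp add: m_def)
  qed
  then show "\<exists>C\<ge>0. \<forall>x y. norm (f x - f y) \<le> \<epsilon> * (1 + norm x + norm y) powr (s - 1) + C * norm (x - y) powr (s - 1)"
    using C0 by auto
qed

section \<open>The flux of the p-Laplacian\<close>

abbreviation pflux :: "real \<Rightarrow> 'b::euclidean_space \<Rightarrow> 'b" where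
  "pflux p x \<equiv> norm x powr (p - 2) *\<^sub>R x"

text \<open>The mean value theorem leaves the power \<open>r - 1\<close> of an intermediate point,
  which is singular near 0 when \<open>r < 1\<close>; the factor \<open>b\<close>, not larger than
  that point, restores the power \<open>r\<close>.\<close>

lemma powr_diff_mult_le:
  fixes a b r :: real
  assumes "0 \<le> r" "0 \<le> b" "b \<le> a"
  shows "(a powr r - b powr r) * b \<le> r * a powr r * (a - b)"
proof (cases "b = 0 \<or> a = b")
  case True then show ?thesis using assms by auto
next
  case False
  then have ab: "0 < b" "b < a" using assms by auto
  have "\<exists>z. b < z \<and> z < a \<and> a powr r - b powr r = (a - b) * (r * z powr (r - 1))"
    using ab by (intro MVT2) (auto intro!: derivative_eq_intros simp: powr_diff)
  then obtain z where z: "b < z" "z < a" "a powr r - b powr r = (a - b) * (r * z powr (r - 1))" by blast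
  have "z powr (r - 1) * b \<le> z powr (r - 1) * z" using z ab by (intro mult_left_mono) auto
  also have "\<dots> = z powr r" using z ab by (simp add: powr_diff)
  also have "\<dots> \<le> a powr r" using z ab assms by (intro powr_mono2) auto
  finally have "(a - b) * r * (z powr (r - 1) * b) \<le> (a - b) * r * a powr r"
    using ab assms by (intro mult_left_mono) auto
  then show ?thesis using z(3) by (simp add: mult_ac)
qed

text \<open>By symmetry \<open>y\<close> is the shorter vector. Adding and subtracting
  \<open>norm x powr (p - 2) *\<^sub>R y\<close> leaves a multiple of \<open>x - y\<close> and a
  difference of scalar powers multiplied by \<open>y\<close>.\<close>

lemma pflux_diff_le:
  fixes x y :: "'b::euclidean_space"
  assumes p: "2 \<le> p"
  shows "norm (pflux p x - pflux p y) \<le> (p - 1) * (norm x + norm y) powr (p - 2) * norm (x - y)"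
proof -
  have *: "norm (pflux p x - pflux p y) \<le> (p - 1) * (norm x + norm y) powr (p - 2) * norm (x - y)"
    if le: "norm y \<le> norm x" for x y :: 'b
  proof -
    have "pflux p x - pflux p y = norm x powr (p - 2) *\<^sub>R (x - y) + (norm x powr (p - 2) - norm y powr (p - 2)) *\<^sub>R y"
      by (simp add: algebra_simps)
    then have "norm (pflux p x - pflux p y) \<le> norm x powr (p - 2) * norm (x - y) + \<bar>norm x powr (p - 2) - norm y powr (p - 2)\<bar> * norm y"
      using norm_triangle_ineq[of "norm x powr (p - 2) *\<^sub>R (x - y)" "(norm x powr (p - 2) - norm y powr (p - 2)) *\<^sub>R y"] by simp
    also have "\<bar>norm x powr (p - 2) - norm y powr (p - 2)\<bar> = norm x powr (p - 2) - norm y powr (p - 2)"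
      using le p powr_mono2[of "p - 2" "norm y" "norm x"] by simp
    also have "(norm x powr (p - 2) - norm y powr (p - 2)) * norm y \<le> (p - 2) * norm x powr (p - 2) * (norm x - norm y)"
      using p le by (intro powr_diff_mult_le) auto
    also have "\<dots> \<le> (p - 2) * norm x powr (p - 2) * norm (x - y)"
      using p by (intro mult_left_mono norm_triangle_ineq2) auto
    also have "norm x powr (p - 2) * norm (x - y) + \<dots> = (p - 1) * norm x powr (p - 2) * norm (x - y)"
      by (simp add: algebra_simps)
    also have "\<dots> \<le> (p - 1) * (norm x + norm y) powr (p - 2) * norm (x - y)"
      using p by (intro mult_right_mono mult_left_mono powr_mono2) auto
    finally show ?thesis by simp
  qed
  show ?thesis
  proof (cases "norm y \<le> norm x")
    case False
    then have "norm x \<le> norm y" by simp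
    from *[OF this] show ?thesis by (simp add: norm_minus_commute add.commute)
  qed (rule *)
qed

text \<open>The growth is exactly \<open>p - 1\<close> here, so no exponent is left to spare for
  large arguments. Homogeneity replaces it: the distance is compared with \<open>\<eta>\<close>
  times the sum of the norms. A relatively close pair is covered by the \<open>\<epsilon>\<close>
  term, any other by the term in the distance.\<close>

lemma nemy_pflux:
  assumes p: "2 \<le> p"
  shows "nemy p (pflux p :: 'b::euclidean_space \<Rightarrow> 'b)"
  unfolding nemy_def
proof (intro conjI allI impI)
  have b: "norm (pflux p x - pflux p y :: 'b) \<le> (p - 1) * (norm x + norm y) powr (p - 2) * norm (x - y)" for x y
    by (rule pflux_diff_le[OF p])
  have "isCont (pflux p :: 'b \<Rightarrow> 'b) x" for x
  proof -
    have "((\<lambda>y::'b. pflux p y - pflux p x) \<longlongrightarrow> 0) (at x)"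
    proof (rule Lim_null_comparison)
      show "\<forall>\<^sub>F y in at x. norm (pflux p y - pflux p x) \<le> (p - 1) * (norm y + norm x + 1) powr (p - 2) * norm (y - x)"
      proof (intro always_eventually allI)
        fix y
        have "(p - 1) * (norm y + norm x) powr (p - 2) * norm (y - x) \<le> (p - 1) * (norm y + norm x + 1) powr (p - 2) * norm (y - x)"
          using p by (intro mult_right_mono mult_left_mono powr_mono2) auto
        with b[of y x] show "norm (pflux p y - pflux p x) \<le> (p - 1) * (norm y + norm x + 1) powr (p - 2) * norm (y - x)"
          by linarith
      qed
      have "((\<lambda>y. (p - 1) * (norm y + norm x + 1) powr (p - 2) * norm (y - x)) \<longlongrightarrow> (p - 1) * (norm x + norm x + 1) powr (p - 2) * norm (x - x)) (at x)"
        by (intro tendsto_intros) (auto simp: add_nonneg_eq_0_iff)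
      then show "((\<lambda>y. (p - 1) * (norm y + norm x + 1) powr (p - 2) * norm (y - x)) \<longlongrightarrow> 0) (at x)" by simp
    qed
    then show ?thesis by (simp add: isCont_def LIM_zero_iff)
  qed
  then show "continuous_on UNIV (pflux p :: 'b \<Rightarrow> 'b)" by (simp add: continuous_at_imp_continuous_on)
  fix \<epsilon> :: real assume \<epsilon>: "\<epsilon> > 0"
  define \<eta> where "\<eta> = \<epsilon> / (p - 1)"
  have \<eta>: "\<eta> > 0" using \<epsilon> p by (simp add: \<eta>_def)
  define C where "C = (p - 1) * (1 / \<eta>) powr (p - 2)"
  have C0: "C \<ge> 0" using p by (simp add: C_def)
  have "norm (pflux p x - pflux p y) \<le> \<epsilon> * (1 + norm x + norm y) powr (p - 1) + C * norm (x - y) powr (p - 1)" for x y :: 'b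
  proof -
    define m where "m = norm x + norm y"
    have m: "m \<ge> 0" by (simp add: m_def)
    show ?thesis
    proof (cases "norm (x - y) \<le> \<eta> * m")
      case True
      have "(p - 1) * m powr (p - 2) * norm (x - y) \<le> (p - 1) * m powr (p - 2) * (\<eta> * m)"
        using True p by (intro mult_left_mono) auto
      also have "\<dots> = \<epsilon> * m powr (p - 1)"
        using p m by (cases "m = 0") (auto simp: \<eta>_def powr_diff power2_eq_square)
      also have "\<dots> \<le> \<epsilon> * (1 + norm x + norm y) powr (p - 1)"
        using p \<epsilon> m unfolding m_def by (intro mult_left_mono powr_mono2) auto
      finally have "(p - 1) * m powr (p - 2) * norm (x - y) \<le> \<epsilon> * (1 + norm x + norm y) powr (p - 1)" .
      moreover have "0 \<le> C * norm (x - y) powr (p - 1)" using C0 by simp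
      ultimately show ?thesis using b[of x y] unfolding m_def by linarith
    next
      case False
      then have "m \<le> norm (x - y) / \<eta>" using \<eta> by (simp add: field_simps)
      then have "(p - 1) * m powr (p - 2) * norm (x - y) \<le> (p - 1) * (norm (x - y) / \<eta>) powr (p - 2) * norm (x - y)"
        using p m by (intro mult_right_mono mult_left_mono powr_mono2) auto
      also have "\<dots> = C * (norm (x - y) powr (p - 2) * norm (x - y))"
        using \<eta> by (simp add: C_def powr_divide powr_one)
      also have "norm (x - y) powr (p - 2) * norm (x - y) = norm (x - y) powr (p - 1)"
        by (cases "x = y") (auto simp: powr_diff power2_eq_square)
      finally have "(p - 1) * m powr (p - 2) * norm (x - y) \<le> C * norm (x - y) powr (p - 1)" .
      moreover have "0 \<le> \<epsilon> * (1 + norm x + norm y) powr (p - 1)" using \<epsilon> by simp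
      ultimately show ?thesis using b[of x y] unfolding m_def by linarith
    qed
  qed
  then show "\<exists>C\<ge>0. \<forall>x y. norm (pflux p x - pflux p y :: 'b) \<le> \<epsilon> * (1 + norm x + norm y) powr (p - 1) + C * norm (x - y) powr (p - 1)"
    using C0 by auto
qed

text \<open>Away from 0 this is the chain rule; at 0 the difference quotient is the power
  \<open>p - 1\<close> of the increment divided by \<open>p\<close>, which tends to 0.\<close>

lemma has_derivative_norm_powr:
  fixes x :: "'b::euclidean_space"
  assumes p: "2 \<le> p"
  shows "((\<lambda>x. norm x powr p / p) has_derivative (\<lambda>h. pflux p x \<bullet> h)) (at x)"
proof (cases "x = 0")
  case False
  then have "(norm has_derivative (\<lambda>h. h \<bullet> sgn x)) (at x)"
    using has_derivative_norm[of x] by (simp add: inner_commute)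
  from this False show ?thesis using p
    by (auto intro!: derivative_eq_intros simp: powr_diff power2_eq_square sgn_div_norm inner_commute field_simps)
next
  case True
  have "((\<lambda>h::'b. (norm h powr p / p) / norm h) \<longlongrightarrow> 0) (at 0)"
  proof (rule Lim_transform_eventually)
    show "((\<lambda>h::'b. norm h powr (p - 1) / p) \<longlongrightarrow> 0) (at 0)"
      using p by (intro tendsto_divide_zero tendsto_zero_powrI[where b = "p - 1"] tendsto_norm_zero) auto
    show "\<forall>\<^sub>F h::'b in at 0. norm h powr (p - 1) / p = (norm h powr p / p) / norm h"
      unfolding eventually_at by (auto simp: powr_diff intro!: exI[of _ 1])
  qed
  then show ?thesis using True p by (simp add: has_derivative_at)
qed

text \<open>With \<open>A\<close> and \<open>B\<close> the scalar factors, the right side equals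
  (A+B)/2 times the squared distance plus half the product of \<open>A - B\<close> with the
  difference of the squared norms. Since \<open>p \<ge> 2\<close>, that product is nonnegative, and
  the distance is at most twice the longer vector, so \<open>A + B\<close> dominates its power
  \<open>p - 2\<close> up to the factor 2^(p-2).\<close>

lemma pflux_strongly_monotone:
  fixes x y :: "'b::euclidean_space"
  assumes p: "2 \<le> p"
  shows "2 powr (1 - p) * norm (x - y) powr p \<le> (pflux p x - pflux p y) \<bullet> (x - y)"
proof -
  define A B where "A = norm x powr (p - 2)" and "B = norm y powr (p - 2)"
  have AB: "A \<ge> 0" "B \<ge> 0" by (auto simp: A_def B_def)
  have "(pflux p x - pflux p y) \<bullet> (x - y) = (A + B) / 2 * (norm (x - y))\<^sup>2 + (A - B) * ((norm x)\<^sup>2 - (norm y)\<^sup>2) / 2"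
    unfolding A_def[symmetric] B_def[symmetric] power2_norm_eq_inner
    by (simp add: inner_diff inner_commute algebra_simps) (simp add: field_simps)
  moreover have "(A - B) * ((norm x)\<^sup>2 - (norm y)\<^sup>2) \<ge> 0"
  proof (cases "norm x \<le> norm y")
    case True
    then have "A \<le> B" "(norm x)\<^sup>2 \<le> (norm y)\<^sup>2" using p by (auto simp: A_def B_def intro!: powr_mono2)
    then show ?thesis by (intro mult_nonpos_nonpos) auto
  next
    case False
    then have "B \<le> A" "(norm y)\<^sup>2 \<le> (norm x)\<^sup>2" using p by (auto simp: A_def B_def intro!: powr_mono2)
    then show ?thesis by (intro mult_nonneg_nonneg) auto
  qed
  ultimately have 1: "(pflux p x - pflux p y) \<bullet> (x - y) \<ge> (A + B) / 2 * (norm (x - y))\<^sup>2" by linarith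
  have "norm (x - y) powr (p - 2) \<le> (2 * max (norm x) (norm y)) powr (p - 2)"
    using p norm_triangle_ineq4[of x y] by (intro powr_mono2) auto
  also have "\<dots> = 2 powr (p - 2) * max (norm x) (norm y) powr (p - 2)"
    by (simp add: powr_mult)
  also have "max (norm x) (norm y) powr (p - 2) \<le> A + B"
    using AB by (auto simp: max_def A_def B_def)
  finally have "2 powr (1 - p) * norm (x - y) powr (p - 2) \<le> 2 powr (1 - p) * (2 powr (p - 2) * (A + B))"
    by (intro mult_left_mono) (auto simp: mult_left_mono)
  also have "\<dots> = (A + B) / 2"
    by (simp add: powr_diff field_simps power2_eq_square)
  finally have "2 powr (1 - p) * norm (x - y) powr (p - 2) * (norm (x - y))\<^sup>2 \<le> (A + B) / 2 * (norm (x - y))\<^sup>2"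
    by (intro mult_right_mono) auto
  moreover have "norm (x - y) powr (p - 2) * (norm (x - y))\<^sup>2 = norm (x - y) powr p"
    by (cases "x = y") (use p in \<open>auto simp: powr_diff powr_numeral\<close>)
  ultimately show ?thesis using 1 by (simp add: mult.assoc)
qed

section \<open>Almost critical sequences and the mountain pass\<close>

text \<open>\<open>D\<close> is not assumed complete: critical points need not exist in it, only almost critical ones.\<close>

locale energy =
  fixes D :: "'a::real_vector set" and N :: "'a \<Rightarrow> real" and E :: "'a \<Rightarrow> real"
    and dE :: "'a \<Rightarrow> 'a \<Rightarrow> real" and R :: real
  assumes zero_D: "0 \<in> D"
    and add_D: "u \<in> D \<Longrightarrow> v \<in> D \<Longrightarrow> u + v \<in> D"
    and scale_D: "u \<in> D \<Longrightarrow> c *\<^sub>R u \<in> D"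
    and N_nonneg: "0 \<le> N u"
    and N_scale: "u \<in> D \<Longrightarrow> N (c *\<^sub>R u) = \<bar>c\<bar> * N u"
    and N_add: "u \<in> D \<Longrightarrow> v \<in> D \<Longrightarrow> N (u + v) \<le> N u + N v"
    and dE_add: "u \<in> D \<Longrightarrow> v \<in> D \<Longrightarrow> w \<in> D \<Longrightarrow> dE u (v + w) = dE u v + dE u w"
    and dE_scale: "u \<in> D \<Longrightarrow> v \<in> D \<Longrightarrow> dE u (c *\<^sub>R v) = c * dE u v"
    and frechet: "\<epsilon> > 0 \<Longrightarrow> \<exists>d>0. \<forall>u\<in>D. \<forall>v\<in>D. N u \<le> R \<longrightarrow> N v \<le> d \<longrightarrow> \<bar>E (u + v) - E u - dE u v\<bar> \<le> \<epsilon> * N v"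
    and dE_bound: "\<exists>C\<ge>0. \<forall>u\<in>D. \<forall>v\<in>D. N u \<le> R \<longrightarrow> \<bar>dE u v\<bar> \<le> C * N v"
    and dE_cont: "\<epsilon> > 0 \<Longrightarrow> \<exists>d>0. \<forall>u\<in>D. \<forall>w\<in>D. \<forall>v\<in>D. N u \<le> R \<longrightarrow> N (w - u) \<le> d \<longrightarrow> \<bar>dE w v - dE u v\<bar> \<le> \<epsilon> * N v"
    and E_bound: "\<exists>B. \<forall>u\<in>D. N u \<le> R \<longrightarrow> \<bar>E u\<bar> \<le> B"
begin

lemma diff_D: "u \<in> D \<Longrightarrow> v \<in> D \<Longrightarrow> u - v \<in> D"
  using add_D[of u "(-1) *\<^sub>R v"] scale_D[of v "-1"] by simp

lemma N_minus: "u \<in> D \<Longrightarrow> N (- u) = N u"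
  using N_scale[of u "-1"] by simp

lemma N_commute: "u \<in> D \<Longrightarrow> v \<in> D \<Longrightarrow> N (u - v) = N (v - u)"
  using N_minus[OF diff_D, of u v] by simp

lemma N_0: "N 0 = 0"
  using N_scale[OF zero_D, of 0] by simp

lemma N_diff: "u \<in> D \<Longrightarrow> v \<in> D \<Longrightarrow> N (u - v) \<le> N u + N v"
  using N_add[of u "-v"] scale_D[of v "-1"] N_minus[of v] by simp

text \<open>The dual norm of the derivative at \<open>u\<close> is at most
  \<open>\<epsilon>\<close>, phrased without a dual space.\<close>

definition almost_critical :: "real \<Rightarrow> 'a \<Rightarrow> bool" where
  "almost_critical \<epsilon> u \<longleftrightarrow> (\<forall>v\<in>D. \<bar>dE u v\<bar> \<le> \<epsilon> * N v)"

lemma not_almost_critical: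
  assumes "u \<in> D" "N u \<le> R" "\<not> almost_critical \<epsilon> u" "\<epsilon> > 0"
  shows "\<exists>v\<in>D. N v = 1 \<and> dE u v > \<epsilon>"
proof -
  obtain v where v: "v \<in> D" "\<bar>dE u v\<bar> > \<epsilon> * N v"
    using assms unfolding almost_critical_def by force
  obtain C where C: "C \<ge> 0" "\<bar>dE u v\<bar> \<le> C * N v" using dE_bound v assms by blast
  \<comment> \<open>\<open>N\<close> is only a seminorm; it is the boundedness of
    \<open>dE u\<close> that excludes null directions.\<close>
  have "N v \<noteq> 0" using C v by auto
  then have Nv: "N v > 0" using N_nonneg[of v] by simp
  define c where "c = sgn (dE u v) / N v"
  have nz: "dE u v \<noteq> 0" using v(2) assms(4) N_nonneg[of v] by (metis abs_zero less_le_not_le mult_nonneg_nonneg less_imp_le)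
  have "N (c *\<^sub>R v) = 1" using v Nv nz by (simp add: N_scale c_def abs_mult abs_sgn_eq)
  moreover have "dE u (c *\<^sub>R v) = \<bar>dE u v\<bar> / N v"
    using v assms(1) by (simp add: dE_scale c_def abs_sgn[of "dE u v"] mult.commute)
  then have "dE u (c *\<^sub>R v) > \<epsilon>" using v(2) Nv by (simp add: pos_less_divide_eq)
  ultimately show ?thesis using scale_D[OF v(1)] by blast
qed

lemma E_lipschitz:
  "\<exists>L>0. \<exists>d>0. \<forall>u\<in>D. \<forall>v\<in>D. N u \<le> R \<longrightarrow> N v \<le> d \<longrightarrow> \<bar>E (u + v) - E u\<bar> \<le> L * N v"
proof -
  obtain d where d: "d > 0" "\<And>u v. u \<in> D \<Longrightarrow> v \<in> D \<Longrightarrow> N u \<le> R \<Longrightarrow> N v \<le> d \<Longrightarrow> \<bar>E (u + v) - E u - dE u v\<bar> \<le> 1 * N v"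
    using frechet[of 1] by auto
  obtain C where C: "C \<ge> 0" "\<And>u v. u \<in> D \<Longrightarrow> v \<in> D \<Longrightarrow> N u \<le> R \<Longrightarrow> \<bar>dE u v\<bar> \<le> C * N v"
    using dE_bound by blast
  have "\<bar>E (u + v) - E u\<bar> \<le> (C + 1) * N v" if "u \<in> D" "v \<in> D" "N u \<le> R" "N v \<le> d" for u v
    using d(2)[OF that] C(2)[OF that(1-3)] by (simp add: algebra_simps)
  then show ?thesis using C d(1) by (intro exI[of _ "C + 1"] conjI exI[of _ d]) auto
qed

lemma descent:
  assumes "\<epsilon> > 0"
  shows "\<exists>d>0. \<forall>u\<in>D. \<forall>v\<in>D. \<forall>s. N u \<le> R \<longrightarrow> N v \<le> 1 \<longrightarrow> 0 \<le> s \<longrightarrow> s \<le> d \<longrightarrow>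
    E (u - s *\<^sub>R v) \<le> E u - s * dE u v + s * \<epsilon>"
proof -
  obtain d where d: "d > 0" "\<And>u v. u \<in> D \<Longrightarrow> v \<in> D \<Longrightarrow> N u \<le> R \<Longrightarrow> N v \<le> d \<Longrightarrow> \<bar>E (u + v) - E u - dE u v\<bar> \<le> \<epsilon> * N v"
    using frechet[OF assms] by blast
  have "E (u - s *\<^sub>R v) \<le> E u - s * dE u v + s * \<epsilon>"
    if "u \<in> D" "v \<in> D" "N u \<le> R" "N v \<le> 1" "0 \<le> s" "s \<le> d" for u v s
  proof -
    have sv: "N ((-s) *\<^sub>R v) \<le> s" using that by (simp add: N_scale mult_left_le del: scaleR_minus_left)
    have "\<bar>E (u + (-s) *\<^sub>R v) - E u - dE u ((-s) *\<^sub>R v)\<bar> \<le> \<epsilon> * N ((-s) *\<^sub>R v)"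
      using that sv by (intro d(2) scale_D) auto
    also have "\<dots> \<le> \<epsilon> * s" using assms sv by (intro mult_left_mono) auto
    finally show ?thesis using that dE_scale[of u v "-s"] by (simp add: mult.commute)
  qed
  then show ?thesis using d(1) by blast
qed

text \<open>Takes the place of Ekeland's variational principle. Differentiability is uniform on the
  ball, so a step of one fixed length \<open>s\<close> along a direction steeper than
  \<open>\<epsilon>\<close> lowers the energy by at least \<open>s * \<epsilon> / 2\<close>, below
  the local bound \<open>c\<close>. This gain is \<open>\<eta>\<close>, independent of
  \<open>c\<close> and \<open>u\<close>.\<close>

lemma near_minimizer_almost_critical:
  assumes "\<epsilon> > 0" "\<sigma> > 0"
  shows "\<exists>\<eta>>0. \<forall>c. \<forall>u\<in>D. N u \<le> R \<longrightarrow> E u < c + \<eta> \<longrightarrow> (\<forall>w\<in>D. N (w - u) \<le> \<sigma> \<longrightarrow> c \<le> E w) \<longrightarrow> almost_critical \<epsilon> u"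
proof -
  obtain d where d: "d > 0" "\<And>u v s. u \<in> D \<Longrightarrow> v \<in> D \<Longrightarrow> N u \<le> R \<Longrightarrow> N v \<le> 1 \<Longrightarrow> 0 \<le> s \<Longrightarrow> s \<le> d \<Longrightarrow>
    E (u - s *\<^sub>R v) \<le> E u - s * dE u v + s * (\<epsilon> / 2)"
    using descent[of "\<epsilon> / 2"] assms by auto
  define s where "s = min d \<sigma>"
  have s: "0 < s" "s \<le> d" "s \<le> \<sigma>" using d assms by (auto simp: s_def)
  have "almost_critical \<epsilon> u" if u: "u \<in> D" "N u \<le> R" and c: "E u < c + s * \<epsilon> / 2"
    and m: "\<forall>w\<in>D. N (w - u) \<le> \<sigma> \<longrightarrow> c \<le> E w" for c u
  proof (rule ccontr)
    assume "\<not> almost_critical \<epsilon> u"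
    then obtain v where v: "v \<in> D" "N v = 1" "dE u v > \<epsilon>"
      using not_almost_critical u assms by blast
    have "E (u - s *\<^sub>R v) \<le> E u - s * dE u v + s * (\<epsilon> / 2)" using u v s by (intro d(2)) auto
    moreover have "s * dE u v \<ge> s * \<epsilon>" using s v by (intro mult_left_mono) auto
    moreover have "c \<le> E (u - s *\<^sub>R v)"
      using m diff_D[OF u(1) scale_D[OF v(1), of s]] N_minus[OF scale_D[OF v(1), of s]] s v
      by (auto simp: N_scale)
    ultimately show False using c by simp
  qed
  then show ?thesis using s assms by (intro exI[of _ "s * \<epsilon> / 2"]) auto
qed

text \<open>Chains of segments play the role of continuous paths in the mountain pass argument.\<close>

definition link :: "real \<Rightarrow> ('a \<times> 'a) set" where
  "link c = {(x, y). x \<in> D \<and> y \<in> D \<and> (\<forall>t\<in>{0..1}. N ((1 - t) *\<^sub>R x + t *\<^sub>R y) < R \<and> E ((1 - t) *\<^sub>R x + t *\<^sub>R y) < c)}"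

lemma segment_D: "x \<in> D \<Longrightarrow> y \<in> D \<Longrightarrow> (1 - t) *\<^sub>R x + t *\<^sub>R y \<in> D"
  by (intro add_D scale_D)

lemma continuous_N_segment:
  assumes "x \<in> D" "y \<in> D"
  shows "continuous_on {0..1::real} (\<lambda>t. N ((1 - t) *\<^sub>R x + t *\<^sub>R y))"
proof -
  have *: "N ((1 - t) *\<^sub>R x + t *\<^sub>R y) \<le> N ((1 - t') *\<^sub>R x + t' *\<^sub>R y) + \<bar>t - t'\<bar> * N (y - x)" for t t'
  proof -
    have "(1 - t) *\<^sub>R x + t *\<^sub>R y = ((1 - t') *\<^sub>R x + t' *\<^sub>R y) + (t - t') *\<^sub>R (y - x)"
      by (simp add: algebra_simps)
    then show ?thesis
      using N_add[OF segment_D[OF assms, of t'] scale_D[OF diff_D[OF assms(2,1)], of "t - t'"]]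
        N_scale[OF diff_D[OF assms(2,1)], of "t - t'"] by simp
  qed
  have "\<bar>N ((1 - t) *\<^sub>R x + t *\<^sub>R y) - N ((1 - t') *\<^sub>R x + t' *\<^sub>R y)\<bar> \<le> N (y - x) * \<bar>t - t'\<bar>" for t t'
    using *[of t t'] *[of t' t] by (simp add: abs_minus_commute mult.commute abs_le_iff)
  then have "(N (y - x))-lipschitz_on {0..1} (\<lambda>t. N ((1 - t) *\<^sub>R x + t *\<^sub>R y))"
    using N_nonneg by (auto simp: lipschitz_on_def dist_real_def)
  then show ?thesis by (rule lipschitz_on_continuous_on)
qed

text \<open>\<open>N\<close> is continuous along each segment, so leaving the ball would produce a
  point of the sphere \<open>N u = \<rho>\<close> at which the energy is less than
  \<open>c\<close>.\<close>

lemma link_barrier: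
  assumes "(x, y) \<in> (link c)\<^sup>*" "N x < \<rho>" "\<And>u. u \<in> D \<Longrightarrow> N u = \<rho> \<Longrightarrow> c \<le> E u"
  shows "N y < \<rho>"
  using assms(1,2)
proof (induction rule: rtrancl_induct)
  case (step y z)
  then have y: "N y < \<rho>" and yz: "(y, z) \<in> link c" by auto
  show ?case
  proof (rule ccontr)
    assume "\<not> N z < \<rho>"
    then have "\<exists>t\<ge>0. t \<le> 1 \<and> N ((1 - t) *\<^sub>R y + t *\<^sub>R z) = \<rho>"
      using y yz by (intro IVT' continuous_N_segment) (auto simp: link_def)
    then obtain t where t: "t \<in> {0..1}" "N ((1 - t) *\<^sub>R y + t *\<^sub>R z) = \<rho>" by auto
    then have "c \<le> E ((1 - t) *\<^sub>R y + t *\<^sub>R z)" using yz by (intro assms(3) segment_D) (auto simp: link_def)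
    then show False using t yz unfolding link_def by force
  qed
qed

lemma rtrancl_pieces:
  fixes f :: "nat \<Rightarrow> 'b"
  assumes "\<And>i. i < n \<Longrightarrow> (f i, f (Suc i)) \<in> Q"
  shows "(f 0, f n) \<in> Q\<^sup>*"
  using assms by (induction n) (auto intro: rtrancl.rtrancl_into_rtrancl)

text \<open>The vertices of a finely subdivided chain are moved against directions of steep descent, one
  small step at a time; almost constancy of \<open>dE\<close> at small distances makes the segments between the
  moved vertices descend as well.\<close>

lemma deformation:
  assumes eps: "\<epsilon> > 0" and rR: "r < R"
    and coer: "\<And>u. u \<in> D \<Longrightarrow> N u < R \<Longrightarrow> E u \<le> c + \<epsilon> \<Longrightarrow> N u \<le> r"
    and nc: "\<And>u. u \<in> D \<Longrightarrow> N u \<le> r \<Longrightarrow> \<bar>E u - c\<bar> \<le> \<epsilon> \<Longrightarrow> \<not> almost_critical \<epsilon> u"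
    and x0: "E x0 < c - \<epsilon>" and x1: "E x1 < c - \<epsilon>"
  shows "\<exists>\<eta>>0. (x0, x1) \<in> (link (c + \<eta>))\<^sup>* \<longrightarrow> (x0, x1) \<in> (link (c - \<eta>))\<^sup>*"
proof -
  \<comment> \<open>An arbitrary selection of descent directions, not a continuous pseudo-gradient
    field: only its values at the vertices of chains matter. It is 0 outside the energy band, which
    keeps the end points fixed.\<close>
  define V where "V u = (if u \<in> D \<and> N u \<le> r \<and> \<bar>E u - c\<bar> \<le> \<epsilon> then SOME v. v \<in> D \<and> N v = 1 \<and> dE u v > \<epsilon> else 0)" for u
  have V: "V u \<in> D \<and> N (V u) = 1 \<and> dE u (V u) > \<epsilon>" if "u \<in> D" "N u \<le> r" "\<bar>E u - c\<bar> \<le> \<epsilon>" for u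
  proof -
    have "\<exists>v. v \<in> D \<and> N v = 1 \<and> dE u v > \<epsilon>"
      using not_almost_critical[of u \<epsilon>] nc[OF that] that rR eps by auto
    from someI_ex[OF this] show ?thesis using that by (simp add: V_def)
  qed
  have VD: "V u \<in> D" "N (V u) \<le> 1" for u
    using V[of u] zero_D N_0 by (cases "u \<in> D \<and> N u \<le> r \<and> \<bar>E u - c\<bar> \<le> \<epsilon>"; force simp: V_def)+
  obtain L d1 where L: "L > 0" "d1 > 0" "\<And>u v. u \<in> D \<Longrightarrow> v \<in> D \<Longrightarrow> N u \<le> R \<Longrightarrow> N v \<le> d1 \<Longrightarrow> \<bar>E (u + v) - E u\<bar> \<le> L * N v"
    using E_lipschitz by blast
  obtain d2 where d2: "d2 > 0" "\<And>u v s. u \<in> D \<Longrightarrow> v \<in> D \<Longrightarrow> N u \<le> R \<Longrightarrow> N v \<le> 1 \<Longrightarrow> 0 \<le> s \<Longrightarrow> s \<le> d2 \<Longrightarrow>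
    E (u - s *\<^sub>R v) \<le> E u - s * dE u v + s * (\<epsilon> / 4)"
    using descent[of "\<epsilon> / 4"] eps by auto
  obtain d3 where d3: "d3 > 0" "\<And>u w v. u \<in> D \<Longrightarrow> w \<in> D \<Longrightarrow> v \<in> D \<Longrightarrow> N u \<le> R \<Longrightarrow> N (w - u) \<le> d3 \<Longrightarrow> \<bar>dE w v - dE u v\<bar> \<le> \<epsilon> / 4 * N v"
    using dE_cont[of "\<epsilon> / 4"] eps by auto
  \<comment> \<open>The step length: short enough for the descent estimate, for staying inside the
    ball of radius \<open>R\<close> when starting in the one of radius \<open>r\<close>, and for
    changing the energy by at most \<open>\<epsilon> / 4\<close>.\<close>
  define s where "s = Min {1, d1, d2, (R - r) / 2, \<epsilon> / (4 * L)}"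
  have s: "0 < s" "s \<le> 1" "s \<le> d1" "s \<le> d2" "s \<le> (R - r) / 2" "s \<le> \<epsilon> / (4 * L)"
  proof -
    have "s \<le> x" if "x \<in> {1, d1, d2, (R - r) / 2, \<epsilon> / (4 * L)}" for x
      unfolding s_def by (rule Min_le) (use that in auto)
    then show "s \<le> 1" "s \<le> d1" "s \<le> d2" "s \<le> (R - r) / 2" "s \<le> \<epsilon> / (4 * L)" by blast+
    show "0 < s" using L d2 rR eps by (auto simp: s_def)
  qed
  have sL: "L * s \<le> \<epsilon> / 4" using s(6) L(1) by (simp add: field_simps)
  \<comment> \<open>The mesh of the subdivision: along one piece the energy varies by at most
    \<open>\<epsilon> / 2\<close>, and the derivative in a unit direction by at most
    \<open>\<epsilon> / 4\<close>.\<close>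
  define m where "m = Min {d1, d3, \<epsilon> / (2 * L)}"
  have m: "0 < m" "m \<le> d1" "m \<le> d3" "m \<le> \<epsilon> / (2 * L)" using L d3 eps by (auto simp: m_def)
  have mL: "L * m \<le> \<epsilon> / 2" using m(4) L(1) by (simp add: field_simps)
  \<comment> \<open>Half of the guaranteed gain \<open>s * \<epsilon> / 2\<close> of one step, so
    that points below \<open>c + \<eta>\<close> land below \<open>c - \<eta>\<close>.\<close>
  define \<eta> where "\<eta> = s * \<epsilon> / 4"
  have \<eta>: "\<eta> > 0" "\<eta> \<le> \<epsilon> / 4" using s(1,2) eps by (auto simp: \<eta>_def)
  define T where "T u = u - s *\<^sub>R V u" for u
  have TD: "T u \<in> D" if "u \<in> D" for u using that VD by (auto simp: T_def intro!: diff_D scale_D)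
  have piece: "(T x, T y) \<in> link (c - \<eta>)" if xy: "(x, y) \<in> link (c + \<eta>)" and small: "N (y - x) \<le> m" for x y
  proof -
    have x: "x \<in> D" and y: "y \<in> D" using xy by (auto simp: link_def)
    have "N ((1 - t) *\<^sub>R T x + t *\<^sub>R T y) < R \<and> E ((1 - t) *\<^sub>R T x + t *\<^sub>R T y) < c - \<eta>"
      if t: "0 \<le> t \<and> t \<le> 1" for t :: real
    proof -
    define w where "w = (1 - t) *\<^sub>R x + t *\<^sub>R y"
    define v where "v = (1 - t) *\<^sub>R V x + t *\<^sub>R V y"
    have w: "w \<in> D" "N w < R" "E w < c + \<eta>"
      using xy t segment_D[OF x y, of t] by (auto simp: w_def link_def)
    then have wr: "N w \<le> r" using \<eta> eps by (intro coer) auto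
    have v: "v \<in> D" unfolding v_def by (intro segment_D VD)
    have "N v \<le> N ((1 - t) *\<^sub>R V x) + N (t *\<^sub>R V y)" unfolding v_def by (intro N_add scale_D VD)
    also have "\<dots> = (1 - t) * N (V x) + t * N (V y)" using t by (simp add: N_scale VD)
    also have "\<dots> \<le> (1 - t) * 1 + t * 1" using t VD by (intro add_mono mult_left_mono) auto
    finally have v1: "N v \<le> 1" by simp
    have eq: "(1 - t) *\<^sub>R T x + t *\<^sub>R T y = w - s *\<^sub>R v"
      by (simp add: T_def w_def v_def algebra_simps)
    have Nsv: "N (s *\<^sub>R v) \<le> s" using v v1 s(1) by (simp add: N_scale mult_left_le)
    have "N (w - s *\<^sub>R v) \<le> r + s" using N_diff[OF w(1) scale_D[OF v, of s]] Nsv wr by linarith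
    also have "\<dots> < R"
    proof -
      have "2 * s \<le> R - r" using s(5) by simp
      then show ?thesis using rR by linarith
    qed
    finally have NR: "N ((1 - t) *\<^sub>R T x + t *\<^sub>R T y) < R" by (simp add: eq)
    have "E (w - s *\<^sub>R v) < c - \<eta>"
    \<comment> \<open>A low point may be moved in any direction, since one step raises the energy by
      at most \<open>\<epsilon> / 4\<close>. If \<open>w\<close> is high, the vertices near it lie
      in the band where \<open>V\<close> is a direction of steep descent.\<close>
    proof (cases "E w < c - \<epsilon> / 2")
      case True
      have "\<bar>E (w + (- (s *\<^sub>R v))) - E w\<bar> \<le> L * N (- (s *\<^sub>R v))"
        using w v s Nsv N_minus[OF scale_D[OF v, of s]] scale_D[OF v, of "-s"] by (intro L(3)) auto
      also have "\<dots> \<le> L * s" using Nsv L(1) v by (simp add: N_minus scale_D)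
      finally have "E (w - s *\<^sub>R v) \<le> E w + \<epsilon> / 4" using sL by simp
      then show ?thesis using True \<eta> by linarith
    next
      case False
      have near: "dE w (V z) \<ge> 3 * \<epsilon> / 4" if z: "z \<in> D" "N z < R" "E z < c + \<eta>" "N (w - z) \<le> m" for z
      proof -
        have zr: "N z \<le> r" using z \<eta> eps by (intro coer) auto
        have "\<bar>E (z + (w - z)) - E z\<bar> \<le> L * N (w - z)"
          using z w m by (intro L(3) diff_D) auto
        also have "\<dots> \<le> L * m" using z L by (intro mult_left_mono) auto
        finally have "\<bar>E w - E z\<bar> \<le> \<epsilon> / 2" using mL by simp
        then have "\<bar>E z - c\<bar> \<le> \<epsilon>" using False z(3) \<eta> by linarith
        from V[OF z(1) zr this] have Vz: "V z \<in> D" "N (V z) = 1" "dE z (V z) > \<epsilon>" by auto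
        have "\<bar>dE w (V z) - dE z (V z)\<bar> \<le> \<epsilon> / 4 * N (V z)"
          using z w m Vz by (intro d3(2)) auto
        then have "4 * \<bar>dE w (V z) - dE z (V z)\<bar> \<le> \<epsilon>" using Vz by simp
        moreover have "dE z (V z) - dE w (V z) \<le> \<bar>dE w (V z) - dE z (V z)\<bar>" by simp
        ultimately show ?thesis using Vz by simp
      qed
      have Nyx: "N (y - x) = N (x - y)" using N_commute x y by blast
      have "w - x = t *\<^sub>R (y - x)" "w - y = (1 - t) *\<^sub>R (x - y)" by (simp_all add: w_def algebra_simps)
      then have "N (w - x) = t * N (y - x)" "N (w - y) = (1 - t) * N (y - x)"
        using t Nyx diff_D[OF x y] diff_D[OF y x] by (simp_all add: N_scale)
      moreover have "t * N (y - x) \<le> N (y - x)" "(1 - t) * N (y - x) \<le> N (y - x)"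
        using t N_nonneg[of "y - x"] by (auto intro!: mult_left_le_one_le)
      ultimately have wx: "N (w - x) \<le> m" "N (w - y) \<le> m" using small by auto
      have "N x < R \<and> E x < c + \<eta>" "N y < R \<and> E y < c + \<eta>"
        using xy unfolding link_def by (force dest: bspec[of _ _ 0] bspec[of _ _ 1])+
      then have "dE w (V x) \<ge> 3 * \<epsilon> / 4" "dE w (V y) \<ge> 3 * \<epsilon> / 4"
        using near x y wx by auto
      then have "(1 - t) * (3 * \<epsilon> / 4) + t * (3 * \<epsilon> / 4) \<le> (1 - t) * dE w (V x) + t * dE w (V y)"
        using t by (intro add_mono mult_left_mono) auto
      also have "\<dots> = dE w v"
        unfolding v_def using w VD by (simp add: dE_add dE_scale scale_D)
      finally have "3 * \<epsilon> / 4 \<le> dE w v" by (simp add: diff_divide_distrib algebra_simps)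
      then have "s * (3 * \<epsilon> / 4) \<le> s * dE w v" using s by (intro mult_left_mono) auto
      moreover have "E (w - s *\<^sub>R v) \<le> E w - s * dE w v + s * (\<epsilon> / 4)"
        using w v v1 s by (intro d2(2)) auto
      ultimately have "E (w - s *\<^sub>R v) \<le> E w - s * \<epsilon> / 2" by (simp add: algebra_simps)
      then show ?thesis using w(3) unfolding \<eta>_def by (simp add: algebra_simps)
    qed
    then show ?thesis using NR by (simp add: eq)
    qed
    then show ?thesis unfolding link_def using TD x y by auto
  qed
  have seg: "(T x, T y) \<in> (link (c - \<eta>))\<^sup>*" if xy: "(x, y) \<in> link (c + \<eta>)" for x y
  proof -
    have x: "x \<in> D" and y: "y \<in> D" using xy by (auto simp: link_def)
    obtain n :: nat where n: "N (y - x) / m < real n" using reals_Archimedean2 by blast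
    have n0: "n > 0" using n m(1) N_nonneg[of "y - x"] by (intro gr0I) (auto simp: divide_less_0_iff)
    define f where "f i = x + (real i / n) *\<^sub>R (y - x)" for i
    have "(T (f i), T (f (Suc i))) \<in> link (c - \<eta>)" if i: "i < n" for i
    proof (rule piece)
      have "f (Suc i) - f i = (1 / n) *\<^sub>R (y - x)"
        using n0 by (simp add: f_def add_divide_distrib scaleR_add_left)
      then have "N (f (Suc i) - f i) = N (y - x) / n" using x y by (simp add: N_scale diff_D)
      also have "\<dots> \<le> m" using n n0 m by (simp add: field_simps)
      finally show "N (f (Suc i) - f i) \<le> m" .
      show "(f i, f (Suc i)) \<in> link (c + \<eta>)"
      proof -
        have "N ((1 - t) *\<^sub>R f i + t *\<^sub>R f (Suc i)) < R \<and> E ((1 - t) *\<^sub>R f i + t *\<^sub>R f (Suc i)) < c + \<eta>"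
          if t: "0 \<le> t \<and> t \<le> 1" for t :: real
        proof -
        define t' where "t' = (real i + t) / n"
        have "real i + t \<le> real n" using i t by linarith
        then have t': "t' \<in> {0..1}" using t n0 by (auto simp: t'_def)
        have "f (Suc i) = f i + (1 / n) *\<^sub>R (y - x)"
          by (simp add: f_def add_divide_distrib scaleR_add_left)
        then have "(1 - t) *\<^sub>R f i + t *\<^sub>R f (Suc i) = f i + (t / n) *\<^sub>R (y - x)"
          by (simp add: scaleR_diff_left scaleR_add_right)
        also have "\<dots> = (1 - t') *\<^sub>R x + t' *\<^sub>R y"
          by (simp add: f_def t'_def algebra_simps add_divide_distrib)
        finally have "(1 - t) *\<^sub>R f i + t *\<^sub>R f (Suc i) = (1 - t') *\<^sub>R x + t' *\<^sub>R y" .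
        then show ?thesis using xy t' by (auto simp: link_def)
        qed
        moreover have "f i \<in> D" "f (Suc i) \<in> D" unfolding f_def using x y by (auto intro!: add_D scale_D diff_D)
        ultimately show ?thesis unfolding link_def by auto
      qed
    qed
    then have "(T (f 0), T (f n)) \<in> (link (c - \<eta>))\<^sup>*" by (rule rtrancl_pieces)
    then show ?thesis using n0 by (simp add: f_def)
  qed
  have chain: "(T x, T y) \<in> (link (c - \<eta>))\<^sup>*" if "(x, y) \<in> (link (c + \<eta>))\<^sup>*" for x y
    using that by (induction rule: rtrancl_induct) (auto intro: rtrancl_trans seg)
  \<comment> \<open>Both end points lie below the band and hence are not moved.\<close>
  have "T x0 = x0" "T x1 = x1" using x0 x1 eps by (auto simp: T_def V_def)
  then show ?thesis using chain[of x0 x1] \<eta> by (intro exI[of _ \<eta>]) auto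
qed

text \<open>The minimax level is the infimum of the heights at which chains lead from 0 to
  \<open>e\<close>. The sphere \<open>N u = \<rho>\<close> bounds it below by
  \<open>\<alpha>\<close>; without almost critical points at this level, \<open>deformation\<close>
  would produce a chain below the infimum. Coercivity is required up to \<open>K > K'\<close> so
  that it covers energies slightly above the level.\<close>

lemma mountain_pass:
  assumes r: "r < R" and K: "K' < K"
    and coer: "\<And>u. u \<in> D \<Longrightarrow> N u < R \<Longrightarrow> E u \<le> K \<Longrightarrow> N u \<le> r"
    and barrier: "\<And>u. u \<in> D \<Longrightarrow> N u = \<rho> \<Longrightarrow> \<alpha> \<le> E u" and \<alpha>: "0 < \<alpha>" and \<rho>: "0 < \<rho>"
    and e: "(0, e) \<in> link K'" "\<rho> \<le> N e" "E e \<le> 0" and E0: "E 0 = 0"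
  shows "\<exists>c\<ge>\<alpha>. \<forall>\<epsilon>>0. \<exists>u\<in>D. N u \<le> r \<and> \<bar>E u - c\<bar> \<le> \<epsilon> \<and> almost_critical \<epsilon> u"
proof -
  define C where "C = {c. (0, e) \<in> (link c)\<^sup>*}"
  have KC: "K' \<in> C" using e(1) by (auto simp: C_def)
  have lb: "\<alpha> \<le> c" if "c \<in> C" for c
  proof (rule ccontr)
    assume "\<not> \<alpha> \<le> c"
    then have "N e < \<rho>" using that \<rho> barrier N_0
      by (intro link_barrier[of 0 e c]) (force simp: C_def)+
    then show False using e by simp
  qed
  then have bdd: "bdd_below C" by (auto intro: bdd_belowI[of _ \<alpha>])
  define c where "c = Inf C"
  have c\<alpha>: "\<alpha> \<le> c" unfolding c_def using KC lb by (intro cInf_greatest) auto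
  have cK: "c \<le> K'" unfolding c_def using KC bdd by (intro cInf_lower)
  have main: "\<exists>u\<in>D. N u \<le> r \<and> \<bar>E u - c\<bar> \<le> \<epsilon> \<and> almost_critical \<epsilon> u"
    if eps: "\<epsilon> > 0" "\<epsilon> < \<alpha>" "\<epsilon> \<le> K - K'" for \<epsilon>
  proof (rule ccontr)
    assume no: "\<not> ?thesis"
    have "\<exists>\<eta>>0. (0, e) \<in> (link (c + \<eta>))\<^sup>* \<longrightarrow> (0, e) \<in> (link (c - \<eta>))\<^sup>*"
    proof (rule deformation[OF eps(1) r])
      fix u assume "u \<in> D" "N u < R" "E u \<le> c + \<epsilon>"
      then show "N u \<le> r" using cK eps by (intro coer) auto
    qed (use no c\<alpha> e E0 eps in auto)
    then obtain \<eta> where \<eta>: "\<eta> > 0" "(0, e) \<in> (link (c + \<eta>))\<^sup>* \<longrightarrow> c - \<eta> \<in> C" by (auto simp: C_def)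
    have "Inf C < c + \<eta>" using \<eta> by (simp add: c_def)
    then obtain c' where c': "c' \<in> C" "c' < c + \<eta>" using KC cInf_lessD by blast
    have "link c' \<subseteq> link (c + \<eta>)" using c' by (force simp: link_def)
    then have "(0, e) \<in> (link (c + \<eta>))\<^sup>*" using c' rtrancl_mono by (auto simp: C_def)
    then have "c - \<eta> \<in> C" using \<eta> by simp
    then have "c \<le> c - \<eta>" unfolding c_def using bdd by (intro cInf_lower)
    then show False using \<eta> by simp
  qed
  have "\<exists>u\<in>D. N u \<le> r \<and> \<bar>E u - c\<bar> \<le> \<epsilon> \<and> almost_critical \<epsilon> u" if eps: "\<epsilon> > 0" for \<epsilon>
  proof -
    \<comment> \<open>The assertion only weakens as \<open>\<epsilon>\<close> grows, so it is enough
      to treat values for which both end points lie below the band and the band stays below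
      \<open>K\<close>.\<close>
    define \<epsilon>' where "\<epsilon>' = Min {\<epsilon>, \<alpha> / 2, K - K'}"
    have \<epsilon>': "\<epsilon>' > 0" "\<epsilon>' < \<alpha>" "\<epsilon>' \<le> K - K'" "\<epsilon>' \<le> \<epsilon>" using eps \<alpha> K by (auto simp: \<epsilon>'_def)
    obtain u where u: "u \<in> D" "N u \<le> r" "\<bar>E u - c\<bar> \<le> \<epsilon>'" "almost_critical \<epsilon>' u" using main[OF \<epsilon>'(1-3)] by blast
    have "\<epsilon>' * N v \<le> \<epsilon> * N v" for v using \<epsilon>' N_nonneg by (intro mult_right_mono) auto
    then have "almost_critical \<epsilon> u" using u(4) unfolding almost_critical_def by (meson order_trans)
    then show ?thesis using u \<epsilon>' by force
  qed
  with c\<alpha> show ?thesis by blast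
qed

text \<open>Points of \<open>S\<close> with energy below \<open>m\<close> have a whole
  \<open>\<sigma>\<close>-neighbourhood in \<open>S\<close>, so near the infimum the constraint
  \<open>u \<in> S\<close> is inactive and \<open>near_minimizer_almost_critical\<close>
  applies.\<close>

lemma local_minimum:
  assumes S: "S \<subseteq> D" "S \<noteq> {}" "\<And>u. u \<in> S \<Longrightarrow> N u \<le> R"
    and interior: "\<sigma> > 0" "m > Inf (E ` S)" "\<And>u w. u \<in> S \<Longrightarrow> w \<in> D \<Longrightarrow> E u < m \<Longrightarrow> N (w - u) \<le> \<sigma> \<Longrightarrow> w \<in> S"
  shows "\<forall>\<epsilon>>0. \<exists>u\<in>S. \<bar>E u - Inf (E ` S)\<bar> \<le> \<epsilon> \<and> almost_critical \<epsilon> u \<and> E u < m"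
proof (intro allI impI)
  fix \<epsilon> :: real assume eps: "\<epsilon> > 0"
  define c where "c = Inf (E ` S)"
  obtain B where B: "\<forall>u\<in>D. N u \<le> R \<longrightarrow> \<bar>E u\<bar> \<le> B" using E_bound by blast
  have bdd: "bdd_below (E ` S)"
    using B S by (intro bdd_belowI[of _ "-B"]) (force simp: abs_le_iff)
  have lower: "c \<le> E u" if "u \<in> S" for u unfolding c_def using that bdd by (intro cInf_lower) auto
  obtain \<eta> where \<eta>: "\<eta> > 0" "\<And>c u. u \<in> D \<Longrightarrow> N u \<le> R \<Longrightarrow> E u < c + \<eta> \<Longrightarrow> (\<forall>w\<in>D. N (w - u) \<le> \<sigma> \<longrightarrow> c \<le> E w) \<Longrightarrow> almost_critical \<epsilon> u"
    using near_minimizer_almost_critical[OF eps interior(1)] by blast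
  have "Inf (E ` S) < min (c + min \<eta> \<epsilon>) m" using \<eta> eps interior(2) by (auto simp: c_def)
  then obtain y where "y \<in> E ` S" "y < min (c + min \<eta> \<epsilon>) m" using S(2) cInf_lessD[of "E ` S"] by blast
  then obtain u where u: "u \<in> S" "E u < min (c + min \<eta> \<epsilon>) m" by blast
  have "almost_critical \<epsilon> u" using u S lower interior(3)[OF u(1)] by (intro \<eta>(2)[of _ c]) auto
  moreover have "\<bar>E u - c\<bar> \<le> \<epsilon>" using lower[OF u(1)] u(2) by auto
  ultimately show "\<exists>u\<in>S. \<bar>E u - Inf (E ` S)\<bar> \<le> \<epsilon> \<and> almost_critical \<epsilon> u \<and> E u < m"
    using u unfolding c_def by auto
qed

text \<open>The value \<open>- \<kappa>\<close> separates the first two levels: the infimum over the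
  small ball is at least \<open>- \<kappa>\<close> and at most 0, the one over the large ball is
  below \<open>- \<kappa>\<close> because of \<open>e\<close>, and the mountain pass level is at
  least \<open>\<alpha> > 0\<close>. Near-minimisers are kept away from the boundary by the shell in
  the small ball and by coercivity in the large one.\<close>

lemma three_almost_critical_levels:
  assumes r: "0 < \<rho>" "\<rho> < R" "r < R" and K: "0 < K'" "K' < K"
    and coer: "\<And>u. u \<in> D \<Longrightarrow> N u < R \<Longrightarrow> E u \<le> K \<Longrightarrow> N u \<le> r"
    and shell: "\<And>u. u \<in> D \<Longrightarrow> \<rho> / 2 \<le> N u \<Longrightarrow> N u \<le> \<rho> \<Longrightarrow> \<alpha> \<le> E u" and \<alpha>: "0 < \<alpha>" "\<alpha> \<le> K"
    and ball: "\<And>u. u \<in> D \<Longrightarrow> N u \<le> \<rho> \<Longrightarrow> - \<kappa> \<le> E u"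
    and e: "(0, e) \<in> link K'" "E e < - \<kappa>" and E0: "E 0 = 0"
  obtains c1 c2 c3 where "c1 \<noteq> c2" "c1 \<noteq> c3" "c2 \<noteq> c3"
    "\<And>c \<epsilon>. c \<in> {c1, c2, c3} \<Longrightarrow> \<epsilon> > 0 \<Longrightarrow> \<exists>u\<in>D. N u \<le> r \<and> \<bar>E u - c\<bar> \<le> \<epsilon> \<and> almost_critical \<epsilon> u"
proof -
  define S1 where "S1 = {u \<in> D. N u \<le> \<rho>}"
  define S2 where "S2 = {u \<in> D. N u < R}"
  define c1 c2 where "c1 = Inf (E ` S1)" and "c2 = Inf (E ` S2)"
  have eD: "e \<in> D" "N e < R"
  proof -
    have "\<forall>t\<in>{0..1}. N ((1 - t) *\<^sub>R 0 + t *\<^sub>R e) < R" using e(1) by (simp add: link_def)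
    from bspec[OF this, of 1] show "N e < R" by simp
  qed (use e(1) in \<open>simp add: link_def\<close>)
  have e\<rho>: "\<not> N e \<le> \<rho>" using ball[OF eD(1)] e(2) by force
  have \<kappa>: "0 \<le> \<kappa>" using ball[OF zero_D] N_0 r E0 by auto
  have z1: "0 \<in> S1" using zero_D N_0 r by (auto simp: S1_def)
  have z2: "e \<in> S2" using eD by (auto simp: S2_def)
  obtain B where B: "\<forall>u\<in>D. N u \<le> R \<longrightarrow> \<bar>E u\<bar> \<le> B" using E_bound by blast
  have bdd1: "bdd_below (E ` S1)"
    using B r by (intro bdd_belowI[of _ "-B"]) (force simp: abs_le_iff S1_def)
  have bdd2: "bdd_below (E ` S2)"
    using B r by (intro bdd_belowI[of _ "-B"]) (force simp: abs_le_iff S2_def)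
  have c1: "c1 \<le> 0" unfolding c1_def using cInf_lower[OF _ bdd1, of "E 0"] z1 E0 by auto
  have c1': "- \<kappa> \<le> c1" unfolding c1_def using z1 ball by (intro cInf_greatest) (auto simp: S1_def)
  have c2: "c2 < - \<kappa>" unfolding c2_def using cInf_lower[OF _ bdd2, of "E e"] z2 e by auto
  obtain c3 where c3: "\<alpha> \<le> c3" "\<And>\<epsilon>. \<epsilon> > 0 \<Longrightarrow> \<exists>u\<in>D. N u \<le> r \<and> \<bar>E u - c3\<bar> \<le> \<epsilon> \<and> almost_critical \<epsilon> u"
    using mountain_pass[OF r(3) K(2) coer _ \<alpha>(1) r(1) e(1) _ _ E0] shell e\<rho> e \<kappa> r(1)
    by (smt (verit, best) field_sum_of_halves)
  have P1: "\<exists>u\<in>D. N u \<le> r \<and> \<bar>E u - c1\<bar> \<le> \<epsilon> \<and> almost_critical \<epsilon> u" if eps: "\<epsilon> > 0" for \<epsilon>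
  proof -
    have "\<forall>\<epsilon>>0. \<exists>u\<in>S1. \<bar>E u - Inf (E ` S1)\<bar> \<le> \<epsilon> \<and> almost_critical \<epsilon> u \<and> E u < \<alpha>"
    proof (rule local_minimum[where \<sigma> = "\<rho> / 2"])
      show "Inf (E ` S1) < \<alpha>" using c1 \<alpha> by (simp add: c1_def)
      fix u w assume *: "u \<in> S1" "w \<in> D" "E u < \<alpha>" "N (w - u) \<le> \<rho> / 2"
      then have "N u < \<rho> / 2" using shell[of u] by (force simp: S1_def)
      moreover have "N w \<le> N u + N (w - u)" using N_add[of u "w - u"] * diff_D[of w u] by (auto simp: S1_def)
      ultimately show "w \<in> S1" using * by (simp add: S1_def)
    qed (use z1 r in \<open>auto simp: S1_def\<close>)
    then obtain u where u: "u \<in> S1" "\<bar>E u - c1\<bar> \<le> \<epsilon>" "almost_critical \<epsilon> u" "E u < \<alpha>"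
      using eps unfolding c1_def by blast
    then have "N u \<le> r" using r \<alpha> by (intro coer) (auto simp: S1_def)
    then show ?thesis using u by (auto simp: S1_def)
  qed
  have P2: "\<exists>u\<in>D. N u \<le> r \<and> \<bar>E u - c2\<bar> \<le> \<epsilon> \<and> almost_critical \<epsilon> u" if eps: "\<epsilon> > 0" for \<epsilon>
  proof -
    have "\<forall>\<epsilon>>0. \<exists>u\<in>S2. \<bar>E u - Inf (E ` S2)\<bar> \<le> \<epsilon> \<and> almost_critical \<epsilon> u \<and> E u < K"
    proof (rule local_minimum[where \<sigma> = "(R - r) / 2"])
      show "Inf (E ` S2) < K" using c2 \<kappa> K by (simp add: c2_def)
      fix u w assume *: "u \<in> S2" "w \<in> D" "E u < K" "N (w - u) \<le> (R - r) / 2"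
      then have "N u \<le> r" using coer[of u] by (force simp: S2_def)
      moreover have "N w \<le> N u + N (w - u)" using N_add[of u "w - u"] * diff_D[of w u] by (auto simp: S2_def)
      moreover have "2 * N (w - u) \<le> R - r" using * by simp
      ultimately have "N w < R" using r by linarith
      then show "w \<in> S2" using * by (simp add: S2_def)
    qed (use z2 r in \<open>auto simp: S2_def\<close>)
    then obtain u where u: "u \<in> S2" "\<bar>E u - c2\<bar> \<le> \<epsilon>" "almost_critical \<epsilon> u" "E u < K"
      using eps unfolding c2_def by blast
    then have "N u \<le> r" by (intro coer) (auto simp: S2_def)
    then show ?thesis using u by (auto simp: S2_def)
  qed
  show ?thesis
    by (rule that[of c1 c2 c3]) (use c1 c1' c2 c3 \<alpha> \<kappa> P1 P2 in auto)
qed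

end

section \<open>Hardy's inequality\<close>

text \<open>The gradient is a parameter, so that functions built by product and power rules come
  with an explicit one.\<close>

definition C1c :: "(real ^ 'n \<Rightarrow> real) \<Rightarrow> (real ^ 'n \<Rightarrow> real ^ 'n) \<Rightarrow> bool" where
  "C1c \<phi> g \<longleftrightarrow> (\<forall>x. (\<phi> has_derivative (\<lambda>h. g x \<bullet> h)) (at x)) \<and> continuous_on UNIV g \<and>
    (\<exists>R. \<forall>x. R < norm x \<longrightarrow> \<phi> x = 0)"

lemma C1c_D:
  assumes "C1c \<phi> g"
  shows "(\<phi> has_derivative (\<lambda>h. g x \<bullet> h)) (at x)" "continuous_on UNIV g" "continuous_on UNIV \<phi>"
    "g \<in> borel_measurable borel" "\<phi> \<in> borel_measurable borel"
proof -
  show d: "(\<phi> has_derivative (\<lambda>h. g x \<bullet> h)) (at x)" for x using assms by (auto simp: C1c_def)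
  show g: "continuous_on UNIV g" using assms by (auto simp: C1c_def)
  show \<phi>: "continuous_on UNIV \<phi>"
    using d by (intro continuous_at_imp_continuous_on ballI has_derivative_continuous)
  show "g \<in> borel_measurable borel" "\<phi> \<in> borel_measurable borel"
    using g \<phi> by (auto intro: borel_measurable_continuous_onI)
qed

lemma C1c_support:
  assumes "C1c \<phi> g"
  obtains R where "0 < R" "\<And>x. R < norm x \<Longrightarrow> \<phi> x = 0" "\<And>x. R < norm x \<Longrightarrow> g x = 0"
proof -
  obtain R where R: "\<And>x. R < norm x \<Longrightarrow> \<phi> x = 0" using assms by (auto simp: C1c_def)
  have g0: "g x = 0" if "max 1 R < norm x" for x
  proof -
    have "((\<lambda>x. 0) has_derivative (\<lambda>h. g x \<bullet> h)) (at x)"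
    proof (rule has_derivative_transform_within_open[OF C1c_D(1)[OF assms]])
      show "open {x::real^'n. R < norm x}" by (intro open_Collect_less continuous_intros)
    qed (use that R in auto)
    then have "(\<lambda>h. g x \<bullet> h) = (\<lambda>h. 0)"
      by (rule has_derivative_unique) (rule has_derivative_const)
    then have "g x \<bullet> g x = 0" by meson
    then show ?thesis by simp
  qed
  show ?thesis by (rule that[of "max 1 R"]) (use R g0 in auto)
qed

lemma integrable_compact_support:
  fixes h :: "real ^ 'n \<Rightarrow> 'b::euclidean_space"
  assumes "continuous_on UNIV h" "\<And>x. R < norm x \<Longrightarrow> h x = 0"
  shows "integrable lborel h"
proof -
  have "integrable lborel (\<lambda>x. indicator (cball 0 R) x *\<^sub>R h x)"
    by (intro borel_integrable_compact continuous_on_subset[OF assms(1)]) auto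
  also have "(\<lambda>x. indicator (cball 0 R) x *\<^sub>R h x) = h"
    using assms(2) by (force simp: indicator_def fun_eq_iff)
  finally show ?thesis .
qed

lemma Lps_compact_support:
  fixes h :: "real ^ 'n \<Rightarrow> 'b::euclidean_space"
  assumes "continuous_on UNIV h" "\<And>x. R < norm x \<Longrightarrow> h x = 0" "0 < s"
  shows "h \<in> Lps lborel s"
proof (rule LpsI)
  show "h \<in> borel_measurable lborel"
    using borel_measurable_continuous_onI[OF assms(1)] by simp
  show "integrable lborel (\<lambda>x. norm (h x) powr s)"
  proof (rule integrable_compact_support[where R = R])
    show "continuous_on UNIV (\<lambda>x. norm (h x) powr s)"
      by (intro continuous_on_powr' continuous_on_norm assms(1) continuous_on_const) (use assms in auto)
  qed (use assms in auto)
qed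

lemma C1c_Lps:
  assumes "C1c \<phi> g" "0 < s"
  shows "\<phi> \<in> Lps lborel s" "g \<in> Lps lborel s"
proof -
  obtain R where "0 < R" "\<And>x. R < norm x \<Longrightarrow> \<phi> x = 0" "\<And>x. R < norm x \<Longrightarrow> g x = 0"
    using C1c_support[OF assms(1)] by blast
  then show "\<phi> \<in> Lps lborel s" "g \<in> Lps lborel s"
    using C1c_D[OF assms(1)] assms(2) by (auto intro: Lps_compact_support)
qed

lemma compact_support_bounded:
  fixes h :: "real ^ 'n \<Rightarrow> 'b::euclidean_space"
  assumes "continuous_on UNIV h" "\<And>x. R < norm x \<Longrightarrow> h x = 0"
  obtains B where "0 \<le> B" "\<And>x. norm (h x) \<le> B"
proof -
  have "compact (h ` cball 0 R)"
    by (intro compact_continuous_image continuous_on_subset[OF assms(1)]) auto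
  then obtain B where B: "B > 0" "\<And>x. x \<in> cball 0 R \<Longrightarrow> norm (h x) \<le> B"
    using compact_imp_bounded bounded_pos[of "h ` cball 0 R"] by blast
  have "norm (h x) \<le> B" for x using B(2)[of x] B(1) assms(2)[of x] by (cases "norm x \<le> R") auto
  then show ?thesis using that[of B] B by auto
qed

lemma C1c_lipschitz:
  assumes "C1c \<phi> g" "\<And>x. norm (g x) \<le> B"
  shows "\<bar>\<phi> y - \<phi> x\<bar> \<le> B * norm (y - x)"
proof -
  have "norm (\<phi> y - \<phi> x) \<le> B * norm (y - x)"
  proof (rule differentiable_bound[where S = UNIV])
    show "(\<phi> has_derivative (\<lambda>h. g x \<bullet> h)) (at x within UNIV)" for x using C1c_D[OF assms(1)] by simp
    show "onorm (\<lambda>h. g x \<bullet> h) \<le> B" for x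
      using assms(2)[of x] by (intro onorm_le) (auto intro!: order_trans[OF Cauchy_Schwarz_ineq2] mult_right_mono)
  qed auto
  then show ?thesis by simp
qed

lemma integral_translate:
  fixes f :: "'a::euclidean_space \<Rightarrow> 'b::euclidean_space"
  assumes "f \<in> borel_measurable borel"
  shows "(\<integral>x. f (x + z) \<partial>lborel) = (\<integral>x. f x \<partial>lborel)"
proof -
  have "(\<integral>x. f x \<partial>lborel) = (\<integral>x. f x \<partial>(distr lborel borel ((+) z)))" by (simp add: lborel_distr_plus)
  also have "\<dots> = (\<integral>x. f (z + x) \<partial>lborel)" using assms by (intro integral_distr) auto
  finally show ?thesis by (simp add: add.commute)
qed

lemma integrable_translate:
  fixes f :: "'a::euclidean_space \<Rightarrow> 'b::euclidean_space"
  assumes "integrable lborel f"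
  shows "integrable lborel (\<lambda>x. f (x + z))"
proof -
  have "integrable (distr lborel borel ((+) z)) f" using assms by (simp add: lborel_distr_plus)
  then show ?thesis using assms by (subst (asm) integrable_distr_eq) (auto simp: add.commute)
qed

text \<open>Translation invariance of the integral replaces Fubini's theorem: the difference quotients of
  \<open>\<phi>\<close> have integral zero, and so has their limit.\<close>

lemma integral_directional_derivative_0:
  assumes \<phi>: "C1c \<phi> g"
  shows "(\<integral>x. g x \<bullet> z \<partial>lborel) = 0"
proof -
  obtain R where R: "0 < R" "\<And>x. R < norm x \<Longrightarrow> \<phi> x = 0" "\<And>x. R < norm x \<Longrightarrow> g x = 0"
    using C1c_support[OF \<phi>] by blast
  obtain B where B: "0 \<le> B" "\<And>x. norm (g x) \<le> B"
    using compact_support_bounded[OF C1c_D(2)[OF \<phi>] R(3)] by blast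
  note [measurable] = C1c_D(4,5)[OF \<phi>]
  define q where "q k x = real (Suc k) * (\<phi> (x + z /\<^sub>R real (Suc k)) - \<phi> x)" for k x
  have int: "integrable lborel \<phi>" by (rule integrable_compact_support[OF C1c_D(3)[OF \<phi>] R(2)])
  have "(\<lambda>k. \<integral>x. q k x \<partial>lborel) \<longlonglongrightarrow> (\<integral>x. g x \<bullet> z \<partial>lborel)"
  proof (rule integral_dominated_convergence)
    show "integrable lborel (\<lambda>x. indicator (cball 0 (R + norm z)) x *\<^sub>R (B * norm z))"
      by (intro borel_integrable_compact) auto
    show "AE x in lborel. (\<lambda>k. q k x) \<longlonglongrightarrow> g x \<bullet> z"
    proof (intro AE_I2)
      fix x
      have "((\<lambda>t. \<phi> (x + t *\<^sub>R z)) has_derivative (\<lambda>h. g (x + 0 *\<^sub>R z) \<bullet> (h *\<^sub>R z))) (at 0)"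
        by (rule has_derivative_compose[OF _ C1c_D(1)[OF \<phi>]]) (auto intro!: derivative_eq_intros)
      then have "((\<lambda>t. \<phi> (x + t *\<^sub>R z)) has_real_derivative g x \<bullet> z) (at 0)"
        by (simp add: has_field_derivative_def mult_commute_abs)
      then have "((\<lambda>h. (\<phi> (x + h *\<^sub>R z) - \<phi> x) / h) \<longlongrightarrow> g x \<bullet> z) (at 0)"
        by (simp add: DERIV_def)
      moreover have "filterlim (\<lambda>k. 1 / real (Suc k)) (at 0) sequentially"
        unfolding filterlim_at using LIMSEQ_Suc[OF lim_1_over_n] by (auto simp del: of_nat_Suc)
      ultimately have "(\<lambda>k. (\<phi> (x + (1 / real (Suc k)) *\<^sub>R z) - \<phi> x) / (1 / real (Suc k))) \<longlonglongrightarrow> g x \<bullet> z"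
        by (rule filterlim_compose)
      then show "(\<lambda>k. q k x) \<longlonglongrightarrow> g x \<bullet> z"
        by (simp add: q_def divide_inverse mult.commute del: of_nat_Suc)
    qed
    fix k
    show "AE x in lborel. norm (q k x) \<le> indicator (cball 0 (R + norm z)) x *\<^sub>R (B * norm z)"
    proof (intro AE_I2)
      fix x
      show "norm (q k x) \<le> indicator (cball 0 (R + norm z)) x *\<^sub>R (B * norm z)"
      proof (cases "x \<in> cball 0 (R + norm z)")
        case True
        have "\<bar>\<phi> (x + z /\<^sub>R real (Suc k)) - \<phi> x\<bar> \<le> B * norm (z /\<^sub>R real (Suc k))"
          using C1c_lipschitz[OF \<phi> B(2), of "x + z /\<^sub>R real (Suc k)" x] by simp
        then have "real (Suc k) * \<bar>\<phi> (x + z /\<^sub>R real (Suc k)) - \<phi> x\<bar> \<le> real (Suc k) * (B * norm (z /\<^sub>R real (Suc k)))"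
          by (intro mult_left_mono) auto
        also have "\<dots> = B * norm z" by (simp add: divide_simps)
        finally show ?thesis using True by (simp add: q_def abs_mult del: of_nat_Suc)
      next
        case False
        then have n: "R + norm z < norm x" by simp
        have "norm (z /\<^sub>R real (Suc k)) \<le> norm z" by (simp add: mult_left_le_one_le field_simps)
        then have "R < norm (x + z /\<^sub>R real (Suc k))"
          using n norm_triangle_ineq2[of x "- (z /\<^sub>R real (Suc k))"] by simp
        moreover have "R < norm x" using n norm_ge_zero[of z] by linarith
        ultimately show ?thesis using False R by (simp add: q_def)
      qed
    qed
  qed (auto simp: q_def)
  moreover have "(\<integral>x. q k x \<partial>lborel) = 0" for k
    using integral_translate[of \<phi> "z /\<^sub>R real (Suc k)"] integrable_translate[OF int, of "z /\<^sub>R real (Suc k)"] int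
    by (simp add: q_def del: of_nat_Suc)
  ultimately show ?thesis by (simp add: LIMSEQ_const_iff)
qed

lemma C1c_mult:
  assumes \<phi>: "C1c \<phi> g" and w: "\<And>x. (w has_derivative (\<lambda>h. v x \<bullet> h)) (at x)" "continuous_on UNIV v"
  shows "C1c (\<lambda>x. \<phi> x * w x) (\<lambda>x. \<phi> x *\<^sub>R v x + w x *\<^sub>R g x)"
  unfolding C1c_def
proof (intro conjI allI)
  have cw: "continuous_on UNIV w"
    using w by (intro continuous_at_imp_continuous_on ballI has_derivative_continuous)
  show "((\<lambda>x. \<phi> x * w x) has_derivative (\<lambda>h. (\<phi> x *\<^sub>R v x + w x *\<^sub>R g x) \<bullet> h)) (at x)" for x
    using has_derivative_mult[OF C1c_D(1)[OF \<phi>] w(1), of x] by (simp add: algebra_simps)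
  show "continuous_on UNIV (\<lambda>x. \<phi> x *\<^sub>R v x + w x *\<^sub>R g x)"
    by (intro continuous_intros C1c_D[OF \<phi>] w cw)
  show "\<exists>R. \<forall>x. R < norm x \<longrightarrow> \<phi> x * w x = 0"
    using \<phi> unfolding C1c_def by auto
qed

text \<open>For \<open>p \<ge> 2\<close> the power of the absolute value is continuously
  differentiable across 0, so zeros of \<open>\<phi>\<close> cause no trouble.\<close>

lemma C1c_powr:
  assumes \<phi>: "C1c \<phi> g" and p: "2 \<le> p"
  shows "C1c (\<lambda>x. \<bar>\<phi> x\<bar> powr p) (\<lambda>x. (p * pflux p (\<phi> x)) *\<^sub>R g x)"
  unfolding C1c_def
proof (intro conjI allI)
  show "((\<lambda>x. \<bar>\<phi> x\<bar> powr p) has_derivative (\<lambda>h. ((p * pflux p (\<phi> x)) *\<^sub>R g x) \<bullet> h)) (at x)" for x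
  proof -
    have "((\<lambda>x. norm (\<phi> x) powr p / p) has_derivative (\<lambda>h. pflux p (\<phi> x) \<bullet> (g x \<bullet> h))) (at x)"
      by (rule has_derivative_compose[OF C1c_D(1)[OF \<phi>] has_derivative_norm_powr[OF p]])
    from has_derivative_mult_right[OF this, of p] show ?thesis
      using p by (simp add: mult.assoc)
  qed
  have "continuous_on UNIV (pflux p :: real \<Rightarrow> real)" using nemy_pflux[OF p] unfolding nemy_def by blast
  then have "continuous_on UNIV (\<lambda>x. pflux p (\<phi> x))"
    by (rule continuous_on_compose2[OF _ C1c_D(3)[OF \<phi>]]) auto
  then show "continuous_on UNIV (\<lambda>x. (p * pflux p (\<phi> x)) *\<^sub>R g x)"
    by (rule continuous_on_scaleR[OF continuous_on_mult[OF continuous_on_const] C1c_D(2)[OF \<phi>]])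
  obtain R where "0 < R" "\<And>x. R < norm x \<Longrightarrow> \<phi> x = 0" "\<And>x. R < norm x \<Longrightarrow> g x = 0"
    using C1c_support[OF \<phi>] by blast
  then show "\<exists>R. \<forall>x. R < norm x \<longrightarrow> \<bar>\<phi> x\<bar> powr p = 0" by (intro exI[of _ R]) auto
qed

text \<open>The vector field
  \<open>x / ((norm x)\<^sup>2 + \<epsilon>) powr (p / 2)\<close> has divergence at least \<open>(n - p) / ((norm x)\<^sup>2 + \<epsilon>) powr (p / 2)\<close>.\<close>

lemma Hardy_regularised:
  fixes \<phi> :: "real ^ 'n \<Rightarrow> real" and p :: real
  assumes \<phi>: "C1c \<phi> g" and p: "2 \<le> p" "p < CARD('n)" and eps: "\<epsilon> > 0"
  shows "(\<lambda>x. \<phi> x / sqrt ((norm x)\<^sup>2 + \<epsilon>)) \<in> Lps lborel p"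
    "lpn lborel p (\<lambda>x. \<phi> x / sqrt ((norm x)\<^sup>2 + \<epsilon>)) \<le> p / (CARD('n) - p) * lpn lborel p g"
proof -
  define m where "m x = (norm x)\<^sup>2 + \<epsilon>" for x :: "real ^ 'n"
  have m: "m x > 0" for x using eps by (simp add: m_def add_nonneg_pos)
  have mn: "m x \<noteq> 0" for x using m[of x] by simp
  have cm: "continuous_on UNIV m" unfolding m_def by (intro continuous_intros)
  define w where "w x = m x powr (- p / 2)" for x
  define v where "v x = (- p * m x powr (- p / 2 - 1)) *\<^sub>R x" for x :: "real ^ 'n"
  have dm: "(m has_derivative (\<lambda>h. 2 * (x \<bullet> h))) (at x)" for x
    unfolding m_def power2_norm_eq_inner
    by (auto intro!: derivative_eq_intros simp: inner_commute)
  have dw: "(w has_derivative (\<lambda>h. v x \<bullet> h)) (at x)" for x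
  proof -
    have "((\<lambda>t. t powr (- p / 2)) has_derivative (*) (- p / 2 * m x powr (- p / 2 - 1))) (at (m x))"
      using has_real_derivative_powr[OF m, of "- p / 2" x] by (simp add: has_field_derivative_def)
    from has_derivative_compose[OF dm this] show ?thesis
      by (simp add: w_def[abs_def] v_def mult_ac)
  qed
  have cv: "continuous_on UNIV v" unfolding v_def by (intro continuous_intros cm) (use mn in auto)
  define U where "U x = \<phi> x / sqrt (m x)" for x
  obtain R where R: "0 < R" "\<And>x. R < norm x \<Longrightarrow> \<phi> x = 0" "\<And>x. R < norm x \<Longrightarrow> g x = 0"
    using C1c_support[OF \<phi>] by blast
  have cU: "continuous_on UNIV U" unfolding U_def by (intro continuous_intros C1c_D[OF \<phi>] cm) (use m mn in auto)
  have U: "U \<in> Lps lborel p"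
    using cU R p by (intro Lps_compact_support[of _ R]) (auto simp: U_def)
  then show "(\<lambda>x. \<phi> x / sqrt ((norm x)\<^sup>2 + \<epsilon>)) \<in> Lps lborel p" by (simp add: U_def[abs_def] m_def)
  \<comment> \<open>\<open>Q\<close> is the p-th power of the regularised quotient \<open>U\<close>,
    whose integral is to be estimated, and \<open>q\<close> is its gradient.\<close>
  define Q where "Q x = \<bar>\<phi> x\<bar> powr p * w x" for x
  define q where "q x = \<bar>\<phi> x\<bar> powr p *\<^sub>R v x + w x *\<^sub>R ((p * pflux p (\<phi> x)) *\<^sub>R g x)" for x
  have Q: "C1c Q q"
    unfolding Q_def[abs_def] q_def[abs_def] by (rule C1c_mult[OF C1c_powr[OF \<phi> p(1)] dw cv])
  have sm: "sqrt (m x) = m x powr (1 / 2)" for x using m[of x] by (simp add: powr_half_sqrt)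
  have UE: "\<bar>U x\<bar> powr r = \<bar>\<phi> x\<bar> powr r * m x powr (- r / 2)" for x r
  proof -
    have "\<bar>U x\<bar> = \<bar>\<phi> x\<bar> / m x powr (1 / 2)" unfolding U_def sm by simp
    then have "\<bar>U x\<bar> powr r = \<bar>\<phi> x\<bar> powr r / (m x powr (1 / 2)) powr r" by (simp add: powr_divide)
    also have "(m x powr (1 / 2)) powr r = m x powr (r / 2)" by (simp add: powr_powr)
    finally show ?thesis using powr_minus_divide[of "m x" "r / 2"] by simp
  qed
  have QU: "Q x = \<bar>U x\<bar> powr p" for x
    unfolding UE by (simp add: Q_def w_def)
  obtain RQ where RQ: "0 < RQ" "\<And>x. RQ < norm x \<Longrightarrow> Q x = 0" "\<And>x. RQ < norm x \<Longrightarrow> q x = 0" using C1c_support[OF Q] by blast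
  have Qi: "integrable lborel Q" by (rule integrable_compact_support[OF C1c_D(3)[OF Q] RQ(2)])
  have cq: "continuous_on UNIV (\<lambda>x. q x \<bullet> x)" by (intro continuous_intros C1c_D[OF Q])
  have qi: "integrable lborel (\<lambda>x. q x \<bullet> x)"
    by (rule integrable_compact_support[OF cq, of RQ]) (simp add: RQ(3))
  \<comment> \<open>The divergence theorem for the field \<open>Q x *\<^sub>R x\<close>, one
    coordinate at a time: each coordinate is a compactly supported C^1 function, whose directional
    derivatives have integral 0.\<close>
  have i0: "integrable lborel (\<lambda>x. (Q x *\<^sub>R axis i 1 + (x $ i) *\<^sub>R q x) \<bullet> axis i 1)"
    "(\<integral>x. (Q x *\<^sub>R axis i 1 + (x $ i) *\<^sub>R q x) \<bullet> axis i 1 \<partial>lborel) = 0" for i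
  proof -
    have *: "C1c (\<lambda>x. Q x * (x $ i)) (\<lambda>x. Q x *\<^sub>R axis i 1 + (x $ i) *\<^sub>R q x)"
    proof (rule C1c_mult[OF Q])
      show "((\<lambda>x. x $ i) has_derivative (\<lambda>h. axis i 1 \<bullet> h)) (at x)" for x :: "real ^ 'n"
        using bounded_linear_imp_has_derivative[OF bounded_linear_vec_nth[of i], of "at x"] by (simp add: inner_axis')
    qed auto
    then show "(\<integral>x. (Q x *\<^sub>R axis i 1 + (x $ i) *\<^sub>R q x) \<bullet> axis i 1 \<partial>lborel) = 0"
      by (rule integral_directional_derivative_0)
    have c: "continuous_on UNIV (\<lambda>x. (Q x *\<^sub>R axis i 1 + (x $ i) *\<^sub>R q x) \<bullet> axis i 1)"
      by (intro continuous_intros C1c_D[OF *])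
    show "integrable lborel (\<lambda>x. (Q x *\<^sub>R axis i 1 + (x $ i) *\<^sub>R q x) \<bullet> axis i 1)"
      by (rule integrable_compact_support[OF c, of RQ]) (simp add: RQ)
  qed
  have s: "(\<Sum>i\<in>UNIV. (Q x *\<^sub>R axis i 1 + (x $ i) *\<^sub>R q x) \<bullet> axis i 1) = CARD('n) * Q x + q x \<bullet> x" for x
  proof -
    have "(Q x *\<^sub>R axis i 1 + (x $ i) *\<^sub>R q x) \<bullet> axis i 1 = Q x + q x $ i * x $ i" for i
      by (simp add: inner_add_left inner_axis_axis inner_axis mult.commute)
    then show ?thesis by (simp add: sum.distrib inner_vec_def[of "q x" x])
  qed
  have "(\<integral>x. CARD('n) * Q x + q x \<bullet> x \<partial>lborel) = 0"
    unfolding s[symmetric] using i0 by (subst Bochner_Integration.integral_sum) auto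
  then have id: "(\<integral>x. CARD('n) * Q x + q x \<bullet> x \<partial>lborel) = 0" .
  have Ug: "integrable lborel (\<lambda>x. norm (U x) powr (p - 1) * norm (g x))"
     "(\<integral>x. norm (U x) powr (p - 1) * norm (g x) \<partial>lborel) \<le> lpn lborel p U powr (p - 1) * lpn lborel p g"
    using Holder_powr[OF _ U C1c_Lps(2)[OF \<phi>, of p]] p by auto
  \<comment> \<open>A lower bound for the divergence. In the term coming from the weight, the
    squared norm of \<open>x\<close> is replaced by the larger \<open>m x\<close>; in the term with
    \<open>g\<close>, the norm of \<open>x\<close> by the larger root of \<open>m x\<close>.\<close>
  have pw: "(CARD('n) - p) * Q x - p * (norm (U x) powr (p - 1) * norm (g x)) \<le> CARD('n) * Q x + q x \<bullet> x" for x
  proof -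
    have qx: "q x \<bullet> x = - p * (\<bar>\<phi> x\<bar> powr p * (m x powr (- p / 2 - 1) * (norm x)\<^sup>2)) + p * (w x * pflux p (\<phi> x) * (g x \<bullet> x))"
      by (simp add: q_def v_def inner_add_left inner_diff_left power2_norm_eq_inner algebra_simps)
    have 1: "\<bar>\<phi> x\<bar> powr p * (m x powr (- p / 2 - 1) * (norm x)\<^sup>2) \<le> Q x"
    proof -
      have "m x powr (- p / 2 - 1) * (norm x)\<^sup>2 \<le> m x powr (- p / 2 - 1) * m x"
        using eps by (intro mult_left_mono) (auto simp: m_def)
      also have "\<dots> = w x" using m[of x] by (simp add: w_def powr_diff)
      finally show ?thesis unfolding Q_def by (intro mult_left_mono) auto
    qed
    have 2: "- (w x * pflux p (\<phi> x) * (g x \<bullet> x)) \<le> norm (U x) powr (p - 1) * norm (g x)"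
    proof -
      have "- (w x * pflux p (\<phi> x) * (g x \<bullet> x)) \<le> \<bar>w x * pflux p (\<phi> x) * (g x \<bullet> x)\<bar>" by linarith
      also have "\<dots> = w x * \<bar>\<phi> x\<bar> powr (p - 1) * \<bar>g x \<bullet> x\<bar>"
        by (cases "\<phi> x = 0") (auto simp: w_def abs_mult powr_diff power2_eq_square)
      also have "\<dots> \<le> w x * \<bar>\<phi> x\<bar> powr (p - 1) * (norm (g x) * sqrt (m x))"
      proof (intro mult_left_mono)
        have "norm x \<le> sqrt (m x)" using eps by (intro real_le_rsqrt) (simp add: m_def)
        then show "\<bar>g x \<bullet> x\<bar> \<le> norm (g x) * sqrt (m x)"
          by (intro order_trans[OF Cauchy_Schwarz_ineq2] mult_left_mono) auto
      qed (auto simp: w_def)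
      also have "\<dots> = norm (U x) powr (p - 1) * norm (g x)"
      proof -
        have "w x * sqrt (m x) = m x powr (- (p - 1) / 2)"
          unfolding sm w_def powr_add[symmetric] by (simp add: field_simps)
        moreover have "norm (U x) powr (p - 1) = \<bar>\<phi> x\<bar> powr (p - 1) * m x powr (- (p - 1) / 2)"
          using UE[of x "p - 1"] by simp
        moreover have "w x * \<bar>\<phi> x\<bar> powr (p - 1) * (norm (g x) * sqrt (m x)) = \<bar>\<phi> x\<bar> powr (p - 1) * (w x * sqrt (m x)) * norm (g x)"
          by (simp only: mult_ac)
        ultimately show ?thesis by simp
      qed
      finally show ?thesis .
    qed
    have "q x \<bullet> x \<ge> - p * Q x - p * (norm (U x) powr (p - 1) * norm (g x))"
    proof -
      have "p * (\<bar>\<phi> x\<bar> powr p * (m x powr (- p / 2 - 1) * (norm x)\<^sup>2)) \<le> p * Q x"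
        "p * - (w x * pflux p (\<phi> x) * (g x \<bullet> x)) \<le> p * (norm (U x) powr (p - 1) * norm (g x))"
        by (rule mult_left_mono[OF 1] mult_left_mono[OF 2]; use p in simp)+
      then show ?thesis unfolding qx by simp
    qed
    then show ?thesis by (simp add: algebra_simps)
  qed
  have "(\<integral>x. (CARD('n) - p) * Q x - p * (norm (U x) powr (p - 1) * norm (g x)) \<partial>lborel) \<le> (\<integral>x. CARD('n) * Q x + q x \<bullet> x \<partial>lborel)"
    by (intro integral_mono pw Bochner_Integration.integrable_diff Bochner_Integration.integrable_add integrable_mult_right Qi qi Ug)
  then have "(CARD('n) - p) * (\<integral>x. Q x \<partial>lborel) \<le> p * (\<integral>x. norm (U x) powr (p - 1) * norm (g x) \<partial>lborel)"
    using id Qi Ug(1) by simp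
  also have "\<dots> \<le> p * (lpn lborel p U powr (p - 1) * lpn lborel p g)" using Ug(2) p by (intro mult_left_mono) auto
  also have "(\<integral>x. Q x \<partial>lborel) = lpn lborel p U powr p" using p by (simp add: lpn_powr QU)
  finally have fin: "(CARD('n) - p) * lpn lborel p U powr p \<le> p * (lpn lborel p U powr (p - 1) * lpn lborel p g)" .
  \<comment> \<open>Dividing by a power of the norm of \<open>U\<close> is legitimate because the
    regularised quotient is known beforehand to lie in L^p. For the singular quotient this would be
    circular.\<close>
  have "lpn lborel p U \<le> p / (CARD('n) - p) * lpn lborel p g"
  proof (cases "lpn lborel p U = 0")
    case False
    then have U0: "lpn lborel p U > 0" using lpn_nonneg[of lborel p U] by linarith
    have "lpn lborel p U powr (p - 1) * ((CARD('n) - p) * lpn lborel p U) \<le> lpn lborel p U powr (p - 1) * (p * lpn lborel p g)"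
      using fin U0 by (simp add: powr_diff mult_ac)
    then have "(CARD('n) - p) * lpn lborel p U \<le> p * lpn lborel p g" using U0 by simp
    then show ?thesis using p by (simp add: field_simps)
  qed (use p in auto)
  then show "lpn lborel p (\<lambda>x. \<phi> x / sqrt ((norm x)\<^sup>2 + \<epsilon>)) \<le> p / (CARD('n) - p) * lpn lborel p g"
    by (simp add: U_def[abs_def] m_def)
qed

text \<open>The regularised inequality has a constant independent of \<open>\<epsilon>\<close>, so
  Fatou's lemma along \<epsilon> = 1/(k+1) removes the regularisation; the origin is a null
  set.\<close>

lemma Hardy:
  fixes \<phi> :: "real ^ 'n \<Rightarrow> real" and p :: real
  assumes \<phi>: "C1c \<phi> g" and p: "2 \<le> p" "p < CARD('n)"
  shows "(\<lambda>x. \<phi> x / norm x) \<in> Lps lborel p"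
    "lpn lborel p (\<lambda>x. \<phi> x / norm x) \<le> p / (CARD('n) - p) * lpn lborel p g"
proof -
  note [measurable] = C1c_D(4,5)[OF \<phi>]
  have lim: "AE x in lborel. (\<lambda>k. \<phi> x / sqrt ((norm x)\<^sup>2 + 1 / real (Suc k))) \<longlonglongrightarrow> \<phi> x / norm x"
    using AE_lborel_singleton[of 0]
  proof eventually_elim
    case (elim x)
    have "(\<lambda>k. \<phi> x / sqrt ((norm x)\<^sup>2 + 1 / real (Suc k))) \<longlonglongrightarrow> \<phi> x / sqrt ((norm x)\<^sup>2 + 0)"
      using elim by (intro tendsto_intros LIMSEQ_Suc[OF lim_1_over_n]) auto
    then show ?case by simp
  qed
  have "(\<lambda>x. \<phi> x / norm x) \<in> borel_measurable lborel" by measurable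
  from lpn_Fatou[of "\<lambda>k x. \<phi> x / sqrt ((norm x)\<^sup>2 + 1 / real (Suc k))", OF Hardy_regularised(1)[OF \<phi> p] this lim
      Hardy_regularised(2)[OF \<phi> p]]
  show "(\<lambda>x. \<phi> x / norm x) \<in> Lps lborel p"
    "lpn lborel p (\<lambda>x. \<phi> x / norm x) \<le> p / (CARD('n) - p) * lpn lborel p g"
    using p by auto
qed

text \<open>On the support the norm of \<open>x\<close> is at most \<open>R\<close>, hence the
  absolute value of \<open>\<phi> x\<close> is at most \<open>R\<close> times that of
  \<open>\<phi> x / norm x\<close>, and Hardy's inequality applies.\<close>

lemma Poincare:
  fixes \<phi> :: "real ^ 'n \<Rightarrow> real" and p :: real
  assumes \<phi>: "C1c \<phi> g" and p: "2 \<le> p" "p < CARD('n)" and R: "0 \<le> R" "\<And>x. R < norm x \<Longrightarrow> \<phi> x = 0"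
  shows "lpn lborel p \<phi> \<le> R * (p / (CARD('n) - p)) * lpn lborel p g"
proof -
  note [measurable] = C1c_D(4,5)[OF \<phi>]
  have "lpn lborel p \<phi> \<le> lpn lborel p (\<lambda>x. R * (\<phi> x / norm x))"
  proof (rule lpn_mono)
    show "AE x in lborel. norm (\<phi> x) \<le> norm (R * (\<phi> x / norm x))"
      using AE_lborel_singleton[of 0]
    proof eventually_elim
      case (elim x)
      show ?case
      proof (cases "norm x \<le> R")
        case True
        have "\<bar>\<phi> x\<bar> * norm x \<le> \<bar>\<phi> x\<bar> * R" using True by (intro mult_left_mono) auto
        then show ?thesis using elim R by (simp add: abs_mult field_simps)
      qed (use R in simp)
    qed
    show "(\<lambda>x. R * (\<phi> x / norm x)) \<in> Lps lborel p" using Hardy(1)[OF \<phi> p] by (rule Lps_mult)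
  qed (use p in auto)
  also have "\<dots> = R * lpn lborel p (\<lambda>x. \<phi> x / norm x)"
    using p R by (subst lpn_mult) auto
  also have "\<dots> \<le> R * (p / (CARD('n) - p) * lpn lborel p g)"
    by (intro mult_left_mono Hardy(2) \<phi> p R)
  finally show ?thesis by (simp add: mult.assoc)
qed

section \<open>Averages over cubes\<close>

lemma measurable_continuous_pair:
  fixes H :: "'a::euclidean_space \<times> 'c::euclidean_space \<Rightarrow> 'b::euclidean_space"
  assumes "continuous_on UNIV H"
  shows "H \<in> borel_measurable (lborel \<Otimes>\<^sub>M restrict_space lborel S)"
proof -
  have 1: "H \<in> borel_measurable (borel \<Otimes>\<^sub>M borel)"
    using borel_measurable_continuous_onI[OF assms] by (simp add: borel_prod)
  have "(\<lambda>x. x) \<in> restrict_space lborel S \<rightarrow>\<^sub>M borel"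
    by (rule measurable_restrict_space1) auto
  then have "(\<lambda>w. (fst w, snd w)) \<in> lborel \<Otimes>\<^sub>M restrict_space lborel S \<rightarrow>\<^sub>M borel \<Otimes>\<^sub>M borel"
    by (intro measurable_Pair measurable_compose[OF measurable_snd, of "\<lambda>x. x"] measurable_compose[OF measurable_fst, of "\<lambda>x. x"]) auto
  from measurable_compose[OF this 1] show ?thesis by simp
qed

lemma unit_mass_box:
  assumes "measure lborel (cbox a b) = 1"
  shows "finite_measure (restrict_space lborel (cbox a b))"
    "lpn (restrict_space lborel (cbox a b)) s (\<lambda>x. 1::real) = 1"
proof -
  show 1: "finite_measure (restrict_space lborel (cbox a b))"
    by (rule finite_measureI) (simp add: emeasure_restrict_space space_restrict_space emeasure_lborel_cbox_eq)
  have "measure (restrict_space lborel (cbox a b)) (space (restrict_space lborel (cbox a b))) = 1"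
    using assms by (simp add: measure_restrict_space space_restrict_space)
  then show "lpn (restrict_space lborel (cbox a b)) s (\<lambda>x. 1::real) = 1"
    by (simp add: lpn_def)
qed

lemma continuous_Lps_box:
  fixes f :: "'a::euclidean_space \<Rightarrow> 'b::euclidean_space"
  assumes "continuous_on UNIV f" "0 < s"
  shows "f \<in> Lps (restrict_space lborel (cbox a b)) s" "integrable (restrict_space lborel (cbox a b)) f"
proof -
  have *: "integrable (restrict_space lborel (cbox a b)) h" if "continuous_on UNIV h" for h :: "'a \<Rightarrow> 'c::euclidean_space"
    using borel_integrable_compact[OF compact_cbox continuous_on_subset[OF that subset_UNIV], of a b]
    by (subst integrable_restrict_space) auto
  have "f \<in> borel_measurable (restrict_space lborel (cbox a b))"
    using borel_measurable_continuous_onI[OF assms(1)] by (intro measurable_restrict_space1) auto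
  moreover have "continuous_on UNIV (\<lambda>x. norm (f x) powr s)"
    by (intro continuous_on_powr' continuous_on_norm assms(1) continuous_on_const) (use assms in auto)
  ultimately show "f \<in> Lps (restrict_space lborel (cbox a b)) s" by (intro LpsI *)
  show "integrable (restrict_space lborel (cbox a b)) f" by (rule *[OF assms(1)])
qed

text \<open>Hoelder's inequality on the box of unit mass bounds the power of the mean by the mean of
  the powers, and Tonelli's theorem exchanges the integrals. Only a bound uniform in
  \<open>y\<close> is carried through, which is all that averages need.\<close>

lemma Minkowski_integral:
  fixes F :: "'a::euclidean_space \<Rightarrow> 'c::euclidean_space \<Rightarrow> 'b::euclidean_space"
  defines "M \<equiv> \<lambda>a b :: 'c. restrict_space lborel (cbox a b)"
  assumes box: "measure lborel (cbox a b) = 1" and s: "1 < s"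
    and F: "continuous_on UNIV (\<lambda>(x, y). F x y)"
    and B: "\<And>y. y \<in> cbox a b \<Longrightarrow> (\<lambda>x. F x y) \<in> Lps lborel s" "\<And>y. y \<in> cbox a b \<Longrightarrow> lpn lborel s (\<lambda>x. F x y) \<le> B"
  shows "(\<lambda>x. \<integral>y. F x y \<partial>M a b) \<in> Lps lborel s" "lpn lborel s (\<lambda>x. \<integral>y. F x y \<partial>M a b) \<le> B"
proof -
  interpret Mf: finite_measure "M a b" using unit_mass_box(1)[OF box] by (simp add: M_def)
  interpret P: pair_sigma_finite "lborel :: 'a measure" "M a b" ..
  have one: "lpn (M a b) s (\<lambda>x. 1::real) = 1" using unit_mass_box(2)[OF box] by (simp add: M_def)
  have sp: "space (M a b) = cbox a b" by (simp add: M_def space_restrict_space)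
  have "cbox a b \<noteq> {}" using box by force
  then obtain y0 where "y0 \<in> cbox a b" by blast
  then have B0: "0 \<le> B" using B(2)[of y0] lpn_nonneg[of lborel s "\<lambda>x. F x y0"] by linarith
  have meas: "(\<lambda>(x, y). F x y) \<in> borel_measurable (lborel \<Otimes>\<^sub>M M a b)"
    unfolding M_def by (rule measurable_continuous_pair[OF F])
  define u where "u x = (\<integral>y. F x y \<partial>M a b)" for x
  have um: "u \<in> borel_measurable lborel"
    unfolding u_def by (rule Mf.borel_measurable_lebesgue_integral[OF meas])
  have Fx: "continuous_on UNIV (F x)" for x
    by (rule continuous_on_compose2[OF F, of _ "\<lambda>y. (x, y)", simplified]) (auto intro!: continuous_intros)
  have FL: "F x \<in> Lps (M a b) s" for x
    unfolding M_def using s by (intro continuous_Lps_box Fx) auto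
  have pt: "ennreal (norm (u x) powr s) \<le> (\<integral>\<^sup>+y. ennreal (norm (F x y) powr s) \<partial>M a b)" for x
  proof -
    have "norm (u x) \<le> (\<integral>y. norm (F x y) \<partial>M a b)" unfolding u_def by (rule integral_norm_bound)
    also have "\<dots> \<le> lpn (M a b) s (F x)"
      using Holder_finite(2)[OF Mf.finite_measure_axioms s FL, of x] by (simp add: one)
    finally have "norm (u x) powr s \<le> lpn (M a b) s (F x) powr s" using s by (intro powr_mono2) auto
    also have "\<dots> = (\<integral>y. norm (F x y) powr s \<partial>M a b)" using s by (simp add: lpn_powr)
    finally have "ennreal (norm (u x) powr s) \<le> ennreal (\<integral>y. norm (F x y) powr s \<partial>M a b)" by (rule ennreal_leI)
    also have "\<dots> = (\<integral>\<^sup>+y. ennreal (norm (F x y) powr s) \<partial>M a b)"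
      using LpsD(2)[OF FL] by (intro nn_integral_eq_integral[symmetric]) auto
    finally show ?thesis .
  qed
  have meas': "(\<lambda>(x, y). ennreal (norm (F x y) powr s)) \<in> borel_measurable (lborel \<Otimes>\<^sub>M M a b)"
  proof -
    have "(\<lambda>w. ennreal (norm (case w of (x, y) \<Rightarrow> F x y) powr s)) \<in> borel_measurable (lborel \<Otimes>\<^sub>M M a b)"
      using meas by measurable
    then show ?thesis by (simp add: split_beta')
  qed
  have "(\<integral>\<^sup>+x. ennreal (norm (u x) powr s) \<partial>lborel) \<le> (\<integral>\<^sup>+x. \<integral>\<^sup>+y. ennreal (norm (F x y) powr s) \<partial>M a b \<partial>lborel)"
    by (intro nn_integral_mono pt)
  also have "\<dots> = (\<integral>\<^sup>+y. \<integral>\<^sup>+x. ennreal (norm (F x y) powr s) \<partial>lborel \<partial>M a b)"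
    by (rule P.Fubini'[OF meas', symmetric])
  also have "\<dots> \<le> (\<integral>\<^sup>+y. ennreal (B powr s) \<partial>M a b)"
  proof (rule nn_integral_mono)
    fix y assume "y \<in> space (M a b)"
    then have y: "y \<in> cbox a b" by (simp add: sp)
    have "(\<integral>\<^sup>+x. ennreal (norm (F x y) powr s) \<partial>lborel) = ennreal (\<integral>x. norm (F x y) powr s \<partial>lborel)"
      using LpsD(2)[OF B(1)[OF y]] by (intro nn_integral_eq_integral) auto
    also have "(\<integral>x. norm (F x y) powr s \<partial>lborel) = lpn lborel s (\<lambda>x. F x y) powr s"
      using s by (simp add: lpn_powr)
    also have "ennreal \<dots> \<le> ennreal (B powr s)"
      using B(2)[OF y] s by (intro ennreal_leI powr_mono2) auto
    finally show "(\<integral>\<^sup>+x. ennreal (norm (F x y) powr s) \<partial>lborel) \<le> ennreal (B powr s)" .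
  qed
  also have "\<dots> = ennreal (B powr s)"
  proof -
    have "measure (M a b) (space (M a b)) = 1"
      using box by (simp add: M_def measure_restrict_space space_restrict_space)
    then have "emeasure (M a b) (space (M a b)) = 1" by (simp add: Mf.emeasure_eq_measure)
    then show ?thesis by simp
  qed
  finally have le: "(\<integral>\<^sup>+x. ennreal (norm (u x) powr s) \<partial>lborel) \<le> ennreal (B powr s)" .
  note [measurable] = um
  have int: "integrable lborel (\<lambda>x. norm (u x) powr s)"
    by (rule integrableI_nonneg) (use le in \<open>auto intro: le_less_trans[OF le]\<close>)
  then show "(\<lambda>x. \<integral>y. F x y \<partial>M a b) \<in> Lps lborel s" using um unfolding u_def[symmetric] by (intro LpsI)
  have "ennreal (\<integral>x. norm (u x) powr s \<partial>lborel) \<le> ennreal (B powr s)"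
    using le int by (subst (asm) nn_integral_eq_integral) auto
  then have "(\<integral>x. norm (u x) powr s \<partial>lborel) \<le> B powr s" by (simp add: ennreal_le_iff)
  then have "lpn lborel s u \<le> (B powr s) powr (1/s)"
    unfolding lpn_def using s by (intro powr_mono2) (auto intro: integral_nonneg_AE)
  also have "\<dots> = B" using s B0 by (simp add: powr_powr)
  finally show "lpn lborel s (\<lambda>x. \<integral>y. F x y \<partial>M a b) \<le> B" unfolding u_def[symmetric] .
qed

lemma lpn_translate:
  fixes f :: "'a::euclidean_space \<Rightarrow> 'b::euclidean_space"
  assumes "f \<in> Lps lborel s"
  shows "(\<lambda>x. f (x + z)) \<in> Lps lborel s" "lpn lborel s (\<lambda>x. f (x + z)) = lpn lborel s f"
proof -
  note [measurable] = LpsD(1)[OF assms]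
  show "(\<lambda>x. f (x + z)) \<in> Lps lborel s"
    using integrable_translate[OF LpsD(2)[OF assms], of z] by (intro LpsI) auto
  show "lpn lborel s (\<lambda>x. f (x + z)) = lpn lborel s f"
    unfolding lpn_def by (subst integral_translate) auto
qed

lemma unit_interval_mass: "measure lborel (cbox 0 (1::real)) = 1"
  by simp

text \<open>The difference is the mean over \<open>t\<close> in the unit interval of the directional
  derivative at \<open>x + t *\<^sub>R z\<close>. Minkowski's inequality and the translation
  invariance of the norm finish the estimate.\<close>

lemma translation_estimate:
  assumes \<phi>: "C1c \<phi> g" and s: "1 < s"
  shows "(\<lambda>x. \<phi> (x + z) - \<phi> x) \<in> Lps lborel s" "lpn lborel s (\<lambda>x. \<phi> (x + z) - \<phi> x) \<le> norm z * lpn lborel s g"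
proof -
  have s0: "0 < s" using s by simp
  have eq: "\<phi> (x + z) - \<phi> x = (\<integral>t. g (x + t *\<^sub>R z) \<bullet> z \<partial>restrict_space lborel (cbox 0 (1::real)))" for x
  proof -
    have c: "continuous_on {0..1} (\<lambda>t. g (x + t *\<^sub>R z) \<bullet> z)"
      by (intro continuous_intros continuous_on_compose2[OF C1c_D(2)[OF \<phi>]]) auto
    have d: "((\<lambda>t. \<phi> (x + t *\<^sub>R z)) has_vector_derivative g (x + t *\<^sub>R z) \<bullet> z) (at t within {0..1})" for t
    proof -
      have "((\<lambda>t. \<phi> (x + t *\<^sub>R z)) has_derivative (\<lambda>h. g (x + t *\<^sub>R z) \<bullet> (h *\<^sub>R z))) (at t within {0..1})"
        by (rule has_derivative_compose[OF _ C1c_D(1)[OF \<phi>]]) (auto intro!: derivative_eq_intros)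
      then show ?thesis by (simp add: has_vector_derivative_def)
    qed
    have "(\<integral>t. indicator {0..1} t *\<^sub>R (g (x + t *\<^sub>R z) \<bullet> z) \<partial>lborel) = \<phi> (x + 1 *\<^sub>R z) - \<phi> (x + 0 *\<^sub>R z)"
      by (rule integral_FTC_Icc[OF _ d c]) auto
    then show ?thesis by (subst integral_restrict_space) auto
  qed
  have cont: "continuous_on UNIV (\<lambda>(x, t). g (x + t *\<^sub>R z) \<bullet> z)"
    unfolding split_beta' by (intro continuous_intros continuous_on_compose2[OF C1c_D(2)[OF \<phi>]]) auto
  have gt: "(\<lambda>x. g (x + t *\<^sub>R z)) \<in> Lps lborel s" "lpn lborel s (\<lambda>x. g (x + t *\<^sub>R z)) = lpn lborel s g" for t
    using lpn_translate[OF C1c_Lps(2)[OF \<phi> s0]] by auto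
  note [measurable] = C1c_D(4)[OF \<phi>]
  have gz: "(\<lambda>x. norm z *\<^sub>R g (x + t *\<^sub>R z)) \<in> Lps lborel s" for t by (rule Lps_scaleR[OF gt(1)])
  have le: "norm (g (x + t *\<^sub>R z) \<bullet> z) \<le> norm (norm z *\<^sub>R g (x + t *\<^sub>R z))" for x t
    using Cauchy_Schwarz_ineq2[of "g (x + t *\<^sub>R z)" z] by (simp add: mult.commute)
  have 1: "(\<lambda>x. g (x + t *\<^sub>R z) \<bullet> z) \<in> Lps lborel s" for t
    by (rule Lps_bound[OF gz[of t]]) (use le s in auto)
  have 2: "lpn lborel s (\<lambda>x. g (x + t *\<^sub>R z) \<bullet> z) \<le> norm z * lpn lborel s g" for t
  proof -
    have "lpn lborel s (\<lambda>x. g (x + t *\<^sub>R z) \<bullet> z) \<le> lpn lborel s (\<lambda>x. norm z *\<^sub>R g (x + t *\<^sub>R z))"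
      by (rule lpn_mono[OF gz]) (use le s in auto)
    then show ?thesis using s gt(2)[of t] by (simp add: lpn_scaleR)
  qed
  from Minkowski_integral[OF unit_interval_mass s cont 1 2]
  show "(\<lambda>x. \<phi> (x + z) - \<phi> x) \<in> Lps lborel s" "lpn lborel s (\<lambda>x. \<phi> (x + z) - \<phi> x) \<le> norm z * lpn lborel s g"
    unfolding eq by auto
qed

definition cube :: "(real ^ 'n) measure" where
  "cube = restrict_space lborel (cbox 0 One)"

text \<open>The mean of \<open>\<phi>\<close> over the cube of side \<open>h\<close> with corner
  \<open>x\<close>, substituted to the unit cube: the domain of integration then does not move, and
  \<open>h\<close> can be varied and differentiated under the integral.\<close>

definition avg :: "real \<Rightarrow> (real ^ 'n \<Rightarrow> real) \<Rightarrow> real ^ 'n \<Rightarrow> real" where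
  "avg h \<phi> x = (\<integral>y. \<phi> (x + h *\<^sub>R y) \<partial>cube)"

text \<open>Any positive bound for the norm on the unit cube serves; its value never
  matters.\<close>

definition diam_cube :: "'n::finite itself \<Rightarrow> real" where
  "diam_cube _ = (SOME c. 0 < c \<and> (\<forall>y \<in> cbox (0::real^'n) One. norm y \<le> c))"

lemma diam_cube:
  "0 < diam_cube TYPE('n::finite)" "\<And>y :: real ^ 'n. y \<in> cbox 0 One \<Longrightarrow> norm y \<le> diam_cube TYPE('n)"
proof -
  have "\<exists>c. 0 < c \<and> (\<forall>y \<in> cbox (0::real^'n) One. norm y \<le> c)"
    using bounded_cbox[of "0::real^'n" One] by (auto simp: bounded_pos)
  from someI_ex[OF this] show "0 < diam_cube TYPE('n)" "\<And>y :: real ^ 'n. y \<in> cbox 0 One \<Longrightarrow> norm y \<le> diam_cube TYPE('n)"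
    unfolding diam_cube_def by auto
qed

lemma unit_cube_mass: "measure lborel (cbox 0 (One :: real ^ 'n)) = 1"
  using content_unit[where 'a = "real ^ 'n"] by (simp add: measure_completion)

lemma finite_cube: "finite_measure cube"
  unfolding cube_def by (rule unit_mass_box(1)[OF unit_cube_mass])

lemma lpn_cube_one: "lpn cube s (\<lambda>x. 1::real) = 1"
  unfolding cube_def by (rule unit_mass_box(2)[OF unit_cube_mass])

lemma space_cube: "space cube = cbox 0 One"
  by (simp add: cube_def space_restrict_space)

lemma continuous_cube:
  fixes f :: "real ^ 'n \<Rightarrow> 'b::euclidean_space"
  assumes "continuous_on UNIV f"
  shows "integrable cube f" "0 < s \<Longrightarrow> f \<in> Lps cube s"
  unfolding cube_def using continuous_Lps_box[OF assms] zero_less_one by blast+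

lemma continuous_affine:
  fixes f :: "real ^ 'n \<Rightarrow> 'b::euclidean_space"
  assumes "continuous_on UNIV f"
  shows "continuous_on UNIV (\<lambda>y. f (x + h *\<^sub>R y))"
  by (intro continuous_on_compose2[OF assms] continuous_intros) auto

lemma lborel_scale:
  fixes f :: "real ^ 'n \<Rightarrow> real"
  assumes h: "h > 0" and f: "integrable lborel f"
  shows "integrable lborel (\<lambda>y. f (x + h *\<^sub>R y))"
    "(\<integral>y. f (x + h *\<^sub>R y) \<partial>lborel) = h powr (- real CARD('n)) * (\<integral>y. f y \<partial>lborel)"
proof -
  have h0: "h \<noteq> 0" using h by simp
  note [measurable] = borel_measurable_integrable[OF f]
  define L where "L = distr lborel borel (\<lambda>y::real^'n. x + h *\<^sub>R y)"
  have L: "lborel = density L (\<lambda>_. ennreal (h ^ CARD('n)))"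
    using lborel_affine[OF h0, of x] h by (simp add: L_def)
  have fL: "f \<in> borel_measurable L" by (simp add: L_def)
  have "integrable (density L (\<lambda>_. ennreal (h ^ CARD('n)))) f" using f L by metis
  then have "integrable L (\<lambda>x. (h ^ CARD('n)) *\<^sub>R f x)"
    using h fL by (subst (asm) integrable_density) auto
  then have "integrable L f" using h by simp
  then show "integrable lborel (\<lambda>y. f (x + h *\<^sub>R y))"
    unfolding L_def by (subst (asm) integrable_distr_eq) auto
  have "(\<integral>y. f y \<partial>lborel) = (\<integral>y. f y \<partial>density L (\<lambda>_. ennreal (h ^ CARD('n))))" using L by metis
  also have "\<dots> = (\<integral>y. (h ^ CARD('n)) *\<^sub>R f y \<partial>L)" using h fL by (subst integral_density) auto
  also have "\<dots> = h ^ CARD('n) * (\<integral>y. f y \<partial>L)" by simp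
  also have "(\<integral>y. f y \<partial>L) = (\<integral>y. f (x + h *\<^sub>R y) \<partial>lborel)"
    unfolding L_def by (subst integral_distr) auto
  finally show "(\<integral>y. f (x + h *\<^sub>R y) \<partial>lborel) = h powr (- real CARD('n)) * (\<integral>y. f y \<partial>lborel)"
    using h by (simp add: powr_minus powr_realpow)
qed

text \<open>Hoelder's inequality on the cube of mass one, then enlargement of the cube to the whole
  space; rescaling the Lebesgue measure produces the negative power of \<open>h\<close>.\<close>

lemma cube_mean_bound:
  fixes f :: "real ^ 'n \<Rightarrow> 'b::euclidean_space"
  assumes f: "continuous_on UNIV f" "f \<in> Lps lborel s" and h: "h > 0" and s: "1 < s"
  shows "(\<integral>y. norm (f (x + h *\<^sub>R y)) \<partial>cube) \<le> h powr (- real CARD('n) / s) * lpn lborel s f"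
proof -
  have s0: "0 < s" using s by simp
  note [measurable] = LpsD(1)[OF f(2)]
  have L: "(\<lambda>y. f (x + h *\<^sub>R y)) \<in> Lps cube s" by (rule continuous_cube(2)[OF continuous_affine[OF f(1)] s0])
  have "(\<integral>y. norm (f (x + h *\<^sub>R y)) \<partial>cube) \<le> lpn cube s (\<lambda>y. f (x + h *\<^sub>R y))"
    using Holder_finite(2)[OF finite_cube s L] by (simp add: lpn_cube_one)
  also have "\<dots> \<le> (h powr (- real CARD('n)) * (\<integral>y. norm (f y) powr s \<partial>lborel)) powr (1 / s)"
    unfolding lpn_def
  proof (rule powr_mono2)
    have "(\<integral>y. norm (f (x + h *\<^sub>R y)) powr s \<partial>cube) = (\<integral>y. indicator (cbox 0 One) y *\<^sub>R norm (f (x + h *\<^sub>R y)) powr s \<partial>lborel)"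
      unfolding cube_def by (subst integral_restrict_space) auto
    also have "\<dots> \<le> (\<integral>y. norm (f (x + h *\<^sub>R y)) powr s \<partial>lborel)"
      using lborel_scale(1)[OF h LpsD(2)[OF f(2)], of x]
      by (intro integral_mono integrable_mult_indicator[where 'b = real]) (auto simp: indicator_def)
    also have "\<dots> = h powr (- real CARD('n)) * (\<integral>y. norm (f y) powr s \<partial>lborel)"
      by (rule lborel_scale(2)[OF h LpsD(2)[OF f(2)]])
    finally show "(\<integral>y. norm (f (x + h *\<^sub>R y)) powr s \<partial>cube) \<le> h powr (- real CARD('n)) * (\<integral>y. norm (f y) powr s \<partial>lborel)" .
  qed (use s in auto)
  also have "\<dots> = h powr (- real CARD('n) / s) * lpn lborel s f"
    by (simp add: powr_mult powr_powr lpn_def)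
  finally show ?thesis .
qed

text \<open>Interpolation between L^p and the supremum norm: \<open>s - p\<close> of the
  \<open>s\<close> factors are estimated by \<open>S\<close>.\<close>

lemma lpn_interpolate:
  assumes D: "D \<in> Lps M p" and S: "\<And>x. norm (D x) \<le> S" and ps: "0 < p" "p < s"
  shows "D \<in> Lps M s" "lpn M s D \<le> S powr (1 - p / s) * lpn M p D powr (p / s)"
proof -
  note [measurable] = LpsD(1)[OF D]
  have pt: "norm (D x) powr s \<le> S powr (s - p) * norm (D x) powr p" for x
  proof -
    have "norm (D x) powr s = norm (D x) powr (s - p) * norm (D x) powr p" by (simp flip: powr_add)
    also have "\<dots> \<le> S powr (s - p) * norm (D x) powr p"
      using S ps by (intro mult_right_mono powr_mono2) auto
    finally show ?thesis .
  qed
  have i: "integrable M (\<lambda>x. norm (D x) powr s)"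
    by (rule Bochner_Integration.integrable_bound[OF integrable_mult_right[OF LpsD(2)[OF D], of "S powr (s - p)"]])
       (use pt in auto)
  then show "D \<in> Lps M s" by (intro LpsI LpsD(1)[OF D])
  have "(\<integral>x. norm (D x) powr s \<partial>M) \<le> (\<integral>x. S powr (s - p) * norm (D x) powr p \<partial>M)"
    by (intro integral_mono i pt integrable_mult_right LpsD(2)[OF D])
  also have "\<dots> = S powr (s - p) * lpn M p D powr p" using ps by (simp add: lpn_powr)
  finally have "lpn M s D \<le> (S powr (s - p) * lpn M p D powr p) powr (1 / s)"
    unfolding lpn_def[of M s] using ps by (intro powr_mono2) (auto intro: integral_nonneg_AE)
  also have "\<dots> = S powr (1 - p / s) * lpn M p D powr (p / s)"
    using ps by (simp add: powr_mult powr_powr diff_divide_distrib)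
  finally show "lpn M s D \<le> S powr (1 - p / s) * lpn M p D powr (p / s)" .
qed

lemma avg_Lps:
  assumes \<phi>: "C1c \<phi> g" and s: "1 < s"
  shows "avg h \<phi> \<in> Lps lborel s"
proof -
  have s0: "0 < s" using s by simp
  have cont: "continuous_on UNIV (\<lambda>(x, y). \<phi> (x + h *\<^sub>R y))"
    unfolding split_beta' by (intro continuous_intros continuous_on_compose2[OF C1c_D(3)[OF \<phi>]]) auto
  have "lpn lborel s (\<lambda>x. \<phi> (x + h *\<^sub>R y)) \<le> lpn lborel s \<phi>" for y
    using lpn_translate[OF C1c_Lps(1)[OF \<phi> s0]] by simp
  from Minkowski_integral(1)[OF unit_cube_mass s cont lpn_translate(1)[OF C1c_Lps(1)[OF \<phi> s0]] this]
  show ?thesis by (simp add: avg_def[abs_def] cube_def)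
qed

text \<open>For fixed \<open>y\<close> the two integrands differ by a translation by
  \<open>h *\<^sub>R y\<close>, which costs at most \<open>h\<close> times \<open>diam_cube\<close>
  in L^p of the gradient; the mean over \<open>y\<close> preserves this.\<close>

lemma avg_step_Lp:
  fixes \<phi> :: "real ^ 'n \<Rightarrow> real"
  assumes \<phi>: "C1c \<phi> g" and s: "1 < s" and h: "0 \<le> h"
  shows "(\<lambda>x. avg h \<phi> x - avg (2 * h) \<phi> x) \<in> Lps lborel s"
    "lpn lborel s (\<lambda>x. avg h \<phi> x - avg (2 * h) \<phi> x) \<le> h * diam_cube TYPE('n) * lpn lborel s g"
proof -
  have s0: "0 < s" using s by simp
  have cont: "continuous_on UNIV (\<lambda>(x, y). \<phi> (x + h *\<^sub>R y) - \<phi> (x + (2 * h) *\<^sub>R y))"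
    unfolding split_beta' by (intro continuous_intros continuous_on_compose2[OF C1c_D(3)[OF \<phi>]]) auto
  have eq: "avg h \<phi> x - avg (2 * h) \<phi> x = (\<integral>y. \<phi> (x + h *\<^sub>R y) - \<phi> (x + (2 * h) *\<^sub>R y) \<partial>cube)" for x
    unfolding avg_def
    by (intro Bochner_Integration.integral_diff[symmetric] continuous_cube(1) continuous_affine C1c_D(3)[OF \<phi>])
  have 1: "(\<lambda>x. \<phi> (x + h *\<^sub>R y) - \<phi> (x + (2 * h) *\<^sub>R y)) \<in> Lps lborel s" for y
    by (intro Lps_diff lpn_translate(1) C1c_Lps(1)[OF \<phi>] s0)
  have 2: "lpn lborel s (\<lambda>x. \<phi> (x + h *\<^sub>R y) - \<phi> (x + (2 * h) *\<^sub>R y)) \<le> h * diam_cube TYPE('n) * lpn lborel s g"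
    if y: "y \<in> cbox 0 One" for y
  proof -
    have "lpn lborel s (\<lambda>x. \<phi> (x + h *\<^sub>R y) - \<phi> (x + (2 * h) *\<^sub>R y))
        = lpn lborel s (\<lambda>x. \<phi> ((x + h *\<^sub>R y) + h *\<^sub>R y) - \<phi> (x + h *\<^sub>R y))"
      by (subst lpn_minus_commute) (simp add: add.assoc flip: scaleR_add_left)
    also have "\<dots> = lpn lborel s (\<lambda>x. \<phi> (x + h *\<^sub>R y) - \<phi> x)"
      by (rule lpn_translate(2)[OF translation_estimate(1)[OF \<phi> s]])
    also have "\<dots> \<le> norm (h *\<^sub>R y) * lpn lborel s g" by (rule translation_estimate(2)[OF \<phi> s])
    also have "\<dots> \<le> h * diam_cube TYPE('n) * lpn lborel s g"
      using diam_cube(2)[OF y] h by (intro mult_right_mono) (auto intro: mult_left_mono)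
    finally show ?thesis .
  qed
  from Minkowski_integral[OF unit_cube_mass s cont 1 2]
  show "(\<lambda>x. avg h \<phi> x - avg (2 * h) \<phi> x) \<in> Lps lborel s"
    "lpn lborel s (\<lambda>x. avg h \<phi> x - avg (2 * h) \<phi> x) \<le> h * diam_cube TYPE('n) * lpn lborel s g"
    unfolding eq cube_def by auto
qed

text \<open>The mean value theorem for the average as a function of its side, between
  \<open>h\<close> and \<open>2 * h\<close>. The derivative is a mean of the gradient over a cube of
  side at least \<open>h\<close>, so \<open>cube_mean_bound\<close> applies.\<close>

lemma avg_step_sup:
  fixes \<phi> :: "real ^ 'n \<Rightarrow> real"
  assumes \<phi>: "C1c \<phi> g" and s: "1 < s" and h: "0 < h"
  shows "\<bar>avg h \<phi> x - avg (2 * h) \<phi> x\<bar> \<le> h * diam_cube TYPE('n) * (h powr (- real CARD('n) / s) * lpn lborel s g)"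
proof -
  define A where "A t = integral (cbox 0 One) (\<lambda>y. \<phi> (x + t *\<^sub>R y))" for t
  define A' where "A' t = integral (cbox 0 One) (\<lambda>y. g (x + t *\<^sub>R y) \<bullet> y)" for t
  \<comment> \<open>On continuous functions both integrals agree; the gauge integral carries the
    rule for differentiation under the integral sign.\<close>
  have HK: "(\<integral>y. f y \<partial>cube) = integral (cbox 0 One) f" if "continuous_on UNIV f" for f :: "real ^ 'n \<Rightarrow> real"
  proof -
    have "set_integrable lborel (cbox 0 One) f"
      unfolding set_integrable_def
      by (intro borel_integrable_compact continuous_on_subset[OF that]) auto
    from set_borel_integral_eq_integral(2)[OF this] show ?thesis
      unfolding cube_def by (subst integral_restrict_space) (auto simp: set_lebesgue_integral_def)
  qed
  have av: "avg t \<phi> x = A t" for t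
    unfolding avg_def A_def by (intro HK continuous_affine C1c_D(3)[OF \<phi>])
  have "(A has_field_derivative A' t) (at t)" for t
  proof -
    have "((\<lambda>t. integral (cbox 0 One) (\<lambda>y. \<phi> (x + t *\<^sub>R y))) has_field_derivative integral (cbox 0 One) (\<lambda>y. g (x + t *\<^sub>R y) \<bullet> y)) (at t within UNIV)"
    proof (rule leibniz_rule_field_derivative)
      fix t :: real and y :: "real ^ 'n"
      have "((\<lambda>t. \<phi> (x + t *\<^sub>R y)) has_derivative (\<lambda>h. g (x + t *\<^sub>R y) \<bullet> (h *\<^sub>R y))) (at t)"
        by (rule has_derivative_compose[OF _ C1c_D(1)[OF \<phi>]]) (auto intro!: derivative_eq_intros)
      then show "((\<lambda>t. \<phi> (x + t *\<^sub>R y)) has_field_derivative g (x + t *\<^sub>R y) \<bullet> y) (at t within UNIV)"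
        by (simp add: has_field_derivative_def mult_commute_abs)
      show "(\<lambda>y. \<phi> (x + t *\<^sub>R y)) integrable_on cbox 0 One"
        by (intro integrable_continuous continuous_on_subset[OF continuous_affine[OF C1c_D(3)[OF \<phi>]]]) auto
      show "continuous_on (UNIV \<times> cbox 0 One) (\<lambda>(t, y). g (x + t *\<^sub>R y) \<bullet> y)"
        unfolding split_beta' by (intro continuous_intros continuous_on_compose2[OF C1c_D(2)[OF \<phi>]]) auto
    qed auto
    then show ?thesis by (simp add: A_def[abs_def] A'_def)
  qed
  then have "\<exists>z>h. z < 2 * h \<and> A (2 * h) - A h = (2 * h - h) * A' z"
    using h by (intro MVT2) auto
  then obtain z where z: "h < z" "z < 2 * h" "A (2 * h) - A h = h * A' z" by auto
  have cg: "continuous_on UNIV (\<lambda>y. g (x + z *\<^sub>R y) \<bullet> y)"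
    by (intro continuous_intros continuous_affine C1c_D(2)[OF \<phi>])
  have cn: "continuous_on UNIV (\<lambda>y. norm (g (x + z *\<^sub>R y)))"
    by (intro continuous_intros continuous_affine C1c_D(2)[OF \<phi>])
  have "\<bar>A' z\<bar> = \<bar>\<integral>y. g (x + z *\<^sub>R y) \<bullet> y \<partial>cube\<bar>" unfolding A'_def HK[OF cg] ..
  also have "\<dots> \<le> (\<integral>y. \<bar>g (x + z *\<^sub>R y) \<bullet> y\<bar> \<partial>cube)" by (rule integral_abs_bound)
  also have "\<dots> \<le> (\<integral>y. diam_cube TYPE('n) * norm (g (x + z *\<^sub>R y)) \<partial>cube)"
  proof (rule integral_mono)
    show "integrable cube (\<lambda>y. \<bar>g (x + z *\<^sub>R y) \<bullet> y\<bar>)" by (intro integrable_abs continuous_cube cg)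
    show "integrable cube (\<lambda>y. diam_cube TYPE('n) * norm (g (x + z *\<^sub>R y)))"
      by (intro integrable_mult_right continuous_cube cn)
    fix y :: "real ^ 'n" assume "y \<in> space cube"
    then have "norm y \<le> diam_cube TYPE('n)" by (intro diam_cube) (simp add: space_cube)
    then have "norm (g (x + z *\<^sub>R y)) * norm y \<le> norm (g (x + z *\<^sub>R y)) * diam_cube TYPE('n)" by (intro mult_left_mono) auto
    with Cauchy_Schwarz_ineq2[of "g (x + z *\<^sub>R y)" y]
    show "\<bar>g (x + z *\<^sub>R y) \<bullet> y\<bar> \<le> diam_cube TYPE('n) * norm (g (x + z *\<^sub>R y))" by (simp add: mult.commute)
  qed
  also have "\<dots> = diam_cube TYPE('n) * (\<integral>y. norm (g (x + z *\<^sub>R y)) \<partial>cube)" by simp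
  also have "\<dots> \<le> diam_cube TYPE('n) * (z powr (- real CARD('n) / s) * lpn lborel s g)"
    using z h s diam_cube(1)[where 'n = 'n] C1c_Lps(2)[OF \<phi>, of s]
    by (intro mult_left_mono cube_mean_bound C1c_D(2)[OF \<phi>]) auto
  also have "\<dots> \<le> diam_cube TYPE('n) * (h powr (- real CARD('n) / s) * lpn lborel s g)"
    using z h s diam_cube(1)[where 'n = 'n]
    by (intro mult_left_mono mult_right_mono powr_mono2') auto
  finally have "h * \<bar>A' z\<bar> \<le> h * (diam_cube TYPE('n) * (h powr (- real CARD('n) / s) * lpn lborel s g))"
    using h by (intro mult_left_mono) auto
  moreover have "\<bar>avg h \<phi> x - avg (2 * h) \<phi> x\<bar> = h * \<bar>A' z\<bar>"
  proof -
    have "avg h \<phi> x - avg (2 * h) \<phi> x = - (h * A' z)" using z(3) by (simp add: av)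
    then show ?thesis using h by (simp add: abs_mult)
  qed
  ultimately show ?thesis by (simp add: mult.assoc)
qed

text \<open>Interpolation of the L^p bound, of order h, with the supremum bound, of order h^(1 -
  n/p), with weights p/s and 1 - p/s. The resulting exponent is positive exactly when
  \<open>s\<close> is subcritical.\<close>

lemma avg_step_Ls:
  fixes \<phi> :: "real ^ 'n \<Rightarrow> real" and p s h :: real
  assumes \<phi>: "C1c \<phi> g" and p: "1 < p" "p < s" and h: "0 < h"
  shows "lpn lborel s (\<lambda>x. avg h \<phi> x - avg (2 * h) \<phi> x)
    \<le> diam_cube TYPE('n) * lpn lborel p g * h powr (1 - CARD('n) / p + CARD('n) / s)"
proof -
  define c where "c = diam_cube TYPE('n) * lpn lborel p g"
  have c: "c \<ge> 0" using diam_cube(1)[where 'n = 'n] by (simp add: c_def)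
  define D where "D x = avg h \<phi> x - avg (2 * h) \<phi> x" for x
  have 1: "D \<in> Lps lborel p" "lpn lborel p D \<le> h * c"
    using avg_step_Lp[OF \<phi> p(1), of h] h unfolding D_def[abs_def] c_def by (auto simp: mult.assoc)
  have 2: "norm (D x) \<le> h powr (1 - CARD('n) / p) * c" for x
  proof -
    have "h powr (1 - CARD('n) / p) = h * h powr (- real CARD('n) / p)"
      using powr_add[of h 1 "- real CARD('n) / p"] h by simp
    then show ?thesis
      using avg_step_sup[OF \<phi> p(1) h, of x] unfolding D_def c_def by (simp only: real_norm_def mult_ac)
  qed
  have "lpn lborel s D \<le> (h powr (1 - CARD('n) / p) * c) powr (1 - p / s) * lpn lborel p D powr (p / s)"
    using p by (intro lpn_interpolate(2)[OF 1(1) 2]) auto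
  also have "\<dots> \<le> (h powr (1 - CARD('n) / p) * c) powr (1 - p / s) * (h * c) powr (p / s)"
    using p 1 by (intro mult_left_mono powr_mono2) auto
  also have "\<dots> = c powr (1 - p / s) * c powr (p / s) * (h powr ((1 - CARD('n) / p) * (1 - p / s)) * h powr (p / s))"
  proof -
    have "(h powr (1 - CARD('n) / p) * c) powr (1 - p / s) = h powr ((1 - CARD('n) / p) * (1 - p / s)) * c powr (1 - p / s)"
      by (simp only: powr_mult powr_powr)
    moreover have "(h * c) powr (p / s) = h powr (p / s) * c powr (p / s)"
      by (simp only: powr_mult)
    ultimately show ?thesis by (simp only: mult_ac)
  qed
  also have "c powr (1 - p / s) * c powr (p / s) = c" using c powr_add[of c "1 - p / s" "p / s"] by simp
  also have "h powr ((1 - CARD('n) / p) * (1 - p / s)) * h powr (p / s) = h powr (1 - CARD('n) / p + CARD('n) / s)"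
  proof -
    have "(1 - CARD('n) / p) * (1 - p / s) + p / s = 1 - CARD('n) / p + CARD('n) / s"
      using p by (simp add: field_simps)
    then show ?thesis using powr_add[of h "(1 - CARD('n) / p) * (1 - p / s)" "p / s"] by simp
  qed
  finally show ?thesis by (simp add: D_def[abs_def] c_def)
qed

lemma avg_converges:
  fixes \<phi> :: "real ^ 'n \<Rightarrow> real"
  assumes \<phi>: "C1c \<phi> g" and h: "h \<longlonglongrightarrow> 0"
  shows "(\<lambda>k. avg (h k) \<phi> x) \<longlonglongrightarrow> \<phi> x"
proof -
  obtain R where R: "0 < R" "\<And>x. R < norm x \<Longrightarrow> \<phi> x = 0" "\<And>x. R < norm x \<Longrightarrow> g x = 0"
    using C1c_support[OF \<phi>] by blast
  obtain B where B: "0 \<le> B" "\<And>x. norm (g x) \<le> B"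
    using compact_support_bounded[OF C1c_D(2)[OF \<phi>] R(3)] by blast
  interpret finite_measure "cube :: (real ^ 'n) measure" by (rule finite_cube)
  have m1: "measure (cube :: (real ^ 'n) measure) (space cube) = 1"
    using unit_cube_mass[where 'n = 'n] unfolding cube_def by (simp add: measure_restrict_space space_restrict_space)
  have *: "\<bar>avg t \<phi> x - \<phi> x\<bar> \<le> B * diam_cube TYPE('n) * \<bar>t\<bar>" for t
  proof -
    have i: "integrable cube (\<lambda>y. \<phi> (x + t *\<^sub>R y))" by (intro continuous_cube continuous_affine C1c_D(3)[OF \<phi>])
    then have "avg t \<phi> x - \<phi> x = (\<integral>y. \<phi> (x + t *\<^sub>R y) - \<phi> x \<partial>cube)"
      by (simp add: avg_def m1)
    also have "\<bar>\<dots>\<bar> \<le> (\<integral>y. \<bar>\<phi> (x + t *\<^sub>R y) - \<phi> x\<bar> \<partial>cube)" by (rule integral_abs_bound)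
    also have "\<dots> \<le> (\<integral>y. B * diam_cube TYPE('n) * \<bar>t\<bar> \<partial>(cube :: (real ^ 'n) measure))"
    proof (rule integral_mono)
      fix y :: "real ^ 'n" assume "y \<in> space cube"
      then have "norm y \<le> diam_cube TYPE('n)" by (intro diam_cube) (simp add: space_cube)
      then have "B * norm (t *\<^sub>R y) \<le> B * (\<bar>t\<bar> * diam_cube TYPE('n))" using B by (auto intro!: mult_left_mono)
      with C1c_lipschitz[OF \<phi> B(2), of "x + t *\<^sub>R y" x]
      show "\<bar>\<phi> (x + t *\<^sub>R y) - \<phi> x\<bar> \<le> B * diam_cube TYPE('n) * \<bar>t\<bar>" by (simp add: mult_ac)
    qed (use i in auto)
    also have "\<dots> = B * diam_cube TYPE('n) * \<bar>t\<bar>" by (simp add: m1)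
    finally show ?thesis .
  qed
  have "(\<lambda>k. avg (h k) \<phi> x - \<phi> x) \<longlonglongrightarrow> 0"
  proof (rule Lim_null_comparison)
    show "\<forall>\<^sub>F k in sequentially. norm (avg (h k) \<phi> x - \<phi> x) \<le> B * diam_cube TYPE('n) * \<bar>h k\<bar>"
      using * by simp
    show "(\<lambda>k. B * diam_cube TYPE('n) * \<bar>h k\<bar>) \<longlonglongrightarrow> 0"
      using h by (intro tendsto_mult_right_zero tendsto_rabs_zero)
  qed
  then show ?thesis by (simp add: LIM_zero_iff)
qed

text \<open>Summing the dyadic differences of averages is a geometric series precisely when
  \<open>s < n p / (n - p)\<close>; this replaces the Sobolev inequality at the critical exponent.\<close>

lemma avg_approximation:
  fixes p s :: real
  assumes p: "1 < p" "p < s" and \<kappa>: "0 < 1 - CARD('n) / p + CARD('n) / s"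
  shows "\<exists>C\<ge>0. \<forall>(\<phi> :: real ^ 'n \<Rightarrow> real) g. C1c \<phi> g \<longrightarrow> (\<forall>h>0.
    lpn lborel s (\<lambda>x. avg h \<phi> x - \<phi> x) \<le> C * h powr (1 - CARD('n) / p + CARD('n) / s) * lpn lborel p g)"
proof -
  define \<kappa> where "\<kappa> = 1 - CARD('n) / p + CARD('n) / s"
  have k0: "\<kappa> > 0" using \<kappa> by (simp add: \<kappa>_def)
  \<comment> \<open>The ratio of the geometric series: halving the side multiplies the bound for one
    dyadic step by this factor, less than 1 because \<open>\<kappa> > 0\<close>.\<close>
  define r where "r = (1 / 2) powr \<kappa>"
  have r: "0 < r" "r < 1" using k0 powr_less_mono2[of \<kappa> "1/2" 1] by (auto simp: r_def)
  define c where "c = diam_cube TYPE('n)"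
  have c: "c > 0" using diam_cube(1) by (simp add: c_def)
  have main: "lpn lborel s (\<lambda>x. avg h \<phi> x - \<phi> x) \<le> c * (r / (1 - r)) * h powr \<kappa> * lpn lborel p g"
    if \<phi>: "C1c \<phi> g" and h: "h > 0" for \<phi> :: "real ^ 'n \<Rightarrow> real" and g h
  proof -
    define G where "G = c * h powr \<kappa> * lpn lborel p g"
    have G: "G \<ge> 0" using c by (simp add: G_def)
    have s: "1 < s" using p by simp
    define H where "H k = h / 2 ^ k" for k
    have H0: "H k > 0" for k using h by (simp add: H_def)
    have step: "lpn lborel s (\<lambda>x. avg (H (Suc k)) \<phi> x - avg (H k) \<phi> x) \<le> G * r ^ Suc k" for k
    proof -
      have "2 * H (Suc k) = H k" by (simp add: H_def)
      then have "lpn lborel s (\<lambda>x. avg (H (Suc k)) \<phi> x - avg (H k) \<phi> x) \<le> c * lpn lborel p g * H (Suc k) powr \<kappa>"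
        using avg_step_Ls[OF \<phi> p H0[of "Suc k"]] by (simp add: c_def \<kappa>_def)
      also have "H (Suc k) powr \<kappa> = h powr \<kappa> * r ^ Suc k"
      proof -
        have "H (Suc k) = h * (1 / 2) ^ Suc k" by (simp add: H_def power_divide)
        then have "H (Suc k) powr \<kappa> = h powr \<kappa> * ((1 / 2) ^ Suc k) powr \<kappa>" by (simp only: powr_mult)
        also have "((1 / 2 :: real) ^ Suc k) powr \<kappa> = ((1 / 2) powr real (Suc k)) powr \<kappa>"
          by (subst powr_realpow) auto
        also have "\<dots> = ((1 / 2) powr \<kappa>) powr real (Suc k)" by (simp only: powr_powr mult.commute)
        also have "\<dots> = r ^ Suc k" unfolding r_def by (subst powr_realpow) auto
        finally show ?thesis .
      qed
      finally show ?thesis by (simp add: G_def mult_ac)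
    qed
    have bound: "lpn lborel s (\<lambda>x. avg (H k) \<phi> x - avg h \<phi> x) \<le> G * ((r - r ^ Suc k) / (1 - r))" for k
    proof (induction k)
      case (Suc k)
      have "lpn lborel s (\<lambda>x. avg (H (Suc k)) \<phi> x - avg h \<phi> x) \<le> lpn lborel s (\<lambda>x. avg (H (Suc k)) \<phi> x - avg (H k) \<phi> x)
          + lpn lborel s (\<lambda>x. avg (H k) \<phi> x - avg h \<phi> x)"
        by (intro lpn_triangle avg_Lps[OF \<phi> s] s)
      also have "\<dots> \<le> G * r ^ Suc k + G * ((r - r ^ Suc k) / (1 - r))" by (intro add_mono step Suc)
      also have "\<dots> = G * ((r - r ^ Suc (Suc k)) / (1 - r))" using r by (simp add: field_simps)
      finally show ?case .
    qed (simp add: H_def)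
    have bound': "lpn lborel s (\<lambda>x. avg (H k) \<phi> x - avg h \<phi> x) \<le> G * (r / (1 - r))" for k
    proof -
      have "G * ((r - r ^ Suc k) / (1 - r)) \<le> G * (r / (1 - r))"
        using r G by (intro mult_left_mono divide_right_mono) auto
      with bound[of k] show ?thesis by linarith
    qed
    have "H \<longlonglongrightarrow> 0" unfolding H_def using tendsto_mult_right_zero[OF LIMSEQ_power_zero[of "1/2::real"], of h]
      by (simp add: power_divide)
    then have lim: "AE x in lborel. (\<lambda>k. avg (H k) \<phi> x - avg h \<phi> x) \<longlonglongrightarrow> \<phi> x - avg h \<phi> x"
      by (intro AE_I2 tendsto_intros avg_converges[OF \<phi>])
    \<comment> \<open>The partial sums telescope to
      \<open>avg (H k) \<phi> x - avg h \<phi> x\<close>, which tends pointwise to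
      \<open>\<phi> x - avg h \<phi> x\<close>, so the uniform bound survives by Fatou's
      lemma.\<close>
    have "lpn lborel s (\<lambda>x. \<phi> x - avg h \<phi> x) \<le> G * (r / (1 - r))"
      by (rule lpn_Fatou(2)[OF _ _ lim bound'])
        (use s C1c_D(5)[OF \<phi>] LpsD(1)[OF avg_Lps[OF \<phi> s, of h]] in \<open>auto intro!: Lps_diff avg_Lps[OF \<phi> s]\<close>)
    then show ?thesis unfolding G_def by (subst lpn_minus_commute) (simp add: mult_ac)
  qed
  then show ?thesis using c r unfolding \<kappa>_def[symmetric] by (intro exI[of _ "c * (r / (1 - r))"]) auto
qed

lemma avg_bound:
  fixes \<phi> :: "real ^ 'n \<Rightarrow> real"
  assumes \<phi>: "C1c \<phi> g" and s: "1 < s" and h: "0 < h"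
  shows "\<bar>avg h \<phi> x\<bar> \<le> h powr (- real CARD('n) / s) * lpn lborel s \<phi>"
proof -
  have "\<bar>avg h \<phi> x\<bar> \<le> (\<integral>y. norm (\<phi> (x + h *\<^sub>R y)) \<partial>cube)"
    unfolding avg_def using integral_norm_bound[of cube "\<lambda>y. \<phi> (x + h *\<^sub>R y)"] by simp
  also have "\<dots> \<le> h powr (- real CARD('n) / s) * lpn lborel s \<phi>"
    using s by (intro cube_mean_bound C1c_D[OF \<phi>] C1c_Lps[OF \<phi>] h) auto
  finally show ?thesis .
qed

text \<open>The difference is the average at \<open>y\<close> of the increment of
  \<open>\<phi>\<close> under translation by \<open>x - y\<close>, whose L^s norm is controlled by
  \<open>translation_estimate\<close>.\<close>

lemma avg_lipschitz:
  fixes \<phi> :: "real ^ 'n \<Rightarrow> real"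
  assumes \<phi>: "C1c \<phi> g" and s: "1 < s" and h: "0 < h"
  shows "\<bar>avg h \<phi> x - avg h \<phi> y\<bar> \<le> h powr (- real CARD('n) / s) * (norm (x - y) * lpn lborel s g)"
proof -
  define \<psi> where "\<psi> z = \<phi> (z + (x - y)) - \<phi> z" for z
  have c: "continuous_on UNIV \<psi>"
    unfolding \<psi>_def by (intro continuous_intros continuous_on_compose2[OF C1c_D(3)[OF \<phi>]]) auto
  have L: "\<psi> \<in> Lps lborel s" "lpn lborel s \<psi> \<le> norm (x - y) * lpn lborel s g"
    unfolding \<psi>_def using translation_estimate[OF \<phi> s] by auto
  have "avg h \<phi> x - avg h \<phi> y = (\<integral>z. \<phi> (x + h *\<^sub>R z) - \<phi> (y + h *\<^sub>R z) \<partial>cube)"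
    unfolding avg_def
    by (intro Bochner_Integration.integral_diff[symmetric] continuous_cube(1) continuous_affine C1c_D(3)[OF \<phi>])
  also have "\<dots> = (\<integral>z. \<psi> (y + h *\<^sub>R z) \<partial>cube)" by (simp add: \<psi>_def algebra_simps)
  also have "\<bar>\<dots>\<bar> \<le> (\<integral>z. norm (\<psi> (y + h *\<^sub>R z)) \<partial>cube)"
    using integral_norm_bound[of cube "\<lambda>z. \<psi> (y + h *\<^sub>R z)"] by simp
  also have "\<dots> \<le> h powr (- real CARD('n) / s) * lpn lborel s \<psi>" by (rule cube_mean_bound[OF c L(1) h s])
  also have "\<dots> \<le> h powr (- real CARD('n) / s) * (norm (x - y) * lpn lborel s g)" by (intro mult_left_mono L) auto
  finally show ?thesis .
qed

lemma avg_support: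
  fixes \<phi> :: "real ^ 'n \<Rightarrow> real"
  assumes "\<And>x. R < norm x \<Longrightarrow> \<phi> x = 0" "0 \<le> h" "h \<le> 1" "R + diam_cube TYPE('n) < norm x"
  shows "avg h \<phi> x = 0"
proof -
  have "(\<integral>y. \<phi> (x + h *\<^sub>R y) \<partial>cube) = (\<integral>y. 0 \<partial>(cube :: (real ^ 'n) measure))"
  proof (rule Bochner_Integration.integral_cong)
    fix y :: "real ^ 'n" assume "y \<in> space cube"
    then have "norm y \<le> diam_cube TYPE('n)" by (intro diam_cube) (simp add: space_cube)
    moreover have "norm (h *\<^sub>R y) \<le> norm y" using assms by (simp add: mult_left_le_one_le)
    ultimately have "norm (h *\<^sub>R y) \<le> diam_cube TYPE('n)" by linarith
    then have "R < norm (x + h *\<^sub>R y)" using assms(4) norm_triangle_ineq2[of x "- (h *\<^sub>R y)"] by simp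
    then show "\<phi> (x + h *\<^sub>R y) = 0" by (rule assms(1))
  qed simp
  then show ?thesis by (simp add: avg_def)
qed

lemma lpn_bounded_support:
  fixes u :: "real ^ 'n \<Rightarrow> real"
  assumes "u \<in> borel_measurable borel" "\<And>x. R < norm x \<Longrightarrow> u x = 0" "\<And>x. \<bar>u x\<bar> \<le> S" "0 < s"
  shows "lpn lborel s u \<le> S * lpn lborel s (indicator (cball 0 R) :: real ^ 'n \<Rightarrow> real)"
proof -
  have S: "0 \<le> S" using assms(3)[of 0] by linarith
  have e: "emeasure lborel (cball (0::real^'n) R) < \<infinity>" using emeasure_compact_finite[of "cball (0::real^'n) R"] by simp
  have I: "(indicator (cball 0 R) :: real ^ 'n \<Rightarrow> real) \<in> Lps lborel s"
  proof (rule LpsI)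
    have "(\<lambda>x::real^'n. norm (indicator (cball 0 R) x :: real) powr s) = indicator (cball 0 R)"
      by (auto simp: indicator_def fun_eq_iff)
    then show "integrable lborel (\<lambda>x::real^'n. norm (indicator (cball 0 R) x :: real) powr s)"
      using e by simp
  qed (auto intro!: borel_measurable_indicator)
  have "lpn lborel s u \<le> lpn lborel s (\<lambda>x::real^'n. S * indicator (cball 0 R) x)"
  proof (rule lpn_mono)
    show "(\<lambda>x::real^'n. S * indicator (cball 0 R) x) \<in> Lps lborel s" by (rule Lps_mult[OF I])
    show "AE x in lborel. norm (u x) \<le> norm (S * indicator (cball 0 R) x)"
      using assms(2,3) S by (intro AE_I2) (auto simp: indicator_def abs_mult not_le)
  qed (use assms in auto)
  also have "\<dots> = S * lpn lborel s (indicator (cball 0 R) :: real ^ 'n \<Rightarrow> real)"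
    using assms(4) S by (subst lpn_mult) auto
  finally show ?thesis .
qed

section \<open>Subcritical Sobolev embedding and compactness\<close>

text \<open>Split \<open>\<phi>\<close> at scale 1. The deviation from the average is covered by
  \<open>avg_approximation\<close>. The average itself is supported in a fixed ball and bounded by
  the L^p norm of \<open>\<phi>\<close>, hence by that of the gradient.\<close>

lemma Sobolev_subcritical:
  fixes p s R :: real
  assumes p: "2 \<le> p" "p < CARD('n)" "p < s" and \<kappa>: "0 < 1 - CARD('n) / p + CARD('n) / s" and R: "0 \<le> R"
  shows "\<exists>C\<ge>0. \<forall>(\<phi> :: real ^ 'n \<Rightarrow> real) g. C1c \<phi> g \<longrightarrow> (\<forall>x. R < norm x \<longrightarrow> \<phi> x = 0) \<longrightarrow>
    lpn lborel s \<phi> \<le> C * lpn lborel p g"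
proof -
  have p1: "1 < p" and s1: "1 < s" using p by auto
  obtain C where C: "C \<ge> 0" "\<And>(\<phi> :: real ^ 'n \<Rightarrow> real) g h. C1c \<phi> g \<Longrightarrow> h > 0 \<Longrightarrow>
    lpn lborel s (\<lambda>x. avg h \<phi> x - \<phi> x) \<le> C * h powr (1 - CARD('n) / p + CARD('n) / s) * lpn lborel p g"
    using avg_approximation[OF p1 p(3) \<kappa>] by blast
  define I where "I = lpn lborel s (indicator (cball 0 (R + diam_cube TYPE('n))) :: real ^ 'n \<Rightarrow> real)"
  define P where "P = R * (p / (CARD('n) - p))"
  have P: "P \<ge> 0" using R p by (simp add: P_def)
  have I: "I \<ge> 0" by (simp add: I_def)
  have "lpn lborel s \<phi> \<le> (C + P * I) * lpn lborel p g"
    if \<phi>: "C1c \<phi> g" and supp: "\<forall>x. R < norm x \<longrightarrow> \<phi> x = 0" for \<phi> :: "real ^ 'n \<Rightarrow> real" and g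
  proof -
    have av: "avg 1 \<phi> \<in> Lps lborel s" by (rule avg_Lps[OF \<phi> s1])
    have ph: "\<phi> \<in> Lps lborel s" using C1c_Lps[OF \<phi>] s1 by auto
    have "lpn lborel s \<phi> \<le> lpn lborel s (\<lambda>x. \<phi> x - avg 1 \<phi> x) + lpn lborel s (avg 1 \<phi>)"
      using lpn_add[OF Lps_diff[OF ph av] av s1] s1 by simp
    also have "lpn lborel s (\<lambda>x. \<phi> x - avg 1 \<phi> x) \<le> C * lpn lborel p g"
      using C(2)[OF \<phi>, of 1] by (subst lpn_minus_commute) simp
    also have "lpn lborel s (avg 1 \<phi>) \<le> (P * lpn lborel p g) * I"
      unfolding I_def
    proof (rule lpn_bounded_support)
      show "avg 1 \<phi> \<in> borel_measurable borel" using LpsD(1)[OF av] by simp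
      show "avg 1 \<phi> x = 0" if "R + diam_cube TYPE('n) < norm x" for x
        using avg_support[of R \<phi> 1 x] supp that by auto
      show "\<bar>avg 1 \<phi> x\<bar> \<le> P * lpn lborel p g" for x
      proof -
        have "\<bar>avg 1 \<phi> x\<bar> \<le> lpn lborel p \<phi>" using avg_bound[OF \<phi> p1, of 1 x] by simp
        also have "\<dots> \<le> P * lpn lborel p g" unfolding P_def using supp by (intro Poincare \<phi> p R) auto
        finally show ?thesis .
      qed
    qed (use s1 in auto)
    finally show ?thesis by (simp add: algebra_simps)
  qed
  then show ?thesis using C P I by (intro exI[of _ "C + P * I"]) auto
qed

text \<open>At a fixed scale \<open>h\<close> the averages are uniformly bounded and uniformly
  Lipschitz with support in a common ball, so Arzela-Ascoli gives uniform convergence on that ball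
  and thus smallness in L^s.\<close>

lemma Rellich_one_scale:
  fixes \<phi> :: "nat \<Rightarrow> real ^ 'n \<Rightarrow> real" and p s R h :: real
  assumes p: "2 \<le> p" "p < CARD('n)" and s: "1 < s" and R: "0 \<le> R"
    and \<phi>: "\<And>k. C1c (\<phi> k) (g k)" "\<And>k x. R < norm x \<Longrightarrow> \<phi> k x = 0" "\<And>k. lpn lborel p (g k) \<le> B"
    and h: "0 < h" "h \<le> 1" and e: "0 < e"
  shows "\<exists>r :: nat \<Rightarrow> nat. strict_mono r \<and> (\<forall>i j. lpn lborel s (\<lambda>x. avg h (\<phi> (r i)) x - avg h (\<phi> (r j)) x) \<le> e)"
proof -
  have p1: "1 < p" using p by simp
  define S :: "(real ^ 'n) set" where "S = cball 0 (R + diam_cube TYPE('n))"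
  define I where "I = lpn lborel s (indicator S :: real ^ 'n \<Rightarrow> real)"
  have I: "I \<ge> 0" by (simp add: I_def)
  define H where "H = h powr (- real CARD('n) / p)"
  have H: "H \<ge> 0" by (simp add: H_def)
  have B: "B \<ge> 0" using \<phi>(3)[of 0] lpn_nonneg[of lborel p "g 0"] by linarith
  define P where "P = R * (p / (CARD('n) - p))"
  have P: "P \<ge> 0" using R p by (simp add: P_def)
  have bnd: "norm (avg h (\<phi> k) x) \<le> H * (P * B)" for k x
  proof -
    have "\<bar>avg h (\<phi> k) x\<bar> \<le> H * lpn lborel p (\<phi> k)" unfolding H_def by (rule avg_bound[OF \<phi>(1) p1 h(1)])
    also have "\<dots> \<le> H * (P * lpn lborel p (g k))" unfolding P_def using H by (intro mult_left_mono Poincare \<phi> p R) auto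
    also have "\<dots> \<le> H * (P * B)" using H P \<phi>(3) by (intro mult_left_mono) auto
    finally show ?thesis by simp
  qed
  have lip: "norm (avg h (\<phi> k) x - avg h (\<phi> k) y) \<le> H * B * norm (x - y)" for k x y
  proof -
    have "\<bar>avg h (\<phi> k) x - avg h (\<phi> k) y\<bar> \<le> H * (norm (x - y) * lpn lborel p (g k))"
      unfolding H_def by (rule avg_lipschitz[OF \<phi>(1) p1 h(1)])
    also have "\<dots> \<le> H * (norm (x - y) * B)" using H \<phi>(3) by (intro mult_left_mono) auto
    finally show ?thesis by (simp add: mult_ac)
  qed
  obtain F k where k: "strict_mono (k :: nat \<Rightarrow> nat)"
    "\<And>e. 0 < e \<Longrightarrow> \<exists>N. \<forall>n x. n \<ge> N \<and> x \<in> S \<longrightarrow> norm (avg h (\<phi> (k n)) x - F x) < e"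
  proof (rule Arzela_Ascoli[of S "\<lambda>k. avg h (\<phi> k)" "H * (P * B)"])
    show "compact S" by (simp add: S_def)
    show "norm (avg h (\<phi> n) x) \<le> H * (P * B)" for n x by (rule bnd)
    show "\<exists>d. 0 < d \<and> (\<forall>n y. y \<in> S \<and> norm (x - y) < d \<longrightarrow> norm (avg h (\<phi> n) x - avg h (\<phi> n) y) < e)"
      if "0 < e" for x e
    proof (intro exI conjI allI impI)
      have HB: "H * B + 1 > 0" using H B by (simp add: add_nonneg_pos)
      show "0 < e / (H * B + 1)" using that HB by simp
      fix n y assume "y \<in> S \<and> norm (x - y) < e / (H * B + 1)"
      then have "(H * B + 1) * norm (x - y) < e" using HB by (simp add: field_simps)
      moreover have "H * B * norm (x - y) \<le> (H * B + 1) * norm (x - y)" by (intro mult_right_mono) auto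
      ultimately show "norm (avg h (\<phi> n) x - avg h (\<phi> n) y) < e" using lip[of n x y] by linarith
    qed
  qed (blast intro: that)
  define d where "d = e / (I + 1) / 2"
  have d: "d > 0" using e I by (simp add: d_def)
  obtain N where N: "\<And>n x. n \<ge> N \<Longrightarrow> x \<in> S \<Longrightarrow> norm (avg h (\<phi> (k n)) x - F x) < d"
    using k(2)[OF d] by blast
  show ?thesis
  proof (intro exI[of _ "\<lambda>i. k (i + N)"] conjI allI)
    show "strict_mono (\<lambda>i. k (i + N))" using k(1) by (simp add: strict_mono_def)
    fix i j
    have "lpn lborel s (\<lambda>x. avg h (\<phi> (k (i + N))) x - avg h (\<phi> (k (j + N))) x) \<le> (2 * d) * I"
      unfolding I_def S_def
    proof (rule lpn_bounded_support)
      show "(\<lambda>x. avg h (\<phi> (k (i + N))) x - avg h (\<phi> (k (j + N))) x) \<in> borel_measurable borel"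
        using LpsD(1)[OF avg_Lps[OF \<phi>(1) s, of h "k (i + N)"]] LpsD(1)[OF avg_Lps[OF \<phi>(1) s, of h "k (j + N)"]] by simp
      have out: "avg h (\<phi> l) x = 0" if "R + diam_cube TYPE('n) < norm x" for x l
        using avg_support[of R "\<phi> l" h x] \<phi>(2) h that by auto
      then show "avg h (\<phi> (k (i + N))) x - avg h (\<phi> (k (j + N))) x = 0" if "R + diam_cube TYPE('n) < norm x" for x
        using that by simp
      show "\<bar>avg h (\<phi> (k (i + N))) x - avg h (\<phi> (k (j + N))) x\<bar> \<le> 2 * d" for x
      proof (cases "x \<in> S")
        case True
        then show ?thesis using N[of "i + N" x] N[of "j + N" x] by simp
      next
        case False
        then show ?thesis using out[of x] d by (simp add: S_def)
      qed
    qed (use s in auto)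
    also have "\<dots> \<le> e" using I e by (simp add: d_def field_simps)
    finally show "lpn lborel s (\<lambda>x. avg h (\<phi> (k (i + N))) x - avg h (\<phi> (k (j + N))) x) \<le> e" .
  qed
qed

text \<open>Replacing the functions by their averages at scale 1/(m+1) costs an error that is
  uniform along the sequence and tends to 0 with the scale. At each scale there is a nearly constant
  subsequence, and a diagonal sequence serves all scales.\<close>

lemma Rellich:
  fixes \<phi> :: "nat \<Rightarrow> real ^ 'n \<Rightarrow> real" and p s R :: real
  assumes p: "2 \<le> p" "p < CARD('n)" "p < s" and \<kappa>: "0 < 1 - CARD('n) / p + CARD('n) / s" and R: "0 \<le> R"
    and \<phi>: "\<And>k. C1c (\<phi> k) (g k)" "\<And>k x. R < norm x \<Longrightarrow> \<phi> k x = 0" "\<And>k. lpn lborel p (g k) \<le> B"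
  obtains r :: "nat \<Rightarrow> nat" where "strict_mono r"
    "\<And>e. e > 0 \<Longrightarrow> \<exists>N. \<forall>i\<ge>N. \<forall>j\<ge>N. lpn lborel s (\<lambda>x. \<phi> (r i) x - \<phi> (r j) x) < e"
proof -
  have p1: "1 < p" and s1: "1 < s" using p by auto
  define \<kappa>' where "\<kappa>' = 1 - CARD('n) / p + CARD('n) / s"
  obtain C where C: "C \<ge> 0" "\<And>(\<phi> :: real ^ 'n \<Rightarrow> real) g h. C1c \<phi> g \<Longrightarrow> h > 0 \<Longrightarrow>
    lpn lborel s (\<lambda>x. avg h \<phi> x - \<phi> x) \<le> C * h powr \<kappa>' * lpn lborel p g"
    using avg_approximation[OF p1 p(3) \<kappa>] unfolding \<kappa>'_def by blast
  \<comment> \<open>Two approximation errors, one for each function, plus the oscillation allowed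
    among the averages at this scale.\<close>
  define b where "b m = 2 * (C * (1 / real (Suc m)) powr \<kappa>' * B) + 1 / real (Suc m)" for m
  have B: "B \<ge> 0" using \<phi>(3)[of 0] lpn_nonneg[of lborel p "g 0"] by linarith
  define Pr where "Pr m r \<longleftrightarrow> (\<forall>i j. lpn lborel s (\<lambda>x. \<phi> (r i) x - \<phi> (r j) x) \<le> b m)" for m and r :: "nat \<Rightarrow> nat"
  have ps: "\<phi> k \<in> Lps lborel s" for k using C1c_Lps[OF \<phi>(1)] s1 by auto
  have av: "avg h (\<phi> k) \<in> Lps lborel s" for k h by (rule avg_Lps[OF \<phi>(1) s1])
  interpret sub: subseqs Pr
  proof
    fix m and t :: "nat \<Rightarrow> nat" assume "strict_mono t"
    define h where "h = 1 / real (Suc m)"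
    have h: "0 < h" "h \<le> 1" by (auto simp: h_def)
    have "\<exists>r :: nat \<Rightarrow> nat. strict_mono r \<and> (\<forall>i j. lpn lborel s (\<lambda>x. avg h (\<phi> (t (r i))) x - avg h (\<phi> (t (r j))) x) \<le> h)"
      by (rule Rellich_one_scale[OF p(1,2) s1 R, of "\<lambda>k. \<phi> (t k)" "\<lambda>k. g (t k)" B h h]) (use \<phi> h in auto)
    then obtain r :: "nat \<Rightarrow> nat" where r: "strict_mono r" "\<And>i j. lpn lborel s (\<lambda>x. avg h (\<phi> (t (r i))) x - avg h (\<phi> (t (r j))) x) \<le> h"
      by blast
    have "lpn lborel s (\<lambda>x. \<phi> (t (r i)) x - \<phi> (t (r j)) x) \<le> b m" for i j
    proof -
      have c: "lpn lborel s (\<lambda>x. avg h (\<phi> k) x - \<phi> k x) \<le> C * h powr \<kappa>' * B" for k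
        using C(2)[OF \<phi>(1), of h k] mult_left_mono[OF \<phi>(3)[of k], of "C * h powr \<kappa>'"] C(1) h by simp
      have "lpn lborel s (\<lambda>x. \<phi> (t (r i)) x - \<phi> (t (r j)) x) \<le> lpn lborel s (\<lambda>x. \<phi> (t (r i)) x - avg h (\<phi> (t (r i))) x)
          + lpn lborel s (\<lambda>x. avg h (\<phi> (t (r i))) x - \<phi> (t (r j)) x)"
        by (intro lpn_triangle ps av s1)
      also have "lpn lborel s (\<lambda>x. avg h (\<phi> (t (r i))) x - \<phi> (t (r j)) x) \<le>
          lpn lborel s (\<lambda>x. avg h (\<phi> (t (r i))) x - avg h (\<phi> (t (r j))) x) + lpn lborel s (\<lambda>x. avg h (\<phi> (t (r j))) x - \<phi> (t (r j)) x)"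
        by (intro lpn_triangle ps av s1)
      finally show ?thesis
        using c[of "t (r i)"] c[of "t (r j)"] r(2)[of i j] lpn_minus_commute[of lborel s "\<phi> (t (r i))" "avg h (\<phi> (t (r i)))"]
        unfolding b_def h_def by linarith
    qed
    then show "\<exists>r'. strict_mono r' \<and> Pr m (t \<circ> r')" using r(1) by (auto simp: Pr_def)
  qed
  have stable: "Pr n (t \<circ> r)" if "Pr n t" for n t r using that by (auto simp: Pr_def)
  have "(\<lambda>m. 2 * (C * (1 / real (Suc m)) powr \<kappa>' * B) + 1 / real (Suc m)) \<longlonglongrightarrow> 2 * (C * 0 * B) + 0"
    using \<kappa> unfolding \<kappa>'_def
    by (intro tendsto_intros tendsto_zero_powrI[OF LIMSEQ_Suc[OF lim_1_over_n]] LIMSEQ_Suc[OF lim_1_over_n] tendsto_const) auto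
  then have b0: "b \<longlonglongrightarrow> 0" by (simp add: b_def[abs_def])
  show ?thesis
  proof (rule that[OF sub.subseq_diagseq])
    fix e :: real assume "e > 0"
    then obtain m where m: "b m < e" using order_tendstoD(2)[OF b0, of e] eventually_happens'[OF sequentially_bot] by blast
    \<comment> \<open>The diagonal sequence is a subsequence of the m-th one only from index
      \<open>Suc m\<close> on, hence the shift.\<close>
    have "Pr m (sub.diagseq \<circ> (+) (Suc m))" using stable by (intro sub.diagseq_holds)
    then have P: "lpn lborel s (\<lambda>x. \<phi> (sub.diagseq (Suc m + i)) x - \<phi> (sub.diagseq (Suc m + j)) x) \<le> b m" for i j
      by (auto simp: Pr_def)
    have "lpn lborel s (\<lambda>x. \<phi> (sub.diagseq i) x - \<phi> (sub.diagseq j) x) < e" if "i \<ge> Suc m" "j \<ge> Suc m" for i j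
      using P[of "i - Suc m" "j - Suc m"] that m by simp
    then show "\<exists>N. \<forall>i\<ge>N. \<forall>j\<ge>N. lpn lborel s (\<lambda>x. \<phi> (sub.diagseq i) x - \<phi> (sub.diagseq j) x) < e" by blast
  qed
qed

section \<open>Test functions and smooth functionals\<close>

definition grad :: "(real ^ 'n \<Rightarrow> real) \<Rightarrow> real ^ 'n \<Rightarrow> real ^ 'n" where
  "grad \<phi> x = (\<chi> i. partial_deriv i \<phi> x)"

lemma frechet_derivative_grad:
  fixes \<phi> :: "real ^ 'n \<Rightarrow> real"
  assumes "\<phi> differentiable (at x)"
  shows "(\<phi> has_derivative (\<lambda>h. grad \<phi> x \<bullet> h)) (at x)"
proof -
  define f' where "f' = frechet_derivative \<phi> (at x)"
  have d: "(\<phi> has_derivative f') (at x)" using assms by (simp add: f'_def frechet_derivative_works)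
  then interpret f': linear f' by (rule has_derivative_linear)
  have "f' h = grad \<phi> x \<bullet> h" for h
  proof -
    have "h = (\<Sum>i\<in>UNIV. (h $ i) *\<^sub>R axis i 1)"
      using basis_expansion[of h] by (simp add: scalar_mult_eq_scaleR)
    then have "f' h = (\<Sum>i\<in>UNIV. f' ((h $ i) *\<^sub>R axis i 1))" by (metis f'.sum)
    also have "\<dots> = (\<Sum>i\<in>UNIV. (h $ i) * f' (axis i 1))" by (simp add: f'.scale)
    also have "\<dots> = grad \<phi> x \<bullet> h"
      by (simp add: grad_def inner_vec_def partial_deriv_def f'_def mult.commute)
    finally show ?thesis .
  qed
  then have "f' = (\<lambda>h. grad \<phi> x \<bullet> h)" by auto
  with d show ?thesis by simp
qed

lemma grad_eqI:
  assumes "(\<phi> has_derivative (\<lambda>h. g \<bullet> h)) (at x)"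
  shows "grad \<phi> x = g"
proof -
  have "frechet_derivative \<phi> (at x) = (\<lambda>h. g \<bullet> h)" using frechet_derivative_at[OF assms] by simp
  then show ?thesis by (simp add: grad_def partial_deriv_def vec_eq_iff inner_axis)
qed

lemma partial_deriv_grad: "partial_deriv i \<phi> x = grad \<phi> x $ i"
  by (simp add: grad_def)

lemma C_k_add_scale:
  assumes "C_k k f" "C_k k g"
  shows "C_k k (\<lambda>x. f x + c * g x)"
  using assms
proof (induction k arbitrary: f g)
  case 0
  then show ?case by (auto intro!: continuous_intros)
next
  case (Suc k)
  then have d: "f differentiable (at x)" "g differentiable (at x)" for x by auto
  have "partial_deriv i (\<lambda>x. f x + c * g x) = (\<lambda>x. partial_deriv i f x + c * partial_deriv i g x)" for i
  proof
    fix x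
    have "((\<lambda>x. f x + c * g x) has_derivative (\<lambda>h. (grad f x + c *\<^sub>R grad g x) \<bullet> h)) (at x)"
      using d[of x, THEN frechet_derivative_grad]
      by (auto intro!: derivative_eq_intros simp: inner_add_left)
    then have "grad (\<lambda>x. f x + c * g x) x = grad f x + c *\<^sub>R grad g x" by (rule grad_eqI)
    then show "partial_deriv i (\<lambda>x. f x + c * g x) x = partial_deriv i f x + c * partial_deriv i g x"
      by (simp add: partial_deriv_grad)
  qed
  moreover have "(\<lambda>x. f x + c * g x) differentiable (at x)" for x
    using d[of x] by (intro differentiable_add differentiable_mult) auto
  ultimately show ?case using Suc by auto
qed

lemma test_function_differentiable:
  assumes "\<phi> \<in> test_functions \<Omega>"
  shows "\<phi> differentiable (at x)" "continuous_on UNIV (partial_deriv i \<phi>)"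
proof -
  have "C_k 1 \<phi>" using assms by (simp add: test_functions_def)
  then show "\<phi> differentiable (at x)" "continuous_on UNIV (partial_deriv i \<phi>)" by auto
qed

lemma test_function_C1c:
  assumes "\<phi> \<in> test_functions \<Omega>"
  shows "C1c \<phi> (grad \<phi>)"
  unfolding C1c_def
proof (intro conjI allI)
  show "(\<phi> has_derivative (\<bullet>) (grad \<phi> x)) (at x)" for x
    by (rule frechet_derivative_grad[OF test_function_differentiable(1)[OF assms]])
  show "continuous_on UNIV (grad \<phi>)"
    unfolding grad_def[abs_def]
    by (intro continuous_on_vec_lambda test_function_differentiable(2)[OF assms])
  have "bounded (closure {x. \<phi> x \<noteq> 0})" using assms by (auto simp: test_functions_def compact_imp_bounded)
  then obtain R where "\<forall>x\<in>closure {x. \<phi> x \<noteq> 0}. norm x \<le> R" by (auto simp: bounded_iff)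
  moreover have "{x. \<phi> x \<noteq> 0} \<subseteq> closure {x. \<phi> x \<noteq> 0}" by (rule closure_subset)
  ultimately show "\<exists>R. \<forall>x. R < norm x \<longrightarrow> \<phi> x = 0" by (intro exI[of _ R]) force
qed

lemma test_function_outside:
  assumes "\<phi> \<in> test_functions \<Omega>" "x \<notin> \<Omega>"
  shows "\<phi> x = 0" "grad \<phi> x = 0"
proof -
  have x: "x \<in> - closure {x. \<phi> x \<noteq> 0}" using assms by (auto simp: test_functions_def)
  have 0: "\<phi> y = 0" if "y \<in> - closure {x. \<phi> x \<noteq> 0}" for y
    using that closure_subset[of "{x. \<phi> x \<noteq> 0}"] by blast
  show "\<phi> x = 0" by (rule 0[OF x])
  have "((\<lambda>_. 0) has_derivative (\<lambda>h. 0 \<bullet> h)) (at x)" by simp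
  then have "(\<phi> has_derivative (\<lambda>h. 0 \<bullet> h)) (at x)"
  proof (rule has_derivative_transform_within_open)
    show "open (- closure {x. \<phi> x \<noteq> 0})" by (rule open_Compl[OF closed_closure])
    show "x \<in> - closure {x. \<phi> x \<noteq> 0}" by (rule x)
    show "0 = \<phi> y" if "y \<in> - closure {x. \<phi> x \<noteq> 0}" for y by (rule 0[OF that, symmetric])
  qed
  then show "grad \<phi> x = 0" by (rule grad_eqI)
qed

lemma test_functions_zero: "(\<lambda>x::real^'n. 0) \<in> test_functions \<Omega>"
proof -
  have "C_k k (\<lambda>x::real^'n. 0)" for k
  proof (induction k)
    case (Suc k)
    have "grad (\<lambda>x::real^'n. 0) x = 0" for x by (rule grad_eqI) simp
    then have "partial_deriv i (\<lambda>x::real^'n. 0) = (\<lambda>x. 0)" for i by (simp add: fun_eq_iff partial_deriv_grad)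
    with Suc show ?case by auto
  qed simp
  then show ?thesis by (simp add: test_functions_def)
qed

lemma test_functions_add_scale:
  assumes f: "f \<in> test_functions \<Omega>" and g: "g \<in> test_functions \<Omega>"
  shows "(\<lambda>x. f x + c * g x) \<in> test_functions \<Omega>" "grad (\<lambda>x. f x + c * g x) x = grad f x + c *\<^sub>R grad g x"
proof -
  define S where "S = closure {x. f x \<noteq> 0} \<union> closure {x. g x \<noteq> 0}"
  have S: "compact S" "S \<subseteq> \<Omega>" using f g by (auto simp: S_def test_functions_def)
  have "{x. f x + c * g x \<noteq> 0} \<subseteq> S"
  proof
    fix x assume "x \<in> {x. f x + c * g x \<noteq> 0}"
    then have "x \<in> {x. f x \<noteq> 0} \<or> x \<in> {x. g x \<noteq> 0}" by auto
    then show "x \<in> S"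
      using closure_subset[of "{x. f x \<noteq> 0}"] closure_subset[of "{x. g x \<noteq> 0}"] unfolding S_def by blast
  qed
  then have cl: "closure {x. f x + c * g x \<noteq> 0} \<subseteq> S" using S(1) by (intro closure_minimal compact_imp_closed)
  then have "compact (closure {x. f x + c * g x \<noteq> 0})"
    using compact_Int_closed[OF S(1) closed_closure, of "{x. f x + c * g x \<noteq> 0}"] by (simp add: Int_absorb1)
  then show "(\<lambda>x. f x + c * g x) \<in> test_functions \<Omega>"
  proof -
    have "C_k k (\<lambda>x. f x + c * g x)" for k
      using f g by (intro C_k_add_scale) (auto simp: test_functions_def)
    then show ?thesis using cl S \<open>compact (closure {x. f x + c * g x \<noteq> 0})\<close> by (auto simp: test_functions_def)
  qed
  have "((\<lambda>x. f x + c * g x) has_derivative (\<lambda>h. (grad f x + c *\<^sub>R grad g x) \<bullet> h)) (at x)"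
    using frechet_derivative_grad[OF test_function_differentiable(1)[OF f]]
      frechet_derivative_grad[OF test_function_differentiable(1)[OF g]]
    by (auto intro!: derivative_eq_intros simp: inner_add_left)
  then show "grad (\<lambda>x. f x + c * g x) x = grad f x + c *\<^sub>R grad g x" by (rule grad_eqI)
qed

lemma test_functions_diff:
  assumes "f \<in> test_functions \<Omega>" "g \<in> test_functions \<Omega>"
  shows "(\<lambda>x. f x - g x) \<in> test_functions \<Omega>" "grad (\<lambda>x. f x - g x) = (\<lambda>x. grad f x - grad g x)"
  using test_functions_add_scale[OF assms, of "-1"] by (auto simp: fun_eq_iff)

lemma test_functions_add:
  assumes "f \<in> test_functions \<Omega>" "g \<in> test_functions \<Omega>"
  shows "(\<lambda>x. f x + g x) \<in> test_functions \<Omega>" "grad (\<lambda>x. f x + g x) = (\<lambda>x. grad f x + grad g x)"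
  using test_functions_add_scale[OF assms, of "1"] by (auto simp: fun_eq_iff)

lemma test_functions_scale:
  assumes "f \<in> test_functions \<Omega>"
  shows "(\<lambda>x. c * f x) \<in> test_functions \<Omega>" "grad (\<lambda>x. c * f x) = (\<lambda>x. c *\<^sub>R grad f x)"
proof -
  have "grad (\<lambda>x::real^'n. 0) x = 0" for x by (rule grad_eqI) simp
  then show "(\<lambda>x. c * f x) \<in> test_functions \<Omega>" "grad (\<lambda>x. c * f x) = (\<lambda>x. c *\<^sub>R grad f x)"
    using test_functions_add_scale[OF test_functions_zero assms, of c] by (auto simp: fun_eq_iff)
qed

text \<open>The inequalities so far live on the whole space with \<open>lborel\<close>, the problem
  on \<open>lebesgue_on \<Omega>\<close>. For Borel functions that vanish off
  \<open>\<Omega>\<close> the two integrals agree.\<close>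

lemma lebesgue_on_lborel:
  fixes f :: "'a::euclidean_space \<Rightarrow> 'b::euclidean_space"
  assumes \<Omega>: "\<Omega> \<in> sets lebesgue" and f: "f \<in> borel_measurable borel" "\<And>x. x \<notin> \<Omega> \<Longrightarrow> f x = 0"
  shows "integrable (lebesgue_on \<Omega>) f \<longleftrightarrow> integrable lborel f"
    "(\<integral>x. f x \<partial>lebesgue_on \<Omega>) = (\<integral>x. f x \<partial>lborel)"
proof -
  have eq: "(\<lambda>x. indicator \<Omega> x *\<^sub>R f x) = f" using f(2) by (auto simp: indicator_def fun_eq_iff)
  have "integrable (lebesgue_on \<Omega>) f \<longleftrightarrow> integrable lebesgue f"
    using \<Omega> by (subst integrable_restrict_space) (auto simp: eq)
  also have "\<dots> \<longleftrightarrow> integrable lborel f" using f by (intro integrable_completion) simp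
  finally show "integrable (lebesgue_on \<Omega>) f \<longleftrightarrow> integrable lborel f" .
  have "(\<integral>x. f x \<partial>lebesgue_on \<Omega>) = (\<integral>x. f x \<partial>lebesgue)"
    using \<Omega> by (subst integral_restrict_space) (auto simp: eq)
  also have "\<dots> = (\<integral>x. f x \<partial>lborel)" using f by (intro integral_completion) simp
  finally show "(\<integral>x. f x \<partial>lebesgue_on \<Omega>) = (\<integral>x. f x \<partial>lborel)" .
qed

lemma Lps_lebesgue_on:
  fixes f :: "'a::euclidean_space \<Rightarrow> 'b::euclidean_space"
  assumes \<Omega>: "\<Omega> \<in> sets lebesgue" and f: "f \<in> Lps lborel s" "\<And>x. x \<notin> \<Omega> \<Longrightarrow> f x = 0"
  shows "f \<in> Lps (lebesgue_on \<Omega>) s" "lpn (lebesgue_on \<Omega>) s f = lpn lborel s f"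
proof -
  have fm [measurable]: "f \<in> borel_measurable borel" using LpsD(1)[OF f(1)] by simp
  have nm: "(\<lambda>x. norm (f x) powr s) \<in> borel_measurable borel" by measurable
  have n0: "norm (f x) powr s = 0" if "x \<notin> \<Omega>" for x using f(2)[OF that] by simp
  have "f \<in> borel_measurable lebesgue" using measurable_completion[of f lborel borel] fm by simp
  then have "f \<in> borel_measurable (lebesgue_on \<Omega>)" by (rule measurable_restrict_space1)
  then show "f \<in> Lps (lebesgue_on \<Omega>) s"
    using lebesgue_on_lborel(1)[OF \<Omega> nm n0] LpsD(2)[OF f(1)] by (intro LpsI) auto
  show "lpn (lebesgue_on \<Omega>) s f = lpn lborel s f"
    unfolding lpn_def using lebesgue_on_lborel(2)[OF \<Omega> nm n0] by simp
qed

text \<open>The last assumption says s < n p / (n - p), written as positivity of the power of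
  \<open>h\<close> gained in the approximation by averages.\<close>

locale hardy_domain =
  fixes \<Omega> :: "(real ^ 'n) set" and p s :: real
  assumes bounded_domain: "bounded \<Omega>" and open_domain: "open \<Omega>"
    and p: "2 \<le> p" "p < CARD('n)" and ps: "p < s" and subcritical: "0 < 1 - CARD('n) / p + CARD('n) / s"
begin

abbreviation "M \<equiv> lebesgue_on \<Omega>"
abbreviation "D \<equiv> test_functions \<Omega>"
abbreviation "N \<phi> \<equiv> lpn M p (grad \<phi>)"

lemma p1: "1 < p" and s1: "1 < s" and p0: "0 < p" and s0: "0 < s"
  using p ps by auto

lemma domain_sets: "\<Omega> \<in> sets lebesgue"
  using open_domain by (simp add: borel_open)

lemma finite_M: "finite_measure M"
proof (rule finite_measureI)
  have "emeasure lebesgue \<Omega> < \<infinity>"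
    using bounded_domain emeasure_bounded_finite[of \<Omega>] open_domain by (simp add: emeasure_completion borel_open)
  then show "emeasure M (space M) \<noteq> \<infinity>"
    using domain_sets by (simp add: space_restrict_space emeasure_restrict_space)
qed

lemma test_Lps:
  assumes "\<phi> \<in> D"
  shows "\<phi> \<in> Lps M s" "\<phi> \<in> Lps M p" "grad \<phi> \<in> Lps M p" "(\<lambda>x. \<phi> x / norm x) \<in> Lps M p"
    "lpn M s \<phi> = lpn lborel s \<phi>" "lpn M p \<phi> = lpn lborel p \<phi>" "N \<phi> = lpn lborel p (grad \<phi>)"
    "lpn M p (\<lambda>x. \<phi> x / norm x) = lpn lborel p (\<lambda>x. \<phi> x / norm x)"
  using Lps_lebesgue_on[OF domain_sets C1c_Lps(1)[OF test_function_C1c[OF assms] s0] test_function_outside(1)[OF assms]]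
    Lps_lebesgue_on[OF domain_sets C1c_Lps(1)[OF test_function_C1c[OF assms] p0] test_function_outside(1)[OF assms]]
    Lps_lebesgue_on[OF domain_sets C1c_Lps(2)[OF test_function_C1c[OF assms] p0] test_function_outside(2)[OF assms]]
    Lps_lebesgue_on[OF domain_sets Hardy(1)[OF test_function_C1c[OF assms] p]] test_function_outside(1)[OF assms]
  by auto

text \<open>A single constant for the Hardy quotient, the subcritical norm and the L^p norm. It
  makes a sequence that is Cauchy for \<open>N\<close> Cauchy in all three at once.\<close>

lemma embedding:
  "\<exists>K\<ge>0. \<forall>\<phi>\<in>D. lpn M p (\<lambda>x. \<phi> x / norm x) \<le> K * N \<phi> \<and> lpn M s \<phi> \<le> K * N \<phi> \<and> lpn M p \<phi> \<le> K * N \<phi>"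
proof -
  obtain R where R: "R > 0" "\<forall>x\<in>\<Omega>. norm x \<le> R" using bounded_domain by (auto simp: bounded_pos)
  obtain C where C: "C \<ge> 0" "\<And>(\<phi> :: real ^ 'n \<Rightarrow> real) g. C1c \<phi> g \<Longrightarrow> (\<forall>x. R < norm x \<longrightarrow> \<phi> x = 0) \<Longrightarrow>
    lpn lborel s \<phi> \<le> C * lpn lborel p g"
    using Sobolev_subcritical[OF p ps subcritical, of R] R by auto
  define H where "H = p / (CARD('n) - p)"
  have H: "H \<ge> 0" using p by (simp add: H_def)
  define K where "K = C + H + R * H"
  have K: "C \<le> K" "H \<le> K" "R * H \<le> K" using C H R by (auto simp: K_def)
  have "lpn M p (\<lambda>x. \<phi> x / norm x) \<le> K * N \<phi> \<and> lpn M s \<phi> \<le> K * N \<phi> \<and> lpn M p \<phi> \<le> K * N \<phi>" if \<phi>: "\<phi> \<in> D" for \<phi>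
  proof -
    have c: "C1c \<phi> (grad \<phi>)" by (rule test_function_C1c[OF \<phi>])
    have out: "\<phi> x = 0" if "R < norm x" for x
      using that R by (intro test_function_outside(1)[OF \<phi>]) force
    have "C * N \<phi> \<le> K * N \<phi>" "H * N \<phi> \<le> K * N \<phi>" "R * H * N \<phi> \<le> K * N \<phi>"
      using K by (auto intro!: mult_right_mono)
    moreover have "lpn M p (\<lambda>x. \<phi> x / norm x) \<le> H * N \<phi>" "lpn M s \<phi> \<le> C * N \<phi>" "lpn M p \<phi> \<le> R * H * N \<phi>"
      using Hardy(2)[OF c p] C(2)[OF c] Poincare[OF c p, of R] out R(1) unfolding H_def test_Lps[OF \<phi>] by auto
    ultimately show ?thesis by linarith
  qed
  then show ?thesis using C H R by (intro exI[of _ K]) (auto simp: K_def)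
qed

lemma N_add: "u \<in> D \<Longrightarrow> v \<in> D \<Longrightarrow> N (\<lambda>x. u x + v x) \<le> N u + N v"
  unfolding test_functions_add(2) by (intro lpn_add test_Lps p1)

lemma N_scale: "u \<in> D \<Longrightarrow> N (\<lambda>x. c * u x) = \<bar>c\<bar> * N u"
  unfolding test_functions_scale(2) using p0 by (rule lpn_scaleR)

lemma N_diff: "u \<in> D \<Longrightarrow> v \<in> D \<Longrightarrow> N (\<lambda>x. u x - v x) = lpn M p (\<lambda>x. grad u x - grad v x)"
  by (simp add: test_functions_diff(2))

lemma Rellich_domain:
  assumes u: "\<And>k. u k \<in> D" "\<And>k. N (u k) \<le> B"
  obtains r :: "nat \<Rightarrow> nat" where "strict_mono r"
    "\<And>e. e > 0 \<Longrightarrow> \<exists>n. \<forall>i\<ge>n. \<forall>j\<ge>n. lpn M s (\<lambda>x. u (r i) x - u (r j) x) < e"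
proof -
  obtain R where R: "R > 0" "\<forall>x\<in>\<Omega>. norm x \<le> R" using bounded_domain by (auto simp: bounded_pos)
  have out: "u k x = 0" if "R < norm x" for k x
    using that R by (intro test_function_outside(1)[OF u(1)]) force
  have B: "lpn lborel p (grad (u k)) \<le> B" for k using u(2)[of k] test_Lps(7)[OF u(1)] by simp
  show ?thesis
  proof (rule Rellich[OF p ps subcritical less_imp_le[OF R(1)] test_function_C1c[OF u(1)] out B])
    fix r :: "nat \<Rightarrow> nat"
    assume r: "strict_mono r"
      "\<And>e. e > 0 \<Longrightarrow> \<exists>n. \<forall>i\<ge>n. \<forall>j\<ge>n. lpn lborel s (\<lambda>x. u (r i) x - u (r j) x) < e"
    have "lpn M s (\<lambda>x. u (r i) x - u (r j) x) = lpn lborel s (\<lambda>x. u (r i) x - u (r j) x)" for i j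
      by (rule test_Lps(5)[OF test_functions_diff(1)[OF u(1) u(1)]])
    then show ?thesis using r(2) by (intro that[OF r(1)]) simp
  qed
qed

end

text \<open>The analytic axioms of the locale \<open>energy\<close>, for every radius: in this form
  they can be verified for each term of the energy separately and then added.\<close>

definition smooth_on :: "'a::real_vector set \<Rightarrow> ('a \<Rightarrow> real) \<Rightarrow> ('a \<Rightarrow> real) \<Rightarrow> ('a \<Rightarrow> 'a \<Rightarrow> real) \<Rightarrow> bool" where
  "smooth_on D N I dI \<longleftrightarrow>
    (\<forall>u\<in>D. \<forall>v\<in>D. \<forall>w\<in>D. dI u (v + w) = dI u v + dI u w) \<and>
    (\<forall>u\<in>D. \<forall>v\<in>D. \<forall>c. dI u (c *\<^sub>R v) = c * dI u v) \<and>
    (\<forall>R. \<forall>\<epsilon>>0. \<exists>d>0. \<forall>u\<in>D. \<forall>v\<in>D. N u \<le> R \<longrightarrow> N v \<le> d \<longrightarrow> \<bar>I (u + v) - I u - dI u v\<bar> \<le> \<epsilon> * N v) \<and>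
    (\<forall>R. \<exists>C\<ge>0. \<forall>u\<in>D. \<forall>v\<in>D. N u \<le> R \<longrightarrow> \<bar>dI u v\<bar> \<le> C * N v) \<and>
    (\<forall>R. \<forall>\<epsilon>>0. \<exists>d>0. \<forall>u\<in>D. \<forall>w\<in>D. \<forall>v\<in>D. N u \<le> R \<longrightarrow> N (w - u) \<le> d \<longrightarrow> \<bar>dI w v - dI u v\<bar> \<le> \<epsilon> * N v) \<and>
    (\<forall>R. \<exists>B. \<forall>u\<in>D. N u \<le> R \<longrightarrow> \<bar>I u\<bar> \<le> B)"

lemma smooth_onD:
  assumes "smooth_on D N I dI"
  shows "\<epsilon> > 0 \<Longrightarrow> \<exists>d>0. \<forall>u\<in>D. \<forall>v\<in>D. N u \<le> R \<longrightarrow> N v \<le> d \<longrightarrow> \<bar>I (u + v) - I u - dI u v\<bar> \<le> \<epsilon> * N v"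
    "\<exists>C\<ge>0. \<forall>u\<in>D. \<forall>v\<in>D. N u \<le> R \<longrightarrow> \<bar>dI u v\<bar> \<le> C * N v"
    "\<epsilon> > 0 \<Longrightarrow> \<exists>d>0. \<forall>u\<in>D. \<forall>w\<in>D. \<forall>v\<in>D. N u \<le> R \<longrightarrow> N (w - u) \<le> d \<longrightarrow> \<bar>dI w v - dI u v\<bar> \<le> \<epsilon> * N v"
    "\<exists>B. \<forall>u\<in>D. N u \<le> R \<longrightarrow> \<bar>I u\<bar> \<le> B"
  using assms unfolding smooth_on_def by simp_all

lemma potential_bounded:
  assumes M: "finite_measure M" and s: "1 < s" and a: "nemy s a"
    and P: "\<And>x. (P has_derivative (\<lambda>h. a x \<bullet> h)) (at x)"
  shows "\<exists>B. \<forall>U\<in>Lps M s. lpn M s U \<le> R \<longrightarrow> \<bar>\<integral>x. P (U x) \<partial>M\<bar> \<le> B"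
proof -
  obtain C where C: "C \<ge> 0" "\<And>x. norm (a x) \<le> C * (1 + norm x) powr (s - 1)"
    using nemy_bound[OF a s] by blast
  define K where "K = lpn M s (\<lambda>x. 1::real) + \<bar>R\<bar>"
  have "\<bar>\<integral>x. P (U x) \<partial>M\<bar> \<le> C * K powr (s - 1) * \<bar>R\<bar> + \<bar>\<integral>x. P 0 \<partial>M\<bar>"
    if U: "U \<in> Lps M s" and R: "lpn M s U \<le> R" for U
  proof -
    note [measurable] = potential_measurable[OF P LpsD(1)[OF U]]
    have *: "\<bar>P (U x) - P 0\<bar> \<le> (C * (1 + norm (U x)) powr (s - 1) + 0 * 0 powr (s - 1)) * norm (U x)" for x
    proof -
      obtain t where t: "0 < t" "t < 1" "P (0 + U x) - P 0 = a (0 + t *\<^sub>R U x) \<bullet> U x"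
        using potential_mvt[OF P, of 0 "U x"] by blast
      then have "\<bar>P (U x) - P 0\<bar> \<le> norm (a (t *\<^sub>R U x)) * norm (U x)"
        by (simp add: Cauchy_Schwarz_ineq2)
      also have "norm (a (t *\<^sub>R U x)) \<le> C * (1 + norm (t *\<^sub>R U x)) powr (s - 1)" by (rule C)
      also have "\<dots> \<le> C * (1 + norm (U x)) powr (s - 1)"
        using s C t by (intro mult_left_mono powr_mono2) (auto intro!: mult_left_le_one_le)
      finally show ?thesis by (simp add: mult_right_mono)
    qed
    have "\<bar>\<integral>x. P (U x) - P 0 \<partial>M\<bar> \<le> (C * lpn M s (\<lambda>x. 1 + norm (U x)) powr (s - 1) + 0 * lpn M s (\<lambda>x. 0::real) powr (s - 1)) * lpn M s U"
      by (rule Holder_estimate(2)[OF s Lps_one_plus(1)[OF M U s] Lps_zero U _ _ _ *]) (use C in auto)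
    also have "\<dots> \<le> C * K powr (s - 1) * \<bar>R\<bar>"
      using Lps_one_plus(2)[OF M U s] R s C unfolding K_def
      by (auto intro!: mult_mono mult_left_mono powr_mono2)
    finally have "\<bar>\<integral>x. P (U x) - P 0 \<partial>M\<bar> \<le> C * K powr (s - 1) * \<bar>R\<bar>" .
    moreover have "(\<integral>x. P (U x) - P 0 \<partial>M) = (\<integral>x. P (U x) \<partial>M) - (\<integral>x. P 0 \<partial>M)"
      using potential_integrable[OF M s a P U] finite_measure.integrable_const[OF M]
      by (intro Bochner_Integration.integral_diff) auto
    ultimately show ?thesis by linarith
  qed
  then show ?thesis by blast
qed

text \<open>Every term of the energy is a potential composed with a linear map \<open>T\<close> into
  a Lebesgue space: the gradient, the quotient by \<open>norm x\<close>, or the inclusion into L^s.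
  Boundedness of \<open>T\<close> with respect to \<open>N\<close> transports the uniform
  estimates.\<close>

lemma smooth_component:
  fixes T :: "'u::real_vector \<Rightarrow> 'a \<Rightarrow> 'b::euclidean_space"
  assumes M: "finite_measure M" and s: "1 < s" and a: "nemy s a"
    and P: "\<And>x. (P has_derivative (\<lambda>h. a x \<bullet> h)) (at x)"
    and K: "K \<ge> 0" and T: "\<And>u. u \<in> D \<Longrightarrow> T u \<in> Lps M s" "\<And>u. u \<in> D \<Longrightarrow> lpn M s (T u) \<le> K * N u"
    and lin: "\<And>u v x. u \<in> D \<Longrightarrow> v \<in> D \<Longrightarrow> T (u + v) x = T u x + T v x"
      "\<And>u v x. u \<in> D \<Longrightarrow> v \<in> D \<Longrightarrow> T (u - v) x = T u x - T v x"
      "\<And>u c x. u \<in> D \<Longrightarrow> T (c *\<^sub>R u) x = c *\<^sub>R T u x"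
    and D: "\<And>u v. u \<in> D \<Longrightarrow> v \<in> D \<Longrightarrow> u - v \<in> D" and N: "\<And>u. 0 \<le> N u"
  shows "smooth_on D N (\<lambda>u. \<integral>x. P (T u x) \<partial>M) (\<lambda>u v. \<integral>x. a (T u x) \<bullet> T v x \<partial>M)"
  unfolding smooth_on_def
proof (intro conjI ballI allI impI)
  have TR: "lpn M s (T u) \<le> K * \<bar>R\<bar>" if "u \<in> D" "N u \<le> R" for u R
    using order_trans[OF T(2)[OF that(1)] mult_left_mono[of "N u" "\<bar>R\<bar>" K]] that K by auto
  have small: "lpn M s (T v) \<le> d" if "v \<in> D" "N v \<le> d / (K + 1)" "d > 0" for v d
  proof -
    have "lpn M s (T v) \<le> K * (d / (K + 1))" using order_trans[OF T(2)[OF that(1)] mult_left_mono[OF that(2) K]] .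
    also have "\<dots> \<le> d" using K that by (simp add: field_simps)
    finally show ?thesis .
  qed
  have eK: "c * lpn M s (T v) \<le> c * (K + 1) * N v" if "v \<in> D" "c \<ge> 0" for c v
  proof -
    have "lpn M s (T v) \<le> K * N v" by (rule T(2)[OF that(1)])
    also have "\<dots> \<le> (K + 1) * N v" using N by (intro mult_right_mono) auto
    finally have "c * lpn M s (T v) \<le> c * ((K + 1) * N v)" using that(2) by (intro mult_left_mono)
    then show ?thesis by (simp add: mult.assoc)
  qed
  show "(\<integral>x. a (T u x) \<bullet> T (v + w) x \<partial>M) = (\<integral>x. a (T u x) \<bullet> T v x \<partial>M) + (\<integral>x. a (T u x) \<bullet> T w x \<partial>M)"
    if "u \<in> D" "v \<in> D" "w \<in> D" for u v w
    using that nemy_integrable[OF M s a T(1) T(1)] by (simp add: lin inner_add_right)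
  show "(\<integral>x. a (T u x) \<bullet> T (c *\<^sub>R v) x \<partial>M) = c * (\<integral>x. a (T u x) \<bullet> T v x \<partial>M)"
    if "u \<in> D" "v \<in> D" for u v c
    using that by (simp add: lin)
  show "\<exists>B. \<forall>u\<in>D. N u \<le> R \<longrightarrow> \<bar>\<integral>x. P (T u x) \<partial>M\<bar> \<le> B" for R
    using potential_bounded[OF M s a P, of "K * \<bar>R\<bar>"] T(1) TR by meson
  show "\<exists>C\<ge>0. \<forall>u\<in>D. \<forall>v\<in>D. N u \<le> R \<longrightarrow> \<bar>\<integral>x. a (T u x) \<bullet> T v x \<partial>M\<bar> \<le> C * N v" for R
  proof -
    obtain C where C: "C \<ge> 0" "\<And>U V. U\<in>Lps M s \<Longrightarrow> V\<in>Lps M s \<Longrightarrow> lpn M s U \<le> K * \<bar>R\<bar> \<Longrightarrow>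
      \<bar>\<integral>x. a (U x) \<bullet> V x \<partial>M\<bar> \<le> C * lpn M s V"
      using nemy_bound_integral[OF M s a, of "K * \<bar>R\<bar>"] by blast
    have "\<bar>\<integral>x. a (T u x) \<bullet> T v x \<partial>M\<bar> \<le> C * (K + 1) * N v" if "u \<in> D" "v \<in> D" "N u \<le> R" for u v
      using C(2)[OF T(1)[OF that(1)] T(1)[OF that(2)] TR[OF that(1,3)]] eK[OF that(2) C(1)] by linarith
    then show ?thesis using C(1) K by (intro exI[of _ "C * (K + 1)"]) auto
  qed
  fix R \<epsilon> :: real assume eps: "\<epsilon> > 0"
  define e where "e = \<epsilon> / (K + 1)"
  have e: "e > 0" "e * (K + 1) = \<epsilon>" using eps K by (auto simp: e_def)
  show "\<exists>d>0. \<forall>u\<in>D. \<forall>v\<in>D. N u \<le> R \<longrightarrow> N v \<le> d \<longrightarrow>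
     \<bar>(\<integral>x. P (T (u + v) x) \<partial>M) - (\<integral>x. P (T u x) \<partial>M) - (\<integral>x. a (T u x) \<bullet> T v x \<partial>M)\<bar> \<le> \<epsilon> * N v"
  proof -
    obtain d where d: "d > 0" "\<And>U V. U\<in>Lps M s \<Longrightarrow> V\<in>Lps M s \<Longrightarrow> lpn M s U \<le> K * \<bar>R\<bar> \<Longrightarrow> lpn M s V \<le> d \<Longrightarrow>
      \<bar>(\<integral>x. P (U x + V x) \<partial>M) - (\<integral>x. P (U x) \<partial>M) - (\<integral>x. a (U x) \<bullet> V x \<partial>M)\<bar> \<le> e * lpn M s V"
      using potential_frechet[OF M s a e(1) P, of "K * \<bar>R\<bar>"] by blast
    have "\<bar>(\<integral>x. P (T (u + v) x) \<partial>M) - (\<integral>x. P (T u x) \<partial>M) - (\<integral>x. a (T u x) \<bullet> T v x \<partial>M)\<bar> \<le> \<epsilon> * N v"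
      if "u \<in> D" "v \<in> D" "N u \<le> R" "N v \<le> d / (K + 1)" for u v
      using d(2)[OF T(1)[OF that(1)] T(1)[OF that(2)] TR[OF that(1,3)] small[OF that(2,4) d(1)]]
        eK[OF that(2) less_imp_le[OF e(1)]] that by (simp add: lin e(2))
    then show ?thesis using d(1) K by (intro exI[of _ "d / (K + 1)"]) auto
  qed
  show "\<exists>d>0. \<forall>u\<in>D. \<forall>w\<in>D. \<forall>v\<in>D. N u \<le> R \<longrightarrow> N (w - u) \<le> d \<longrightarrow>
     \<bar>(\<integral>x. a (T w x) \<bullet> T v x \<partial>M) - (\<integral>x. a (T u x) \<bullet> T v x \<partial>M)\<bar> \<le> \<epsilon> * N v"
  proof -
    obtain d where d: "d > 0" "\<And>U W V. U\<in>Lps M s \<Longrightarrow> W\<in>Lps M s \<Longrightarrow> V\<in>Lps M s \<Longrightarrow> lpn M s U \<le> K * \<bar>R\<bar> \<Longrightarrow>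
      lpn M s (\<lambda>x. W x - U x) \<le> d \<Longrightarrow>
      \<bar>(\<integral>x. a (W x) \<bullet> V x \<partial>M) - (\<integral>x. a (U x) \<bullet> V x \<partial>M)\<bar> \<le> e * lpn M s V"
      using nemy_uniform_continuity[OF M s a e(1), of "K * \<bar>R\<bar>"] by blast
    have "\<bar>(\<integral>x. a (T w x) \<bullet> T v x \<partial>M) - (\<integral>x. a (T u x) \<bullet> T v x \<partial>M)\<bar> \<le> \<epsilon> * N v"
      if "u \<in> D" "w \<in> D" "v \<in> D" "N u \<le> R" "N (w - u) \<le> d / (K + 1)" for u w v
    proof -
      have "lpn M s (\<lambda>x. T w x - T u x) = lpn M s (T (w - u))" using that by (simp add: lin fun_eq_iff lpn_def)
      also have "\<dots> \<le> d" by (rule small[OF D[OF that(2,1)] that(5) d(1)])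
      finally show ?thesis
        using d(2)[OF T(1)[OF that(1)] T(1)[OF that(2)] T(1)[OF that(3)] TR[OF that(1,4)]]
        eK[OF that(3) less_imp_le[OF e(1)]] by (simp add: e(2))
    qed
    then show ?thesis using d(1) K by (intro exI[of _ "d / (K + 1)"]) auto
  qed
qed

lemma smooth_combine:
  assumes I: "smooth_on D N I dI" and J: "smooth_on D N J dJ" and N: "\<And>u. 0 \<le> N u"
  shows "smooth_on D N (\<lambda>u. I u + c * J u) (\<lambda>u v. dI u v + c * dJ u v)"
  unfolding smooth_on_def
proof (intro conjI ballI allI impI)
  show "dI u (v + w) + c * dJ u (v + w) = dI u v + c * dJ u v + (dI u w + c * dJ u w)" if "u \<in> D" "v \<in> D" "w \<in> D" for u v w
    using I J that unfolding smooth_on_def by (simp add: algebra_simps)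
  show "dI u (b *\<^sub>R v) + c * dJ u (b *\<^sub>R v) = b * (dI u v + c * dJ u v)" if "u \<in> D" "v \<in> D" for u v b
    using I J that unfolding smooth_on_def by (simp add: algebra_simps)
  have c: "\<bar>x + c * y\<bar> \<le> a + \<bar>c\<bar> * b" if "\<bar>x\<bar> \<le> a" "\<bar>y\<bar> \<le> b" for x y a b
  proof -
    have "\<bar>x + c * y\<bar> \<le> \<bar>x\<bar> + \<bar>c\<bar> * \<bar>y\<bar>" using abs_triangle_ineq[of x "c * y"] by (simp add: abs_mult)
    also have "\<dots> \<le> a + \<bar>c\<bar> * b" using that by (intro add_mono mult_left_mono) auto
    finally show ?thesis .
  qed
  show "\<exists>B. \<forall>u\<in>D. N u \<le> R \<longrightarrow> \<bar>I u + c * J u\<bar> \<le> B" for R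
  proof -
    obtain A where A: "\<forall>u\<in>D. N u \<le> R \<longrightarrow> \<bar>I u\<bar> \<le> A" using smooth_onD(4)[OF I, of R] by blast
    obtain B where B: "\<forall>u\<in>D. N u \<le> R \<longrightarrow> \<bar>J u\<bar> \<le> B" using smooth_onD(4)[OF J, of R] by blast
    show ?thesis using A B c by (intro exI[of _ "A + \<bar>c\<bar> * B"]) blast
  qed
  show "\<exists>C\<ge>0. \<forall>u\<in>D. \<forall>v\<in>D. N u \<le> R \<longrightarrow> \<bar>dI u v + c * dJ u v\<bar> \<le> C * N v" for R
  proof -
    obtain A where A: "A \<ge> 0" "\<forall>u\<in>D. \<forall>v\<in>D. N u \<le> R \<longrightarrow> \<bar>dI u v\<bar> \<le> A * N v" using smooth_onD(2)[OF I, of R] by blast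
    obtain B where B: "B \<ge> 0" "\<forall>u\<in>D. \<forall>v\<in>D. N u \<le> R \<longrightarrow> \<bar>dJ u v\<bar> \<le> B * N v" using smooth_onD(2)[OF J, of R] by blast
    have "\<bar>dI u v + c * dJ u v\<bar> \<le> (A + \<bar>c\<bar> * B) * N v" if "u \<in> D" "v \<in> D" "N u \<le> R" for u v
      using c[of "dI u v" "A * N v" "dJ u v" "B * N v"] A B that by (simp add: algebra_simps)
    then show ?thesis using A B by (intro exI[of _ "A + \<bar>c\<bar> * B"]) auto
  qed
  fix R \<epsilon> :: real assume eps: "\<epsilon> > 0"
  define e where "e = \<epsilon> / (1 + \<bar>c\<bar>)"
  have "1 + \<bar>c\<bar> > 0" by (simp add: add_pos_nonneg)
  then have e: "e > 0" "e + \<bar>c\<bar> * e = \<epsilon>"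
    using eps unfolding e_def by (simp_all add: add_divide_distrib[symmetric] distrib_left[symmetric] field_simps)
  have ce: "\<bar>x + c * y\<bar> \<le> \<epsilon> * N v" if "\<bar>x\<bar> \<le> e * N v" "\<bar>y\<bar> \<le> e * N v" for x y v
  proof -
    have "\<bar>x + c * y\<bar> \<le> e * N v + \<bar>c\<bar> * (e * N v)" by (rule c[OF that])
    also have "\<dots> = (e + \<bar>c\<bar> * e) * N v" by (simp add: algebra_simps)
    finally show ?thesis by (simp add: e(2))
  qed
  show "\<exists>d>0. \<forall>u\<in>D. \<forall>v\<in>D. N u \<le> R \<longrightarrow> N v \<le> d \<longrightarrow>
      \<bar>I (u + v) + c * J (u + v) - (I u + c * J u) - (dI u v + c * dJ u v)\<bar> \<le> \<epsilon> * N v"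
  proof -
    obtain d1 where d1: "d1 > 0" "\<And>u v. u \<in> D \<Longrightarrow> v \<in> D \<Longrightarrow> N u \<le> R \<Longrightarrow> N v \<le> d1 \<Longrightarrow> \<bar>I (u + v) - I u - dI u v\<bar> \<le> e * N v"
      using smooth_onD(1)[OF I e(1), of R] by blast
    obtain d2 where d2: "d2 > 0" "\<And>u v. u \<in> D \<Longrightarrow> v \<in> D \<Longrightarrow> N u \<le> R \<Longrightarrow> N v \<le> d2 \<Longrightarrow> \<bar>J (u + v) - J u - dJ u v\<bar> \<le> e * N v"
      using smooth_onD(1)[OF J e(1), of R] by blast
    have "\<bar>I (u + v) + c * J (u + v) - (I u + c * J u) - (dI u v + c * dJ u v)\<bar> \<le> \<epsilon> * N v"
      if "u \<in> D" "v \<in> D" "N u \<le> R" "N v \<le> min d1 d2" for u v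
      using ce[OF d1(2)[of u v] d2(2)[of u v]] that by (simp add: algebra_simps)
    then show ?thesis using d1(1) d2(1) by (intro exI[of _ "min d1 d2"]) auto
  qed
  show "\<exists>d>0. \<forall>u\<in>D. \<forall>w\<in>D. \<forall>v\<in>D. N u \<le> R \<longrightarrow> N (w - u) \<le> d \<longrightarrow>
      \<bar>dI w v + c * dJ w v - (dI u v + c * dJ u v)\<bar> \<le> \<epsilon> * N v"
  proof -
    obtain d1 where d1: "d1 > 0" "\<And>u w v. u \<in> D \<Longrightarrow> w \<in> D \<Longrightarrow> v \<in> D \<Longrightarrow> N u \<le> R \<Longrightarrow> N (w - u) \<le> d1 \<Longrightarrow> \<bar>dI w v - dI u v\<bar> \<le> e * N v"
      using smooth_onD(3)[OF I e(1), of R] by blast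
    obtain d2 where d2: "d2 > 0" "\<And>u w v. u \<in> D \<Longrightarrow> w \<in> D \<Longrightarrow> v \<in> D \<Longrightarrow> N u \<le> R \<Longrightarrow> N (w - u) \<le> d2 \<Longrightarrow> \<bar>dJ w v - dJ u v\<bar> \<le> e * N v"
      using smooth_onD(3)[OF J e(1), of R] by blast
    have "\<bar>dI w v + c * dJ w v - (dI u v + c * dJ u v)\<bar> \<le> \<epsilon> * N v"
      if "u \<in> D" "w \<in> D" "v \<in> D" "N u \<le> R" "N (w - u) \<le> min d1 d2" for u w v
      using ce[OF d1(2)[of u w v] d2(2)[of u w v]] that by (simp add: algebra_simps)
    then show ?thesis using d1(1) d2(1) by (intro exI[of _ "min d1 d2"]) auto
  qed
qed

lemma energy_smooth_on:
  fixes R :: real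
  assumes "smooth_on D N E dE" and "0 \<in> D" and "\<And>u v. u \<in> D \<Longrightarrow> v \<in> D \<Longrightarrow> u + v \<in> D" and "\<And>u c. u \<in> D \<Longrightarrow> c *\<^sub>R u \<in> D"
    and "\<And>u. 0 \<le> N u" and "\<And>u c. u \<in> D \<Longrightarrow> N (c *\<^sub>R u) = \<bar>c\<bar> * N u"
    and "\<And>u v. u \<in> D \<Longrightarrow> v \<in> D \<Longrightarrow> N (u + v) \<le> N u + N v"
  shows "energy D N E dE R"
  by unfold_locales (use assms in \<open>auto simp: smooth_on_def\<close>)

section \<open>The fundamental lemma of the calculus of variations\<close>

text \<open>The factor \<open>inverse t ^ m\<close> makes the family closed, up to linear combinations, under differentiation.\<close>

definition expm :: "nat \<Rightarrow> real \<Rightarrow> real" where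
  "expm m t = (if 0 < t then inverse t ^ m * exp (- inverse t) else 0)"

lemma expm_tendsto_0: "(expm m \<longlongrightarrow> 0) (at 0)"
proof (rule filterlim_split_at)
  have "(expm m \<longlongrightarrow> 0) (at_left 0) \<longleftrightarrow> ((\<lambda>_. 0) \<longlongrightarrow> (0::real)) (at_left (0::real))"
    by (rule tendsto_cong) (auto simp: expm_def eventually_at_filter)
  then show "(expm m \<longlongrightarrow> 0) (at_left 0)" by simp
  have "((\<lambda>t. inverse t ^ m / exp (inverse t)) \<longlongrightarrow> (0::real)) (at_right 0)"
    by (rule filterlim_compose[OF tendsto_power_div_exp_0 filterlim_inverse_at_top_right])
  moreover have "(expm m \<longlongrightarrow> 0) (at_right 0) \<longleftrightarrow> ((\<lambda>t. inverse t ^ m / exp (inverse t)) \<longlongrightarrow> (0::real)) (at_right 0)"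
    by (rule tendsto_cong) (auto simp: expm_def eventually_at_filter exp_minus divide_inverse)
  ultimately show "(expm m \<longlongrightarrow> 0) (at_right 0)" by blast
qed

text \<open>For positive \<open>t\<close> this is the product rule. At 0 the difference quotient of
  \<open>expm m\<close> is \<open>expm (m + 1)\<close> itself, so the limit at 0, known for all
  \<open>m\<close>, settles every order.\<close>

lemma expm_deriv: "(expm m has_real_derivative (expm (m + 2) t - real m * expm (m + 1) t)) (at t)"
proof -
  consider "t > 0" | "t < 0" | "t = 0" by linarith
  then show ?thesis
  proof cases
    case 1
    have "((\<lambda>t. inverse t ^ m * exp (- inverse t)) has_real_derivative (expm (m + 2) t - real m * expm (m + 1) t)) (at t)"
    proof -
      have "((\<lambda>t. inverse t ^ m) has_real_derivative - (real m * inverse t ^ (m + 1))) (at t)"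
        using DERIV_power[OF DERIV_inverse[of t UNIV], of m] 1 by (cases m) (simp_all add: mult_ac)
      moreover have "((\<lambda>t. exp (- inverse t)) has_real_derivative exp (- inverse t) * inverse t ^ 2) (at t)"
        using 1 by (auto intro!: derivative_eq_intros simp: power2_eq_square)
      ultimately have "((\<lambda>t. inverse t ^ m * exp (- inverse t)) has_real_derivative
        - (real m * inverse t ^ (m + 1)) * exp (- inverse t) + exp (- inverse t) * inverse t ^ 2 * inverse t ^ m) (at t)"
        by (rule DERIV_mult)
      moreover have "- (real m * inverse t ^ (m + 1)) * exp (- inverse t) + exp (- inverse t) * inverse t ^ 2 * inverse t ^ m
          = expm (m + 2) t - real m * expm (m + 1) t"
        using 1 by (simp add: expm_def power_add power2_eq_square)
      ultimately show ?thesis by simp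
    qed
    then show ?thesis
      by (rule has_field_derivative_transform_within_open[where S = "{0<..}"]) (use 1 in \<open>auto simp: expm_def\<close>)
  next
    case 2
    have "((\<lambda>t. 0) has_real_derivative 0) (at t)" by simp
    then have "(expm m has_real_derivative 0) (at t)"
      by (rule has_field_derivative_transform_within_open[where S = "{..<0}"]) (use 2 in \<open>auto simp: expm_def\<close>)
    then show ?thesis using 2 by (simp add: expm_def)
  next
    case 3
    have "((\<lambda>h. (expm m (0 + h) - expm m 0) / h) \<longlongrightarrow> 0) (at 0)"
    proof (rule Lim_transform_eventually[OF expm_tendsto_0[of "m + 1"]])
      show "\<forall>\<^sub>F h in at 0. expm (m + 1) h = (expm m (0 + h) - expm m 0) / h"
        by (auto simp: eventually_at_filter expm_def divide_inverse)
    qed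
    then show ?thesis using 3 by (simp add: DERIV_def expm_def)
  qed
qed

text \<open>Smoothness of all orders is obtained from closure: each partial derivative of a member
  is again a member, so \<open>C_k\<close> follows by induction on the order without computing
  higher derivatives.\<close>

inductive_set smooth_class :: "(real ^ 'n \<Rightarrow> real) set" where
  expm: "(\<lambda>x. expm m (c * x $ i + d)) \<in> smooth_class"
| const: "(\<lambda>x. c) \<in> smooth_class"
| add: "f \<in> smooth_class \<Longrightarrow> g \<in> smooth_class \<Longrightarrow> (\<lambda>x. f x + g x) \<in> smooth_class"
| mult: "f \<in> smooth_class \<Longrightarrow> g \<in> smooth_class \<Longrightarrow> (\<lambda>x. f x * g x) \<in> smooth_class"

lemma smooth_class_derivative:
  fixes f :: "real ^ 'n \<Rightarrow> real"
  assumes "f \<in> smooth_class"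
  shows "\<exists>g. (\<forall>x. (f has_derivative (\<lambda>h. g x \<bullet> h)) (at x)) \<and> (\<forall>j. (\<lambda>x. g x $ j) \<in> smooth_class)"
  using assms
proof induction
  case (expm m c i d)
  define e where "e x = c * (expm (m + 2) (c * x $ i + d) + (- real m) * expm (m + 1) (c * x $ i + d))" for x :: "real ^ 'n"
  have "((\<lambda>x. expm m (c * x $ i + d)) has_derivative (\<lambda>h. (e x *\<^sub>R axis i 1) \<bullet> h)) (at x)" for x :: "real ^ 'n"
  proof -
    have "((\<lambda>x. c * x $ i + d) has_derivative (\<lambda>h. c * h $ i)) (at x)"
      by (auto intro!: derivative_eq_intros bounded_linear_imp_has_derivative[OF bounded_linear_vec_nth])
    from has_derivative_compose[OF this expm_deriv[of m "c * x $ i + d", unfolded has_field_derivative_def]]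
    show ?thesis by (simp add: e_def inner_axis' mult_ac)
  qed
  moreover have "(\<lambda>x. (e x *\<^sub>R axis i 1) $ j) \<in> smooth_class" for j
  proof (cases "i = j")
    case True
    have "e \<in> smooth_class"
      unfolding e_def by (intro smooth_class.mult smooth_class.add smooth_class.const smooth_class.expm)
    then show ?thesis using True by simp
  qed (simp add: axis_def smooth_class.const)
  ultimately show ?case by (intro exI[of _ "\<lambda>x. e x *\<^sub>R axis i 1"]) blast
next
  case (const c)
  then show ?case by (intro exI[of _ "\<lambda>x. 0"]) (auto intro: smooth_class.const)
next
  case (add f f')
  then obtain g g' where g: "\<And>x. (f has_derivative (\<lambda>h. g x \<bullet> h)) (at x)" "\<And>j. (\<lambda>x. g x $ j) \<in> smooth_class"
    "\<And>x. (f' has_derivative (\<lambda>h. g' x \<bullet> h)) (at x)" "\<And>j. (\<lambda>x. g' x $ j) \<in> smooth_class" by blast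
  have "((\<lambda>x. f x + f' x) has_derivative (\<lambda>h. (g x + g' x) \<bullet> h)) (at x)" for x
    using has_derivative_add[OF g(1,3)] by (simp add: inner_add_left)
  moreover have "(\<lambda>x. (g x + g' x) $ j) \<in> smooth_class" for j
    using smooth_class.add[OF g(2,4)] by simp
  ultimately show ?case by (intro exI[of _ "\<lambda>x. g x + g' x"]) blast
next
  case (mult f f')
  then obtain g g' where g: "\<And>x. (f has_derivative (\<lambda>h. g x \<bullet> h)) (at x)" "\<And>j. (\<lambda>x. g x $ j) \<in> smooth_class"
    "\<And>x. (f' has_derivative (\<lambda>h. g' x \<bullet> h)) (at x)" "\<And>j. (\<lambda>x. g' x $ j) \<in> smooth_class" by blast
  have "((\<lambda>x. f x * f' x) has_derivative (\<lambda>h. (f x *\<^sub>R g' x + f' x *\<^sub>R g x) \<bullet> h)) (at x)" for x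
    using has_derivative_mult[OF g(1,3)] by (simp add: inner_add_left mult.commute)
  moreover have "(\<lambda>x. (f x *\<^sub>R g' x + f' x *\<^sub>R g x) $ j) \<in> smooth_class" for j
    using smooth_class.add[OF smooth_class.mult[OF mult.hyps(1) g(4)] smooth_class.mult[OF mult.hyps(2) g(2)]] by simp
  ultimately show ?case by (intro exI[of _ "\<lambda>x. f x *\<^sub>R g' x + f' x *\<^sub>R g x"]) blast
qed

lemma smooth_class_C_k: "f \<in> smooth_class \<Longrightarrow> C_k k f"
proof (induction k arbitrary: f)
  case 0
  obtain g where "\<And>x. (f has_derivative (\<lambda>h. g x \<bullet> h)) (at x)" using smooth_class_derivative[OF 0] by blast
  then show ?case
    by (auto intro!: continuous_at_imp_continuous_on has_derivative_continuous)
next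
  case (Suc k)
  obtain g where g: "\<And>x. (f has_derivative (\<lambda>h. g x \<bullet> h)) (at x)" "\<And>j. (\<lambda>x. g x $ j) \<in> smooth_class"
    using smooth_class_derivative[OF Suc.prems] by blast
  have "partial_deriv j f = (\<lambda>x. g x $ j)" for j
    using grad_eqI[OF g(1)] by (simp add: fun_eq_iff partial_deriv_grad)
  then show ?case using g Suc.IH by (auto intro: differentiableI)
qed

text \<open>For each positive \<open>k\<close> it is nonzero exactly on the open box. The parameter
  only sharpens the profile: each factor has the form exp(-1/(k t)), which tends to 1 as
  \<open>k\<close> grows, so the limit is the indicator of the box.\<close>

definition bump :: "real ^ 'n \<Rightarrow> real ^ 'n \<Rightarrow> real \<Rightarrow> real ^ 'n \<Rightarrow> real" where
  "bump a b k x = (\<Prod>i\<in>UNIV. expm 0 (k * x $ i + - (k * a $ i)) * expm 0 (- k * x $ i + k * b $ i))"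

lemma bump_smooth: "bump a b k \<in> smooth_class"
proof -
  have "finite A \<Longrightarrow> (\<lambda>x. \<Prod>i\<in>A. expm 0 (k * x $ i + - (k * a $ i)) * expm 0 (- k * x $ i + k * b $ i)) \<in> smooth_class" for A
  proof (induction A rule: finite_induct)
    case (insert i A)
    show ?case unfolding prod.insert[OF insert.hyps]
      by (intro smooth_class.mult smooth_class.expm insert.IH)
  qed (simp add: smooth_class.const)
  then show ?thesis unfolding bump_def[abs_def] by simp
qed

lemma expm_0_bounds: "0 \<le> expm 0 t" "expm 0 t \<le> 1"
  by (auto simp: expm_def)

lemma bump_bounds: "0 \<le> bump a b k x" "bump a b k x \<le> 1"
  unfolding bump_def
  by (auto intro!: prod_nonneg prod_le_1 mult_nonneg_nonneg mult_le_one expm_0_bounds)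

lemma expm_pos_iff: "k > 0 \<Longrightarrow> expm 0 (k * u + - (k * v)) \<noteq> 0 \<longleftrightarrow> v < u" "k > 0 \<Longrightarrow> expm 0 (- k * u + k * v) \<noteq> 0 \<longleftrightarrow> u < v"
  by (auto simp: expm_def)

lemma bump_support:
  assumes "k > 0"
  shows "bump a b k x \<noteq> 0 \<longleftrightarrow> x \<in> box a b"
  using expm_pos_iff[OF assms] unfolding bump_def mem_box_cart by (simp add: all_conj_distrib)

lemma bump_test_function:
  assumes "cbox a b \<subseteq> \<Omega>" "k > 0"
  shows "bump a b k \<in> test_functions \<Omega>"
proof -
  have "{x. bump a b k x \<noteq> 0} \<subseteq> cbox a b" using bump_support[OF assms(2), of a b] box_subset_cbox by auto
  then have cl: "closure {x. bump a b k x \<noteq> 0} \<subseteq> cbox a b" by (intro closure_minimal closed_cbox)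
  then have "compact (closure {x. bump a b k x \<noteq> 0})"
    using compact_Int_closed[OF compact_cbox closed_closure, of a b "{x. bump a b k x \<noteq> 0}"] by (simp add: Int_absorb1)
  then show ?thesis
    using cl assms smooth_class_C_k[OF bump_smooth] unfolding test_functions_def by auto
qed

lemma expm_0_limit:
  assumes "t > 0"
  shows "(\<lambda>k. expm 0 (real (Suc k) * t)) \<longlonglongrightarrow> 1"
proof -
  have "(\<lambda>k. exp (- (inverse t * inverse (real (Suc k))))) \<longlonglongrightarrow> exp (- (inverse t * 0))"
    by (intro tendsto_intros LIMSEQ_inverse_real_of_nat)
  moreover have "expm 0 (real (Suc k) * t) = exp (- (inverse t * inverse (real (Suc k))))" for k
    using assms by (simp add: expm_def mult.commute)
  ultimately show ?thesis by simp
qed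

lemma bump_limit: "(\<lambda>k. bump a b (real (Suc k)) x) \<longlonglongrightarrow> indicator (box a b) x"
proof (cases "x \<in> box a b")
  case True
  then have *: "x $ i - a $ i > 0" "b $ i - x $ i > 0" for i by (auto simp: mem_box_cart)
  have "(\<lambda>k. \<Prod>i\<in>UNIV. expm 0 (real (Suc k) * (x $ i - a $ i)) * expm 0 (real (Suc k) * (b $ i - x $ i))) \<longlonglongrightarrow> (\<Prod>i\<in>(UNIV::'a set). 1 * 1)"
    by (intro tendsto_prod tendsto_mult expm_0_limit *)
  moreover have "bump a b (real (Suc k)) x = (\<Prod>i\<in>UNIV. expm 0 (real (Suc k) * (x $ i - a $ i)) * expm 0 (real (Suc k) * (b $ i - x $ i)))" for k
    unfolding bump_def by (simp add: algebra_simps del: of_nat_Suc)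
  ultimately show ?thesis using True by simp
next
  case False
  then have "bump a b (real (Suc k)) x = 0" for k using bump_support[of "real (Suc k)" a b x] by auto
  then show ?thesis using False by simp
qed

lemma test_function_measurable:
  assumes "\<phi> \<in> test_functions \<Omega>"
  shows "\<phi> \<in> borel_measurable lebesgue"
proof (rule measurable_completion)
  show "\<phi> \<in> borel_measurable lborel" using C1c_D(5)[OF test_function_C1c[OF assms]] by simp
qed

text \<open>Bumps converge boundedly to indicators of boxes, so \<open>h\<close> has integral 0 over
  every box whose closed version lies in \<open>\<Omega>\<close>. Within a fixed box this extends
  from boxes to all Borel sets, which forces \<open>h\<close> to vanish almost everywhere.\<close>

lemma fundamental_lemma:
  fixes h :: "real ^ 'n \<Rightarrow> real"
  assumes \<Omega>: "open \<Omega>" and h: "\<And>K. compact K \<Longrightarrow> K \<subseteq> \<Omega> \<Longrightarrow> set_integrable lebesgue K h"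
    and test: "\<And>\<phi>. \<phi> \<in> test_functions \<Omega> \<Longrightarrow> (\<integral>x. h x * \<phi> x \<partial>lebesgue_on \<Omega>) = 0"
  shows "AE x in lebesgue_on \<Omega>. h x = 0"
proof -
  have \<Omega>s: "\<Omega> \<in> sets lebesgue" using \<Omega> by (simp add: borel_open)
  have box0: "(\<integral>x. indicator (box a b) x * h x \<partial>lebesgue) = 0" if ab: "cbox a b \<subseteq> \<Omega>" for a b
  proof -
    have H: "integrable lebesgue (\<lambda>x. indicator (cbox a b) x * h x)"
      using h[OF compact_cbox ab] by (simp add: set_integrable_def)
    define \<phi> where "\<phi> k = bump a b (real (Suc k))" for k
    have t: "\<phi> k \<in> test_functions \<Omega>" for k unfolding \<phi>_def by (rule bump_test_function[OF ab]) simp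
    have out: "\<phi> k x = 0" if "x \<notin> cbox a b" for k x
      using that bump_support[of "real (Suc k)" a b x] box_subset_cbox[of a b] by (auto simp: \<phi>_def)
    have \<phi>m: "\<phi> k \<in> borel_measurable lebesgue" for k
      by (rule test_function_measurable[OF t])
    have "(\<lambda>k. \<integral>x. indicator (cbox a b) x * h x * \<phi> k x \<partial>lebesgue) \<longlonglongrightarrow> (\<integral>x. indicator (cbox a b) x * h x * indicator (box a b) x \<partial>lebesgue)"
    proof (rule integral_dominated_convergence)
      show "integrable lebesgue (\<lambda>x. norm (indicator (cbox a b) x * h x))" using H by (rule integrable_norm)
      show "AE x in lebesgue. (\<lambda>k. indicator (cbox a b) x * h x * \<phi> k x) \<longlonglongrightarrow> indicator (cbox a b) x * h x * indicator (box a b) x"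
        unfolding \<phi>_def by (intro AE_I2 tendsto_mult tendsto_const bump_limit)
      show "AE x in lebesgue. norm (indicator (cbox a b) x * h x * \<phi> k x) \<le> norm (indicator (cbox a b) x * h x)" for k
        using bump_bounds[of a b "real (Suc k)"] by (intro AE_I2) (auto simp: abs_mult \<phi>_def intro!: mult_right_le_one_le)
      show "(\<lambda>x. indicator (cbox a b) x * h x * \<phi> k x) \<in> borel_measurable lebesgue" for k
        using borel_measurable_integrable[OF H] \<phi>m[of k] by (rule borel_measurable_times)
      show "(\<lambda>x. indicator (cbox a b) x * h x * indicator (box a b) x) \<in> borel_measurable lebesgue"
        by (rule borel_measurable_times[OF borel_measurable_integrable[OF H]]) (auto intro!: borel_measurable_indicator)
    qed
    moreover have "(\<integral>x. indicator (cbox a b) x * h x * \<phi> k x \<partial>lebesgue) = 0" for k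
    proof -
      have "(\<integral>x. indicator (cbox a b) x * h x * \<phi> k x \<partial>lebesgue) = (\<integral>x. indicator \<Omega> x *\<^sub>R (h x * \<phi> k x) \<partial>lebesgue)"
        using out ab by (intro Bochner_Integration.integral_cong) (auto simp: indicator_def)
      also have "\<dots> = (\<integral>x. h x * \<phi> k x \<partial>lebesgue_on \<Omega>)" using \<Omega>s by (subst integral_restrict_space) auto
      also have "\<dots> = 0" by (rule test[OF t])
      finally show ?thesis .
    qed
    moreover have "(\<integral>x. indicator (cbox a b) x * h x * indicator (box a b) x \<partial>lebesgue) = (\<integral>x. indicator (box a b) x * h x \<partial>lebesgue)"
      using box_subset_cbox[of a b] by (intro Bochner_Integration.integral_cong) (auto simp: indicator_def)
    ultimately show ?thesis by (simp add: LIMSEQ_const_iff)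
  qed
  have AEbox: "AE x in lebesgue. x \<in> box a b \<longrightarrow> h x = 0" if ab: "cbox a b \<subseteq> \<Omega>" for a b
  proof -
    define H where "H x = indicator (box a b) x * h x" for x
    have "set_integrable lebesgue (box a b) h"
      by (rule set_integrable_subset[OF h[OF compact_cbox ab]]) (auto simp: box_subset_cbox)
    then have H: "integrable lebesgue H" by (simp add: set_integrable_def H_def[abs_def])
    \<comment> \<open>Boxes generate the Borel sets and not their completion, so \<open>H\<close> is
      exchanged for a Borel representative.\<close>
    obtain H' where H': "H' \<in> borel_measurable lborel" "AE x in lborel. H x = H' x"
      using completion_ex_borel_measurable_real[OF borel_measurable_integrable[OF H]] by blast
    then have AEH: "AE x in lebesgue. H x = H' x" by (rule_tac AE_completion)
    have H'l: "H' \<in> borel_measurable lebesgue" using H'(1) by (rule measurable_completion)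
    have "integrable lebesgue H'"
      using integrable_cong_AE[OF borel_measurable_integrable[OF H] H'l AEH] H by simp
    then have H'i: "integrable lborel H'" using integrable_completion[OF H'(1)] by simp
    have eq: "(LINT x:A|lborel. H' x) = (\<integral>x. indicator A x * H x \<partial>lebesgue)" if "A \<in> sets borel" for A
    proof -
      have "(LINT x:A|lborel. H' x) = (\<integral>x. indicator A x * H' x \<partial>lebesgue)"
        unfolding set_lebesgue_integral_def using H'(1) that
        by (subst integral_completion) (auto intro!: borel_measurable_times)
      also have "\<dots> = (\<integral>x. indicator A x * H x \<partial>lebesgue)"
      proof (rule integral_cong_AE)
        have "indicator A \<in> borel_measurable lebesgue" using that by (intro borel_measurable_indicator) auto
        then show "(\<lambda>x. indicator A x * H' x) \<in> borel_measurable lebesgue" "(\<lambda>x. indicator A x * H x) \<in> borel_measurable lebesgue"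
          by (rule borel_measurable_times[OF _ H'l] borel_measurable_times[OF _ borel_measurable_integrable[OF H]])+
        show "AE x in lebesgue. indicator A x * H' x = indicator A x * H x" using AEH by eventually_elim simp
      qed
      finally show ?thesis .
    qed
    have all: "(LINT x:UNIV|lborel. H' x) = 0"
      using eq[of UNIV] box0[OF ab] by (simp add: H_def)
    have zero: "(LINT x:A|lborel. H' x) = 0" if A: "A \<in> sets borel" for A
    proof -
      \<comment> \<open>Boxes are stable under intersection and generate the Borel sets. Vanishing
        of the integral passes to complements, because the total integral is 0, and to countable
        disjoint unions.\<close>
      have st: "Int_stable (range (\<lambda>(a, b). box a b :: (real ^ 'n) set))" by (auto simp: Int_stable_def box_Int_box)
      have sub: "range (\<lambda>(a, b). box a b :: (real ^ 'n) set) \<subseteq> Pow UNIV" by auto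
      have A': "A \<in> sigma_sets UNIV (range (\<lambda>(a, b). box a b))" using A unfolding borel_eq_box by simp
      from st sub A' show ?thesis
      proof (induction rule: sigma_sets_induct_disjoint)
        case (basic B)
        then obtain c d where B: "B = box c d" by auto
        obtain e f where ef: "box c d \<inter> box a b = box e f"
          using box_Int_box[of c d a b] by blast
        have "(LINT x:B|lborel. H' x) = (\<integral>x. indicator B x * H x \<partial>lebesgue)" by (rule eq) (simp add: B)
        also have "\<dots> = (\<integral>x. indicator (box e f) x * h x \<partial>lebesgue)"
          unfolding H_def ef[symmetric] B by (intro Bochner_Integration.integral_cong) (auto simp: indicator_def)
        also have "\<dots> = 0"
        proof (cases "box e f = {}")
          case False
          have "box e f \<subseteq> box a b" using ef by auto
          then have "closure (box e f) \<subseteq> cbox a b"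
            using box_subset_cbox[of a b] by (intro closure_minimal closed_cbox) auto
          then have "cbox e f \<subseteq> cbox a b" by (simp add: closure_box[OF False])
          then show ?thesis using ab by (intro box0) auto
        qed simp
        finally show ?case .
      next
        case (compl B)
        then have B: "B \<in> sets borel" unfolding borel_eq_box by simp
        have i: "set_integrable lborel B H'" "set_integrable lborel (UNIV - B) H'"
          unfolding set_integrable_def by (rule integrable_mult_indicator[OF _ H'i]; use B in simp)+
        have "(LINT x:B \<union> (UNIV - B)|lborel. H' x) = (LINT x:B|lborel. H' x) + (LINT x:UNIV - B|lborel. H' x)"
          by (rule set_integral_Un[OF _ i]) auto
        then show ?case using compl all by simp
      next
        case (union B)
        then have B: "B i \<in> sets borel" for i unfolding borel_eq_box by auto
        have "(LINT x:(\<Union>i. B i)|lborel. H' x) = (\<Sum>i. (LINT x:(B i)|lborel. H' x))"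
        proof (rule lebesgue_integral_countable_add)
          show "B i \<inter> B j = {}" if "i \<noteq> j" for i j using union that by (auto simp: disjoint_family_on_def)
          show "set_integrable lborel (\<Union>i. B i) H'"
            unfolding set_integrable_def by (rule integrable_mult_indicator[OF _ H'i]) (use B in auto)
        qed (use B in auto)
        then show ?case using union by simp
      qed (simp add: set_lebesgue_integral_def)
    qed
    have "AE x in lborel. H' x = 0"
    proof (rule density_unique_real[OF H'i])
      show "integrable lborel (\<lambda>x::real^'n. 0::real)" by simp
      show "(LINT x:A|lborel. H' x) = (LINT x:A|lborel. 0)" if "A \<in> sets lborel" for A
        using zero[of A] that by (simp add: set_lebesgue_integral_def)
    qed
    then have "AE x in lebesgue. H' x = 0" by (rule AE_completion)
    with AEH show ?thesis by eventually_elim (auto simp: H_def)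
  qed
  \<comment> \<open>Countably many closed boxes exhaust \<open>\<Omega>\<close>, and the faces by
    which they exceed the open boxes are null sets.\<close>
  obtain \<D> where D: "countable \<D>" "\<And>X. X \<in> \<D> \<Longrightarrow> X \<subseteq> \<Omega>" "\<And>X. X \<in> \<D> \<Longrightarrow> \<exists>a b. X = cbox a b" "\<Union>\<D> = \<Omega>"
    by (rule open_countable_Union_open_cbox[OF \<Omega>]) auto
  have "AE x in lebesgue. x \<in> X \<longrightarrow> h x = 0" if X: "X \<in> \<D>" for X
  proof -
    obtain a b where ab: "X = cbox a b" using D(3)[OF X] by blast
    have "cbox a b - box a b \<in> null_sets lebesgue"
      using negligible_frontier_interval[of a b] negligible_iff_null_sets by blast
    then have "AE x in lebesgue. x \<notin> cbox a b - box a b" by (rule AE_not_in)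
    moreover have "AE x in lebesgue. x \<in> box a b \<longrightarrow> h x = 0" using D(2)[OF X] ab by (intro AEbox) simp
    ultimately show ?thesis by eventually_elim (auto simp: ab)
  qed
  then have "AE x in lebesgue. \<forall>X\<in>\<D>. x \<in> X \<longrightarrow> h x = 0" using D(1) by (subst AE_ball_countable) auto
  then have "AE x in lebesgue. x \<in> \<Omega> \<longrightarrow> h x = 0" by eventually_elim (use D(4) in auto)
  then show ?thesis using \<Omega>s by (subst AE_restrict_space_iff) auto
qed

section \<open>Uniqueness of the weak gradient\<close>

lemma test_function_bounded:
  assumes "\<phi> \<in> test_functions \<Omega>"
  obtains B where "0 \<le> B" "\<And>x. \<bar>\<phi> x\<bar> \<le> B" "\<And>x i. \<bar>partial_deriv i \<phi> x\<bar> \<le> B"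
proof -
  have c: "C1c \<phi> (grad \<phi>)" by (rule test_function_C1c[OF assms])
  obtain R where R: "0 < R" "\<And>x. R < norm x \<Longrightarrow> \<phi> x = 0" "\<And>x. R < norm x \<Longrightarrow> grad \<phi> x = 0"
    using C1c_support[OF c] by blast
  obtain B1 where B1: "0 \<le> B1" "\<And>x. norm (\<phi> x) \<le> B1" using compact_support_bounded[OF C1c_D(3)[OF c] R(2)] by blast
  obtain B2 where B2: "0 \<le> B2" "\<And>x. norm (grad \<phi> x) \<le> B2" using compact_support_bounded[OF C1c_D(2)[OF c] R(3)] by blast
  show ?thesis
  proof (rule that[of "B1 + B2"])
    show "\<bar>\<phi> x\<bar> \<le> B1 + B2" for x using B1(2)[of x] B2(1) by simp
    show "\<bar>partial_deriv i \<phi> x\<bar> \<le> B1 + B2" for i x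
      using component_le_norm_cart[of "grad \<phi> x" i] B2(2)[of x] B1(1) by (simp add: partial_deriv_grad)
  qed (use B1 B2 in auto)
qed

lemma locally_integrable_test:
  fixes h :: "real ^ 'n \<Rightarrow> real"
  assumes \<Omega>: "open \<Omega>" and h: "\<And>K. compact K \<Longrightarrow> K \<subseteq> \<Omega> \<Longrightarrow> set_integrable lebesgue K h" and \<phi>: "\<phi> \<in> test_functions \<Omega>"
  shows "integrable (lebesgue_on \<Omega>) (\<lambda>x. h x * \<phi> x)"
proof -
  define K where "K = closure {x. \<phi> x \<noteq> 0}"
  have K: "compact K" "K \<subseteq> \<Omega>" using \<phi> by (auto simp: K_def test_functions_def)
  have out: "\<phi> x = 0" if "x \<notin> K" for x using that closure_subset[of "{x. \<phi> x \<noteq> 0}"] unfolding K_def by blast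
  obtain B where B: "0 \<le> B" "\<And>x. \<bar>\<phi> x\<bar> \<le> B" using test_function_bounded[OF \<phi>] by metis
  have H: "integrable lebesgue (\<lambda>x. indicator K x * h x)" using h[OF K] by (simp add: set_integrable_def)
  have \<phi>m: "\<phi> \<in> borel_measurable lebesgue"
    by (rule test_function_measurable[OF \<phi>])
  have "integrable lebesgue (\<lambda>x. (indicator K x * h x) * \<phi> x)"
  proof (rule Bochner_Integration.integrable_bound[OF integrable_mult_right[OF H, of B]])
    show "(\<lambda>x. indicator K x * h x * \<phi> x) \<in> borel_measurable lebesgue"
      by (rule borel_measurable_times[OF borel_measurable_integrable[OF H] \<phi>m])
    show "AE x in lebesgue. norm (indicator K x * h x * \<phi> x) \<le> norm (B * (indicator K x * h x))"
    proof (intro AE_I2)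
      fix x
      have "\<bar>indicator K x * h x\<bar> * \<bar>\<phi> x\<bar> \<le> \<bar>indicator K x * h x\<bar> * B" using B by (intro mult_left_mono) auto
      then show "norm (indicator K x * h x * \<phi> x) \<le> norm (B * (indicator K x * h x))" using B by (simp add: abs_mult mult_ac)
    qed
  qed
  also have "(\<lambda>x. (indicator K x * h x) * \<phi> x) = (\<lambda>x. indicator \<Omega> x *\<^sub>R (h x * \<phi> x))"
    using out K by (auto simp: fun_eq_iff indicator_def)
  finally show ?thesis using \<Omega> by (subst integrable_restrict_space) (auto simp: borel_open)
qed

lemma set_integrable_component:
  fixes G :: "real ^ 'n \<Rightarrow> real ^ 'm"
  shows "set_integrable M K G \<Longrightarrow> set_integrable M K (\<lambda>x. G x $ i)"
  unfolding set_integrable_def using integrable_bounded_linear[OF bounded_linear_vec_nth[of i]] by force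

text \<open>Each component of the difference integrates to 0 against all test functions, so the
  fundamental lemma applies to finitely many components.\<close>

lemma weak_gradient_unique:
  assumes \<Omega>: "open \<Omega>" and G: "has_weak_gradient \<Omega> u G" and G': "has_weak_gradient \<Omega> u G'"
  shows "AE x in lebesgue_on \<Omega>. G x = G' x"
proof -
  have i: "set_integrable lebesgue K (\<lambda>x. G x $ i)" "set_integrable lebesgue K (\<lambda>x. G' x $ i)"
    if "compact K" "K \<subseteq> \<Omega>" for K i
    using that G G' by (auto simp: has_weak_gradient_def locally_integrable_def intro!: set_integrable_component)
  have "AE x in lebesgue_on \<Omega>. G x $ i - G' x $ i = 0" for i
  proof (rule fundamental_lemma[OF \<Omega>])
    show "set_integrable lebesgue K (\<lambda>x. G x $ i - G' x $ i)" if "compact K" "K \<subseteq> \<Omega>" for K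
      using i[OF that] by (rule set_integral_diff(1))
    fix \<phi> assume \<phi>: "\<phi> \<in> test_functions \<Omega>"
    have "(\<integral>x. G x $ i * \<phi> x \<partial>lebesgue_on \<Omega>) = (\<integral>x. G' x $ i * \<phi> x \<partial>lebesgue_on \<Omega>)"
    proof -
      have "(\<integral>x. u x * partial_deriv i \<phi> x \<partial>lebesgue_on \<Omega>) = - (\<integral>x. G x $ i * \<phi> x \<partial>lebesgue_on \<Omega>)"
        "(\<integral>x. u x * partial_deriv i \<phi> x \<partial>lebesgue_on \<Omega>) = - (\<integral>x. G' x $ i * \<phi> x \<partial>lebesgue_on \<Omega>)"
        using G G' \<phi> unfolding has_weak_gradient_def by blast+
      then show ?thesis by simp
    qed
    moreover have "(\<integral>x. (G x $ i - G' x $ i) * \<phi> x \<partial>lebesgue_on \<Omega>)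
        = (\<integral>x. G x $ i * \<phi> x \<partial>lebesgue_on \<Omega>) - (\<integral>x. G' x $ i * \<phi> x \<partial>lebesgue_on \<Omega>)"
      unfolding left_diff_distrib
      by (intro Bochner_Integration.integral_diff locally_integrable_test[OF \<Omega> _ \<phi>] i)
    ultimately show "(\<integral>x. (G x $ i - G' x $ i) * \<phi> x \<partial>lebesgue_on \<Omega>) = 0" by simp
  qed
  then have "AE x in lebesgue_on \<Omega>. \<forall>i. G x $ i - G' x $ i = 0" by (subst AE_all_countable) auto
  then show ?thesis by eventually_elim (simp add: vec_eq_iff)
qed

lemma weak_gradient_AE:
  assumes "open \<Omega>" "has_weak_gradient \<Omega> u G"
  shows "has_weak_gradient \<Omega> u (weak_gradient \<Omega> u)" "AE x in lebesgue_on \<Omega>. weak_gradient \<Omega> u x = G x"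
proof -
  show "has_weak_gradient \<Omega> u (weak_gradient \<Omega> u)"
    unfolding weak_gradient_def by (rule someI[of "has_weak_gradient \<Omega> u", OF assms(2)])
  then show "AE x in lebesgue_on \<Omega>. weak_gradient \<Omega> u x = G x" by (rule weak_gradient_unique[OF assms(1) _ assms(2)])
qed

section \<open>The Sobolev space as a completion of the test functions\<close>

lemma Lps_cong_AE:
  assumes "f \<in> Lps M s" "g \<in> borel_measurable M" "AE x in M. f x = g x"
  shows "g \<in> Lps M s"
proof (rule LpsI[OF assms(2)])
  note [measurable] = LpsD(1)[OF assms(1)] assms(2)
  have "integrable M (\<lambda>x. norm (g x) powr s) \<longleftrightarrow> integrable M (\<lambda>x. norm (f x) powr s)"
    using assms(3) by (intro integrable_cong_AE) auto
  then show "integrable M (\<lambda>x. norm (g x) powr s)" using LpsD(2)[OF assms(1)] by simp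
qed

lemma lpn_diff_cong_AE:
  assumes "f \<in> borel_measurable M" "g \<in> borel_measurable M" "h \<in> borel_measurable M" "AE x in M. f x = g x"
  shows "lpn M s (\<lambda>x. h x - f x) = lpn M s (\<lambda>x. h x - g x)"
proof (rule lpn_cong_AE)
  show "AE x in M. norm (h x - f x) = norm (h x - g x)" using assms(4) by eventually_elim simp
qed (use assms in auto)

text \<open>Limits taken in different Lebesgue spaces are identified through a common subsequence
  along which both hold almost everywhere. The weight \<open>c\<close> is 1 or the reciprocal of the
  norm in the applications.\<close>

lemma limits_agree:
  fixes f g :: "nat \<Rightarrow> 'a \<Rightarrow> real"
  assumes M: "finite_measure M" and ab: "1 < a" "1 < b"
    and f: "\<And>k. f k \<in> Lps M a" "F \<in> Lps M a" "(\<lambda>k. lpn M a (\<lambda>x. f k x - F x)) \<longlonglongrightarrow> 0"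
    and g: "\<And>k. g k \<in> Lps M b" "G \<in> Lps M b" "(\<lambda>k. lpn M b (\<lambda>x. g k x - G x)) \<longlonglongrightarrow> 0"
    and c: "\<And>k x. g k x = c x * f k x"
  shows "AE x in M. G x = c x * F x"
proof -
  obtain r :: "nat \<Rightarrow> nat" where r: "strict_mono r" "AE x in M. (\<lambda>k. f (r k) x) \<longlonglongrightarrow> F x"
    using Lps_tendsto_AE[OF M ab(1) f] by blast
  have "(\<lambda>k. lpn M b (\<lambda>x. g (r k) x - G x)) \<longlonglongrightarrow> 0"
    using LIMSEQ_subseq_LIMSEQ[OF g(3) r(1)] by (simp add: o_def)
  then obtain t :: "nat \<Rightarrow> nat" where t: "strict_mono t" "AE x in M. (\<lambda>k. g (r (t k)) x) \<longlonglongrightarrow> G x"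
    using Lps_tendsto_AE[OF M ab(2), of "\<lambda>k. g (r k)" G] g by blast
  from r(2) t(2) show ?thesis
  proof eventually_elim
    case (elim x)
    have "(\<lambda>k. f (r (t k)) x) \<longlonglongrightarrow> F x" using LIMSEQ_subseq_LIMSEQ[OF elim(1) t(1)] by (simp add: o_def)
    then have "(\<lambda>k. g (r (t k)) x) \<longlonglongrightarrow> c x * F x" unfolding c by (intro tendsto_mult tendsto_const)
    with elim(2) show ?case by (rule LIMSEQ_unique)
  qed
qed

text \<open>Integration against a bounded weight is continuous on L^b over a finite measure; this
  passes the defining identity of the weak gradient to limits.\<close>

lemma bounded_test_limit:
  fixes f :: "nat \<Rightarrow> 'a \<Rightarrow> 'b::euclidean_space"
  assumes M: "finite_measure M" and b: "1 < b"
    and f: "\<And>k. f k \<in> Lps M b" "F \<in> Lps M b" "(\<lambda>k. lpn M b (\<lambda>x. f k x - F x)) \<longlonglongrightarrow> 0"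
    and w: "w \<in> borel_measurable M" "\<And>x. norm (w x) \<le> B"
  shows "(\<lambda>k. \<integral>x. f k x \<bullet> w x \<partial>M) \<longlonglongrightarrow> (\<integral>x. F x \<bullet> w x \<partial>M)"
proof -
  have i: "integrable M (\<lambda>x. h x \<bullet> w x)" "\<bar>\<integral>x. h x \<bullet> w x \<partial>M\<bar> \<le> B * (\<integral>x. norm (h x) \<partial>M)" if h: "h \<in> Lps M b" for h
  proof -
    have hi: "integrable M (\<lambda>x. norm (h x))" using Holder_finite(1)[OF M b h] by (rule integrable_norm)
    have le: "\<bar>h x \<bullet> w x\<bar> \<le> B * norm (h x)" for x
      using order_trans[OF Cauchy_Schwarz_ineq2 mult_left_mono[OF w(2) norm_ge_zero]] by (simp add: mult.commute)
    show 1: "integrable M (\<lambda>x. h x \<bullet> w x)"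
    proof (rule Bochner_Integration.integrable_bound[OF integrable_mult_right[OF hi, of B]])
      show "(\<lambda>x. h x \<bullet> w x) \<in> borel_measurable M" using LpsD(1)[OF h] w(1) by measurable
      show "AE x in M. norm (h x \<bullet> w x) \<le> norm (B * norm (h x))"
        using le by (intro AE_I2) (auto intro: order_trans[OF _ abs_ge_self])
    qed
    have "\<bar>\<integral>x. h x \<bullet> w x \<partial>M\<bar> \<le> (\<integral>x. \<bar>h x \<bullet> w x\<bar> \<partial>M)" by (rule integral_abs_bound)
    also have "\<dots> \<le> (\<integral>x. B * norm (h x) \<partial>M)" by (intro integral_mono le integrable_abs 1 integrable_mult_right hi)
    finally show "\<bar>\<integral>x. h x \<bullet> w x \<partial>M\<bar> \<le> B * (\<integral>x. norm (h x) \<partial>M)" by simp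
  qed
  have B: "B \<ge> 0" using w(2) norm_ge_zero order_trans by blast
  have d: "(\<lambda>x. f k x - F x) \<in> Lps M b" for k using b by (intro Lps_diff f) auto
  define c where "c = lpn M b (\<lambda>x. 1::real) powr (b - 1)"
  have "(\<lambda>k. \<integral>x. (f k x - F x) \<bullet> w x \<partial>M) \<longlonglongrightarrow> 0"
  proof (rule Lim_null_comparison)
    have "norm (\<integral>x. (f k x - F x) \<bullet> w x \<partial>M) \<le> B * (c * lpn M b (\<lambda>x. f k x - F x))" for k
      using order_trans[OF i(2)[OF d] mult_left_mono[OF Holder_finite(2)[OF M b d] B]] unfolding c_def by simp
    then show "\<forall>\<^sub>F k in sequentially. norm (\<integral>x. (f k x - F x) \<bullet> w x \<partial>M) \<le> B * (c * lpn M b (\<lambda>x. f k x - F x))" by simp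
    show "(\<lambda>k. B * (c * lpn M b (\<lambda>x. f k x - F x))) \<longlonglongrightarrow> 0" by (intro tendsto_mult_right_zero f(3))
  qed
  moreover have "(\<integral>x. (f k x - F x) \<bullet> w x \<partial>M) = (\<integral>x. f k x \<bullet> w x \<partial>M) - (\<integral>x. F x \<bullet> w x \<partial>M)" for k
    unfolding inner_diff_left by (intro Bochner_Integration.integral_diff i f)
  ultimately show ?thesis by (simp add: LIM_zero_iff)
qed

lemma measurable_component:
  fixes G :: "'a \<Rightarrow> real ^ 'm"
  assumes "G \<in> borel_measurable M" shows "(\<lambda>x. G x $ i) \<in> borel_measurable M"
proof (rule measurable_compose[OF assms])
  show "(\<lambda>v :: real ^ 'm. v $ i) \<in> borel_measurable borel"
    by (intro borel_measurable_continuous_onI continuous_intros)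
qed

context hardy_domain
begin

lemma L_p_eq: "L_p p \<Omega> = Lps M p"
  by (auto simp: L_p_def Lps_def)

lemma Lps_locally_integrable:
  fixes u :: "real ^ 'n \<Rightarrow> 'b::euclidean_space"
  assumes "u \<in> Lps M p"
  shows "locally_integrable \<Omega> u"
  unfolding locally_integrable_def
proof (intro conjI allI impI)
  show "u \<in> borel_measurable M" by (rule LpsD(1)[OF assms])
  have "set_integrable lebesgue \<Omega> u"
    using Holder_finite(1)[OF finite_M p1 assms] domain_sets unfolding set_integrable_def
    by (subst (asm) integrable_restrict_space) auto
  then show "set_integrable lebesgue K u" if "compact K \<and> K \<subseteq> \<Omega>" for K
    by (rule set_integrable_subset) (use that in \<open>auto intro: fmeasurableD lmeasurable_compact\<close>)
qed

lemma test_measurable_M: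
  assumes "\<psi> \<in> D"
  shows "\<psi> \<in> borel_measurable M" "partial_deriv i \<psi> \<in> borel_measurable M"
proof -
  show "\<psi> \<in> borel_measurable M" by (rule LpsD(1)[OF test_Lps(1)[OF assms]])
  have "(\<lambda>x. grad \<psi> x $ i) \<in> borel_measurable M"
    by (rule measurable_component[OF LpsD(1)[OF test_Lps(3)[OF assms]]])
  then show "partial_deriv i \<psi> \<in> borel_measurable M" by (simp add: partial_deriv_grad[abs_def])
qed

text \<open>Integration by parts: the i-th directional derivative of the product of the two test
  functions has integral 0.\<close>

lemma has_weak_gradient_test:
  assumes \<phi>: "\<phi> \<in> D"
  shows "has_weak_gradient \<Omega> \<phi> (grad \<phi>)"
  unfolding has_weak_gradient_def
proof (intro conjI ballI allI Lps_locally_integrable test_Lps[OF \<phi>])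
  fix \<psi> i assume \<psi>: "\<psi> \<in> D"
  note c = test_function_C1c[OF \<phi>] test_function_C1c[OF \<psi>]
  have a: "(\<integral>x. (\<phi> x *\<^sub>R grad \<psi> x + \<psi> x *\<^sub>R grad \<phi> x) \<bullet> axis i 1 \<partial>lborel) = 0"
    by (rule integral_directional_derivative_0[OF C1c_mult[OF c(1) C1c_D(1,2)[OF c(2)]]])
  have m1: "(\<lambda>x. \<phi> x * partial_deriv i \<psi> x) \<in> borel_measurable borel"
    unfolding partial_deriv_grad
    by (intro borel_measurable_times measurable_component C1c_D(4,5)[OF c(1)] C1c_D(4,5)[OF c(2)])
  have m2: "(\<lambda>x. grad \<phi> x $ i * \<psi> x) \<in> borel_measurable borel"
    by (intro borel_measurable_times measurable_component C1c_D(4,5)[OF c(1)] C1c_D(4,5)[OF c(2)])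
  have c1: "continuous_on UNIV (\<lambda>x. \<phi> x * partial_deriv i \<psi> x)"
    unfolding partial_deriv_grad by (intro continuous_intros C1c_D[OF c(1)] C1c_D[OF c(2)])
  have c2: "continuous_on UNIV (\<lambda>x. grad \<phi> x $ i * \<psi> x)"
    by (intro continuous_intros C1c_D[OF c(1)] C1c_D[OF c(2)])
  obtain R where R: "0 < R" "\<And>x. R < norm x \<Longrightarrow> \<phi> x = 0" "\<And>x. R < norm x \<Longrightarrow> grad \<phi> x = 0"
    using C1c_support[OF c(1)] by blast
  have i1: "integrable lborel (\<lambda>x. \<phi> x * partial_deriv i \<psi> x)"
    by (rule integrable_compact_support[OF c1, of R]) (simp add: R)
  have i2: "integrable lborel (\<lambda>x. grad \<phi> x $ i * \<psi> x)" by (rule integrable_compact_support[OF c2, of R]) (simp add: R)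
  have "(\<lambda>x. (\<phi> x *\<^sub>R grad \<psi> x + \<psi> x *\<^sub>R grad \<phi> x) \<bullet> axis i 1) = (\<lambda>x. \<phi> x * partial_deriv i \<psi> x + grad \<phi> x $ i * \<psi> x)"
    by (simp add: fun_eq_iff inner_add_left inner_axis partial_deriv_grad mult.commute)
  with a have "(\<integral>x. \<phi> x * partial_deriv i \<psi> x \<partial>lborel) = - (\<integral>x. grad \<phi> x $ i * \<psi> x \<partial>lborel)"
    using i1 i2 by simp
  then show "(\<integral>x. \<phi> x * partial_deriv i \<psi> x \<partial>M) = - (\<integral>x. grad \<phi> x $ i * \<psi> x \<partial>M)"
    using lebesgue_on_lborel(2)[OF domain_sets m1] lebesgue_on_lborel(2)[OF domain_sets m2] test_function_outside[OF \<phi>] by simp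
qed

lemma Lps_test_integrable:
  fixes w :: "real ^ 'n \<Rightarrow> real"
  assumes "u \<in> Lps M p" "w \<in> borel_measurable M" "\<And>x. \<bar>w x\<bar> \<le> B"
  shows "integrable M (\<lambda>x. u x * w x :: real)"
proof (rule Bochner_Integration.integrable_bound)
  show "integrable M (\<lambda>x. B * u x)" using Holder_finite(1)[OF finite_M p1 assms(1)] by simp
  show "(\<lambda>x. u x * w x) \<in> borel_measurable M" using LpsD(1)[OF assms(1)] assms(2) by (rule borel_measurable_times)
  show "AE x in M. norm (u x * w x) \<le> norm (B * u x)"
  proof (intro AE_I2)
    fix x
    have "\<bar>u x\<bar> * \<bar>w x\<bar> \<le> \<bar>u x\<bar> * \<bar>B\<bar>" using assms(3)[of x] by (intro mult_left_mono) auto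
    then show "norm (u x * w x) \<le> norm (B * u x)" by (simp add: abs_mult mult.commute)
  qed
qed

lemma Lps_component:
  fixes G :: "real ^ 'n \<Rightarrow> real ^ 'n"
  assumes "G \<in> Lps M p" shows "(\<lambda>x. G x $ i) \<in> Lps M p"
proof (rule Lps_bound[OF assms])
  show "(\<lambda>x. G x $ i) \<in> borel_measurable M" by (rule measurable_component[OF LpsD(1)[OF assms]])
qed (use p0 component_le_norm_cart in auto)

lemma has_weak_gradient_diff:
  assumes u: "u \<in> Lps M p" "G \<in> Lps M p" "has_weak_gradient \<Omega> u G"
    and v: "v \<in> Lps M p" "H \<in> Lps M p" "has_weak_gradient \<Omega> v H"
  shows "has_weak_gradient \<Omega> (\<lambda>x. u x - v x) (\<lambda>x. G x - H x)"
  unfolding has_weak_gradient_def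
proof (intro conjI ballI allI Lps_locally_integrable Lps_diff u(1,2) v(1,2) p0)
  fix \<psi> i assume \<psi>: "\<psi> \<in> D"
  obtain B where B: "0 \<le> B" "\<And>x. \<bar>\<psi> x\<bar> \<le> B" "\<And>x i. \<bar>partial_deriv i \<psi> x\<bar> \<le> B"
    using test_function_bounded[OF \<psi>] by blast
  note tm = test_measurable_M[OF \<psi>]
  have "(\<integral>x. (u x - v x) * partial_deriv i \<psi> x \<partial>M) = (\<integral>x. u x * partial_deriv i \<psi> x \<partial>M) - (\<integral>x. v x * partial_deriv i \<psi> x \<partial>M)"
    unfolding left_diff_distrib
    by (intro Bochner_Integration.integral_diff Lps_test_integrable[OF u(1) tm(2) B(3)] Lps_test_integrable[OF v(1) tm(2) B(3)])
  also have "\<dots> = - (\<integral>x. G x $ i * \<psi> x \<partial>M) - - (\<integral>x. H x $ i * \<psi> x \<partial>M)"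
    using u(3) v(3) \<psi> unfolding has_weak_gradient_def by simp
  also have "\<dots> = - (\<integral>x. (G x - H x) $ i * \<psi> x \<partial>M)"
    unfolding vector_minus_component left_diff_distrib
    by (subst Bochner_Integration.integral_diff[OF Lps_test_integrable[OF Lps_component[OF u(2)] tm(1) B(2)] Lps_test_integrable[OF Lps_component[OF v(2)] tm(1) B(2)]]) simp
  finally show "(\<integral>x. (u x - v x) * partial_deriv i \<psi> x \<partial>M) = - (\<integral>x. (G x - H x) $ i * \<psi> x \<partial>M)" .
qed

text \<open>These are the modes of convergence in which the four terms of the weak equation are
  continuous: gradients and quotients by \<open>norm x\<close> in L^p, values in L^s.
  \<open>G\<close> is an argument because the gradient first arises as an L^p limit and is
  identified with \<open>weak_gradient\<close> only later.\<close>

definition conv :: "(nat \<Rightarrow> real ^ 'n \<Rightarrow> real) \<Rightarrow> (real ^ 'n \<Rightarrow> real) \<Rightarrow> (real ^ 'n \<Rightarrow> real ^ 'n) \<Rightarrow> bool" where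
  "conv \<phi> u G \<longleftrightarrow> (\<forall>k. \<phi> k \<in> D) \<and> u \<in> Lps M s \<and> G \<in> Lps M p \<and> (\<lambda>x. u x / norm x) \<in> Lps M p \<and>
    (\<lambda>k. lpn M p (\<lambda>x. grad (\<phi> k) x - G x)) \<longlonglongrightarrow> 0 \<and> (\<lambda>k. lpn M s (\<lambda>x. \<phi> k x - u x)) \<longlonglongrightarrow> 0 \<and>
    (\<lambda>k. lpn M p (\<lambda>x. \<phi> k x / norm x - u x / norm x)) \<longlonglongrightarrow> 0"

lemma measurable_divide_norm:
  assumes "u \<in> borel_measurable M" shows "(\<lambda>x. u x / norm x :: real) \<in> borel_measurable M"
proof -
  have "(\<lambda>x::real^'n. norm x) \<in> borel_measurable M"
    by (intro measurable_restrict_space1 measurable_completion) simp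
  with assms show ?thesis by (rule borel_measurable_divide)
qed

text \<open>By \<open>embedding\<close> the sequence is Cauchy in each of the norms involved. The
  limits are obtained in each space separately and then identified almost everywhere, and the weak
  gradient identity passes to the limit.\<close>

lemma Cauchy_limit:
  assumes \<phi>: "\<And>k. \<phi> k \<in> D" and C: "\<And>e. e > 0 \<Longrightarrow> \<exists>n. \<forall>i\<ge>n. \<forall>j\<ge>n. N (\<lambda>x. \<phi> i x - \<phi> j x) < e"
  obtains u G where "u \<in> Lps M p" "(\<lambda>k. lpn M p (\<lambda>x. \<phi> k x - u x)) \<longlonglongrightarrow> 0" "conv \<phi> u G" "has_weak_gradient \<Omega> u G"
proof -
  obtain K where K: "K \<ge> 0" "\<And>\<phi>. \<phi> \<in> D \<Longrightarrow> lpn M p (\<lambda>x. \<phi> x / norm x) \<le> K * N \<phi> \<and> lpn M s \<phi> \<le> K * N \<phi> \<and> lpn M p \<phi> \<le> K * N \<phi>"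
    using embedding by blast
  have CK: "\<exists>n. \<forall>i\<ge>n. \<forall>j\<ge>n. T i j < e" if e: "e > 0" and T: "\<And>i j. T i j \<le> K * N (\<lambda>x. \<phi> i x - \<phi> j x)" for e and T :: "nat \<Rightarrow> nat \<Rightarrow> real"
  proof -
    have "e / (K + 1) > 0" using e K by simp
    then obtain n where n: "\<forall>i\<ge>n. \<forall>j\<ge>n. N (\<lambda>x. \<phi> i x - \<phi> j x) < e / (K + 1)" using C by blast
    have "T i j < e" if "i \<ge> n" "j \<ge> n" for i j
    proof -
      have "T i j \<le> K * (e / (K + 1))" using T[of i j] n that K(1) by (meson less_imp_le mult_left_mono order_trans)
      also have "\<dots> < e" using e K by (simp add: field_simps)
      finally show ?thesis .
    qed
    then show ?thesis by blast
  qed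
  have dD: "(\<lambda>x. \<phi> i x - \<phi> j x) \<in> D" for i j by (rule test_functions_diff(1)[OF \<phi> \<phi>])
  obtain G where G: "G \<in> Lps M p" "(\<lambda>k. lpn M p (\<lambda>x. grad (\<phi> k) x - G x)) \<longlonglongrightarrow> 0"
  proof (rule Lps_complete[OF finite_M p1 test_Lps(3)[OF \<phi>]])
    show "\<exists>n. \<forall>i\<ge>n. \<forall>j\<ge>n. lpn M p (\<lambda>x. grad (\<phi> i) x - grad (\<phi> j) x) < e" if "e > 0" for e
      using C[OF that] by (simp add: N_diff[OF \<phi> \<phi>])
  qed blast
  obtain u where u: "u \<in> Lps M s" "(\<lambda>k. lpn M s (\<lambda>x. \<phi> k x - u x)) \<longlonglongrightarrow> 0"
  proof (rule Lps_complete[OF finite_M s1 test_Lps(1)[OF \<phi>]])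
    show "\<exists>n. \<forall>i\<ge>n. \<forall>j\<ge>n. lpn M s (\<lambda>x. \<phi> i x - \<phi> j x) < e" if "e > 0" for e
      using K(2)[OF dD] by (intro CK[OF that]) auto
  qed blast
  obtain w where w: "w \<in> Lps M p" "(\<lambda>k. lpn M p (\<lambda>x. \<phi> k x - w x)) \<longlonglongrightarrow> 0"
  proof (rule Lps_complete[OF finite_M p1 test_Lps(2)[OF \<phi>]])
    show "\<exists>n. \<forall>i\<ge>n. \<forall>j\<ge>n. lpn M p (\<lambda>x. \<phi> i x - \<phi> j x) < e" if "e > 0" for e
      using K(2)[OF dD] by (intro CK[OF that]) auto
  qed blast
  obtain z where z: "z \<in> Lps M p" "(\<lambda>k. lpn M p (\<lambda>x. \<phi> k x / norm x - z x)) \<longlonglongrightarrow> 0"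
  proof (rule Lps_complete[OF finite_M p1 test_Lps(4)[OF \<phi>]])
    show "\<exists>n. \<forall>i\<ge>n. \<forall>j\<ge>n. lpn M p (\<lambda>x. \<phi> i x / norm x - \<phi> j x / norm x) < e" if "e > 0" for e
      using K(2)[OF dD] by (intro CK[OF that]) (auto simp: diff_divide_distrib)
  qed blast
  have um: "u \<in> borel_measurable M" by (rule LpsD(1)[OF u(1)])
  have "AE x in M. w x = 1 * u x"
    by (rule limits_agree[OF finite_M s1 p1 test_Lps(1)[OF \<phi>] u test_Lps(2)[OF \<phi>] w]) simp
  then have wu: "AE x in M. w x = u x" by simp
  have "AE x in M. z x = inverse (norm x) * u x"
    by (rule limits_agree[OF finite_M s1 p1 test_Lps(1)[OF \<phi>] u test_Lps(4)[OF \<phi>] z]) (simp add: divide_inverse mult.commute)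
  then have zu: "AE x in M. z x = u x / norm x" by (simp add: divide_inverse mult.commute)
  have up: "u \<in> Lps M p" by (rule Lps_cong_AE[OF w(1) um wu])
  have lp: "(\<lambda>k. lpn M p (\<lambda>x. \<phi> k x - u x)) \<longlonglongrightarrow> 0"
    using w(2) lpn_diff_cong_AE[OF LpsD(1)[OF w(1)] um LpsD(1)[OF test_Lps(2)[OF \<phi>]] wu] by simp
  have uh: "(\<lambda>x. u x / norm x) \<in> Lps M p" by (rule Lps_cong_AE[OF z(1) measurable_divide_norm[OF um] zu])
  have lh: "(\<lambda>k. lpn M p (\<lambda>x. \<phi> k x / norm x - u x / norm x)) \<longlonglongrightarrow> 0"
    using z(2) lpn_diff_cong_AE[OF LpsD(1)[OF z(1)] measurable_divide_norm[OF um] LpsD(1)[OF test_Lps(4)[OF \<phi>]] zu] by simp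
  have "has_weak_gradient \<Omega> u G"
    unfolding has_weak_gradient_def
  proof (intro conjI ballI allI Lps_locally_integrable up G(1))
    fix \<psi> i assume \<psi>: "\<psi> \<in> D"
    obtain B where B: "0 \<le> B" "\<And>x. \<bar>\<psi> x\<bar> \<le> B" "\<And>x i. \<bar>partial_deriv i \<psi> x\<bar> \<le> B"
      using test_function_bounded[OF \<psi>] by blast
    note [measurable] = test_measurable_M[OF \<psi>]
    have "(\<lambda>k. \<integral>x. \<phi> k x \<bullet> partial_deriv i \<psi> x \<partial>M) \<longlonglongrightarrow> (\<integral>x. u x \<bullet> partial_deriv i \<psi> x \<partial>M)"
      by (rule bounded_test_limit[OF finite_M p1 test_Lps(2)[OF \<phi>] up lp, where B = B]) (use B in auto)
    moreover have "(\<lambda>k. \<integral>x. grad (\<phi> k) x \<bullet> (\<psi> x *\<^sub>R axis i 1) \<partial>M) \<longlonglongrightarrow> (\<integral>x. G x \<bullet> (\<psi> x *\<^sub>R axis i 1) \<partial>M)"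
      by (rule bounded_test_limit[OF finite_M p1 test_Lps(3)[OF \<phi>] G, where B = B]) (use B in auto)
    then have "(\<lambda>k. - (\<integral>x. grad (\<phi> k) x $ i * \<psi> x \<partial>M)) \<longlonglongrightarrow> - (\<integral>x. G x $ i * \<psi> x \<partial>M)"
      by (intro tendsto_minus) (simp add: inner_axis mult.commute)
    moreover have "(\<integral>x. \<phi> k x \<bullet> partial_deriv i \<psi> x \<partial>M) = - (\<integral>x. grad (\<phi> k) x $ i * \<psi> x \<partial>M)" for k
      using has_weak_gradient_test[OF \<phi>[of k]] \<psi> unfolding has_weak_gradient_def by simp
    ultimately have "(\<integral>x. u x \<bullet> partial_deriv i \<psi> x \<partial>M) = - (\<integral>x. G x $ i * \<psi> x \<partial>M)"
      by (simp add: LIMSEQ_unique)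
    then show "(\<integral>x. u x * partial_deriv i \<psi> x \<partial>M) = - (\<integral>x. G x $ i * \<psi> x \<partial>M)" by simp
  qed
  then show ?thesis using that[OF up lp] G u uh lh \<phi> by (simp add: conv_def)
qed

text \<open>Since \<open>weak_gradient\<close> is a choice, the one of a difference is computed
  through uniqueness almost everywhere, not through linearity.\<close>

lemma W1p_norm_diff:
  assumes u: "u \<in> Lps M p" "G \<in> Lps M p" "has_weak_gradient \<Omega> u G" and \<phi>: "\<phi> \<in> D"
  shows "W1p_norm p \<Omega> (\<lambda>x. u x - \<phi> x) = (lpn M p (\<lambda>x. \<phi> x - u x) powr p + lpn M p (\<lambda>x. grad \<phi> x - G x) powr p) powr (1 / p)"
proof -
  have w: "has_weak_gradient \<Omega> (\<lambda>x. u x - \<phi> x) (\<lambda>x. G x - grad \<phi> x)"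
    by (rule has_weak_gradient_diff[OF u test_Lps(2,3)[OF \<phi>] has_weak_gradient_test[OF \<phi>]])
  note wg = weak_gradient_AE[OF open_domain w]
  have m: "weak_gradient \<Omega> (\<lambda>x. u x - \<phi> x) \<in> borel_measurable M"
    using wg(1) by (simp add: has_weak_gradient_def locally_integrable_def)
  have "(\<integral>x. norm (weak_gradient \<Omega> (\<lambda>x. u x - \<phi> x) x) powr p \<partial>M) = lpn M p (weak_gradient \<Omega> (\<lambda>x. u x - \<phi> x)) powr p"
    using p0 by (simp add: lpn_powr)
  also have "lpn M p (weak_gradient \<Omega> (\<lambda>x. u x - \<phi> x)) = lpn M p (\<lambda>x. G x - grad \<phi> x)"
  proof (rule lpn_cong_AE[OF _ m])
    show "AE x in M. norm (weak_gradient \<Omega> (\<lambda>x. u x - \<phi> x) x) = norm (G x - grad \<phi> x)" using wg(2) by eventually_elim simp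
    show "(\<lambda>x. G x - grad \<phi> x) \<in> borel_measurable M" by (intro LpsD(1)[OF Lps_diff[OF u(2) test_Lps(3)[OF \<phi>] p0]])
  qed
  also have "\<dots> = lpn M p (\<lambda>x. grad \<phi> x - G x)" by (rule lpn_minus_commute)
  finally show ?thesis
    using p0 by (simp add: W1p_norm_def lpn_powr lpn_minus_commute[of M p \<phi> u, unfolded lpn_def] abs_minus_commute)
qed

text \<open>An explicit limit gradient \<open>G\<close> shows that the norm of the difference tends
  to 0, which is membership in the closure; afterwards \<open>G\<close> may be exchanged for the
  chosen gradient.\<close>

lemma conv_W1p_0:
  assumes u: "u \<in> Lps M p" "(\<lambda>k. lpn M p (\<lambda>x. \<phi> k x - u x)) \<longlonglongrightarrow> 0" "conv \<phi> u G" "has_weak_gradient \<Omega> u G"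
  shows "u \<in> W1p_0 p \<Omega>" "conv \<phi> u (weak_gradient \<Omega> u)"
proof -
  have G: "G \<in> Lps M p" and \<phi>: "\<And>k. \<phi> k \<in> D" and lG: "(\<lambda>k. lpn M p (\<lambda>x. grad (\<phi> k) x - G x)) \<longlonglongrightarrow> 0"
    using u(3) by (auto simp: conv_def)
  have "(\<lambda>k. (lpn M p (\<lambda>x. \<phi> k x - u x) powr p + lpn M p (\<lambda>x. grad (\<phi> k) x - G x) powr p) powr (1 / p)) \<longlonglongrightarrow> 0"
  proof (rule tendsto_zero_powrI[OF _ tendsto_const])
    have "(\<lambda>k. lpn M p (\<lambda>x. \<phi> k x - u x) powr p + lpn M p (\<lambda>x. grad (\<phi> k) x - G x) powr p) \<longlonglongrightarrow> 0 + 0"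
      using p0 by (intro tendsto_add tendsto_zero_powrI[OF u(2) tendsto_const] tendsto_zero_powrI[OF lG tendsto_const]) auto
    then show "(\<lambda>k. lpn M p (\<lambda>x. \<phi> k x - u x) powr p + lpn M p (\<lambda>x. grad (\<phi> k) x - G x) powr p) \<longlonglongrightarrow> 0" by simp
  qed (use p0 in auto)
  then have lim: "(\<lambda>k. W1p_norm p \<Omega> (\<lambda>x. u x - \<phi> k x)) \<longlonglongrightarrow> 0"
    by (simp add: W1p_norm_diff[OF u(1) G u(4) \<phi>])
  show "u \<in> W1p_0 p \<Omega>"
    unfolding W1p_0_def W1p_def L_p_eq
  proof (clarify, intro conjI allI impI)
    fix \<epsilon> :: real assume "\<epsilon> > 0"
    then have "\<forall>\<^sub>F k in sequentially. W1p_norm p \<Omega> (\<lambda>x. u x - \<phi> k x) < \<epsilon>" by (rule order_tendstoD(2)[OF lim])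
    then obtain k where "W1p_norm p \<Omega> (\<lambda>x. u x - \<phi> k x) < \<epsilon>" using eventually_happens'[OF sequentially_bot] by blast
    then show "\<exists>\<phi>\<in>D. W1p_norm p \<Omega> (\<lambda>x. u x - \<phi> x) < \<epsilon>" using \<phi> by blast
  qed (use u G in auto)
  note wg = weak_gradient_AE[OF open_domain u(4)]
  have m: "weak_gradient \<Omega> u \<in> borel_measurable M"
    using wg(1) by (simp add: has_weak_gradient_def locally_integrable_def)
  have ae: "AE x in M. G x = weak_gradient \<Omega> u x" using wg(2) by eventually_elim simp
  have W: "weak_gradient \<Omega> u \<in> Lps M p" by (rule Lps_cong_AE[OF G m ae])
  have "(\<lambda>k. lpn M p (\<lambda>x. grad (\<phi> k) x - weak_gradient \<Omega> u x)) \<longlonglongrightarrow> 0"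
    using lG lpn_diff_cong_AE[OF LpsD(1)[OF G] m LpsD(1)[OF test_Lps(3)[OF \<phi>]] ae] by simp
  then show "conv \<phi> u (weak_gradient \<Omega> u)" using u(3) W by (simp add: conv_def)
qed

text \<open>The closure supplies test functions that converge in the Sobolev norm. They are Cauchy
  for \<open>N\<close>, and \<open>Cauchy_limit\<close> adds the convergence in L^s and of the Hardy
  quotients; its limit agrees with \<open>v\<close> almost everywhere.\<close>

lemma W1p_0_approx:
  assumes v: "v \<in> W1p_0 p \<Omega>"
  obtains \<phi> where "conv \<phi> v (weak_gradient \<Omega> v)" "has_weak_gradient \<Omega> v (weak_gradient \<Omega> v)"
proof -
  obtain G where G: "v \<in> Lps M p" "G \<in> Lps M p" "has_weak_gradient \<Omega> v G"
    and ap: "\<And>\<epsilon>. \<epsilon> > 0 \<Longrightarrow> \<exists>\<phi>\<in>D. W1p_norm p \<Omega> (\<lambda>x. v x - \<phi> x) < \<epsilon>"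
    using v unfolding W1p_0_def W1p_def L_p_eq by blast
  have "\<forall>k. \<exists>\<phi>. \<phi> \<in> D \<and> W1p_norm p \<Omega> (\<lambda>x. v x - \<phi> x) < 1 / real (Suc k)"
    using ap[of "1 / real (Suc k)" for k] by force
  then obtain \<phi> where \<phi>: "\<And>k. \<phi> k \<in> D" "\<And>k. W1p_norm p \<Omega> (\<lambda>x. v x - \<phi> k x) < 1 / real (Suc k)" by metis
  \<comment> \<open>Each of the two norms that make up the Sobolev norm is at most the
    whole.\<close>
  have root: "a \<le> (a powr p + b powr p) powr (1 / p)" "b \<le> (a powr p + b powr p) powr (1 / p)" if "a \<ge> 0" "b \<ge> 0" for a b
  proof -
    have "(a powr p) powr (1 / p) \<le> (a powr p + b powr p) powr (1 / p)" "(b powr p) powr (1 / p) \<le> (a powr p + b powr p) powr (1 / p)"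
      using p0 by (auto intro!: powr_mono2)
    then show "a \<le> (a powr p + b powr p) powr (1 / p)" "b \<le> (a powr p + b powr p) powr (1 / p)"
      using that p0 by (auto simp: powr_powr)
  qed
  have a: "lpn M p (\<lambda>x. \<phi> k x - v x) \<le> 1 / real (Suc k)" and b: "lpn M p (\<lambda>x. grad (\<phi> k) x - G x) \<le> 1 / real (Suc k)" for k
    using \<phi>(2)[of k] root[of "lpn M p (\<lambda>x. \<phi> k x - v x)" "lpn M p (\<lambda>x. grad (\<phi> k) x - G x)", OF lpn_nonneg lpn_nonneg]
    unfolding W1p_norm_diff[OF G \<phi>(1)] by linarith+
  have la: "(\<lambda>k. lpn M p (\<lambda>x. \<phi> k x - v x)) \<longlonglongrightarrow> 0"
    by (rule tendsto_sandwich[OF _ _ tendsto_const LIMSEQ_Suc[OF lim_1_over_n]]) (use a in \<open>auto simp del: of_nat_Suc\<close>)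
  have lb: "(\<lambda>k. lpn M p (\<lambda>x. grad (\<phi> k) x - G x)) \<longlonglongrightarrow> 0"
    by (rule tendsto_sandwich[OF _ _ tendsto_const LIMSEQ_Suc[OF lim_1_over_n]]) (use b in \<open>auto simp del: of_nat_Suc\<close>)
  have "\<exists>n. \<forall>i\<ge>n. \<forall>j\<ge>n. N (\<lambda>x. \<phi> i x - \<phi> j x) < e" if "e > 0" for e
  proof -
    have "\<forall>\<^sub>F k in sequentially. lpn M p (\<lambda>x. grad (\<phi> k) x - G x) < e / 2"
      using that by (intro order_tendstoD(2)[OF lb]) simp
    then obtain n where n: "\<And>k. k \<ge> n \<Longrightarrow> lpn M p (\<lambda>x. grad (\<phi> k) x - G x) < e / 2" by (auto simp: eventually_sequentially)
    have "N (\<lambda>x. \<phi> i x - \<phi> j x) < e" if "i \<ge> n" "j \<ge> n" for i j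
      using lpn_triangle[OF test_Lps(3)[OF \<phi>(1)[of i]] G(2) test_Lps(3)[OF \<phi>(1)[of j]] p1] n[OF that(1)] n[OF that(2)]
        lpn_minus_commute[of M p "grad (\<phi> j)" G] by (simp add: N_diff[OF \<phi>(1) \<phi>(1)])
    then show ?thesis by blast
  qed
  from Cauchy_limit[OF \<phi>(1) this]
  obtain u H where u: "u \<in> Lps M p" "(\<lambda>k. lpn M p (\<lambda>x. \<phi> k x - u x)) \<longlonglongrightarrow> 0" "conv \<phi> u H" "has_weak_gradient \<Omega> u H"
    by blast
  have uv: "AE x in M. u x = v x" by (rule lpn_lim_unique[OF p1 test_Lps(2)[OF \<phi>(1)] u(1) G(1) u(2) la])
  have vm: "v \<in> borel_measurable M" by (rule LpsD(1)[OF G(1)])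
  have uvh: "AE x in M. u x / norm x = v x / norm x" using uv by eventually_elim simp
  note uc = u(3)[unfolded conv_def]
  have "v \<in> Lps M s" by (rule Lps_cong_AE[OF _ vm uv]) (use uc in blast)
  moreover have vh: "(\<lambda>x. v x / norm x) \<in> Lps M p"
    by (rule Lps_cong_AE[OF _ measurable_divide_norm[OF vm] uvh]) (use uc in blast)
  moreover have "(\<lambda>k. lpn M s (\<lambda>x. \<phi> k x - v x)) \<longlonglongrightarrow> 0"
    using uc lpn_diff_cong_AE[OF LpsD(1)[OF u(1)] vm LpsD(1)[OF test_Lps(2)[OF \<phi>(1)]] uv] by simp
  moreover have "(\<lambda>k. lpn M p (\<lambda>x. \<phi> k x / norm x - v x / norm x)) \<longlonglongrightarrow> 0"
    using uc lpn_diff_cong_AE[OF measurable_divide_norm[OF LpsD(1)[OF u(1)]] measurable_divide_norm[OF vm] LpsD(1)[OF test_Lps(4)[OF \<phi>(1)]] uvh] by simp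
  ultimately have "conv \<phi> v G" using G(2) lb \<phi>(1) by (simp add: conv_def)
  from conv_W1p_0(2)[OF G(1) la this G(3)] weak_gradient_AE(1)[OF open_domain G(3)] show ?thesis by (rule that)
qed

text \<open>The identity defining a weak gradient sees \<open>u\<close> only under the integral, so
  the gradient of \<open>v\<close> is also one of \<open>u\<close>, and uniqueness applies.\<close>

lemma W1p_0_AE_eq:
  assumes u: "u \<in> W1p_0 p \<Omega>" and v: "v \<in> W1p_0 p \<Omega>" and ae: "AE x in M. u x = v x"
  shows "AE x in M. weak_gradient \<Omega> u x = weak_gradient \<Omega> v x"
proof -
  obtain \<phi> where \<phi>: "has_weak_gradient \<Omega> u (weak_gradient \<Omega> u)" using W1p_0_approx[OF u] by blast
  obtain \<psi> where \<psi>: "has_weak_gradient \<Omega> v (weak_gradient \<Omega> v)" using W1p_0_approx[OF v] by blast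
  have um: "u \<in> borel_measurable M" "v \<in> borel_measurable M"
    using \<phi> \<psi> by (auto simp: has_weak_gradient_def locally_integrable_def)
  have "has_weak_gradient \<Omega> u (weak_gradient \<Omega> v)"
    unfolding has_weak_gradient_def
  proof (intro conjI ballI allI)
    show "locally_integrable \<Omega> u" "locally_integrable \<Omega> (weak_gradient \<Omega> v)" using \<phi> \<psi> by (auto simp: has_weak_gradient_def)
    fix \<eta> i assume \<eta>: "\<eta> \<in> D"
    have "(\<integral>x. u x * partial_deriv i \<eta> x \<partial>M) = (\<integral>x. v x * partial_deriv i \<eta> x \<partial>M)"
    proof (rule integral_cong_AE)
      show "AE x in M. u x * partial_deriv i \<eta> x = v x * partial_deriv i \<eta> x" using ae by eventually_elim simp
    qed (use um test_measurable_M[OF \<eta>] in auto)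
    then show "(\<integral>x. u x * partial_deriv i \<eta> x \<partial>M) = - (\<integral>x. weak_gradient \<Omega> v x $ i * \<eta> x \<partial>M)"
      using \<psi> \<eta> by (simp add: has_weak_gradient_def)
  qed
  with \<phi> show ?thesis by (rule weak_gradient_unique[OF open_domain])
qed

end

section \<open>Weak solutions from almost critical sequences\<close>

locale perturbed_problem = hardy_domain \<Omega> p s for \<Omega> :: "(real ^ 'n) set" and p s :: real +
  fixes \<mu> :: real and f g F G :: "real \<Rightarrow> real"
  assumes mu: "0 < \<mu>" and f: "nemy s f" and g: "nemy s g"
    and F: "\<And>t. (F has_real_derivative f t) (at t)" and G: "\<And>t. (G has_real_derivative g t) (at t)"
begin

definition Phi :: "(real ^ 'n \<Rightarrow> real) \<Rightarrow> real" where
  "Phi u = (\<integral>x. norm (grad u x) powr p / p \<partial>M) + \<mu> * (\<integral>x. norm (u x / norm x) powr p / p \<partial>M)"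

text \<open>The signs are kept in the coefficients \<open>- lam\<close> and
  \<open>- \<gamma>\<close>, so that the functional has literally the shape produced by
  \<open>smooth_combine\<close>.\<close>

definition E :: "real \<Rightarrow> real \<Rightarrow> (real ^ 'n \<Rightarrow> real) \<Rightarrow> real" where
  "E lam \<gamma> u = Phi u + (- lam) * (\<integral>x. F (u x) \<partial>M) + (- \<gamma>) * (\<integral>x. G (u x) \<partial>M)"

text \<open>The gradients \<open>U\<close> and \<open>V\<close> are separate arguments: the same
  expression serves test functions with classical gradients, where it is the derivative of
  \<open>E\<close>, and Sobolev functions with weak gradients, where its vanishing is the
  equation.\<close>

definition flux :: "real \<Rightarrow> real \<Rightarrow> (real ^ 'n \<Rightarrow> real) \<Rightarrow> (real ^ 'n \<Rightarrow> real ^ 'n) \<Rightarrow> (real ^ 'n \<Rightarrow> real) \<Rightarrow> (real ^ 'n \<Rightarrow> real ^ 'n) \<Rightarrow> real" where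
  "flux lam \<gamma> u U v V = (\<integral>x. pflux p (U x) \<bullet> V x \<partial>M) + \<mu> * (\<integral>x. pflux p (u x / norm x) \<bullet> (v x / norm x) \<partial>M)
      + (- lam) * (\<integral>x. f (u x) \<bullet> v x \<partial>M) + (- \<gamma>) * (\<integral>x. g (u x) \<bullet> v x \<partial>M)"

abbreviation "dE lam \<gamma> u v \<equiv> flux lam \<gamma> u (grad u) v (grad v)"

text \<open>Functions on \<open>real ^ 'n\<close> carry no vector space instance, so the test functions are viewed as
  bounded continuous functions in order to instantiate the abstract critical point theory.\<close>

abbreviation "DB \<equiv> {b :: (real ^ 'n) \<Rightarrow>\<^sub>C real. apply_bcontfun b \<in> D}"

lemma F_derivative: "(F has_derivative (\<lambda>h. f t \<bullet> h)) (at t)"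
  using F[of t] by (simp add: has_field_derivative_def)

lemma G_derivative: "(G has_derivative (\<lambda>h. g t \<bullet> h)) (at t)"
  using G[of t] by (simp add: has_field_derivative_def)

lemma DB_ops:
  assumes "u \<in> DB" "v \<in> DB"
  shows "u + v \<in> DB" "u - v \<in> DB" "c *\<^sub>R u \<in> DB"
    "apply_bcontfun (u + v) = (\<lambda>x. apply_bcontfun u x + apply_bcontfun v x)"
    "apply_bcontfun (u - v) = (\<lambda>x. apply_bcontfun u x - apply_bcontfun v x)"
    "apply_bcontfun (c *\<^sub>R u) = (\<lambda>x. c * apply_bcontfun u x)"
proof -
  show 1: "apply_bcontfun (u + v) = (\<lambda>x. apply_bcontfun u x + apply_bcontfun v x)"
    and 2: "apply_bcontfun (u - v) = (\<lambda>x. apply_bcontfun u x - apply_bcontfun v x)"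
    and 3: "apply_bcontfun (c *\<^sub>R u) = (\<lambda>x. c * apply_bcontfun u x)" by (simp_all add: fun_eq_iff)
  show "u + v \<in> DB" "u - v \<in> DB" "c *\<^sub>R u \<in> DB"
    unfolding mem_Collect_eq 1 2 3 using assms test_functions_add(1) test_functions_diff(1) test_functions_scale(1) by auto
qed

lemma Bcontfun_test: "\<phi> \<in> D \<Longrightarrow> apply_bcontfun (Bcontfun \<phi>) = \<phi>"
proof (rule Bcontfun_inverse)
  assume \<phi>: "\<phi> \<in> D"
  obtain B where "0 \<le> B" "\<And>x. \<bar>\<phi> x\<bar> \<le> B" "\<And>x i. \<bar>partial_deriv i \<phi> x\<bar> \<le> B" using test_function_bounded[OF \<phi>] by blast
  then show "\<phi> \<in> bcontfun" using C1c_D(3)[OF test_function_C1c[OF \<phi>]] by (intro bcontfun_normI) auto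
qed

lemma smooth_parts:
  "smooth_on DB (\<lambda>b. N (apply_bcontfun b)) (\<lambda>b. \<integral>x. norm (grad (apply_bcontfun b) x) powr p / p \<partial>M)
     (\<lambda>b c. \<integral>x. pflux p (grad (apply_bcontfun b) x) \<bullet> grad (apply_bcontfun c) x \<partial>M)"
  "smooth_on DB (\<lambda>b. N (apply_bcontfun b)) (\<lambda>b. \<integral>x. norm (apply_bcontfun b x / norm x) powr p / p \<partial>M)
     (\<lambda>b c. \<integral>x. pflux p (apply_bcontfun b x / norm x) \<bullet> (apply_bcontfun c x / norm x) \<partial>M)"
  "smooth_on DB (\<lambda>b. N (apply_bcontfun b)) (\<lambda>b. \<integral>x. F (apply_bcontfun b x) \<partial>M)
     (\<lambda>b c. \<integral>x. f (apply_bcontfun b x) \<bullet> apply_bcontfun c x \<partial>M)"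
  "smooth_on DB (\<lambda>b. N (apply_bcontfun b)) (\<lambda>b. \<integral>x. G (apply_bcontfun b x) \<partial>M)
     (\<lambda>b c. \<integral>x. g (apply_bcontfun b x) \<bullet> apply_bcontfun c x \<partial>M)"
proof -
  obtain K where K: "K \<ge> 0" "\<And>\<phi>. \<phi> \<in> D \<Longrightarrow> lpn M p (\<lambda>x. \<phi> x / norm x) \<le> K * N \<phi> \<and> lpn M s \<phi> \<le> K * N \<phi> \<and> lpn M p \<phi> \<le> K * N \<phi>"
    using embedding by blast
  show "smooth_on DB (\<lambda>b. N (apply_bcontfun b)) (\<lambda>b. \<integral>x. norm (grad (apply_bcontfun b) x) powr p / p \<partial>M)
     (\<lambda>b c. \<integral>x. pflux p (grad (apply_bcontfun b) x) \<bullet> grad (apply_bcontfun c) x \<partial>M)"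
  proof (rule smooth_component[where P = "\<lambda>y. norm y powr p / p" and a = "pflux p" and K = 1 and T = "\<lambda>b. grad (apply_bcontfun b)",
        OF finite_M p1 nemy_pflux[OF p(1)] has_derivative_norm_powr[OF p(1)]])
    show "grad (apply_bcontfun (u + v)) x = grad (apply_bcontfun u) x + grad (apply_bcontfun v) x" if "u \<in> DB" "v \<in> DB" for u v x
      unfolding DB_ops(4)[OF that] by (subst test_functions_add(2)) (use that in auto)
    show "grad (apply_bcontfun (u - v)) x = grad (apply_bcontfun u) x - grad (apply_bcontfun v) x" if "u \<in> DB" "v \<in> DB" for u v x
      unfolding DB_ops(5)[OF that] by (subst test_functions_diff(2)) (use that in auto)
    show "grad (apply_bcontfun (c *\<^sub>R u)) x = c *\<^sub>R grad (apply_bcontfun u) x" if "u \<in> DB" for u c x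
      unfolding DB_ops(6)[OF that that] by (subst test_functions_scale(2)) (use that in auto)
  qed (use test_Lps(3) DB_ops(2) in auto)
  show "smooth_on DB (\<lambda>b. N (apply_bcontfun b)) (\<lambda>b. \<integral>x. norm (apply_bcontfun b x / norm x) powr p / p \<partial>M)
     (\<lambda>b c. \<integral>x. pflux p (apply_bcontfun b x / norm x) \<bullet> (apply_bcontfun c x / norm x) \<partial>M)"
    by (rule smooth_component[where P = "\<lambda>y. norm y powr p / p" and a = "pflux p" and K = K and T = "\<lambda>b x. apply_bcontfun b x / norm x",
        OF finite_M p1 nemy_pflux[OF p(1)] has_derivative_norm_powr[OF p(1)] K(1)])
       (use test_Lps(4) K(2) DB_ops(2) in \<open>auto simp: add_divide_distrib diff_divide_distrib\<close>)
  show "smooth_on DB (\<lambda>b. N (apply_bcontfun b)) (\<lambda>b. \<integral>x. F (apply_bcontfun b x) \<partial>M)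
     (\<lambda>b c. \<integral>x. f (apply_bcontfun b x) \<bullet> apply_bcontfun c x \<partial>M)"
    by (rule smooth_component[where K = K and T = "\<lambda>b. apply_bcontfun b", OF finite_M s1 f F_derivative K(1)])
       (use test_Lps(1) K(2) DB_ops(2) in auto)
  show "smooth_on DB (\<lambda>b. N (apply_bcontfun b)) (\<lambda>b. \<integral>x. G (apply_bcontfun b x) \<partial>M)
     (\<lambda>b c. \<integral>x. g (apply_bcontfun b x) \<bullet> apply_bcontfun c x \<partial>M)"
    by (rule smooth_component[where K = K and T = "\<lambda>b. apply_bcontfun b", OF finite_M s1 g G_derivative K(1)])
       (use test_Lps(1) K(2) DB_ops(2) in auto)
qed

lemma smooth_E:
  "smooth_on DB (\<lambda>b. N (apply_bcontfun b)) (\<lambda>b. E lam \<gamma> (apply_bcontfun b)) (\<lambda>b c. dE lam \<gamma> (apply_bcontfun b) (apply_bcontfun c))"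
  unfolding E_def flux_def Phi_def by (intro smooth_combine smooth_parts lpn_nonneg)

lemma energy_E:
  "energy DB (\<lambda>b. N (apply_bcontfun b)) (\<lambda>b. E lam \<gamma> (apply_bcontfun b)) (\<lambda>b c. dE lam \<gamma> (apply_bcontfun b) (apply_bcontfun c)) R"
proof (rule energy_smooth_on[OF smooth_E])
  have "apply_bcontfun (0 :: (real ^ 'n) \<Rightarrow>\<^sub>C real) = (\<lambda>x. 0)" by (simp add: fun_eq_iff)
  then show "0 \<in> DB" using test_functions_zero[of \<Omega>] by simp
  show "N (apply_bcontfun (c *\<^sub>R u)) = \<bar>c\<bar> * N (apply_bcontfun u)" if "u \<in> DB" for u c
    using N_scale that unfolding DB_ops(6)[OF that that] by simp
  show "N (apply_bcontfun (u + v)) \<le> N (apply_bcontfun u) + N (apply_bcontfun v)" if "u \<in> DB" "v \<in> DB" for u v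
    using N_add that unfolding DB_ops(4)[OF that] by simp
  show "u + v \<in> DB" if "u \<in> DB" "v \<in> DB" for u v using DB_ops(1)[OF that] .
  show "c *\<^sub>R u \<in> DB" if "u \<in> DB" for c u using DB_ops(3)[OF that that] .
qed simp

lemma flux_limit:
  assumes "conv \<phi> u U" "conv \<psi> v V"
  shows "(\<lambda>k. dE lam \<gamma> (\<phi> k) (\<psi> k)) \<longlonglongrightarrow> flux lam \<gamma> u U v V"
proof -
  note u = assms(1)[unfolded conv_def] and v = assms(2)[unfolded conv_def]
  have "(\<lambda>k. \<integral>x. pflux p (grad (\<phi> k) x) \<bullet> grad (\<psi> k) x \<partial>M) \<longlonglongrightarrow> (\<integral>x. pflux p (U x) \<bullet> V x \<partial>M)"
    using u v test_Lps(3) by (intro nemy_limit[OF finite_M p1 nemy_pflux[OF p(1)]]) auto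
  moreover have "(\<lambda>k. \<integral>x. pflux p (\<phi> k x / norm x) \<bullet> (\<psi> k x / norm x) \<partial>M) \<longlonglongrightarrow> (\<integral>x. pflux p (u x / norm x) \<bullet> (v x / norm x) \<partial>M)"
    using u v test_Lps(4)
    by (intro nemy_limit[OF finite_M p1 nemy_pflux[OF p(1)], where U = "\<lambda>k x. \<phi> k x / norm x" and u = "\<lambda>x. u x / norm x"
          and V = "\<lambda>k x. \<psi> k x / norm x" and v = "\<lambda>x. v x / norm x"]) auto
  moreover have "(\<lambda>k. \<integral>x. f (\<phi> k x) \<bullet> \<psi> k x \<partial>M) \<longlonglongrightarrow> (\<integral>x. f (u x) \<bullet> v x \<partial>M)"
    using u v test_Lps(1) by (intro nemy_limit[OF finite_M s1 f]) auto
  moreover have "(\<lambda>k. \<integral>x. g (\<phi> k x) \<bullet> \<psi> k x \<partial>M) \<longlonglongrightarrow> (\<integral>x. g (u x) \<bullet> v x \<partial>M)"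
    using u v test_Lps(1) by (intro nemy_limit[OF finite_M s1 g]) auto
  ultimately show ?thesis unfolding flux_def by (intro tendsto_intros)
qed

lemma conv_N:
  assumes "conv \<phi> u U"
  shows "(\<lambda>k. N (\<phi> k)) \<longlonglongrightarrow> lpn M p U"
proof -
  note u = assms[unfolded conv_def]
  have "(\<lambda>k. N (\<phi> k) - lpn M p U) \<longlonglongrightarrow> 0"
  proof (rule Lim_null_comparison)
    have "\<bar>N (\<phi> k) - lpn M p U\<bar> \<le> lpn M p (\<lambda>x. grad (\<phi> k) x - U x)" for k
      using u test_Lps(3) by (intro lpn_abs_diff p1) auto
    then show "\<forall>\<^sub>F k in sequentially. norm (N (\<phi> k) - lpn M p U) \<le> lpn M p (\<lambda>x. grad (\<phi> k) x - U x)" by simp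
  qed (use u in blast)
  then show ?thesis by (simp add: LIM_zero_iff)
qed

text \<open>The singular term is the flux of the p-Laplacian evaluated at the Hardy quotients, which
  lie in L^p. At \<open>x = 0\<close> both sides are 0 by the convention for division by 0.\<close>

lemma hardy_integrand:
  "\<bar>a\<bar> powr (p - 2) * a * b / norm x powr p = pflux p (a / norm x) \<bullet> (b / norm x)" for a b :: real and x :: "real ^ 'n"
proof (cases "x = 0")
  case False
  then have n: "norm x > 0" by simp
  then have "norm x powr p = norm x powr (p - 2) * (norm x)\<^sup>2" by (simp add: powr_diff)
  then show ?thesis using n by (simp add: abs_divide powr_divide power2_eq_square)
qed simp

text \<open>An arbitrary direction \<open>v\<close> is approximated by test functions
  \<open>\<psi> k\<close>. Almost criticality bounds the derivative by
  \<open>e k * N (\<psi> k)\<close>, which tends to 0 because the norms \<open>N (\<psi> k)\<close>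
  converge.\<close>

lemma weak_solution_limit:
  assumes u: "u \<in> W1p_0 p \<Omega>" "conv \<phi> u (weak_gradient \<Omega> u)" and e: "e \<longlonglongrightarrow> 0"
    and crit: "\<And>k \<psi>. \<psi> \<in> D \<Longrightarrow> \<bar>dE lam \<gamma> (\<phi> k) \<psi>\<bar> \<le> e k * N \<psi>"
  shows "weak_solution p \<mu> f g lam \<gamma> \<Omega> u"
  unfolding weak_solution_def
proof (intro conjI u(1) ballI)
  fix v assume v: "v \<in> W1p_0 p \<Omega>"
  obtain \<psi> where \<psi>: "conv \<psi> v (weak_gradient \<Omega> v)" using W1p_0_approx[OF v] by blast
  define U V where "U = weak_gradient \<Omega> u" and "V = weak_gradient \<Omega> v"
  note cu = u(2)[unfolded conv_def U_def[symmetric]] and cv = \<psi>[unfolded conv_def V_def[symmetric]]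
  have "(\<lambda>k. dE lam \<gamma> (\<phi> k) (\<psi> k)) \<longlonglongrightarrow> flux lam \<gamma> u U v V"
    using flux_limit[OF u(2) \<psi>] unfolding U_def V_def .
  moreover have "(\<lambda>k. dE lam \<gamma> (\<phi> k) (\<psi> k)) \<longlonglongrightarrow> 0"
  proof (rule Lim_null_comparison)
    show "\<forall>\<^sub>F k in sequentially. norm (dE lam \<gamma> (\<phi> k) (\<psi> k)) \<le> e k * N (\<psi> k)"
      using crit cv by auto
    have "(\<lambda>k. e k * N (\<psi> k)) \<longlonglongrightarrow> 0 * lpn M p V"
      unfolding V_def by (intro tendsto_mult e conv_N[OF \<psi>])
    then show "(\<lambda>k. e k * N (\<psi> k)) \<longlonglongrightarrow> 0" by simp
  qed
  ultimately have zero: "flux lam \<gamma> u U v V = 0" by (rule LIMSEQ_unique)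
  have i1: "integrable M (\<lambda>x. pflux p (U x) \<bullet> V x)"
    using cu cv by (intro nemy_integrable[OF finite_M p1 nemy_pflux[OF p(1)]]) auto
  have i2: "integrable M (\<lambda>x. pflux p (u x / norm x) \<bullet> (v x / norm x))"
    using cu cv
      by (intro nemy_integrable[OF finite_M p1 nemy_pflux[OF p(1)], where U = "\<lambda>x. u x / norm x" and V = "\<lambda>x. v x / norm x"]) auto
  have i3: "integrable M (\<lambda>x. f (u x) * v x)" "integrable M (\<lambda>x. g (u x) * v x)"
    using cu cv nemy_integrable[OF finite_M s1 f, of u v] nemy_integrable[OF finite_M s1 g, of u v] by auto
  have eq: "norm (U x) powr (p - 2) * (U x \<bullet> V x) + \<mu> * (\<bar>u x\<bar> powr (p - 2) * u x * v x / norm x powr p)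
      = pflux p (U x) \<bullet> V x + \<mu> * (pflux p (u x / norm x) \<bullet> (v x / norm x))" for x
    unfolding hardy_integrand by simp
  show "integrable M (\<lambda>x. norm (weak_gradient \<Omega> u x) powr (p - 2) * (weak_gradient \<Omega> u x \<bullet> weak_gradient \<Omega> v x)
        + \<mu> * (\<bar>u x\<bar> powr (p - 2) * u x * v x / norm x powr p))"
    unfolding U_def[symmetric] V_def[symmetric] eq
    by (intro Bochner_Integration.integrable_add integrable_mult_right i1 i2)
  show "integrable M (\<lambda>x. f (u x) * v x)" "integrable M (\<lambda>x. g (u x) * v x)" by (rule i3)+
  have "(\<integral>x. pflux p (U x) \<bullet> V x + \<mu> * (pflux p (u x / norm x) \<bullet> (v x / norm x)) \<partial>M)
      = (\<integral>x. pflux p (U x) \<bullet> V x \<partial>M) + \<mu> * (\<integral>x. pflux p (u x / norm x) \<bullet> (v x / norm x) \<partial>M)"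
    by (subst Bochner_Integration.integral_add[OF i1 integrable_mult_right[OF i2]]) (simp only: integral_mult_right_zero)
  also have "\<dots> = lam * (\<integral>x. f (u x) * v x \<partial>M) + \<gamma> * (\<integral>x. g (u x) * v x \<partial>M)"
  proof -
    have fg: "(\<integral>x. f (u x) \<bullet> v x \<partial>M) = (\<integral>x. f (u x) * v x \<partial>M)" "(\<integral>x. g (u x) \<bullet> v x \<partial>M) = (\<integral>x. g (u x) * v x \<partial>M)"
      by simp_all
    show ?thesis using zero unfolding flux_def fg by linarith
  qed
  finally show "(\<integral>x. norm (weak_gradient \<Omega> u x) powr (p - 2) * (weak_gradient \<Omega> u x \<bullet> weak_gradient \<Omega> v x)
        + \<mu> * (\<bar>u x\<bar> powr (p - 2) * u x * v x / norm x powr p) \<partial>M)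
      = lam * (\<integral>x. f (u x) * v x \<partial>M) + \<gamma> * (\<integral>x. g (u x) * v x \<partial>M)"
    unfolding U_def[symmetric] V_def[symmetric] eq .
qed

text \<open>Since \<open>p \<ge> 2\<close>, the leading part is strongly monotone, so compactness of the lower order terms
  alone makes almost critical sequences converge strongly; weak compactness is not needed.\<close>

lemma almost_critical_difference:
  assumes r: "0 \<le> r"
  shows "\<exists>B\<ge>0. \<forall>u\<in>D. \<forall>v\<in>D. \<forall>a b. N u \<le> r \<longrightarrow> N v \<le> r \<longrightarrow> 0 \<le> a \<longrightarrow> 0 \<le> b \<longrightarrow>
    (\<forall>\<psi>\<in>D. \<bar>dE lam \<gamma> u \<psi>\<bar> \<le> a * N \<psi>) \<longrightarrow> (\<forall>\<psi>\<in>D. \<bar>dE lam \<gamma> v \<psi>\<bar> \<le> b * N \<psi>) \<longrightarrow>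
    2 powr (1 - p) * N (\<lambda>x. u x - v x) powr p \<le> (a + b) * (2 * r) + B * lpn M s (\<lambda>x. u x - v x)"
proof -
  obtain K where K: "K \<ge> 0" "\<And>\<phi>. \<phi> \<in> D \<Longrightarrow> lpn M p (\<lambda>x. \<phi> x / norm x) \<le> K * N \<phi> \<and> lpn M s \<phi> \<le> K * N \<phi> \<and> lpn M p \<phi> \<le> K * N \<phi>"
    using embedding by blast
  obtain Cf where Cf: "Cf \<ge> 0" "\<And>U V. U\<in>Lps M s \<Longrightarrow> V\<in>Lps M s \<Longrightarrow> lpn M s U \<le> K * r \<Longrightarrow> \<bar>\<integral>x. f (U x) \<bullet> V x \<partial>M\<bar> \<le> Cf * lpn M s V"
    using nemy_bound_integral[OF finite_M s1 f, of "K * r"] by blast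
  obtain Cg where Cg: "Cg \<ge> 0" "\<And>U V. U\<in>Lps M s \<Longrightarrow> V\<in>Lps M s \<Longrightarrow> lpn M s U \<le> K * r \<Longrightarrow> \<bar>\<integral>x. g (U x) \<bullet> V x \<partial>M\<bar> \<le> Cg * lpn M s V"
    using nemy_bound_integral[OF finite_M s1 g, of "K * r"] by blast
  define B where "B = \<bar>lam\<bar> * (2 * Cf) + \<bar>\<gamma>\<bar> * (2 * Cg)"
  have B: "B \<ge> 0" using Cf Cg by (simp add: B_def)
  have "2 powr (1 - p) * N (\<lambda>x. u x - v x) powr p \<le> (a + b) * (2 * r) + B * lpn M s (\<lambda>x. u x - v x)"
    if u: "u \<in> D" and v: "v \<in> D" and ur: "N u \<le> r" and vr: "N v \<le> r" and ab: "0 \<le> a" "0 \<le> b"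
      and cu: "\<forall>\<psi>\<in>D. \<bar>dE lam \<gamma> u \<psi>\<bar> \<le> a * N \<psi>" and cv: "\<forall>\<psi>\<in>D. \<bar>dE lam \<gamma> v \<psi>\<bar> \<le> b * N \<psi>" for u v a b
  proof -
    define d where "d x = u x - v x" for x
    have d: "d \<in> D" unfolding d_def[abs_def] by (rule test_functions_diff(1)[OF u v])
    have gd: "grad d x = grad u x - grad v x" for x unfolding d_def[abs_def] test_functions_diff(2)[OF u v] ..
    have Nd: "N d \<le> 2 * r"
    proof -
      have "N d \<le> N u + N v" unfolding gd[abs_def] using lpn_diff[OF test_Lps(3)[OF u] test_Lps(3)[OF v] p1] by simp
      then show ?thesis using ur vr by linarith
    qed
    define L where "L = lpn M s d"
    have sK: "lpn M s w \<le> K * r" if "w \<in> D" "N w \<le> r" for w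
      using K(2)[OF that(1)] mult_left_mono[OF that(2) K(1)] by linarith
    note iu = nemy_integrable[OF finite_M p1 nemy_pflux[OF p(1)] test_Lps(3)[OF u] test_Lps(3)[OF d]]
      and iv = nemy_integrable[OF finite_M p1 nemy_pflux[OF p(1)] test_Lps(3)[OF v] test_Lps(3)[OF d]]
      and ju = nemy_integrable[OF finite_M p1 nemy_pflux[OF p(1)] test_Lps(4)[OF u] test_Lps(4)[OF d]]
      and jv = nemy_integrable[OF finite_M p1 nemy_pflux[OF p(1)] test_Lps(4)[OF v] test_Lps(4)[OF d]]
    have "2 powr (1 - p) * N d powr p = (\<integral>x. 2 powr (1 - p) * norm (grad d x) powr p \<partial>M)"
      using p0 by (simp add: lpn_powr)
    also have "\<dots> \<le> (\<integral>x. pflux p (grad u x) \<bullet> grad d x - pflux p (grad v x) \<bullet> grad d x \<partial>M)"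
    proof (rule integral_mono)
      show "integrable M (\<lambda>x. 2 powr (1 - p) * norm (grad d x) powr p)"
        by (intro integrable_mult_right LpsD(2)[OF test_Lps(3)[OF d]])
      show "integrable M (\<lambda>x. pflux p (grad u x) \<bullet> grad d x - pflux p (grad v x) \<bullet> grad d x)"
        by (rule Bochner_Integration.integrable_diff[OF iu iv])
      show "2 powr (1 - p) * norm (grad d x) powr p \<le> pflux p (grad u x) \<bullet> grad d x - pflux p (grad v x) \<bullet> grad d x" for x
        using pflux_strongly_monotone[OF p(1), of "grad u x" "grad v x"] unfolding gd inner_diff_left[symmetric] .
    qed
    also have "\<dots> = (\<integral>x. pflux p (grad u x) \<bullet> grad d x \<partial>M) - (\<integral>x. pflux p (grad v x) \<bullet> grad d x \<partial>M)"
      by (rule Bochner_Integration.integral_diff[OF iu iv])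
    finally have 1: "2 powr (1 - p) * N d powr p \<le> (\<integral>x. pflux p (grad u x) \<bullet> grad d x \<partial>M) - (\<integral>x. pflux p (grad v x) \<bullet> grad d x \<partial>M)" .
    \<comment> \<open>Monotonicity gives the Hardy term the favourable sign, as \<open>\<mu>\<close>
      is positive; no compactness of the Hardy embedding is required.\<close>
    have "0 \<le> (\<integral>x. pflux p (u x / norm x) \<bullet> (d x / norm x) - pflux p (v x / norm x) \<bullet> (d x / norm x) \<partial>M)"
    proof (rule integral_nonneg_AE, rule AE_I2)
      fix x
      have "0 \<le> 2 powr (1 - p) * norm (u x / norm x - v x / norm x) powr p" by simp
      also have "\<dots> \<le> (pflux p (u x / norm x) - pflux p (v x / norm x)) \<bullet> (u x / norm x - v x / norm x)"
        by (rule pflux_strongly_monotone[OF p(1)])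
      finally show "0 \<le> pflux p (u x / norm x) \<bullet> (d x / norm x) - pflux p (v x / norm x) \<bullet> (d x / norm x)"
        unfolding inner_diff_left[symmetric] d_def diff_divide_distrib .
    qed
    also have "\<dots> = (\<integral>x. pflux p (u x / norm x) \<bullet> (d x / norm x) \<partial>M) - (\<integral>x. pflux p (v x / norm x) \<bullet> (d x / norm x) \<partial>M)"
      by (rule Bochner_Integration.integral_diff[OF ju jv])
    finally have 2: "0 \<le> \<mu> * (\<integral>x. pflux p (u x / norm x) \<bullet> (d x / norm x) \<partial>M) - \<mu> * (\<integral>x. pflux p (v x / norm x) \<bullet> (d x / norm x) \<partial>M)"
      using mu by (simp add: right_diff_distrib[symmetric])
    have lin: "\<bar>c * x\<bar> \<le> \<bar>c\<bar> * (C * L)" if "\<bar>x\<bar> \<le> C * L" for c x C using that by (simp add: abs_mult mult_left_mono)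
    have 3: "\<bar>lam * (\<integral>x. f (w x) \<bullet> d x \<partial>M)\<bar> \<le> \<bar>lam\<bar> * (Cf * L)" "\<bar>\<gamma> * (\<integral>x. g (w x) \<bullet> d x \<partial>M)\<bar> \<le> \<bar>\<gamma>\<bar> * (Cg * L)"
      if "w \<in> D" "N w \<le> r" for w
      using Cf(2)[OF test_Lps(1)[OF that(1)] test_Lps(1)[OF d] sK[OF that]] Cg(2)[OF test_Lps(1)[OF that(1)] test_Lps(1)[OF d] sK[OF that]]
      unfolding L_def[symmetric] by (auto intro: lin)
    \<comment> \<open>Both derivatives are tested with the difference of the two points, whose norm
      is at most \<open>2 * r\<close>.\<close>
    have 4: "\<bar>dE lam \<gamma> u d\<bar> \<le> a * (2 * r)" "\<bar>dE lam \<gamma> v d\<bar> \<le> b * (2 * r)"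
      using cu cv d mult_left_mono[OF Nd ab(1)] mult_left_mono[OF Nd ab(2)] by (meson order_trans)+
    have "2 powr (1 - p) * N d powr p \<le> a * (2 * r) + b * (2 * r) + (\<bar>lam\<bar> * (Cf * L) + \<bar>lam\<bar> * (Cf * L)) + (\<bar>\<gamma>\<bar> * (Cg * L) + \<bar>\<gamma>\<bar> * (Cg * L))"
      using 1 2 3[OF u ur] 3[OF v vr] 4 unfolding flux_def abs_le_iff by linarith
    also have "\<dots> = (a + b) * (2 * r) + B * L" by (simp add: B_def algebra_simps)
    finally show ?thesis by (simp add: L_def d_def[abs_def])
  qed
  then show ?thesis using B by blast
qed

text \<open>Rellich's theorem first provides a subsequence that is Cauchy in L^s;
  \<open>almost_critical_difference\<close> then upgrades it to a Cauchy sequence for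
  \<open>N\<close>, whose limit solves the equation.\<close>

lemma level_solution:
  assumes r: "0 \<le> r" and lev: "\<And>\<epsilon>. \<epsilon> > 0 \<Longrightarrow> \<exists>\<phi>\<in>D. N \<phi> \<le> r \<and> \<bar>E lam \<gamma> \<phi> - c\<bar> \<le> \<epsilon> \<and> (\<forall>\<psi>\<in>D. \<bar>dE lam \<gamma> \<phi> \<psi>\<bar> \<le> \<epsilon> * N \<psi>)"
  shows "\<exists>\<phi> u. conv \<phi> u (weak_gradient \<Omega> u) \<and> u \<in> W1p_0 p \<Omega> \<and> weak_solution p \<mu> f g lam \<gamma> \<Omega> u \<and>
    W1p_0_norm p \<Omega> u \<le> r \<and> (\<lambda>k. E lam \<gamma> (\<phi> k)) \<longlonglongrightarrow> c \<and> (\<forall>k. N (\<phi> k) \<le> r)"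
proof -
  define e where "e k = 1 / real (Suc k)" for k
  have e: "e \<longlonglongrightarrow> 0" "\<And>k. e k > 0" unfolding e_def using LIMSEQ_Suc[OF lim_1_over_n] by auto
  have "\<forall>k. \<exists>\<phi>. \<phi> \<in> D \<and> N \<phi> \<le> r \<and> \<bar>E lam \<gamma> \<phi> - c\<bar> \<le> e k \<and> (\<forall>\<psi>\<in>D. \<bar>dE lam \<gamma> \<phi> \<psi>\<bar> \<le> e k * N \<psi>)"
    using lev[OF e(2)] by blast
  then obtain \<phi> where \<phi>: "\<And>k. \<phi> k \<in> D" "\<And>k. N (\<phi> k) \<le> r" "\<And>k. \<bar>E lam \<gamma> (\<phi> k) - c\<bar> \<le> e k"
    "\<And>k \<psi>. \<psi> \<in> D \<Longrightarrow> \<bar>dE lam \<gamma> (\<phi> k) \<psi>\<bar> \<le> e k * N \<psi>" by metis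
  obtain B where B: "B \<ge> 0" "\<And>u v a b. u \<in> D \<Longrightarrow> v \<in> D \<Longrightarrow> N u \<le> r \<Longrightarrow> N v \<le> r \<Longrightarrow> 0 \<le> a \<Longrightarrow> 0 \<le> b \<Longrightarrow>
    (\<forall>\<psi>\<in>D. \<bar>dE lam \<gamma> u \<psi>\<bar> \<le> a * N \<psi>) \<Longrightarrow> (\<forall>\<psi>\<in>D. \<bar>dE lam \<gamma> v \<psi>\<bar> \<le> b * N \<psi>) \<Longrightarrow>
    2 powr (1 - p) * N (\<lambda>x. u x - v x) powr p \<le> (a + b) * (2 * r) + B * lpn M s (\<lambda>x. u x - v x)"
    using almost_critical_difference[OF r, of lam \<gamma>] by blast
  obtain t :: "nat \<Rightarrow> nat" where t: "strict_mono t"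
    "\<And>e. e > 0 \<Longrightarrow> \<exists>n. \<forall>i\<ge>n. \<forall>j\<ge>n. lpn M s (\<lambda>x. \<phi> (t i) x - \<phi> (t j) x) < e"
    by (rule Rellich_domain[OF \<phi>(1,2)]) (rule that)
  have et: "(\<lambda>k. e (t k)) \<longlonglongrightarrow> 0" using LIMSEQ_subseq_LIMSEQ[OF e(1) t(1)] by (simp add: o_def)
  have "\<exists>n. \<forall>i\<ge>n. \<forall>j\<ge>n. N (\<lambda>x. \<phi> (t i) x - \<phi> (t j) x) < \<epsilon>" if eps: "\<epsilon> > 0" for \<epsilon>
  proof -
    \<comment> \<open>If two members were at distance at least \<open>\<epsilon>\<close>, strong
      monotonicity would make the left side at least \<open>m\<close>; the thresholds below bound
      the right side by m/2 + m/4.\<close>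
    define m where "m = 2 powr (1 - p) * \<epsilon> powr p"
    have m: "m > 0" using eps by (simp add: m_def)
    have m1: "m / (8 * (r + 1)) > 0" "m / (4 * (B + 1)) > 0" using m r B by auto
    have "\<forall>\<^sub>F k in sequentially. e (t k) < m / (8 * (r + 1))" by (rule order_tendstoD(2)[OF et m1(1)])
    then obtain n1 where n1: "\<And>k. k \<ge> n1 \<Longrightarrow> e (t k) < m / (8 * (r + 1))" by (auto simp: eventually_sequentially)
    obtain n2 where n2: "\<forall>i\<ge>n2. \<forall>j\<ge>n2. lpn M s (\<lambda>x. \<phi> (t i) x - \<phi> (t j) x) < m / (4 * (B + 1))" using t(2)[OF m1(2)] by blast
    have "N (\<lambda>x. \<phi> (t i) x - \<phi> (t j) x) < \<epsilon>" if ij: "i \<ge> max n1 n2" "j \<ge> max n1 n2" for i j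
    proof (rule ccontr)
      assume "\<not> N (\<lambda>x. \<phi> (t i) x - \<phi> (t j) x) < \<epsilon>"
      then have "m \<le> 2 powr (1 - p) * N (\<lambda>x. \<phi> (t i) x - \<phi> (t j) x) powr p"
        unfolding m_def using eps p0 by (intro mult_left_mono powr_mono2) auto
      also have "\<dots> \<le> (e (t i) + e (t j)) * (2 * r) + B * lpn M s (\<lambda>x. \<phi> (t i) x - \<phi> (t j) x)"
        using e(2) \<phi>(4) by (intro B(2) \<phi>(1,2) less_imp_le[OF e(2)]) auto
      also have "\<dots> \<le> (m / (8 * (r + 1)) + m / (8 * (r + 1))) * (2 * r) + B * (m / (4 * (B + 1)))"
        using n1[of i] n1[of j] n2 ij r B(1) by (intro add_mono mult_right_mono mult_left_mono) (auto intro: less_imp_le)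
      also have "\<dots> \<le> m / 2 + m / 4"
      proof (rule add_mono)
        have "(m / (8 * (r + 1)) + m / (8 * (r + 1))) * (2 * r) = m / 2 * (r / (r + 1))"
        proof -
          have *: "(m / (8 * q) + m / (8 * q)) * (2 * r) = m / 2 * (r / q)" if "q > 0" for q
            using that by (simp add: field_simps)
          show ?thesis by (rule *) (use r in simp)
        qed
        also have "\<dots> \<le> m / 2 * 1" using r m by (intro mult_left_mono) auto
        finally show "(m / (8 * (r + 1)) + m / (8 * (r + 1))) * (2 * r) \<le> m / 2" by simp
        have "B * (m / (4 * (B + 1))) = m / 4 * (B / (B + 1))" by simp
        also have "\<dots> \<le> m / 4 * 1" using B m by (intro mult_left_mono) auto
        finally show "B * (m / (4 * (B + 1))) \<le> m / 4" by simp
      qed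
      finally show False using m by simp
    qed
    then show ?thesis by blast
  qed
  from Cauchy_limit[OF \<phi>(1) this]
  obtain u H where u: "u \<in> Lps M p" "(\<lambda>k. lpn M p (\<lambda>x. \<phi> (t k) x - u x)) \<longlonglongrightarrow> 0" "conv (\<lambda>k. \<phi> (t k)) u H" "has_weak_gradient \<Omega> u H"
    by blast
  note w = conv_W1p_0[OF u]
  have sol: "weak_solution p \<mu> f g lam \<gamma> \<Omega> u" by (rule weak_solution_limit[OF w et \<phi>(4)])
  have "W1p_0_norm p \<Omega> u = lpn M p (weak_gradient \<Omega> u)" by (simp add: W1p_0_norm_def lpn_def)
  also have "\<dots> \<le> r" by (rule LIMSEQ_le_const2[OF conv_N[OF w(2)]]) (use \<phi>(2) in auto)
  finally have nr: "W1p_0_norm p \<Omega> u \<le> r" .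
  have "(\<lambda>k. E lam \<gamma> (\<phi> (t k)) - c) \<longlonglongrightarrow> 0"
    by (rule Lim_null_comparison[OF _ et]) (use \<phi>(3) in auto)
  then have "(\<lambda>k. E lam \<gamma> (\<phi> (t k))) \<longlonglongrightarrow> c" by (simp add: LIM_zero_iff)
  with w sol nr \<phi>(2) show ?thesis by blast
qed

lemma E_lipschitz:
  "\<exists>L>0. \<exists>d>0. \<forall>u\<in>D. \<forall>v\<in>D. N u \<le> r \<longrightarrow> N (\<lambda>x. v x - u x) \<le> d \<longrightarrow> \<bar>E lam \<gamma> v - E lam \<gamma> u\<bar> \<le> L * N (\<lambda>x. v x - u x)"
proof -
  interpret en: energy DB "\<lambda>b. N (apply_bcontfun b)" "\<lambda>b. E lam \<gamma> (apply_bcontfun b)" "\<lambda>b c. dE lam \<gamma> (apply_bcontfun b) (apply_bcontfun c)" r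
    by (rule energy_E)
  obtain L d where L: "L > 0" "d > 0" "\<And>u v. u \<in> DB \<Longrightarrow> v \<in> DB \<Longrightarrow> N (apply_bcontfun u) \<le> r \<Longrightarrow> N (apply_bcontfun v) \<le> d \<Longrightarrow>
    \<bar>E lam \<gamma> (apply_bcontfun (u + v)) - E lam \<gamma> (apply_bcontfun u)\<bar> \<le> L * N (apply_bcontfun v)"
    using en.E_lipschitz by blast
  have "\<bar>E lam \<gamma> v - E lam \<gamma> u\<bar> \<le> L * N (\<lambda>x. v x - u x)" if "u \<in> D" "v \<in> D" "N u \<le> r" "N (\<lambda>x. v x - u x) \<le> d" for u v
  proof -
    define w where "w x = v x - u x" for x
    have w: "w \<in> D" unfolding w_def[abs_def] by (rule test_functions_diff(1)[OF that(2,1)])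
    have m: "Bcontfun u \<in> DB" "Bcontfun w \<in> DB" using Bcontfun_test w that(1) by auto
    have "apply_bcontfun (Bcontfun u + Bcontfun w) = v"
      unfolding DB_ops(4)[OF m] Bcontfun_test[OF w] Bcontfun_test[OF that(1)] by (simp add: w_def)
    then show ?thesis
      using L(3)[OF m] that(3,4) unfolding Bcontfun_test[OF w] Bcontfun_test[OF that(1)] by (simp add: w_def[abs_def])
  qed
  then show ?thesis using L(1,2) by blast
qed

text \<open>If the limits agree almost everywhere, so do their gradients. The distance of the two
  approximating sequences then tends to 0, and by the Lipschitz estimate their energies have the
  same limit.\<close>

lemma level_distinct:
  assumes u: "conv \<phi> u (weak_gradient \<Omega> u)" "u \<in> W1p_0 p \<Omega>" "(\<lambda>k. E lam \<gamma> (\<phi> k)) \<longlonglongrightarrow> c" "\<forall>k. N (\<phi> k) \<le> r"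
    and v: "conv \<psi> v (weak_gradient \<Omega> v)" "v \<in> W1p_0 p \<Omega>" "(\<lambda>k. E lam \<gamma> (\<psi> k)) \<longlonglongrightarrow> c'"
    and cc: "c \<noteq> c'"
  shows "ae_distinct \<Omega> u v"
  unfolding ae_distinct_def
proof
  assume ae: "AE x in M. u x = v x"
  define U V where "U = weak_gradient \<Omega> u" and "V = weak_gradient \<Omega> v"
  note cu = u(1)[unfolded conv_def U_def[symmetric]] and cv = v(1)[unfolded conv_def V_def[symmetric]]
  have UV: "AE x in M. V x = U x" using W1p_0_AE_eq[OF u(2) v(2) ae] unfolding U_def V_def by eventually_elim simp
  have \<phi>: "\<And>k. \<phi> k \<in> D" and \<psi>: "\<And>k. \<psi> k \<in> D" using cu cv by auto
  have ULps: "U \<in> Lps M p" "V \<in> Lps M p" using cu cv by auto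
  have lU: "(\<lambda>k. lpn M p (\<lambda>x. grad (\<phi> k) x - U x)) \<longlonglongrightarrow> 0" using cu by blast
  have lV: "(\<lambda>k. lpn M p (\<lambda>x. grad (\<psi> k) x - U x)) \<longlonglongrightarrow> 0"
    using cv lpn_diff_cong_AE[OF LpsD(1)[OF ULps(2)] LpsD(1)[OF ULps(1)] LpsD(1)[OF test_Lps(3)[OF \<psi>]] UV] by simp
  have Nle: "N (\<lambda>x. \<psi> k x - \<phi> k x) \<le> lpn M p (\<lambda>x. grad (\<psi> k) x - U x) + lpn M p (\<lambda>x. grad (\<phi> k) x - U x)" for k
    using lpn_triangle[OF test_Lps(3)[OF \<psi>[of k]] ULps(1) test_Lps(3)[OF \<phi>[of k]] p1] lpn_minus_commute[of M p "grad (\<phi> k)" U]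
    by (simp add: N_diff[OF \<psi> \<phi>])
  have N0: "(\<lambda>k. N (\<lambda>x. \<psi> k x - \<phi> k x)) \<longlonglongrightarrow> 0"
    by (rule tendsto_sandwich[OF _ _ tendsto_const, of _ _ _ "\<lambda>k. lpn M p (\<lambda>x. grad (\<psi> k) x - U x) + lpn M p (\<lambda>x. grad (\<phi> k) x - U x)"])
      (use Nle tendsto_add[OF lV lU] in auto)
  obtain L d where L: "L > 0" "d > 0" "\<And>u v. u \<in> D \<Longrightarrow> v \<in> D \<Longrightarrow> N u \<le> r \<Longrightarrow> N (\<lambda>x. v x - u x) \<le> d \<Longrightarrow> \<bar>E lam \<gamma> v - E lam \<gamma> u\<bar> \<le> L * N (\<lambda>x. v x - u x)"
    using E_lipschitz[of r lam \<gamma>] by blast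
  have "(\<lambda>k. E lam \<gamma> (\<psi> k) - E lam \<gamma> (\<phi> k)) \<longlonglongrightarrow> 0"
  proof (rule Lim_null_comparison)
    show "(\<lambda>k. L * N (\<lambda>x. \<psi> k x - \<phi> k x)) \<longlonglongrightarrow> 0" by (intro tendsto_mult_right_zero N0)
    have "\<forall>\<^sub>F k in sequentially. N (\<lambda>x. \<psi> k x - \<phi> k x) < d" by (rule order_tendstoD(2)[OF N0 L(2)])
    then show "\<forall>\<^sub>F k in sequentially. norm (E lam \<gamma> (\<psi> k) - E lam \<gamma> (\<phi> k)) \<le> L * N (\<lambda>x. \<psi> k x - \<phi> k x)"
      by eventually_elim (use L(3) \<phi> \<psi> u(4) in auto)
  qed
  moreover have "(\<lambda>k. E lam \<gamma> (\<psi> k) - E lam \<gamma> (\<phi> k)) \<longlonglongrightarrow> c' - c" by (intro tendsto_diff u v)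
  ultimately have "0 = c' - c" by (rule LIMSEQ_unique)
  then show False using cc by simp
qed

text \<open>The levels are produced among bounded continuous functions and carried back to test
  functions. The segment from 0 to \<open>w\<close> is a chain with a single link, which is all the
  mountain pass needs.\<close>

lemma three_solutions:
  assumes r: "0 < \<rho>" "\<rho> < R" "0 \<le> r" "r < R" and K: "0 < K'" "K' < K"
    and coer: "\<And>u. u \<in> D \<Longrightarrow> N u < R \<Longrightarrow> E lam \<gamma> u \<le> K \<Longrightarrow> N u \<le> r"
    and shell: "\<And>u. u \<in> D \<Longrightarrow> \<rho> / 2 \<le> N u \<Longrightarrow> N u \<le> \<rho> \<Longrightarrow> \<alpha> \<le> E lam \<gamma> u" and \<alpha>: "0 < \<alpha>" "\<alpha> \<le> K"
    and ball: "\<And>u. u \<in> D \<Longrightarrow> N u \<le> \<rho> \<Longrightarrow> - \<kappa> \<le> E lam \<gamma> u"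
    and w: "w \<in> D" "N w < R" "E lam \<gamma> w < - \<kappa>" "\<And>t. 0 \<le> t \<Longrightarrow> t \<le> 1 \<Longrightarrow> E lam \<gamma> (\<lambda>x. t * w x) < K'"
    and E0: "E lam \<gamma> (\<lambda>x. 0) = 0"
  shows "\<exists>u\<^sub>1 u\<^sub>2 u\<^sub>3. ae_distinct \<Omega> u\<^sub>1 u\<^sub>2 \<and> ae_distinct \<Omega> u\<^sub>1 u\<^sub>3 \<and> ae_distinct \<Omega> u\<^sub>2 u\<^sub>3 \<and>
    (\<forall>u \<in> {u\<^sub>1, u\<^sub>2, u\<^sub>3}. W1p_0_norm p \<Omega> u \<le> r \<and> weak_solution p \<mu> f g lam \<gamma> \<Omega> u)"
proof -
  interpret en: energy DB "\<lambda>b. N (apply_bcontfun b)" "\<lambda>b. E lam \<gamma> (apply_bcontfun b)" "\<lambda>b c. dE lam \<gamma> (apply_bcontfun b) (apply_bcontfun c)" R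
    by (rule energy_E)
  have z: "apply_bcontfun (0 :: (real ^ 'n) \<Rightarrow>\<^sub>C real) = (\<lambda>x. 0)" by (simp add: fun_eq_iff)
  define e where "e = Bcontfun w"
  have e: "e \<in> DB" "apply_bcontfun e = w" using Bcontfun_test[OF w(1)] w(1) by (auto simp: e_def)
  have seg: "apply_bcontfun ((1 - t) *\<^sub>R 0 + t *\<^sub>R e) = (\<lambda>x. t * w x)" for t using e by (simp add: fun_eq_iff)
  have link: "(0, e) \<in> en.link K'"
    unfolding en.link_def
  proof (clarify, intro conjI ballI)
    show "0 \<in> DB" by (rule en.zero_D)
    show "e \<in> DB" by (rule e)
    fix t :: real assume t: "t \<in> {0..1}"
    have "N (\<lambda>x. t * w x) = t * N w" using N_scale[OF w(1)] t by simp
    also have "\<dots> \<le> N w" using t by (intro mult_left_le_one_le) auto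
    finally have "N (\<lambda>x. t * w x) < R" using w(2) by simp
    then show "N (apply_bcontfun ((1 - t) *\<^sub>R 0 + t *\<^sub>R e)) < R" unfolding seg .
    show "E lam \<gamma> (apply_bcontfun ((1 - t) *\<^sub>R 0 + t *\<^sub>R e)) < K'" unfolding seg using t w(4) by simp
  qed
  obtain c1 c2 c3 where c: "c1 \<noteq> c2" "c1 \<noteq> c3" "c2 \<noteq> c3"
    and lev: "\<And>c \<epsilon>. c \<in> {c1, c2, c3} \<Longrightarrow> \<epsilon> > 0 \<Longrightarrow> \<exists>u\<in>DB. N (apply_bcontfun u) \<le> r \<and> \<bar>E lam \<gamma> (apply_bcontfun u) - c\<bar> \<le> \<epsilon> \<and> en.almost_critical \<epsilon> u"
  proof (rule en.three_almost_critical_levels[OF r(1,2,4) K])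
    show "(0, e) \<in> en.link K'" by (rule link)
    show "E lam \<gamma> (apply_bcontfun e) < - \<kappa>" unfolding e by (rule w)
    show "E lam \<gamma> (apply_bcontfun 0) = 0" unfolding z by (rule E0)
  qed (use coer shell \<alpha> ball in auto)
  have "\<exists>\<phi> u. conv \<phi> u (weak_gradient \<Omega> u) \<and> u \<in> W1p_0 p \<Omega> \<and> weak_solution p \<mu> f g lam \<gamma> \<Omega> u \<and>
    W1p_0_norm p \<Omega> u \<le> r \<and> (\<lambda>k. E lam \<gamma> (\<phi> k)) \<longlonglongrightarrow> c \<and> (\<forall>k. N (\<phi> k) \<le> r)" if c: "c \<in> {c1, c2, c3}" for c
  proof (rule level_solution[OF r(3)])
    fix \<epsilon> :: real assume "\<epsilon> > 0"
    from lev[OF c this] obtain b where b: "b \<in> DB" "N (apply_bcontfun b) \<le> r" "\<bar>E lam \<gamma> (apply_bcontfun b) - c\<bar> \<le> \<epsilon>" "en.almost_critical \<epsilon> b" by blast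
    have "\<bar>dE lam \<gamma> (apply_bcontfun b) \<psi>\<bar> \<le> \<epsilon> * N \<psi>" if "\<psi> \<in> D" for \<psi>
    proof -
      have "Bcontfun \<psi> \<in> DB" using Bcontfun_test[OF that] that by simp
      from b(4)[unfolded en.almost_critical_def, rule_format, OF this] show ?thesis unfolding Bcontfun_test[OF that] .
    qed
    then show "\<exists>\<phi>\<in>D. N \<phi> \<le> r \<and> \<bar>E lam \<gamma> \<phi> - c\<bar> \<le> \<epsilon> \<and> (\<forall>\<psi>\<in>D. \<bar>dE lam \<gamma> \<phi> \<psi>\<bar> \<le> \<epsilon> * N \<psi>)"
      using b by blast
  qed
  then have S: "\<exists>\<phi> u. conv \<phi> u (weak_gradient \<Omega> u) \<and> u \<in> W1p_0 p \<Omega> \<and> weak_solution p \<mu> f g lam \<gamma> \<Omega> u \<and>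
    W1p_0_norm p \<Omega> u \<le> r \<and> (\<lambda>k. E lam \<gamma> (\<phi> k)) \<longlonglongrightarrow> c \<and> (\<forall>k. N (\<phi> k) \<le> r)" if "c = c1 \<or> c = c2 \<or> c = c3" for c
    using that by blast
  obtain \<phi>1 u1 where 1: "conv \<phi>1 u1 (weak_gradient \<Omega> u1)" "u1 \<in> W1p_0 p \<Omega>" "weak_solution p \<mu> f g lam \<gamma> \<Omega> u1"
    "W1p_0_norm p \<Omega> u1 \<le> r" "(\<lambda>k. E lam \<gamma> (\<phi>1 k)) \<longlonglongrightarrow> c1" "\<forall>k. N (\<phi>1 k) \<le> r" using S[of c1] by blast
  obtain \<phi>2 u2 where 2: "conv \<phi>2 u2 (weak_gradient \<Omega> u2)" "u2 \<in> W1p_0 p \<Omega>" "weak_solution p \<mu> f g lam \<gamma> \<Omega> u2"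
    "W1p_0_norm p \<Omega> u2 \<le> r" "(\<lambda>k. E lam \<gamma> (\<phi>2 k)) \<longlonglongrightarrow> c2" "\<forall>k. N (\<phi>2 k) \<le> r" using S[of c2] by blast
  obtain \<phi>3 u3 where 3: "conv \<phi>3 u3 (weak_gradient \<Omega> u3)" "u3 \<in> W1p_0 p \<Omega>" "weak_solution p \<mu> f g lam \<gamma> \<Omega> u3"
    "W1p_0_norm p \<Omega> u3 \<le> r" "(\<lambda>k. E lam \<gamma> (\<phi>3 k)) \<longlonglongrightarrow> c3" "\<forall>k. N (\<phi>3 k) \<le> r" using S[of c3] by blast
  show ?thesis
    using level_distinct[OF 1(1,2,5,6) 2(1,2,5) c(1)] level_distinct[OF 1(1,2,5,6) 3(1,2,5) c(2)]
      level_distinct[OF 2(1,2,5,6) 3(1,2,5) c(3)] 1(3,4) 2(3,4) 3(3,4) by blast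
qed

end

section \<open>Three solutions\<close>

context perturbed_problem
begin

lemma Phi_eq: "Phi u = (N u powr p + \<mu> * lpn M p (\<lambda>x. u x / norm x) powr p) / p"
  using p0 by (simp add: Phi_def lpn_powr add_divide_distrib)

lemma Phi_lower: "N u powr p / p \<le> Phi u"
  unfolding Phi_eq using mu p0 by (intro divide_right_mono) auto

text \<open>\<open>Phi\<close> is homogeneous of degree \<open>p\<close> and nonnegative.\<close>

lemma Phi_scale_le:
  assumes "w \<in> D" "0 \<le> t" "t \<le> 1"
  shows "Phi (\<lambda>x. t * w x) \<le> Phi w"
proof -
  have "N (\<lambda>x. t * w x) = t * N w" using N_scale[OF assms(1)] assms by simp
  moreover have "lpn M p (\<lambda>x. t * w x / norm x) = t * lpn M p (\<lambda>x. w x / norm x)"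
    using lpn_mult[OF p0, of M t "\<lambda>x. w x / norm x"] assms by simp
  ultimately have "Phi (\<lambda>x. t * w x) = t powr p * Phi w"
    using assms by (simp add: Phi_eq powr_mult algebra_simps add_divide_distrib)
  also have "\<dots> \<le> 1 * Phi w"
  proof (rule mult_right_mono)
    show "t powr p \<le> 1" using assms p0 powr_mono2[of p t 1] by simp
    have "0 \<le> N w powr p / p" using p0 by simp
    with Phi_lower[of w] show "0 \<le> Phi w" by linarith
  qed
  finally show ?thesis by simp
qed

lemma F_bounded: "\<exists>B. \<forall>\<phi>\<in>D. N \<phi> \<le> R \<longrightarrow> \<bar>\<integral>x. F (\<phi> x) \<partial>M\<bar> \<le> B"
  and G_bounded: "\<exists>B. \<forall>\<phi>\<in>D. N \<phi> \<le> R \<longrightarrow> \<bar>\<integral>x. G (\<phi> x) \<partial>M\<bar> \<le> B"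
proof -
  obtain B where B: "\<forall>b\<in>DB. N (apply_bcontfun b) \<le> R \<longrightarrow> \<bar>\<integral>x. F (apply_bcontfun b x) \<partial>M\<bar> \<le> B"
    using smooth_onD(4)[OF smooth_parts(3)] by blast
  have "\<bar>\<integral>x. F (\<phi> x) \<partial>M\<bar> \<le> B" if "\<phi> \<in> D" "N \<phi> \<le> R" for \<phi>
    using bspec[OF B, of "Bcontfun \<phi>"] that Bcontfun_test[OF that(1)] by simp
  then show "\<exists>B. \<forall>\<phi>\<in>D. N \<phi> \<le> R \<longrightarrow> \<bar>\<integral>x. F (\<phi> x) \<partial>M\<bar> \<le> B" by blast
  obtain B where B: "\<forall>b\<in>DB. N (apply_bcontfun b) \<le> R \<longrightarrow> \<bar>\<integral>x. G (apply_bcontfun b x) \<partial>M\<bar> \<le> B"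
    using smooth_onD(4)[OF smooth_parts(4)] by blast
  have "\<bar>\<integral>x. G (\<phi> x) \<partial>M\<bar> \<le> B" if "\<phi> \<in> D" "N \<phi> \<le> R" for \<phi>
    using bspec[OF B, of "Bcontfun \<phi>"] that Bcontfun_test[OF that(1)] by simp
  then show "\<exists>B. \<forall>\<phi>\<in>D. N \<phi> \<le> R \<longrightarrow> \<bar>\<integral>x. G (\<phi> x) \<partial>M\<bar> \<le> B" by blast
qed

text \<open>Both growth bounds are handled at once: coercivity uses it with \<open>C' = 0\<close>,
  the estimate near 0 with \<open>C = 0\<close>.\<close>

lemma F_integral_bound:
  assumes Fb: "\<And>t. \<bar>F t\<bar> \<le> \<epsilon> * \<bar>t\<bar> powr p + C * \<bar>t\<bar> + C' * \<bar>t\<bar> powr s" and \<phi>: "\<phi> \<in> D"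
  shows "\<bar>\<integral>x. F (\<phi> x) \<partial>M\<bar> \<le> \<epsilon> * lpn M p \<phi> powr p + C * (\<integral>x. norm (\<phi> x) \<partial>M) + C' * lpn M s \<phi> powr s"
proof -
  have i: "integrable M (\<lambda>x. \<bar>\<phi> x\<bar> powr p)" "integrable M (\<lambda>x. \<bar>\<phi> x\<bar>)" "integrable M (\<lambda>x. \<bar>\<phi> x\<bar> powr s)"
    using LpsD(2)[OF test_Lps(2)[OF \<phi>]] Holder_finite(1)[OF finite_M s1 test_Lps(1)[OF \<phi>]] LpsD(2)[OF test_Lps(1)[OF \<phi>]] by auto
  have "\<bar>\<integral>x. F (\<phi> x) \<partial>M\<bar> \<le> (\<integral>x. \<bar>F (\<phi> x)\<bar> \<partial>M)" by (rule integral_abs_bound)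
  also have "\<dots> \<le> (\<integral>x. \<epsilon> * \<bar>\<phi> x\<bar> powr p + C * \<bar>\<phi> x\<bar> + C' * \<bar>\<phi> x\<bar> powr s \<partial>M)"
    using potential_integrable[OF finite_M s1 f F_derivative test_Lps(1)[OF \<phi>]]
    by (intro integral_mono Fb integrable_abs Bochner_Integration.integrable_add integrable_mult_right i)
  also have "\<dots> = \<epsilon> * lpn M p \<phi> powr p + C * (\<integral>x. norm (\<phi> x) \<partial>M) + C' * lpn M s \<phi> powr s"
    using i p0 s0 by (simp add: lpn_powr)
  finally show ?thesis .
qed

lemma E_lower:
  assumes "0 \<le> lam" "lam \<le> b" "0 \<le> \<gamma>"
  shows "N u powr p / p - b * \<bar>\<integral>x. F (u x) \<partial>M\<bar> - \<gamma> * \<bar>\<integral>x. G (u x) \<partial>M\<bar> \<le> E lam \<gamma> u"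
proof -
  have "lam * (\<integral>x. F (u x) \<partial>M) \<le> lam * \<bar>\<integral>x. F (u x) \<partial>M\<bar>" using assms by (intro mult_left_mono) auto
  also have "\<dots> \<le> b * \<bar>\<integral>x. F (u x) \<partial>M\<bar>" using assms by (intro mult_right_mono) auto
  finally have 1: "lam * (\<integral>x. F (u x) \<partial>M) \<le> b * \<bar>\<integral>x. F (u x) \<partial>M\<bar>" .
  have 2: "\<gamma> * (\<integral>x. G (u x) \<partial>M) \<le> \<gamma> * \<bar>\<integral>x. G (u x) \<partial>M\<bar>" using assms by (intro mult_left_mono) auto
  show ?thesis unfolding E_def using Phi_lower[of u] 1 2 by simp
qed

text \<open>\<open>growth1\<close> leaves only a linear remainder and yields coercivity.
  \<open>growth2\<close> leaves a power \<open>s > p\<close>, of higher order near 0, and yields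
  positivity on the shell. In both, \<open>\<epsilon>\<close> lets the leading term
  dominate.\<close>

lemma three_solutions_interval:
  assumes F0: "F 0 = 0" and G0: "G 0 = 0"
    and growth1: "\<And>\<epsilon>. \<epsilon> > 0 \<Longrightarrow> \<exists>C\<ge>0. \<forall>t. \<bar>F t\<bar> \<le> \<epsilon> * \<bar>t\<bar> powr p + C * \<bar>t\<bar>"
    and growth2: "\<And>\<epsilon>. \<epsilon> > 0 \<Longrightarrow> \<exists>C\<ge>0. \<forall>t. \<bar>F t\<bar> \<le> \<epsilon> * \<bar>t\<bar> powr p + C * \<bar>t\<bar> powr s"
    and w: "w \<in> D" "0 < (\<integral>x. F (w x) \<partial>M)"
  shows "\<exists>\<beta> > 0. \<forall>a b. a \<le> b \<and> {a..b} \<subseteq> {\<beta><..} \<longrightarrow>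
           (\<exists>r > 0. \<forall>lam \<in> {a..b}. \<exists>\<delta> > 0. \<forall>\<gamma> \<in> {0..\<delta>}.
              \<exists>u\<^sub>1 u\<^sub>2 u\<^sub>3.
                ae_distinct \<Omega> u\<^sub>1 u\<^sub>2 \<and> ae_distinct \<Omega> u\<^sub>1 u\<^sub>3 \<and> ae_distinct \<Omega> u\<^sub>2 u\<^sub>3 \<and>
                (\<forall>u \<in> {u\<^sub>1, u\<^sub>2, u\<^sub>3}. W1p_0_norm p \<Omega> u < r \<and> weak_solution p \<mu> f g lam \<gamma> \<Omega> u))"
proof -
  obtain K where K: "K \<ge> 0" "\<And>\<phi>. \<phi> \<in> D \<Longrightarrow> lpn M p (\<lambda>x. \<phi> x / norm x) \<le> K * N \<phi> \<and> lpn M s \<phi> \<le> K * N \<phi> \<and> lpn M p \<phi> \<le> K * N \<phi>"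
    using embedding by blast
  define J where "J = (\<integral>x. F (w x) \<partial>M)"
  have J: "J > 0" using w(2) by (simp add: J_def)
  have Phi0: "0 \<le> Phi w"
  proof -
    have "0 \<le> N w powr p / p" using p0 by simp
    with Phi_lower[of w] show ?thesis by linarith
  qed
  \<comment> \<open>For \<open>lam > \<beta>\<close> the unperturbed energy of \<open>w\<close> is
    below -1; after a perturbation of at most 1/2 it is still below -1/2.\<close>
  define \<beta> where "\<beta> = (Phi w + 1) / J"
  have \<beta>: "\<beta> > 0" using J Phi0 by (simp add: \<beta>_def)
  show ?thesis
  proof (rule exI[of _ \<beta>], intro conjI \<beta> allI impI)
    fix a b assume ab: "a \<le> b \<and> {a..b} \<subseteq> {\<beta><..}"
    then have "a \<in> {\<beta><..}" by auto
    then have b: "b > 0" "a > \<beta>" using ab \<beta> by auto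
    define Kp where "Kp = K powr p"
    have Kp: "Kp \<ge> 0" by (simp add: Kp_def)
    \<comment> \<open>Makes the p-th power part of the term with \<open>F\<close> at most half of
      the leading term, for every \<open>lam\<close> up to \<open>b\<close>.\<close>
    define \<epsilon> where "\<epsilon> = 1 / (2 * p * b * (Kp + 1))"
    have eps: "\<epsilon> > 0" using p0 b Kp by (simp add: \<epsilon>_def)
    have bK: "b * (\<epsilon> * Kp) \<le> 1 / (2 * p)"
    proof -
      have "b * (\<epsilon> * Kp) = 1 / (2 * p) * (Kp / (Kp + 1))" using b by (simp add: \<epsilon>_def)
      also have "\<dots> \<le> 1 / (2 * p) * 1" using p0 Kp by (intro mult_left_mono) auto
      finally show ?thesis by simp
    qed
    obtain C1 where C1: "C1 \<ge> 0" "\<And>t. \<bar>F t\<bar> \<le> \<epsilon> * \<bar>t\<bar> powr p + C1 * \<bar>t\<bar>" using growth1[OF eps] by blast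
    obtain C2 where C2: "C2 \<ge> 0" "\<And>t. \<bar>F t\<bar> \<le> \<epsilon> * \<bar>t\<bar> powr p + C2 * \<bar>t\<bar> powr s" using growth2[OF eps] by blast
    have pK: "\<epsilon> * lpn M p \<phi> powr p \<le> \<epsilon> * (Kp * N \<phi> powr p)" if "\<phi> \<in> D" for \<phi>
    proof -
      have "lpn M p \<phi> powr p \<le> (K * N \<phi>) powr p" using K(2)[OF that] p0 by (intro powr_mono2) auto
      also have "\<dots> = Kp * N \<phi> powr p" by (simp add: Kp_def powr_mult)
      finally show ?thesis using eps by (intro mult_left_mono) auto
    qed
    have bp: "b * (\<epsilon> * (Kp * N \<phi> powr p)) \<le> N \<phi> powr p / (2 * p)" for \<phi>
      using mult_right_mono[OF bK, of "N \<phi> powr p"] by (simp add: mult.assoc)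
    define c1 where "c1 = lpn M s (\<lambda>x. 1::real) powr (s - 1)"
    have c1: "c1 \<ge> 0" by (simp add: c1_def)
    define L where "L = b * (C1 * (c1 * K))"
    have L: "L \<ge> 0" using b C1 c1 K by (simp add: L_def)
    have F1: "b * \<bar>\<integral>x. F (\<phi> x) \<partial>M\<bar> \<le> N \<phi> powr p / (2 * p) + L * N \<phi>" if \<phi>: "\<phi> \<in> D" for \<phi>
    proof -
      have "(\<integral>x. norm (\<phi> x) \<partial>M) \<le> c1 * lpn M s \<phi>"
        unfolding c1_def by (rule Holder_finite(2)[OF finite_M s1 test_Lps(1)[OF \<phi>]])
      also have "\<dots> \<le> c1 * (K * N \<phi>)" using K(2)[OF \<phi>] c1 by (intro mult_left_mono) auto
      finally have i: "C1 * (\<integral>x. norm (\<phi> x) \<partial>M) \<le> C1 * (c1 * (K * N \<phi>))" using C1 by (intro mult_left_mono) auto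
      have "\<bar>\<integral>x. F (\<phi> x) \<partial>M\<bar> \<le> \<epsilon> * lpn M p \<phi> powr p + C1 * (\<integral>x. norm (\<phi> x) \<partial>M) + 0 * lpn M s \<phi> powr s"
        using C1(2) by (intro F_integral_bound \<phi>) auto
      also have "\<dots> \<le> \<epsilon> * (Kp * N \<phi> powr p) + C1 * (c1 * (K * N \<phi>))" using pK[OF \<phi>] i by simp
      finally have "b * \<bar>\<integral>x. F (\<phi> x) \<partial>M\<bar> \<le> b * (\<epsilon> * (Kp * N \<phi> powr p) + C1 * (c1 * (K * N \<phi>)))"
        using b by (intro mult_left_mono) auto
      also have "\<dots> = b * (\<epsilon> * (Kp * N \<phi> powr p)) + L * N \<phi>" by (simp add: L_def algebra_simps)
      finally show ?thesis using bp[of \<phi>] by linarith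
    qed
    define B2 where "B2 = b * (C2 * K powr s)"
    have B2: "B2 \<ge> 0" using b C2 by (simp add: B2_def)
    have F2: "b * \<bar>\<integral>x. F (\<phi> x) \<partial>M\<bar> \<le> N \<phi> powr p / (2 * p) + B2 * N \<phi> powr s" if \<phi>: "\<phi> \<in> D" for \<phi>
    proof -
      have "lpn M s \<phi> powr s \<le> (K * N \<phi>) powr s" using K(2)[OF \<phi>] s0 by (intro powr_mono2) auto
      also have "\<dots> = K powr s * N \<phi> powr s" by (simp add: powr_mult)
      finally have i: "C2 * lpn M s \<phi> powr s \<le> C2 * (K powr s * N \<phi> powr s)" using C2 by (intro mult_left_mono) auto
      have "\<bar>\<integral>x. F (\<phi> x) \<partial>M\<bar> \<le> \<epsilon> * lpn M p \<phi> powr p + 0 * (\<integral>x. norm (\<phi> x) \<partial>M) + C2 * lpn M s \<phi> powr s"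
        using C2(2) by (intro F_integral_bound \<phi>) auto
      also have "\<dots> \<le> \<epsilon> * (Kp * N \<phi> powr p) + C2 * (K powr s * N \<phi> powr s)" using pK[OF \<phi>] i by simp
      finally have "b * \<bar>\<integral>x. F (\<phi> x) \<partial>M\<bar> \<le> b * (\<epsilon> * (Kp * N \<phi> powr p) + C2 * (K powr s * N \<phi> powr s))"
        using b by (intro mult_left_mono) auto
      also have "\<dots> = b * (\<epsilon> * (Kp * N \<phi> powr p)) + B2 * N \<phi> powr s" by (simp add: B2_def algebra_simps)
      finally show ?thesis using bp[of \<phi>] by linarith
    qed
    obtain BJ where BJ: "\<And>\<phi>. \<phi> \<in> D \<Longrightarrow> N \<phi> \<le> N w \<Longrightarrow> \<bar>\<integral>x. F (\<phi> x) \<partial>M\<bar> \<le> BJ" using F_bounded[of "N w"] by blast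
    \<comment> \<open>Exceeds the energy along the whole segment from 0 to \<open>w\<close>:
      \<open>Phi\<close> contributes at most \<open>Phi w\<close>, the term with \<open>F\<close> at
      most \<open>b * \<bar>BJ\<bar>\<close>, and the perturbation at most 1/2.\<close>
    define K' where "K' = Phi w + b * \<bar>BJ\<bar> + 2"
    have K'2: "K' \<ge> 2" using Phi0 b by (simp add: K'_def)
    \<comment> \<open>Large enough that a norm \<open>A > r\<close> contradicts
      \<open>A powr p / (2 * p) \<le> L * A + K' + 3 / 2\<close>: as \<open>p \<ge> 2\<close> and
      \<open>A \<ge> 1\<close>, the power of \<open>A\<close> is at least
      \<open>A * r\<close>.\<close>
    define r where "r = 1 + 2 * p * (L + (K' + 1) + 1)"
    have r1: "r \<ge> 1" using p0 L K'2 by (simp add: r_def)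
    \<comment> \<open>The large ball contains \<open>w\<close> and the small ball strictly; the
      perturbation by \<open>g\<close> is controlled only on this ball.\<close>
    define R where "R = r + N w + 2"
    have R: "r < R" "N w < R" "2 < R" using r1 lpn_nonneg[of M p "grad w"] unfolding R_def by linarith+
    obtain BG0 where BG0: "\<And>\<phi>. \<phi> \<in> D \<Longrightarrow> N \<phi> \<le> R \<Longrightarrow> \<bar>\<integral>x. G (\<phi> x) \<partial>M\<bar> \<le> BG0" using G_bounded[of R] by blast
    define BG where "BG = \<bar>BG0\<bar>"
    have BG: "BG \<ge> 0" "\<And>\<phi>. \<phi> \<in> D \<Longrightarrow> N \<phi> \<le> R \<Longrightarrow> \<bar>\<integral>x. G (\<phi> x) \<partial>M\<bar> \<le> BG"
      using BG0 by (force simp: BG_def)+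
    \<comment> \<open>On this ball the remainder of power \<open>s\<close> is at most a quarter of
      the leading term; with the half spent before, a quarter is left.\<close>
    define \<rho> where "\<rho> = min 1 ((1 / (4 * p) / (B2 + 1)) powr (1 / (s - p)))"
    have \<rho>: "0 < \<rho>" "\<rho> \<le> 1" using p0 B2 by (auto simp: \<rho>_def)
    have \<rho>B: "B2 * \<rho> powr (s - p) \<le> 1 / (4 * p)"
    proof -
      have "\<rho> powr (s - p) \<le> ((1 / (4 * p) / (B2 + 1)) powr (1 / (s - p))) powr (s - p)"
        using ps \<rho> by (intro powr_mono2) (auto simp: \<rho>_def)
      also have "\<dots> = 1 / (4 * p) / (B2 + 1)" using ps p0 B2 by (simp add: powr_powr)
      finally have "B2 * \<rho> powr (s - p) \<le> B2 * (1 / (4 * p) / (B2 + 1))" using B2 by (intro mult_left_mono)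
      also have "\<dots> = 1 / (4 * p) * (B2 / (B2 + 1))" by simp
      also have "\<dots> \<le> 1 / (4 * p) * 1" using p0 B2 by (intro mult_left_mono) auto
      finally show ?thesis by simp
    qed
    \<comment> \<open>The remaining quarter of the leading term at the inner radius of the
      shell.\<close>
    define \<alpha> where "\<alpha> = (\<rho> / 2) powr p / (4 * p)"
    have \<alpha>: "\<alpha> > 0" using \<rho> p0 by (simp add: \<alpha>_def)
    have \<alpha>1: "\<alpha> \<le> 1"
    proof -
      have "(\<rho> / 2) powr p \<le> 1" using \<rho> p0 powr_mono2[of p "\<rho> / 2" 1] by simp
      also have "1 \<le> 4 * p" using p by simp
      finally show ?thesis using p0 by (simp add: \<alpha>_def)
    qed
    \<comment> \<open>The perturbation may cost half of the barrier \<open>\<alpha>\<close> on the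
      shell and half of the margin 1 at \<open>w\<close>.\<close>
    define \<delta> where "\<delta> = min (1 / 2) (\<alpha> / 2) / (BG + 1)"
    have \<delta>: "\<delta> > 0" using \<alpha> BG by (simp add: \<delta>_def)
    have \<delta>G: "\<gamma> * \<bar>\<integral>x. G (\<phi> x) \<partial>M\<bar> \<le> min (1 / 2) (\<alpha> / 2)" if "\<gamma> \<in> {0..\<delta>}" "\<phi> \<in> D" "N \<phi> \<le> R" for \<gamma> \<phi>
    proof -
      have "\<gamma> * \<bar>\<integral>x. G (\<phi> x) \<partial>M\<bar> \<le> \<delta> * BG" using that BG(2)[OF that(2,3)] \<delta> by (intro mult_mono) auto
      also have "\<dots> = min (1 / 2) (\<alpha> / 2) * (BG / (BG + 1))" by (simp add: \<delta>_def)
      also have "\<dots> \<le> min (1 / 2) (\<alpha> / 2) * 1" using BG(1) \<alpha> by (intro mult_left_mono) auto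
      finally show ?thesis by simp
    qed
    have main: "\<exists>u\<^sub>1 u\<^sub>2 u\<^sub>3. ae_distinct \<Omega> u\<^sub>1 u\<^sub>2 \<and> ae_distinct \<Omega> u\<^sub>1 u\<^sub>3 \<and> ae_distinct \<Omega> u\<^sub>2 u\<^sub>3 \<and>
        (\<forall>u \<in> {u\<^sub>1, u\<^sub>2, u\<^sub>3}. W1p_0_norm p \<Omega> u \<le> r \<and> weak_solution p \<mu> f g lam \<gamma> \<Omega> u)"
      if lam: "lam \<in> {a..b}" and \<gamma>: "\<gamma> \<in> {0..\<delta>}" for lam \<gamma>
    proof -
      have lam0: "0 \<le> lam" "lam \<le> b" "0 \<le> \<gamma>" "\<beta> < lam" using lam b \<beta> \<gamma> by auto
      show ?thesis
      proof (rule three_solutions[where \<rho> = \<rho> and R = R and K' = K' and K = "K' + 1" and \<alpha> = "\<alpha> / 2" and \<kappa> = "1 / 2" and w = w])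
        fix u assume u: "u \<in> D" "N u < R" "E lam \<gamma> u \<le> K' + 1"
        define A where "A = N u"
        have "A powr p / p - (A powr p / (2 * p) + L * A) - 1 / 2 \<le> K' + 1"
          using E_lower[OF lam0(1,2,3), of u] F1[OF u(1)] \<delta>G[OF \<gamma> u(1) less_imp_le[OF u(2)]] u(3) unfolding A_def by linarith
        then have key: "A powr p / (2 * p) \<le> L * A + K' + 3 / 2" by (simp add: field_simps)
        show "N u \<le> r"
        proof (rule ccontr)
          assume "\<not> N u \<le> r"
          then have A: "A > r" by (simp add: A_def)
          then have A1: "A \<ge> 1" using r1 by simp
          have "A * r \<le> A * A" using A A1 by (intro mult_left_mono) auto
          also have "\<dots> = A powr 2" using A1 by (simp add: powr_numeral power2_eq_square)
          also have "\<dots> \<le> A powr p" using A1 p by (intro powr_mono) auto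
          finally have "A * r / (2 * p) \<le> A powr p / (2 * p)" using p0 by (intro divide_right_mono) auto
          moreover have "A * r / (2 * p) = A / (2 * p) + L * A + A * (K' + 2)" using p0 by (simp add: r_def field_simps)
          moreover have "1 * (K' + 2) \<le> A * (K' + 2)" using A1 K'2 by (intro mult_right_mono) auto
          moreover have "0 \<le> A / (2 * p)" using A1 p0 by simp
          moreover note key
          ultimately have "A / (2 * p) + L * A + A * (K' + 2) \<le> L * A + K' + 3 / 2" by simp
          then show False using \<open>1 * (K' + 2) \<le> A * (K' + 2)\<close> \<open>0 \<le> A / (2 * p)\<close> by simp
        qed
      next
        have low: "N u powr p / (4 * p) - \<gamma> * \<bar>\<integral>x. G (u x) \<partial>M\<bar> \<le> E lam \<gamma> u" if u: "u \<in> D" "N u \<le> \<rho>" for u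
        proof -
          have "N u powr s = N u powr (s - p) * N u powr p" by (simp flip: powr_add)
          also have "\<dots> \<le> \<rho> powr (s - p) * N u powr p" using u ps by (intro mult_right_mono powr_mono2) auto
          finally have "B2 * N u powr s \<le> B2 * (\<rho> powr (s - p) * N u powr p)" using B2 by (intro mult_left_mono)
          also have "\<dots> \<le> 1 / (4 * p) * N u powr p" using mult_right_mono[OF \<rho>B, of "N u powr p"] by (simp add: mult.assoc)
          finally have 1: "B2 * N u powr s \<le> N u powr p / (4 * p)" by simp
          have 2: "N u powr p / p = N u powr p / (2 * p) + N u powr p / (4 * p) + N u powr p / (4 * p)"
            using p0 by (simp add: field_simps)
          from 1 2 show ?thesis using E_lower[OF lam0(1,2,3), of u] F2[OF u(1)] by linarith
        qed
        show "\<alpha> / 2 \<le> E lam \<gamma> u" if u: "u \<in> D" "\<rho> / 2 \<le> N u" "N u \<le> \<rho>" for u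
        proof -
          have "\<alpha> \<le> N u powr p / (4 * p)" unfolding \<alpha>_def using u \<rho> p0 by (intro divide_right_mono powr_mono2) auto
          moreover have "N u \<le> R" using u \<rho> R by linarith
          from \<delta>G[OF \<gamma> u(1) this] have "\<gamma> * \<bar>\<integral>x. G (u x) \<partial>M\<bar> \<le> \<alpha> / 2" by simp
          ultimately show ?thesis using low[OF u(1,3)] by linarith
        qed
        show "- (1 / 2) \<le> E lam \<gamma> u" if u: "u \<in> D" "N u \<le> \<rho>" for u
        proof -
          have "0 \<le> N u powr p / (4 * p)" using p0 by simp
          moreover have "N u \<le> R" using u \<rho> R by linarith
          from \<delta>G[OF \<gamma> u(1) this] have "\<gamma> * \<bar>\<integral>x. G (u x) \<partial>M\<bar> \<le> 1 / 2" by simp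
          ultimately show ?thesis using low[OF u] by linarith
        qed
        have Gw: "- (\<gamma> * (\<integral>x. G (u x) \<partial>M)) \<le> 1 / 2" if "u \<in> D" "N u \<le> R" for u
        proof -
          have "- (\<gamma> * (\<integral>x. G (u x) \<partial>M)) \<le> \<bar>\<gamma> * (\<integral>x. G (u x) \<partial>M)\<bar>" by linarith
          also have "\<dots> = \<gamma> * \<bar>\<integral>x. G (u x) \<partial>M\<bar>" using lam0 by (simp add: abs_mult)
          also have "\<dots> \<le> 1 / 2" using \<delta>G[OF \<gamma> that] by simp
          finally show ?thesis .
        qed
        show "E lam \<gamma> w < - (1 / 2)"
        proof -
          have "Phi w + 1 = \<beta> * J" using J by (simp add: \<beta>_def)
          also have "\<dots> < lam * J" using lam0 J by simp
          finally show ?thesis using Gw[OF w(1) less_imp_le[OF R(2)]] by (simp add: E_def J_def)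
        qed
        show "E lam \<gamma> (\<lambda>x. t * w x) < K'" if t: "0 \<le> t" "t \<le> 1" for t
        proof -
          define v where "v x = t * w x" for x
          have v: "v \<in> D" unfolding v_def[abs_def] by (rule test_functions_scale(1)[OF w(1)])
          have "N v = t * N w" unfolding v_def[abs_def] using N_scale[OF w(1)] t by simp
          also have "\<dots> \<le> N w" using t by (intro mult_left_le_one_le) auto
          finally have Nv: "N v \<le> N w" .
          have "Phi v \<le> Phi w" unfolding v_def[abs_def] by (rule Phi_scale_le[OF w(1) t])
          moreover have "- (lam * (\<integral>x. F (v x) \<partial>M)) \<le> b * \<bar>BJ\<bar>"
          proof -
            have "- (lam * (\<integral>x. F (v x) \<partial>M)) \<le> \<bar>lam * (\<integral>x. F (v x) \<partial>M)\<bar>" by linarith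
            also have "\<dots> = lam * \<bar>\<integral>x. F (v x) \<partial>M\<bar>" using lam0 by (simp add: abs_mult)
            also have "\<dots> \<le> b * \<bar>BJ\<bar>" using lam0 b BJ[OF v Nv] by (intro mult_mono) auto
            finally show ?thesis .
          qed
          moreover have "N v \<le> R" using Nv R by linarith
          from Gw[OF v this] have "- (\<gamma> * (\<integral>x. G (v x) \<partial>M)) \<le> 1 / 2" .
          ultimately have "E lam \<gamma> v < K'" unfolding E_def K'_def by simp
          then show ?thesis by (simp add: v_def[abs_def])
        qed
        show "E lam \<gamma> (\<lambda>x. 0) = 0"
        proof -
          have "grad (\<lambda>x::real^'n. 0) = (\<lambda>x. 0)" using test_functions_scale(2)[OF w(1), of 0] by simp
          then show ?thesis using p0 by (simp add: E_def Phi_def F0 G0)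
        qed
      qed (use \<rho> R r1 K'2 \<alpha> \<alpha>1 w(1) in auto)
    qed
    \<comment> \<open>The limits satisfy only the closed bound, so the radius is enlarged by
      1.\<close>
    have strict: "W1p_0_norm p \<Omega> u \<le> r \<Longrightarrow> W1p_0_norm p \<Omega> u < r + 1" for u by linarith
    show "\<exists>r > 0. \<forall>lam \<in> {a..b}. \<exists>\<delta> > 0. \<forall>\<gamma> \<in> {0..\<delta>}. \<exists>u\<^sub>1 u\<^sub>2 u\<^sub>3.
        ae_distinct \<Omega> u\<^sub>1 u\<^sub>2 \<and> ae_distinct \<Omega> u\<^sub>1 u\<^sub>3 \<and> ae_distinct \<Omega> u\<^sub>2 u\<^sub>3 \<and>
        (\<forall>u \<in> {u\<^sub>1, u\<^sub>2, u\<^sub>3}. W1p_0_norm p \<Omega> u < r \<and> weak_solution p \<mu> f g lam \<gamma> \<Omega> u)"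
    proof (rule exI[of _ "r + 1"], intro conjI ballI)
      show "r + 1 > 0" using r1 by simp
      fix lam assume lam: "lam \<in> {a..b}"
      show "\<exists>\<delta> > 0. \<forall>\<gamma> \<in> {0..\<delta>}. \<exists>u\<^sub>1 u\<^sub>2 u\<^sub>3.
        ae_distinct \<Omega> u\<^sub>1 u\<^sub>2 \<and> ae_distinct \<Omega> u\<^sub>1 u\<^sub>3 \<and> ae_distinct \<Omega> u\<^sub>2 u\<^sub>3 \<and>
        (\<forall>u \<in> {u\<^sub>1, u\<^sub>2, u\<^sub>3}. W1p_0_norm p \<Omega> u < r + 1 \<and> weak_solution p \<mu> f g lam \<gamma> \<Omega> u)"
      proof (intro exI[of _ \<delta>] conjI \<delta> ballI)
        fix \<gamma> assume \<gamma>: "\<gamma> \<in> {0..\<delta>}"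
        from main[OF lam \<gamma>] strict show "\<exists>u\<^sub>1 u\<^sub>2 u\<^sub>3.
          ae_distinct \<Omega> u\<^sub>1 u\<^sub>2 \<and> ae_distinct \<Omega> u\<^sub>1 u\<^sub>3 \<and> ae_distinct \<Omega> u\<^sub>2 u\<^sub>3 \<and>
          (\<forall>u \<in> {u\<^sub>1, u\<^sub>2, u\<^sub>3}. W1p_0_norm p \<Omega> u < r + 1 \<and> weak_solution p \<mu> f g lam \<gamma> \<Omega> u)" by blast
      qed
    qed
  qed
qed

end

section \<open>Growth of the nonlinearity and of its antiderivative\<close>

lemma growth_at_infinity:
  fixes f :: "real \<Rightarrow> real"
  assumes f: "continuous_on UNIV f" and f2: "((\<lambda>t. f t / \<bar>t\<bar> powr a) \<longlongrightarrow> 0) at_infinity" and eps: "\<epsilon> > 0"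
  shows "\<exists>C\<ge>0. \<forall>t. \<bar>f t\<bar> \<le> \<epsilon> * \<bar>t\<bar> powr a + C"
proof -
  have "\<forall>\<^sub>F t in at_infinity. \<bar>f t / \<bar>t\<bar> powr a\<bar> < \<epsilon>"
    using tendstoD[OF f2 eps] by (simp add: dist_real_def)
  then obtain T where T: "\<And>t. T \<le> \<bar>t\<bar> \<Longrightarrow> \<bar>f t / \<bar>t\<bar> powr a\<bar> < \<epsilon>" by (auto simp: eventually_at_infinity)
  define T' where "T' = max T 1"
  have "compact (f ` {-T'..T'})" by (intro compact_continuous_image continuous_on_subset[OF f]) auto
  then obtain C where C: "C > 0" "\<And>t. t \<in> {-T'..T'} \<Longrightarrow> \<bar>f t\<bar> \<le> C"
    using compact_imp_bounded bounded_pos[of "f ` {-T'..T'}"] by auto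
  have "\<bar>f t\<bar> \<le> \<epsilon> * \<bar>t\<bar> powr a + C" for t
  proof (cases "T' \<le> \<bar>t\<bar>")
    case True
    then have t: "\<bar>t\<bar> powr a > 0" "T \<le> \<bar>t\<bar>" by (auto simp: T'_def)
    then have "\<bar>f t\<bar> < \<epsilon> * \<bar>t\<bar> powr a" using T[OF t(2)] by (simp add: abs_divide pos_divide_less_eq)
    then show ?thesis using C(1) by simp
  next
    case False
    then have "\<bar>f t\<bar> \<le> C" by (intro C(2)) auto
    moreover have "0 \<le> \<epsilon> * \<bar>t\<bar> powr a" using eps by simp
    ultimately show ?thesis by simp
  qed
  then show ?thesis using C(1) by (intro exI[of _ C]) auto
qed

lemma growth_near_zero:
  fixes f :: "real \<Rightarrow> real"
  assumes f: "continuous_on UNIV f" and a: "0 < a" "0 < b"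
    and f1: "((\<lambda>t. f t / \<bar>t\<bar> powr a) \<longlongrightarrow> 0) (at 0)" and f2: "((\<lambda>t. f t / \<bar>t\<bar> powr a) \<longlongrightarrow> 0) at_infinity" and eps: "\<epsilon> > 0"
  shows "\<exists>C\<ge>0. \<forall>t. \<bar>f t\<bar> \<le> \<epsilon> * \<bar>t\<bar> powr a + C * \<bar>t\<bar> powr b"
proof -
  have "\<forall>\<^sub>F t in at 0. \<bar>f t / \<bar>t\<bar> powr a\<bar> < \<epsilon>"
    using tendstoD[OF f1 eps] by (simp add: dist_real_def)
  then obtain d where d: "d > 0" "\<And>t. t \<noteq> 0 \<Longrightarrow> \<bar>t\<bar> < d \<Longrightarrow> \<bar>f t / \<bar>t\<bar> powr a\<bar> < \<epsilon>" by (auto simp: eventually_at dist_real_def)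
  obtain C where C: "C \<ge> 0" "\<And>t. \<bar>f t\<bar> \<le> \<epsilon> * \<bar>t\<bar> powr a + C" using growth_at_infinity[OF f f2 eps] by blast
  have near: "\<bar>f t\<bar> \<le> \<epsilon> * \<bar>t\<bar> powr a" if "t \<noteq> 0" "\<bar>t\<bar> < d" for t
    using d(2)[OF that] that(1) by (simp add: abs_divide pos_divide_less_eq)
  \<comment> \<open>The limit at 0 says nothing about the value there. Continuity supplies it, and
    the claimed bound requires it since its right side is 0 at \<open>t = 0\<close>.\<close>
  have f0: "f 0 = 0"
  proof -
    have "(f \<longlongrightarrow> f 0) (at 0)" using f by (simp add: continuous_on_eq_continuous_at isCont_def)
    moreover have "(f \<longlongrightarrow> 0) (at 0)"
    proof (rule Lim_null_comparison)
      show "\<forall>\<^sub>F t in at 0. norm (f t) \<le> \<epsilon> * \<bar>t\<bar> powr a"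
        using near d(1) by (auto simp: eventually_at dist_real_def intro!: exI[of _ d])
      have "((\<lambda>t. \<bar>t\<bar> powr a) \<longlongrightarrow> 0) (at (0::real))"
        by (rule tendsto_zero_powrI[OF _ tendsto_const]) (use a in \<open>auto intro!: tendsto_rabs_zero\<close>)
      then show "((\<lambda>t. \<epsilon> * \<bar>t\<bar> powr a) \<longlongrightarrow> 0) (at 0)" by (rule tendsto_mult_right_zero)
    qed
    ultimately show ?thesis by (rule tendsto_unique[rotated]) simp
  qed
  define C' where "C' = C / d powr b"
  have C': "C' \<ge> 0" using C by (simp add: C'_def)
  have "\<bar>f t\<bar> \<le> \<epsilon> * \<bar>t\<bar> powr a + C' * \<bar>t\<bar> powr b" for t
  proof (cases "\<bar>t\<bar> < d")
    case True
    have "0 \<le> C' * \<bar>t\<bar> powr b" "0 \<le> \<epsilon> * \<bar>t\<bar> powr a" using C' eps by simp_all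
    then show ?thesis using near[OF _ True] f0 by (cases "t = 0") auto
  next
    case False
    have "C = C' * d powr b" using d(1) by (simp add: C'_def)
    also have "\<dots> \<le> C' * \<bar>t\<bar> powr b" using False C' d(1) a by (intro mult_left_mono powr_mono2) auto
    finally show ?thesis using C(2)[of t] by linarith
  qed
  then show ?thesis using C' by blast
qed

text \<open>The mean value theorem from 0: the intermediate point has smaller modulus, and the
  factor \<open>t\<close> raises each exponent by one.\<close>

lemma antiderivative_growth:
  fixes f F :: "real \<Rightarrow> real"
  assumes F: "\<And>t. (F has_real_derivative f t) (at t)" and F0: "F 0 = 0" and a: "0 \<le> a" "0 \<le> b" and c: "0 \<le> \<epsilon>" "0 \<le> C"
    and f: "\<And>t. \<bar>f t\<bar> \<le> \<epsilon> * \<bar>t\<bar> powr a + C * \<bar>t\<bar> powr b"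
  shows "\<bar>F t\<bar> \<le> \<epsilon> * \<bar>t\<bar> powr (a + 1) + C * \<bar>t\<bar> powr (b + 1)"
proof -
  have "(F has_derivative (\<lambda>h. f t \<bullet> h)) (at t)" for t using F[of t] by (simp add: has_field_derivative_def)
  from potential_mvt[OF this, of 0 t] obtain z where z: "0 < z" "z < 1" "F (0 + t) - F 0 = f (0 + z *\<^sub>R t) \<bullet> t" by blast
  have zt: "\<bar>z * t\<bar> \<le> \<bar>t\<bar>" using z by (simp add: abs_mult mult_left_le_one_le)
  have "\<bar>f (z * t)\<bar> \<le> \<epsilon> * \<bar>z * t\<bar> powr a + C * \<bar>z * t\<bar> powr b" by (rule f)
  also have "\<dots> \<le> \<epsilon> * \<bar>t\<bar> powr a + C * \<bar>t\<bar> powr b"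
    using zt a c by (intro add_mono mult_left_mono powr_mono2) auto
  finally have "\<bar>f (z * t)\<bar> * \<bar>t\<bar> \<le> (\<epsilon> * \<bar>t\<bar> powr a + C * \<bar>t\<bar> powr b) * \<bar>t\<bar>" by (intro mult_right_mono) auto
  moreover have "\<bar>F t\<bar> = \<bar>f (z * t)\<bar> * \<bar>t\<bar>" using z(3) F0 by (simp add: abs_mult)
  ultimately show ?thesis by (cases "t = 0") (auto simp: powr_add algebra_simps)
qed

text \<open>The fundamental theorem on a symmetric interval that contains both 0 and
  \<open>t\<close> in its interior covers both signs of \<open>t\<close>.\<close>

lemma interval_integral_antiderivative:
  fixes f :: "real \<Rightarrow> real"
  assumes "continuous_on UNIV f"
  shows "((\<lambda>t. LBINT s=ereal 0..ereal t. f s) has_real_derivative f t) (at t)"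
proof -
  have "((\<lambda>t. LBINT s=ereal 0..ereal t. f s) has_vector_derivative f t) (at t within {-(\<bar>t\<bar> + 1)..\<bar>t\<bar> + 1})"
    by (rule interval_integral_FTC2) (use continuous_on_subset[OF assms] in auto)
  moreover have "at t within {-(\<bar>t\<bar> + 1)..\<bar>t\<bar> + 1} = at t" by (rule at_within_Icc_at) auto
  ultimately show ?thesis by (simp add: has_real_derivative_iff_has_vector_derivative)
qed

text \<open>\<open>F\<close> applied to \<open>t\<close> times a sharpening bump tends to
  \<open>F t\<close> on a box and to \<open>F 0 = 0\<close> elsewhere, so by dominated convergence
  the functional tends to \<open>F t\<close> times the volume of the box.\<close>

lemma positive_functional:
  fixes \<Omega> :: "(real ^ 'n) set" and F :: "real \<Rightarrow> real"
  assumes \<Omega>: "open \<Omega>" "bounded \<Omega>" "0 \<in> \<Omega>" and F: "continuous_on UNIV F" "F 0 = 0" "0 < F t"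
  shows "\<exists>w\<in>test_functions \<Omega>. 0 < (\<integral>x. F (w x) \<partial>lebesgue_on \<Omega>)"
proof -
  have \<Omega>s: "\<Omega> \<in> sets lebesgue" using \<Omega>(1) by (simp add: borel_open)
  obtain c d where cd: "0 \<in> box c d" "cbox c d \<subseteq> \<Omega>"
  proof -
    obtain e where e: "e > 0" "ball 0 e \<subseteq> \<Omega>" using \<Omega> by (auto simp: open_contains_ball)
    obtain c d :: "real ^ 'n" where "0 \<in> box c d" "cbox c d \<subseteq> ball 0 e"
      using open_contains_cbox[of "ball 0 e" 0] e(1) by (metis centre_in_ball open_ball)
    then show ?thesis using that[of c d] e(2) by auto
  qed
  define w where "w k x = t * bump c d (real (Suc k)) x" for k x
  have w: "w k \<in> test_functions \<Omega>" for k
    unfolding w_def[abs_def] by (intro test_functions_scale(1) bump_test_function[OF cd(2)]) simp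
  have ran: "w k x \<in> cball 0 \<bar>t\<bar>" for k x
    using bump_bounds[of c d "real (Suc k)" x] by (simp add: w_def abs_mult mult_left_le del: of_nat_Suc)
  have "compact (F ` cball 0 \<bar>t\<bar>)" by (intro compact_continuous_image continuous_on_subset[OF F(1)]) auto
  then obtain B where B: "B > 0" "\<And>y. y \<in> cball 0 \<bar>t\<bar> \<Longrightarrow> \<bar>F y\<bar> \<le> B"
    using compact_imp_bounded bounded_pos[of "F ` cball 0 \<bar>t\<bar>"] by auto
  have fm: "emeasure lebesgue \<Omega> < \<infinity>"
    using emeasure_bounded_finite[OF \<Omega>(2)] \<Omega>(1) by (simp add: emeasure_completion borel_open)
  have Fm: "F \<in> borel_measurable borel" by (rule borel_measurable_continuous_onI[OF F(1)])
  have wm: "(\<lambda>x. F (w k x)) \<in> borel_measurable lebesgue" for k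
    by (rule measurable_compose[OF test_function_measurable[OF w] Fm])
  have "(\<lambda>k. \<integral>x. indicator \<Omega> x * F (w k x) \<partial>lebesgue) \<longlonglongrightarrow> (\<integral>x. indicator (box c d) x * F t \<partial>lebesgue)"
  proof (rule integral_dominated_convergence)
    show "integrable lebesgue (\<lambda>x. indicator \<Omega> x * B)" using \<Omega>s fm by simp
    show "AE x in lebesgue. (\<lambda>k. indicator \<Omega> x * F (w k x)) \<longlonglongrightarrow> indicator (box c d) x * F t"
    proof (intro AE_I2)
      fix x
      have "(\<lambda>k. w k x) \<longlonglongrightarrow> t * indicator (box c d) x" unfolding w_def by (intro tendsto_intros bump_limit)
      then have "(\<lambda>k. F (w k x)) \<longlonglongrightarrow> F (t * indicator (box c d) x)"
        using F(1) by (intro isCont_tendsto_compose[where g = F]) (auto simp: continuous_on_eq_continuous_at)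
      then have "(\<lambda>k. indicator \<Omega> x * F (w k x)) \<longlonglongrightarrow> indicator \<Omega> x * F (t * indicator (box c d) x)" by (intro tendsto_intros)
      also have "indicator \<Omega> x * F (t * indicator (box c d) x) = indicator (box c d) x * F t"
        using cd(2) box_subset_cbox[of c d] F(2) by (auto simp: indicator_def)
      finally show "(\<lambda>k. indicator \<Omega> x * F (w k x)) \<longlonglongrightarrow> indicator (box c d) x * F t" .
    qed
    show "AE x in lebesgue. norm (indicator \<Omega> x * F (w k x)) \<le> indicator \<Omega> x * B" for k
      using B(2)[OF ran] by (intro AE_I2) (auto simp: indicator_def)
    show "(\<lambda>x. indicator \<Omega> x * F (w k x)) \<in> borel_measurable lebesgue" for k
      by (intro borel_measurable_times borel_measurable_indicator \<Omega>s wm)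
    show "(\<lambda>x. indicator (box c d) x * F t) \<in> borel_measurable lebesgue"
      by (intro borel_measurable_times borel_measurable_indicator) auto
  qed
  moreover have "(\<integral>x. indicator (box c d) x * F t \<partial>lebesgue) > 0"
  proof -
    have "measure lebesgue (box c d) > 0"
    proof -
      have "c \<bullet> i < d \<bullet> i" if "i \<in> Basis" for i using cd(1) that by (auto simp: mem_box)
      then have "0 < measure lborel (box c d)"
        by (subst measure_lborel_box) (auto intro!: prod_pos simp: inner_diff_left less_imp_le)
      then show ?thesis by (simp add: measure_completion)
    qed
    then show ?thesis using F(3) by simp
  qed
  ultimately have "\<forall>\<^sub>F k in sequentially. 0 < (\<integral>x. indicator \<Omega> x * F (w k x) \<partial>lebesgue)" by (rule order_tendstoD(1))
  then obtain k where "0 < (\<integral>x. indicator \<Omega> x * F (w k x) \<partial>lebesgue)" using eventually_happens'[OF sequentially_bot] by blast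
  moreover have "(\<integral>x. F (w k x) \<partial>lebesgue_on \<Omega>) = (\<integral>x. indicator \<Omega> x * F (w k x) \<partial>lebesgue)"
    using \<Omega>s by (subst integral_restrict_space) auto
  ultimately show ?thesis using w by (intro bexI[of _ "w k"]) auto
qed

theorem theorem4p8:
  fixes \<Omega> :: "(real ^ 'n) set" and p \<mu> :: real and f g :: "real \<Rightarrow> real"
  assumes "bounded \<Omega>" and "open \<Omega>" and "lipschitz_boundary \<Omega>" and "0 \<in> \<Omega>"
    and "2 \<le> p" and "p < real CARD('n)" and "0 < \<mu>"
    and "continuous_on UNIV f" and "continuous_on UNIV g"
    and f1: "((\<lambda>t. f t / \<bar>t\<bar> powr (p - 1)) \<longlongrightarrow> 0) (at 0)"
    and f2: "((\<lambda>t. f t / \<bar>t\<bar> powr (p - 1)) \<longlongrightarrow> 0) at_infinity"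
    and f3: "(SUP t::real. ereal (LBINT s=ereal 0..ereal t. f s)) > 0"
    and g1: "\<exists>c\<^sub>g \<ge> 0. \<exists>q. 1 < q \<and> q < p * real CARD('n) / (real CARD('n) - p) \<and>
               (\<forall>t. \<bar>g t\<bar> \<le> c\<^sub>g * (1 + \<bar>t\<bar> powr (q - 1)))"
  shows "\<exists>\<beta> > 0. \<forall>a b. a \<le> b \<and> {a..b} \<subseteq> {\<beta><..} \<longrightarrow>
           (\<exists>r > 0. \<forall>lam \<in> {a..b}. \<exists>\<delta> > 0. \<forall>\<gamma> \<in> {0..\<delta>}.
              \<exists>u\<^sub>1 u\<^sub>2 u\<^sub>3.
                ae_distinct \<Omega> u\<^sub>1 u\<^sub>2 \<and> ae_distinct \<Omega> u\<^sub>1 u\<^sub>3 \<and> ae_distinct \<Omega> u\<^sub>2 u\<^sub>3 \<and>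
                (\<forall>u \<in> {u\<^sub>1, u\<^sub>2, u\<^sub>3}.
                   W1p_0_norm p \<Omega> u < r \<and> weak_solution p \<mu> f g lam \<gamma> \<Omega> u))"
proof -
  note \<Omega> = assms(1,2,4) and p = assms(5,6) and cf = assms(8) and cg = assms(9)
  define n where "n = real CARD('n)"
  define pstar where "pstar = p * n / (n - p)"
  have n: "p < n" using p by (simp add: n_def)
  have pp: "p < pstar"
  proof -
    have "p * (n - p) < p * n" using p by (intro mult_strict_left_mono) auto
    then show ?thesis using n by (simp add: pstar_def pos_less_divide_eq)
  qed
  obtain c q where q: "c \<ge> 0" "1 < q" "q < pstar" "\<And>t. \<bar>g t\<bar> \<le> c * (1 + \<bar>t\<bar> powr (q - 1))"
    using g1 unfolding pstar_def n_def by blast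
  define s where "s = (max p q + pstar) / 2"
  have s: "p < s" "q < s" "s < pstar" using pp q(3) by (auto simp: s_def max_def)
  have s0: "s > 0" using s p by simp
  have "0 < 1 - n / p + n / s"
  proof -
    have "s * (n - p) < p * n" using s(3) n by (simp add: pstar_def pos_less_divide_eq)
    then show ?thesis using p s0 by (simp add: field_simps)
  qed
  then have \<kappa>: "0 < 1 - real CARD('n) / p + real CARD('n) / s" by (simp add: n_def)
  define F where "F t = (LBINT s=ereal 0..ereal t. f s)" for t
  define G where "G t = (LBINT s=ereal 0..ereal t. g s)" for t
  have dF: "(F has_real_derivative f t) (at t)" for t
    unfolding F_def[abs_def] by (rule interval_integral_antiderivative[OF cf])
  have dG: "(G has_real_derivative g t) (at t)" for t
    unfolding G_def[abs_def] by (rule interval_integral_antiderivative[OF cg])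
  have F0: "F 0 = 0" and G0: "G 0 = 0" by (simp_all add: F_def G_def)
  have fs: "nemy s f"
  proof -
    obtain C where C: "C \<ge> 0" "\<And>t. \<bar>f t\<bar> \<le> 1 * \<bar>t\<bar> powr (p - 1) + C" using growth_at_infinity[OF cf f2, of 1] by auto
    show ?thesis
    proof (rule nemy_growth[OF cf, of p _ "1 + C"])
      fix t :: real
      have "\<bar>t\<bar> powr (p - 1) \<le> (1 + \<bar>t\<bar>) powr (p - 1)" using p by (intro powr_mono2) auto
      moreover have "1 \<le> (1 + \<bar>t\<bar>) powr (p - 1)" using p by (intro ge_one_powr_ge_zero) auto
      then have "C * 1 \<le> C * (1 + \<bar>t\<bar>) powr (p - 1)" using C(1) by (intro mult_left_mono)
      ultimately show "\<bar>f t\<bar> \<le> (1 + C) * (1 + \<bar>t\<bar>) powr (p - 1)" using C(2)[of t] by (simp add: algebra_simps)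
    qed (use p s in auto)
  qed
  have gs: "nemy s g"
  proof (rule nemy_growth[OF cg, of q _ "2 * c"])
    fix t :: real
    have "\<bar>t\<bar> powr (q - 1) \<le> (1 + \<bar>t\<bar>) powr (q - 1)" using q by (intro powr_mono2) auto
    moreover have "1 \<le> (1 + \<bar>t\<bar>) powr (q - 1)" using q by (intro ge_one_powr_ge_zero) auto
    ultimately have "c * (1 + \<bar>t\<bar> powr (q - 1)) \<le> c * (2 * (1 + \<bar>t\<bar>) powr (q - 1))" using q(1) by (intro mult_left_mono) auto
    then show "\<bar>g t\<bar> \<le> 2 * c * (1 + \<bar>t\<bar>) powr (q - 1)" using q(4)[of t] by simp
  qed (use q s in auto)
  interpret perturbed_problem \<Omega> p s \<mu> f g F G
    by unfold_locales (use \<Omega> p s \<kappa> assms(7) fs gs dF dG in auto)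
  obtain t where t: "F t > 0" using f3 by (auto simp: less_SUP_iff F_def)
  have "continuous_on UNIV F" using dF by (intro continuous_at_imp_continuous_on ballI DERIV_isCont)
  then obtain w where w: "w \<in> test_functions \<Omega>" "0 < (\<integral>x. F (w x) \<partial>lebesgue_on \<Omega>)"
    using positive_functional[OF \<Omega>(2,1,3) _ F0 t] by blast
  show ?thesis
  proof (rule three_solutions_interval[OF F0 G0 _ _ w])
    fix \<epsilon> :: real assume eps: "\<epsilon> > 0"
    \<comment> \<open>The behaviour of \<open>f\<close> at infinity leaves an additive constant,
      which integrates to the linear term.\<close>
    obtain C where C: "C \<ge> 0" "\<And>t. \<bar>f t\<bar> \<le> \<epsilon> * \<bar>t\<bar> powr (p - 1) + C" using growth_at_infinity[OF cf f2 eps] by blast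
    have "\<bar>F t\<bar> \<le> \<epsilon> * \<bar>t\<bar> powr p + C * \<bar>t\<bar>" for t
    proof -
      have "(F has_derivative (\<lambda>h. f t \<bullet> h)) (at t)" for t using dF[of t] by (simp add: has_field_derivative_def)
      from potential_mvt[OF this, of 0 t] obtain z where z: "0 < z" "z < 1" "F (0 + t) - F 0 = f (0 + z *\<^sub>R t) \<bullet> t" by blast
      have "\<bar>z * t\<bar> powr (p - 1) \<le> \<bar>t\<bar> powr (p - 1)"
        using z p by (intro powr_mono2) (auto simp: abs_mult mult_left_le_one_le)
      then have "\<epsilon> * \<bar>z * t\<bar> powr (p - 1) + C \<le> \<epsilon> * \<bar>t\<bar> powr (p - 1) + C" using eps by (simp add: mult_left_mono)
      then have "\<bar>f (z * t)\<bar> * \<bar>t\<bar> \<le> (\<epsilon> * \<bar>t\<bar> powr (p - 1) + C) * \<bar>t\<bar>"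
        using C(2)[of "z * t"] by (intro mult_right_mono) auto
      moreover have "\<bar>F t\<bar> = \<bar>f (z * t)\<bar> * \<bar>t\<bar>" using z(3) F0 by (simp add: abs_mult)
      moreover have "\<bar>t\<bar> powr (p - 1) * \<bar>t\<bar> = \<bar>t\<bar> powr p" by (cases "t = 0") (auto simp: powr_diff)
      ultimately show ?thesis by (simp add: algebra_simps)
    qed
    then show "\<exists>C\<ge>0. \<forall>t. \<bar>F t\<bar> \<le> \<epsilon> * \<bar>t\<bar> powr p + C * \<bar>t\<bar>" using C(1) by blast
    \<comment> \<open>With the behaviour at 0 as well, the linear term is traded for the power
      \<open>s\<close>.\<close>
    have ps1: "0 < p - 1" "0 < s - 1" using p s by auto
    obtain C where C: "C \<ge> 0" "\<And>t. \<bar>f t\<bar> \<le> \<epsilon> * \<bar>t\<bar> powr (p - 1) + C * \<bar>t\<bar> powr (s - 1)"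
      using growth_near_zero[OF cf ps1 f1 f2 eps] by blast
    show "\<exists>C\<ge>0. \<forall>t. \<bar>F t\<bar> \<le> \<epsilon> * \<bar>t\<bar> powr p + C * \<bar>t\<bar> powr s"
      using antiderivative_growth[OF dF F0 _ _ _ C(1) C(2)] ps1 eps C(1) by (intro exI[of _ C]) auto
  qed
qed

end
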